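(* Let $X$ be a compact Riemann surface with a flat conformal metric $\rho$ with conical points $P_1,\dots,P_M$ of conical angles $\beta_1,\dots,\beta_M$, and let $n_k$ be the integers with $2\pi n_k<\beta_k\le 2\pi(n_k+1)$. Let $\zeta_k$ be the distinguished local parameter near $P_k$, let $\Delta$ be the symmetric Laplacian with domain $C_0^\infty(X\setminus\{P_1,\dots,P_M\})$, $\Delta^*$ its adjoint and $\overline{\Delta}$ its closure. Let $u\in\mathcal D(\Delta^* )$. Then for every $k$ there are complex numbers $\mathfrak L_k(u),\mathfrak c_k(u)$ and $\mathfrak H_{k,m}(u),\mathfrak A_{k,m}(u),\mathfrak h_{k,m}(u),\mathfrak a_{k,m}(u)$ ($1\le m\le n_k$) such that in a vicinity of $P_k$ $$u=\frac{i}{\sqrt{2\pi}}\mathfrak L_k(u)\log|\zeta_k|+\sum_{m=1}^{n_k}\frac{1}{\sqrt{4\pi m}}\mathfrak H_{k,m}(u)\frac1{\zeta_k^m}+\sum_{m=1}^{n_k}\frac{1}{\sqrt{4\pi m}}\mathfrak A_{k,m}(u)\frac1{\bar\zeta_k^m}+\frac{i}{\sqrt{2\pi}}\mathfrak c_k(u)+\sum_{m=1}^{n_k}\frac{1}{\sqrt{4\pi m}}\mathfrak h_{k,m}(u)\zeta_k^m+\sum_{m=1}^{n_k}\frac{1}{\sqrt{4\pi m}}\mathfrak a_{k,m}(u)\bar\zeta_k^m+\chi v,$$ where $\chi$ is a $C^\infty$ cut-off function equal to $1$ in a small vicinity of $P_k$ and supported in another small vicinity of $P_k$, and $v\in\mathcal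 D(\overline{\Delta})$. Moreover $v=o(|\zeta_k|^{n_k})$ as $\zeta_k\to0$.
   Context: A flat conformal metric with conical points $P_1,\dots,P_M$ on $X$ is a conformal metric, smooth and flat on $X\setminus\{P_1,\dots,P_M\}$, such that near each $P_k$ there is a holomorphic local parameter $\zeta_k$, $\zeta_k(P_k)=0$ (the distinguished local parameter), in which the metric is $(b_k+1)^2|\zeta_k|^{2b_k}|d\zeta_k|^2$ with $b_k>-1$; the conical angle is $\beta_k=2\pi(b_k+1)$. The Laplacian of a metric $\rho(z,\bar z)|dz|^2$ is $\Delta=-4\rho^{-1}\partial_z\partial_{\bar z}$, considered as an unbounded operator in $L_2(X,dS)$ with $dS$ the area element of the metric; adjoint and closure are taken in this Hilbert space. Sums $\sum_{m=1}^{n_k}$ with $n_k=0$ are zero. *)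

theory Defs
  imports "HOL-Analysis.Analysis" "HOL-Library.Landau_Symbols"
begin

section \<open>Smooth functions and Wirtinger derivatives in the plane\<close>

text \<open>The set \<open>S\<close> is always open below; \<open>smooth_on\<close> is \<open>C\<^sup>\<infinity>\<close> in the real sense.\<close>

primrec times_differentiable_on ::
    "nat \<Rightarrow> complex set \<Rightarrow> (complex \<Rightarrow> 'b::real_normed_vector) \<Rightarrow> bool" where
  "times_differentiable_on 0 S f \<longleftrightarrow> continuous_on S f"
| "times_differentiable_on (Suc k) S f \<longleftrightarrow>
     (\<forall>z\<in>S. f differentiable (at z)) \<and>
     (\<forall>h. times_differentiable_on k S (\<lambda>z. frechet_derivative f (at z) h))"

definition smooth_on :: "complex set \<Rightarrow> (complex \<Rightarrow> 'b::real_normed_vector) \<Rightarrow> bool" where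
  "smooth_on S f \<longleftrightarrow> (\<forall>k. times_differentiable_on k S f)"

definition d_z :: "(complex \<Rightarrow> complex) \<Rightarrow> complex \<Rightarrow> complex" where
  "d_z f z = (frechet_derivative f (at z) 1 - \<i> * frechet_derivative f (at z) \<i>) / 2"

definition d_zbar :: "(complex \<Rightarrow> complex) \<Rightarrow> complex \<Rightarrow> complex" where
  "d_zbar f z = (frechet_derivative f (at z) 1 + \<i> * frechet_derivative f (at z) \<i>) / 2"

section \<open>Riemann surfaces\<close>

text \<open>The surface is the whole type \<open>'a\<close>. A chart is a pair of its domain and the coordinate
  map; the values of the map outside the domain are irrelevant.\<close>

type_synonym 'a chart = "'a set \<times> ('a \<Rightarrow> complex)"

definition complex_chart :: "'a::t2_space chart \<Rightarrow> bool" where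
  "complex_chart = (\<lambda>(U, \<phi>). open U \<and> open (\<phi> ` U) \<and>
     homeomorphism U (\<phi> ` U) \<phi> (inv_into U \<phi>))"

definition holomorphic_transition :: "'a chart \<Rightarrow> 'a chart \<Rightarrow> bool" where
  "holomorphic_transition = (\<lambda>(U, \<phi>) (V, \<psi>).
     (\<psi> \<circ> inv_into U \<phi>) holomorphic_on (\<phi> ` (U \<inter> V)))"

definition holomorphic_atlas :: "'a::t2_space chart set \<Rightarrow> bool" where
  "holomorphic_atlas A \<longleftrightarrow> (\<forall>c\<in>A. complex_chart c) \<and> (\<Union>c\<in>A. fst c) = UNIV \<and>
     (\<forall>c\<in>A. \<forall>d\<in>A. holomorphic_transition c d)"

definition compact_riemann_surface :: "'a::t2_space chart set \<Rightarrow> bool" where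
  "compact_riemann_surface A \<longleftrightarrow>
     compact (UNIV :: 'a set) \<and> connected (UNIV :: 'a set) \<and> holomorphic_atlas A"

text \<open>Holomorphic local parameters are the members of the maximal atlas generated by \<open>A\<close>.\<close>

definition local_parameters :: "'a::t2_space chart set \<Rightarrow> 'a chart set" where
  "local_parameters A = {c. complex_chart c \<and>
     (\<forall>d\<in>A. holomorphic_transition c d \<and> holomorphic_transition d c)}"

definition smooth_function ::
    "'a::t2_space chart set \<Rightarrow> ('a \<Rightarrow> 'b::real_normed_vector) \<Rightarrow> bool" where
  "smooth_function A f \<longleftrightarrow> (\<forall>(U, \<phi>)\<in>A. smooth_on (\<phi> ` U) (f \<circ> inv_into U \<phi>))"

definition test_functions :: "'a::t2_space chart set \<Rightarrow> 'a set \<Rightarrow> ('a \<Rightarrow> complex) set" where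
  "test_functions A Q = {f. smooth_function A f \<and>
     compact (closure {x. f x \<noteq> 0}) \<and> closure {x. f x \<noteq> 0} \<inter> Q = {}}"

section \<open>Flat conformal metrics with conical points\<close>

text \<open>A conformal metric assigns to every local parameter \<open>(U, \<phi>)\<close> with \<open>z = \<phi> x\<close> its density
  \<open>\<rho>\<close> in the expression \<open>\<rho>(z) \<bar>dz\<bar>\<^sup>2\<close>, as a function of the coordinate \<open>z\<close>. It is defined
  off the set \<open>Q\<close> of conical points; values over \<open>Q\<close> are irrelevant.\<close>

type_synonym 'a density = "'a chart \<Rightarrow> complex \<Rightarrow> real"

definition conformal_metric :: "'a::t2_space chart set \<Rightarrow> 'a set \<Rightarrow> 'a density \<Rightarrow> bool" where
  "conformal_metric A Q \<rho> \<longleftrightarrow>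
     (\<forall>(U, \<phi>)\<in>local_parameters A.
        (\<forall>z\<in>\<phi> ` (U - Q). \<rho> (U, \<phi>) z > 0) \<and> smooth_on (\<phi> ` (U - Q)) (\<rho> (U, \<phi>))) \<and>
     (\<forall>(U, \<phi>)\<in>local_parameters A. \<forall>(V, \<psi>)\<in>local_parameters A. \<forall>x\<in>U \<inter> V - Q.
        \<rho> (U, \<phi>) (\<phi> x) =
          \<rho> (V, \<psi>) (\<psi> x) * (cmod (deriv (\<psi> \<circ> inv_into U \<phi>) (\<phi> x)))\<^sup>2)"

definition gaussian_curvature :: "(complex \<Rightarrow> real) \<Rightarrow> complex \<Rightarrow> complex" where
  "gaussian_curvature r z =
     - 2 / of_real (r z) * d_z (d_zbar (\<lambda>w. of_real (ln (r w)))) z"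

definition flat_metric :: "'a::t2_space chart set \<Rightarrow> 'a set \<Rightarrow> 'a density \<Rightarrow> bool" where
  "flat_metric A Q \<rho> \<longleftrightarrow>
     (\<forall>(U, \<phi>)\<in>local_parameters A. \<forall>z\<in>\<phi> ` (U - Q). gaussian_curvature (\<rho> (U, \<phi>)) z = 0)"

definition distinguished_parameter ::
    "'a::t2_space chart set \<Rightarrow> 'a set \<Rightarrow> 'a density \<Rightarrow> 'a \<Rightarrow> real \<Rightarrow> 'a chart \<Rightarrow> bool" where
  "distinguished_parameter A Q \<rho> p b = (\<lambda>(U, \<zeta>).
     (U, \<zeta>) \<in> local_parameters A \<and> p \<in> U \<and> \<zeta> p = 0 \<and>
     (\<forall>z\<in>\<zeta> ` (U - Q). \<rho> (U, \<zeta>) z = (b + 1)\<^sup>2 * cmod z powr (2 * b)))"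

definition flat_conical_metric ::
    "'a::t2_space chart set \<Rightarrow> 'a density \<Rightarrow> nat \<Rightarrow> (nat \<Rightarrow> 'a) \<Rightarrow> (nat \<Rightarrow> real) \<Rightarrow> bool" where
  "flat_conical_metric A \<rho> M P b \<longleftrightarrow>
     inj_on P {1..M} \<and>
     conformal_metric A (P ` {1..M}) \<rho> \<and> flat_metric A (P ` {1..M}) \<rho> \<and>
     (\<forall>k\<in>{1..M}. b k > -1 \<and>
        (\<exists>c. distinguished_parameter A (P ` {1..M}) \<rho> (P k) (b k) c))"

definition cone_angle :: "real \<Rightarrow> real" where
  "cone_angle b = 2 * pi * (b + 1)"

text \<open>The area element: these conditions determine the Borel measure \<open>dS\<close> uniquely. The values
  of the densities over the finitely many conical points do not contribute.\<close>

definition area_measure :: "'a::t2_space chart set \<Rightarrow> 'a density \<Rightarrow> 'a measure \<Rightarrow> bool" where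
  "area_measure A \<rho> dS \<longleftrightarrow> sets dS = sets borel \<and>
     (\<forall>(U, \<phi>)\<in>local_parameters A. \<forall>B\<in>sets borel. B \<subseteq> U \<longrightarrow>
        emeasure dS B = (\<integral>\<^sup>+z\<in>\<phi> ` B. ennreal (\<rho> (U, \<phi>) z) \<partial>lborel))"

text \<open>The value does not depend on the chart chosen around \<open>x\<close>.\<close>

definition laplacian ::
    "'a::t2_space chart set \<Rightarrow> 'a density \<Rightarrow> ('a \<Rightarrow> complex) \<Rightarrow> 'a \<Rightarrow> complex" where
  "laplacian A \<rho> f x = (let (U, \<phi>) = (SOME c. c \<in> A \<and> x \<in> fst c) in
     - 4 / of_real (\<rho> (U, \<phi>) (\<phi> x)) * d_z (d_zbar (f \<circ> inv_into U \<phi>)) (\<phi> x))"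

section \<open>Unbounded operators in \<open>L\<^sub>2\<close>\<close>

text \<open>Elements of \<open>L\<^sub>2\<close> are represented by functions, and an operator by its graph. Adjoint and
  closure are closed under changing either component on a null set.\<close>

definition L2 :: "'a measure \<Rightarrow> ('a \<Rightarrow> complex) set" where
  "L2 M = {f \<in> borel_measurable M. integrable M (\<lambda>x. (cmod (f x))\<^sup>2)}"

definition L2_inner :: "'a measure \<Rightarrow> ('a \<Rightarrow> complex) \<Rightarrow> ('a \<Rightarrow> complex) \<Rightarrow> complex" where
  "L2_inner M f g = (LINT x|M. f x * cnj (g x))"

definition L2_tendsto ::
    "'a measure \<Rightarrow> (nat \<Rightarrow> 'a \<Rightarrow> complex) \<Rightarrow> ('a \<Rightarrow> complex) \<Rightarrow> bool" where
  "L2_tendsto M F f \<longleftrightarrow> (\<lambda>j. LINT x|M. (cmod (F j x - f x))\<^sup>2) \<longlonglongrightarrow> 0"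

definition op_adjoint :: "'a measure \<Rightarrow> ('a \<Rightarrow> complex) rel \<Rightarrow> ('a \<Rightarrow> complex) rel" where
  "op_adjoint M T = {(u, w). u \<in> L2 M \<and> w \<in> L2 M \<and>
     (\<forall>(f, g)\<in>T. L2_inner M g u = L2_inner M f w)}"

definition op_closure :: "'a measure \<Rightarrow> ('a \<Rightarrow> complex) rel \<Rightarrow> ('a \<Rightarrow> complex) rel" where
  "op_closure M T = {(v, w). v \<in> L2 M \<and> w \<in> L2 M \<and>
     (\<exists>F G. (\<forall>j. (F j, G j) \<in> T) \<and> L2_tendsto M F v \<and> L2_tendsto M G w)}"

definition symmetric_laplacian ::
    "'a::t2_space chart set \<Rightarrow> 'a density \<Rightarrow> 'a set \<Rightarrow> ('a \<Rightarrow> complex) rel" where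
  "symmetric_laplacian A \<rho> Q = {(f, laplacian A \<rho> f) | f. f \<in> test_functions A Q}"

definition cutoff ::
    "'a::t2_space chart set \<Rightarrow> 'a \<Rightarrow> 'a set \<Rightarrow> ('a \<Rightarrow> real) \<Rightarrow> bool" where
  "cutoff A p U \<eta> \<longleftrightarrow> smooth_function A \<eta> \<and> eventually (\<lambda>x. \<eta> x = 1) (nhds p) \<and>
     closure {x. \<eta> x \<noteq> 0} \<subseteq> U"

end

theory Submission
 imports Defs "HOL-Complex_Analysis.Complex_Analysis" "HOL-Real_Asymp.Real_Asymp"
begin

text \<open>In the distinguished parameter z the metric is (b+1)^2 |z|^(2b) |dz|^2, so the surface
  Laplacian is the flat Laplacian 4 \<open>d_z\<close> \<open>d_zbar\<close>, negated and divided by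
  that density. Put U = cnj u, and let G be minus the density times the conjugate of the adjoint
  applied to u. That u lies in the domain of the adjoint gives the weak equation 4
  \<open>d_z\<close> \<open>d_zbar\<close> U = G on a punctured disc, with U square integrable for
  the weight |z|^(2b) and G for |z|^(-2b); nothing is known at the point itself. The angle condition
  reads n < b + 1 \<le> n + 1, and its two halves drive two halves of the argument.

  Singular terms: Green's formula with the kernel log |w - z| and a cut-off that vanishes near 0
  expresses U, up to the constant \<open>kernel_mass\<close>, by the potential of G, by commutator
  terms far from 0, which are harmonic near 0, and by commutator terms on a shell shrinking to 0
  (\<open>identification\<close>). On the shell the kernel is expanded in powers of w/z up to order
  n (\<open>comm_inner_expansion\<close>). The coefficients are moments of U against the commutator
  of the cut-off with w^m and cnj w^m; by the weak equation they converge as the shell shrinks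
  (\<open>mom_tendsto\<close>), and the limits are the coefficients of log |z|, z^-m and cnj z^-m.
  What is left has order |w|^(n+1); since b \<le> n, Cauchy-Schwarz and a logarithmic cut-off on
  e^-K < |w| < e^(-K/2) make its square O(1/K) (\<open>kr_remainder_tendsto\<close>).

  Regular terms: since n < b + 1, the moments of G against w^-m and cnj w^-m with m \<le> n are
  finite. Hence the potential splits into its Taylor polynomial of degree n in z and cnj z and a
  rest \<open>potential n g\<close>, whose kernel is the logarithm of the modulus of the Weierstrass
  factor of z/w. Cauchy-Schwarz in the dual weights bounds the rest by a constant times |z|^t with
  some t > n (\<open>potential_bound\<close>); together with the Taylor tails of the harmonic terms,
  which are O(|z|^(n+1)), this is the remainder v, and v = o(|z|^n).

  Membership in the closure: a function of size O(|z|^(n+1)) with first derivatives O(|z|^n) can be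
  cut off logarithmically at 0 with an error in the Laplacian that tends to 0
  (\<open>planar_closure_inner_limit\<close>). This covers the Taylor tails and the potentials of
  bounded charges that vanish near 0, the latter after smoothing the logarithm
  (\<open>potential_in_planar_closure\<close>). Both the cut-off potential and its Laplacian are
  bounded by the charge in the weighted norms (\<open>potential_source_bound\<close>), so all
  charges follow by density. \<open>planar_expansion\<close> collects these facts, and the locale
  \<open>cone_chart\<close> moves test functions, adjoint and closure between the disc and the
  surface. Neither the coefficients nor v depend on the cut-off of the theorem: the identity is
  asserted near the point, where that cut-off equals 1.\<close>

abbreviation borel_fun :: "('a::topological_space => 'b::topological_space) set"
  where "borel_fun \<equiv> borel_measurable borel"

section \<open>Calculus of smooth functions\<close>

lemma frechet_derivative_cong_open:
 assumes "open S" "z \<in> S" "\<And>x. x \<in> S ==> f x = g x"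
 shows "frechet_derivative f (at z) = frechet_derivative g (at z)"
proof -
 have "(f has_derivative D) (at z) \<longleftrightarrow> (g has_derivative D) (at z)" for D
  using has_derivative_transform_within_open[of f D z UNIV S g]
   has_derivative_transform_within_open[of g D z UNIV S f] assms by auto
 then show ?thesis by (simp add: frechet_derivative_def)
qed

lemma times_differentiable_on_cong:
 assumes "open S" "\<And>x. x \<in> S ==> f x = g x" "times_differentiable_on k S f"
 shows "times_differentiable_on k S g"
 using assms(2,3)
proof (induction k arbitrary: f g)
 case 0
 then show ?case using continuous_on_cong by (auto cong: continuous_on_cong)
next
 case (Suc k)
 have fd: "frechet_derivative f (at z) = frechet_derivative g (at z)" if "z \<in> S" for z
  using frechet_derivative_cong_open[OF assms(1) that] Suc.prems by blast
 have "g differentiable (at z)" if "z \<in> S" for z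
 proof -
  have "f differentiable (at z)" using Suc.prems(2) that by simp
  then obtain D where "(f has_derivative D) (at z)" unfolding differentiable_def by blast
  then have "(g has_derivative D) (at z)"
   by (rule has_derivative_transform_within_open[OF _ assms(1) that]) (use Suc.prems(1) in simp)
  then show ?thesis unfolding differentiable_def by blast
 qed
 moreover have "times_differentiable_on k S (\<lambda>z. frechet_derivative g (at z) h)" for h
  by (rule Suc.IH[of "\<lambda>z. frechet_derivative f (at z) h"]) (use fd Suc.prems in auto)
 ultimately show ?case by auto
qed

text \<open>The recursion is phrased with \<open>frechet_derivative\<close>; on an open set
  derivatives are unique, so any derivative found by calculus rules may take its place. Most closure
  properties below use this in the induction step.\<close>

lemma times_differentiable_on_SucI:
 assumes "open S" "\<And>z. z \<in> S ==> (f has_derivative D z) (at z)"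
  "\<And>h. times_differentiable_on k S (\<lambda>z. D z h)"
 shows "times_differentiable_on (Suc k) S f"
proof -
 have "frechet_derivative f (at z) = D z" if "z \<in> S" for z
  using frechet_derivative_at[OF assms(2)[OF that]] by simp
 then have "times_differentiable_on k S (\<lambda>z. frechet_derivative f (at z) h)" for h
  by (intro times_differentiable_on_cong[OF assms(1) _ assms(3)[of h]]) auto
 then show ?thesis using assms(2) by (auto simp: differentiable_def)
qed

lemma times_differentiable_on_SucD:
 assumes "times_differentiable_on (Suc k) S f"
 shows "z \<in> S ==> (f has_derivative frechet_derivative f (at z)) (at z)"
  "times_differentiable_on k S (\<lambda>z. frechet_derivative f (at z) h)"
 using assms by (auto simp: frechet_derivative_works)

lemma times_differentiable_on_Suc_imp:
 "times_differentiable_on (Suc k) S f ==> times_differentiable_on k S f"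
proof (induction k arbitrary: f)
 case 0
 then show ?case
  by (auto intro!: continuous_at_imp_continuous_on differentiable_imp_continuous_within)
next
 case (Suc k)
 show ?case
  using Suc.prems Suc.IH[of "\<lambda>z. frechet_derivative f (at z) h" for h]
  by simp
qed

lemma times_differentiable_on_subset:
 "times_differentiable_on k S f ==> T \<subseteq> S ==> times_differentiable_on k T f"
 by (induction k arbitrary: f) (auto intro: continuous_on_subset)

lemma times_differentiable_on_local:
 assumes "\<And>z. z \<in> S ==> \<exists>T. open T \<and> z \<in> T \<and> times_differentiable_on k T f"
 shows "times_differentiable_on k S f"
 using assms
proof (induction k arbitrary: f)
 case 0
 then show ?case
  unfolding times_differentiable_on.simps
  by (metis continuous_at_imp_continuous_on continuous_on_eq_continuous_at)
next
 case (Suc k)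
 show ?case
 proof (simp, intro conjI allI ballI)
  show "f differentiable (at z)" if "z \<in> S" for z using Suc.prems[OF that] by auto
  show "times_differentiable_on k S (\<lambda>z. frechet_derivative f (at z) h)" for h
   by (rule Suc.IH) (use Suc.prems in fastforce)
 qed
qed

lemma times_differentiable_on_const: "open S ==> times_differentiable_on k S (\<lambda>z. c)"
proof (induction k arbitrary: c)
 case (Suc k)
 show ?case
  by (rule times_differentiable_on_SucI[where D="\<lambda>z h. 0"]) (use Suc in auto)
qed auto

lemma times_differentiable_on_linear:
 assumes "open S" "bounded_linear L"
 shows "times_differentiable_on k S L"
proof (cases k)
 case 0
 then show ?thesis using assms linear_continuous_on by auto
next
 case (Suc k)
 show ?thesis unfolding Suc
  by (rule times_differentiable_on_SucI[where D="\<lambda>z. L"])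
   (use assms bounded_linear_imp_has_derivative times_differentiable_on_const in auto)
qed

lemma times_differentiable_on_compose_linear:
 assumes "open S" "bounded_linear L" "times_differentiable_on k S f"
 shows "times_differentiable_on k S (\<lambda>z. L (f z))"
 using assms(3)
proof (induction k arbitrary: f)
 case 0
 then show ?case using assms by (auto intro: bounded_linear.continuous_on)
next
 case (Suc k)
 note D = times_differentiable_on_SucD[OF Suc.prems]
 show ?case
  by (rule times_differentiable_on_SucI[where D="\<lambda>z h. L (frechet_derivative f (at z) h)"])
   (auto intro!: assms D Suc.IH bounded_linear.has_derivative[OF assms(2)])
qed

lemma times_differentiable_on_add:
 assumes "open S" "times_differentiable_on k S f" "times_differentiable_on k S g"
 shows "times_differentiable_on k S (\<lambda>z. f z + g z)"
 using assms(2,3)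
proof (induction k arbitrary: f g)
 case 0
 then show ?case by (auto intro: continuous_intros)
next
 case (Suc k)
 note D = times_differentiable_on_SucD[OF Suc.prems(1)] times_differentiable_on_SucD[OF Suc.prems(2)]
 show ?case
  by (rule times_differentiable_on_SucI[where
     D="\<lambda>z h. frechet_derivative f (at z) h + frechet_derivative g (at z) h"])
   (use assms(1) D Suc.IH in \<open>auto intro!: has_derivative_add\<close>)
qed

lemma times_differentiable_on_mult:
 fixes f g :: "complex => 'b::real_normed_algebra"
 assumes "open S" "times_differentiable_on k S f" "times_differentiable_on k S g"
 shows "times_differentiable_on k S (\<lambda>z. f z * g z)"
 using assms(2,3)
proof (induction k arbitrary: f g)
 case 0
 then show ?case by (auto intro: continuous_intros)
next
 case (Suc k)
 note D = times_differentiable_on_SucD[OF Suc.prems(1)] times_differentiable_on_SucD[OF Suc.prems(2)]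
 note I = times_differentiable_on_Suc_imp[OF Suc.prems(1)] times_differentiable_on_Suc_imp[OF Suc.prems(2)]
 show ?case
  by (rule times_differentiable_on_SucI[where
     D="\<lambda>z h. f z * frechet_derivative g (at z) h + frechet_derivative f (at z) h * g z"])
   (use assms(1) D Suc.IH I in \<open>auto intro!: has_derivative_mult times_differentiable_on_add\<close>)
qed

lemma times_differentiable_on_minus:
 assumes "open S" "times_differentiable_on k S f"
 shows "times_differentiable_on k S (\<lambda>z. - f z)"
 by (rule times_differentiable_on_compose_linear[OF assms(1) _ assms(2)])
  (simp add: bounded_linear_minus)

lemma times_differentiable_on_diff:
 assumes "open S" "times_differentiable_on k S f" "times_differentiable_on k S g"
 shows "times_differentiable_on k S (\<lambda>z. f z - g z)"
 using times_differentiable_on_add[OF assms(1,2) times_differentiable_on_minus[OF assms(1,3)]] by simp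

lemma times_differentiable_on_inverse:
 fixes f :: "complex => 'b::real_normed_field"
 assumes "open S" "times_differentiable_on k S f" "\<And>z. z \<in> S ==> f z \<noteq> 0"
 shows "times_differentiable_on k S (\<lambda>z. inverse (f z))"
 using assms(2)
proof (induction k)
 case 0
 then show ?case using assms by (auto intro: continuous_intros)
next
 case (Suc k)
 note D = times_differentiable_on_SucD[OF Suc.prems]
 note I = times_differentiable_on_Suc_imp[OF Suc.prems]
 show ?case
 proof (rule times_differentiable_on_SucI[where
     D="\<lambda>z h. - (inverse (f z) * frechet_derivative f (at z) h * inverse (f z))"])
  show "((\<lambda>z. inverse (f z)) has_derivative
    (\<lambda>h. - (inverse (f z) * frechet_derivative f (at z) h * inverse (f z)))) (at z)"
   if "z \<in> S" for z
   by (rule Deriv.has_derivative_inverse) (use assms(3) that D in auto)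
  show "times_differentiable_on k S
    (\<lambda>z. - (inverse (f z) * frechet_derivative f (at z) h * inverse (f z)))" for h
   by (intro times_differentiable_on_minus times_differentiable_on_mult assms Suc.IH I D)
 qed fact
qed

lemma times_differentiable_on_holomorphic:
 assumes "open S" "f holomorphic_on S"
 shows "times_differentiable_on k S f"
 using assms(2)
proof (induction k arbitrary: f)
 case 0
 then show ?case by (simp add: holomorphic_on_imp_continuous_on)
next
 case (Suc k)
 show ?case
 proof (rule times_differentiable_on_SucI[where D="\<lambda>z h. deriv f z * h"])
  show "(f has_derivative (*) (deriv f z)) (at z)" if "z \<in> S" for z
   using holomorphic_derivI[OF Suc.prems assms(1) that] by (simp add: has_field_derivative_def)
  show "times_differentiable_on k S (\<lambda>z. deriv f z * h)" for h
   by (intro times_differentiable_on_mult Suc.IH holomorphic_deriv Suc.prems assms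
     times_differentiable_on_const)
 qed fact
qed

text \<open>The derivative of the composition in direction e is the derivative of f at h z applied
  to \<open>deriv h z * e\<close>. This direction moves with z, so real linearity splits it into the
  fixed directions 1 and \<i>; the two directional derivatives of f carry one order of
  differentiability less, and the induction hypothesis applies to them.\<close>

lemma times_differentiable_on_compose_holomorphic:
 fixes f :: "complex => complex"
 assumes "open S" "open T" "h holomorphic_on S" "h ` S \<subseteq> T" "times_differentiable_on k T f"
 shows "times_differentiable_on k S (\<lambda>z. f (h z))"
 using assms(5)
proof (induction k arbitrary: f)
 case 0
 then show ?case using assms continuous_on_compose2 holomorphic_on_imp_continuous_on
  by (metis times_differentiable_on.simps(1))
next
 case (Suc k)
 note D = times_differentiable_on_SucD[OF Suc.prems]
 let ?D = "\<lambda>z e. of_real (Re (deriv h z * e)) * frechet_derivative f (at (h z)) 1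
   + of_real (Im (deriv h z * e)) * frechet_derivative f (at (h z)) \<i>"
 show ?case
 proof (rule times_differentiable_on_SucI[where D="?D"])
  fix z assume z: "z \<in> S"
  have hz: "(h has_derivative (*) (deriv h z)) (at z)"
   using holomorphic_derivI[OF assms(3,1) z] by (simp add: has_field_derivative_def)
  have fz: "(f has_derivative frechet_derivative f (at (h z))) (at (h z))" using z D assms by auto
  have lin: "linear (frechet_derivative f (at (h z)))"
   using fz has_derivative_linear by blast
  have "frechet_derivative f (at (h z)) w =
    of_real (Re w) * frechet_derivative f (at (h z)) 1 + of_real (Im w) * frechet_derivative f (at (h z)) \<i>" for w
  proof -
   have "w = Re w *\<^sub>R 1 + Im w *\<^sub>R \<i>" by (simp add: complex_eq_iff)
   then have "frechet_derivative f (at (h z)) w = frechet_derivative f (at (h z)) (Re w *\<^sub>R 1 + Im w *\<^sub>R \<i>)" by (rule arg_cong)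
   also have "\<dots> = Re w *\<^sub>R frechet_derivative f (at (h z)) 1 + Im w *\<^sub>R frechet_derivative f (at (h z)) \<i>"
    using lin by (simp only: linear_add linear_scale)
   finally show ?thesis by (simp only: scaleR_conv_of_real)
  qed
  then have "(\<lambda>e. frechet_derivative f (at (h z)) (deriv h z * e)) = ?D z" by blast
  then show "((\<lambda>z. f (h z)) has_derivative ?D z) (at z)"
   using has_derivative_compose[OF hz fz] by metis
 next
  fix e
  have d: "times_differentiable_on k S (\<lambda>z. deriv h z * e)"
   using assms by (intro times_differentiable_on_holomorphic holomorphic_intros) auto
  have "times_differentiable_on k S (\<lambda>z. complex_of_real (Re (deriv h z * e)))"
   by (rule times_differentiable_on_compose_linear[OF assms(1) _ d, of "\<lambda>w. complex_of_real (Re w)"])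
    (intro bounded_linear_compose[OF bounded_linear_of_real bounded_linear_Re])
  moreover have "times_differentiable_on k S (\<lambda>z. complex_of_real (Im (deriv h z * e)))"
   by (rule times_differentiable_on_compose_linear[OF assms(1) _ d, of "\<lambda>w. complex_of_real (Im w)"])
    (intro bounded_linear_compose[OF bounded_linear_of_real bounded_linear_Im])
  ultimately show "times_differentiable_on k S (\<lambda>z. ?D z e)"
   by (intro times_differentiable_on_add times_differentiable_on_mult assms Suc.IH D)
 qed fact
qed

section \<open>Wirtinger derivatives\<close>

definition has_wirtinger :: "(complex => complex) => complex => complex => complex => bool" where
 "has_wirtinger f p q z \<longleftrightarrow> (f has_derivative (\<lambda>h. p * h + q * cnj h)) (at z)"

lemma has_wirtinger_imp:
 assumes "has_wirtinger f p q z"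
 shows "d_z f z = p" "d_zbar f z = q"
 using frechet_derivative_at[OF assms[unfolded has_wirtinger_def], symmetric]
 by (auto simp: d_z_def d_zbar_def algebra_simps)

text \<open>Every real-linear map of the plane has the form p h + q cnj h; p and q are read off from
  its values at 1 and \<i>.\<close>

lemma has_wirtinger_diff:
 assumes "f differentiable (at z)"
 shows "has_wirtinger f (d_z f z) (d_zbar f z) z"
proof -
 let ?D = "frechet_derivative f (at z)"
 have D: "(f has_derivative ?D) (at z)" using assms by (simp add: frechet_derivative_works)
 then have lin: "linear ?D" using has_derivative_linear by blast
 have "?D w = d_z f z * w + d_zbar f z * cnj w" for w
 proof -
  have w: "w = Re w *\<^sub>R 1 + Im w *\<^sub>R \<i>" by (simp add: complex_eq_iff)
  have "?D w = of_real (Re w) * ?D 1 + of_real (Im w) * ?D \<i>"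
   proof -
   have "?D w = ?D (Re w *\<^sub>R 1 + Im w *\<^sub>R \<i>)" by (rule arg_cong[OF w])
   also have "\<dots> = Re w *\<^sub>R ?D 1 + Im w *\<^sub>R ?D \<i>"
    using lin by (simp only: linear_add linear_scale)
   finally show ?thesis by (simp only: scaleR_conv_of_real)
  qed
  also have "\<dots> = ?D 1 * ((w + cnj w) / 2) + ?D \<i> * (-\<i> * (w - cnj w) / 2)"
  proof -
   have "complex_of_real (Re w) = (w + cnj w) / 2" "complex_of_real (Im w) = -\<i> * (w - cnj w) / 2"
    by (simp_all add: complex_eq_iff)
   then show ?thesis by (simp only: mult.commute)
  qed
  also have "\<dots> = d_z f z * w + d_zbar f z * cnj w"
   by (simp add: d_z_def d_zbar_def field_simps)
  finally show ?thesis .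
 qed
 then have "?D = (\<lambda>w. d_z f z * w + d_zbar f z * cnj w)" by blast
 then show ?thesis using D unfolding has_wirtinger_def by metis
qed

lemma has_wirtinger_cong:
 assumes "open S" "z \<in> S" "\<And>x. x \<in> S ==> f x = g x" "has_wirtinger f p q z"
 shows "has_wirtinger g p q z"
 using assms has_derivative_transform_within_open[of f _ z UNIV S g]
 by (auto simp: has_wirtinger_def)

lemma has_wirtinger_add:
 assumes "has_wirtinger f p q z" "has_wirtinger g p' q' z"
 shows "has_wirtinger (\<lambda>z. f z + g z) (p + p') (q + q') z"
 using has_derivative_add[OF assms[unfolded has_wirtinger_def]]
 by (simp add: has_wirtinger_def algebra_simps)

lemma has_wirtinger_mult:
 assumes "has_wirtinger f p q z" "has_wirtinger g p' q' z"
 shows "has_wirtinger (\<lambda>z. f z * g z) (f z * p' + p * g z) (f z * q' + q * g z) z"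
 using has_derivative_mult[OF assms[unfolded has_wirtinger_def]]
 by (simp add: has_wirtinger_def algebra_simps)

lemma has_wirtinger_const: "has_wirtinger (\<lambda>z. c) 0 0 z"
 by (simp add: has_wirtinger_def)

lemma has_wirtinger_holomorphic:
 assumes "(f has_field_derivative f') (at z)"
 shows "has_wirtinger f f' 0 z"
 using assms by (simp add: has_wirtinger_def has_field_derivative_def)

lemma has_wirtinger_cnj:
 assumes "has_wirtinger f p q z"
 shows "has_wirtinger (\<lambda>z. cnj (f z)) (cnj q) (cnj p) z"
 using has_derivative_cnj[OF assms[unfolded has_wirtinger_def]]
 by (simp add: has_wirtinger_def algebra_simps)

lemma has_wirtinger_compose_holomorphic:
 assumes "(h has_field_derivative h') (at z)" "has_wirtinger f p q (h z)"
 shows "has_wirtinger (\<lambda>z. f (h z)) (p * h') (q * cnj h') z"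
 using has_derivative_compose[OF assms(1)[unfolded has_field_derivative_def] assms(2)[unfolded has_wirtinger_def]]
 by (simp add: has_wirtinger_def algebra_simps)

text \<open>Writing the derivative of a real function as Re (2 a h) makes a its z-derivative and cnj
  a its zbar-derivative, so composing with a real function of one variable scales both by the same
  real factor.\<close>

lemma has_wirtinger_real_compose:
 assumes "(g has_derivative (\<lambda>h. Re (2 * a * h))) (at z)" "(q has_real_derivative d) (at (g z))"
 shows "has_wirtinger (\<lambda>z. complex_of_real (q (g z))) (of_real d * a) (of_real d * cnj a) z"
proof -
 have "((\<lambda>z. q (g z)) has_derivative (\<lambda>h. d * Re (2 * a * h))) (at z)"
  using has_derivative_compose[OF assms(1) assms(2)[unfolded has_field_derivative_def]] by simp
 then have "((\<lambda>z. complex_of_real (q (g z))) has_derivative (\<lambda>h. of_real (d * Re (2 * a * h)))) (at z)"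
  by (rule has_derivative_of_real)
 moreover have "complex_of_real (d * Re (2 * a * h)) = of_real d * a * h + of_real d * cnj a * cnj h" for h
  by (simp add: complex_eq_iff algebra_simps)
 ultimately show ?thesis by (simp add: has_wirtinger_def)
qed

text \<open>\<open>wirtinger2 S f p q l\<close>: on \<open>S\<close> the first derivatives \<open>\<partial>f\<close>, \<open>\<partial>\<bar>f\<close> are \<open>p\<close>, \<open>q\<close>, and
 \<open>l\<close> is a quarter of the Laplacian, \<open>\<partial>\<partial>\<bar>f\<close>.\<close>

definition wirtinger2 where
 "wirtinger2 S f p q l \<longleftrightarrow> (\<forall>z\<in>S. has_wirtinger f (p z) (q z) z \<and> (\<exists>m. has_wirtinger q (l z) m z))"

lemma wirtinger2D:
 assumes "open S" "wirtinger2 S f p q l" "z \<in> S"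
 shows "d_z f z = p z" "d_zbar f z = q z" "d_z (d_zbar f) z = l z"
proof -
 show "d_z f z = p z" "d_zbar f z = q z"
  using assms has_wirtinger_imp unfolding wirtinger2_def by blast+
 obtain m where m: "has_wirtinger q (l z) m z" using assms unfolding wirtinger2_def by blast
 have "has_wirtinger (d_zbar f) (l z) m z"
  by (rule has_wirtinger_cong[OF assms(1,3) _ m])
   (use assms(2) has_wirtinger_imp in \<open>auto simp: wirtinger2_def\<close>)
 then show "d_z (d_zbar f) z = l z" by (rule has_wirtinger_imp)
qed

lemma wirtinger2_smooth:
 assumes "open S" "smooth_on S f"
 shows "wirtinger2 S f (d_z f) (d_zbar f) (d_z (d_zbar f))"
 unfolding wirtinger2_def
proof (intro ballI conjI)
 fix z assume z: "z \<in> S"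
 have 2: "times_differentiable_on (Suc (Suc 0)) S f" using assms by (auto simp: smooth_on_def)
 show "has_wirtinger f (d_z f z) (d_zbar f z) z"
  using 2 z by (intro has_wirtinger_diff) auto
 have "(\<lambda>z. frechet_derivative f (at z) h) differentiable (at z)" for h using 2 z by auto
 then have "d_zbar f differentiable (at z)"
  unfolding d_zbar_def[abs_def] by (intro derivative_intros) auto
 then show "\<exists>m. has_wirtinger (d_zbar f) (d_z (d_zbar f) z) m z"
  using has_wirtinger_diff by blast
qed

lemma wirtinger2_add:
 assumes "wirtinger2 S f p q l" "wirtinger2 S f' p' q' l'"
 shows "wirtinger2 S (\<lambda>z. f z + f' z) (\<lambda>z. p z + p' z) (\<lambda>z. q z + q' z) (\<lambda>z. l z + l' z)"
 using assms has_wirtinger_add unfolding wirtinger2_def by blast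

lemma wirtinger2_mult:
 assumes "wirtinger2 S f p q l" "wirtinger2 S f' p' q' l'"
 shows "wirtinger2 S (\<lambda>z. f z * f' z) (\<lambda>z. f z * p' z + p z * f' z) (\<lambda>z. f z * q' z + q z * f' z)
  (\<lambda>z. f z * l' z + p z * q' z + q z * p' z + l z * f' z)"
 unfolding wirtinger2_def
proof (intro ballI conjI)
 fix z assume z: "z \<in> S"
 obtain m m' where m: "has_wirtinger q (l z) m z" "has_wirtinger q' (l' z) m' z"
  using assms z unfolding wirtinger2_def by blast
 have f: "has_wirtinger f (p z) (q z) z" "has_wirtinger f' (p' z) (q' z) z"
  using assms z unfolding wirtinger2_def by blast+
 show "has_wirtinger (\<lambda>z. f z * f' z) (f z * p' z + p z * f' z) (f z * q' z + q z * f' z) z"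
  by (rule has_wirtinger_mult[OF f])
 have "has_wirtinger (\<lambda>z. f z * q' z + q z * f' z)
   ((f z * l' z + p z * q' z) + (q z * p' z + l z * f' z)) ((f z * m' + q z * q' z) + (q z * q' z + m * f' z)) z"
  by (intro has_wirtinger_add has_wirtinger_mult f m)
 then show "\<exists>m. has_wirtinger (\<lambda>z. f z * q' z + q z * f' z)
   (f z * l' z + p z * q' z + q z * p' z + l z * f' z) m z"
  by (auto simp: algebra_simps)
qed

lemma wirtinger2_subset: "wirtinger2 S f p q l ==> T \<subseteq> S ==> wirtinger2 T f p q l"
 by (auto simp: wirtinger2_def)

lemma wirtinger2_holomorphic:
 assumes "open S" "f holomorphic_on S"
 shows "wirtinger2 S f (deriv f) (\<lambda>z. 0) (\<lambda>z. 0)"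
 unfolding wirtinger2_def
 using has_wirtinger_holomorphic[OF holomorphic_derivI[OF assms(2,1)]] has_wirtinger_const by blast

lemma wirtinger2_cnj_holomorphic:
 assumes "open S" "f holomorphic_on S"
 shows "wirtinger2 S (\<lambda>z. cnj (f z)) (\<lambda>z. 0) (\<lambda>z. cnj (deriv f z)) (\<lambda>z. 0)"
 unfolding wirtinger2_def
proof (intro ballI conjI)
 fix z assume z: "z \<in> S"
 show "has_wirtinger (\<lambda>z. cnj (f z)) 0 (cnj (deriv f z)) z"
  using has_wirtinger_cnj[OF has_wirtinger_holomorphic[OF holomorphic_derivI[OF assms(2,1) z]]] by simp
 have "deriv f holomorphic_on S" by (rule holomorphic_deriv[OF assms(2,1)])
 from has_wirtinger_cnj[OF has_wirtinger_holomorphic[OF holomorphic_derivI[OF this assms(1) z]]]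
 show "\<exists>m. has_wirtinger (\<lambda>z. cnj (deriv f z)) 0 m z" by auto
qed

lemma wirtinger2_const: "wirtinger2 S (\<lambda>z. c) (\<lambda>z. 0) (\<lambda>z. 0) (\<lambda>z. 0)"
 using has_wirtinger_const by (auto simp: wirtinger2_def)

section \<open>Cut-off functions\<close>

text \<open>Polynomials in 1/x times exp (-1/x), extended by 0: a class closed under
  differentiation, so that smoothness, also at 0, follows by induction on the order.\<close>

definition bump_poly :: "real poly => real => real" where
 "bump_poly p x = (if x > 0 then poly p (1 / x) * exp (- (1 / x)) else 0)"

lemma poly_times_exp_minus_tendsto_0:
 fixes p :: "real poly"
 shows "((\<lambda>y. poly p y * exp (- y)) \<longlongrightarrow> 0) at_top"
proof -
 have "((\<lambda>y. \<Sum>i\<le>degree p. coeff p i * (y ^ i / exp y)) \<longlongrightarrow> (\<Sum>i\<le>degree p. coeff p i * 0)) at_top"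
  by (intro tendsto_sum tendsto_mult tendsto_const tendsto_power_div_exp_0)
 then show ?thesis
  by (simp add: poly_altdef sum_distrib_right sum_divide_distrib exp_minus divide_inverse mult.assoc)
qed

lemma bump_poly_has_derivative:
 "(bump_poly p has_real_derivative bump_poly ([:0,0,1:] * (p - pderiv p)) x) (at x)"
proof -
 consider "x > 0" | "x < 0" | "x = 0" by linarith
 then show ?thesis
 proof cases
  case 1
  have d: "((\<lambda>x. poly p (1 / x) * exp (- (1 / x))) has_real_derivative
    poly p (1 / x) * (exp (- (1 / x)) * (1 / x^2)) + poly (pderiv p) (1 / x) * (- 1 / x^2) * exp (- (1 / x))) (at x)"
   using 1 by (auto intro!: derivative_eq_intros DERIV_chain2[OF poly_DERIV] simp: power2_eq_square)
  have "(bump_poly p has_real_derivative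
    poly p (1 / x) * (exp (- (1 / x)) * (1 / x^2)) + poly (pderiv p) (1 / x) * (- 1 / x^2) * exp (- (1 / x))) (at x)"
   by (rule has_field_derivative_transform_within_open[OF d, of "{0<..}"]) (use 1 in \<open>auto simp: bump_poly_def\<close>)
  moreover have "poly p (1 / x) * (exp (- (1 / x)) * (1 / x^2)) + poly (pderiv p) (1 / x) * (- 1 / x^2) * exp (- (1 / x))
   = bump_poly ([:0,0,1:] * (p - pderiv p)) x"
   using 1 by (simp add: bump_poly_def field_simps power2_eq_square)
  ultimately show ?thesis by simp
 next
  case 2
  have "(bump_poly p has_real_derivative 0) (at x)"
   by (rule has_field_derivative_transform_within_open[OF DERIV_const[of 0], of "{..<0}"])
    (use 2 in \<open>auto simp: bump_poly_def\<close>)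
  then show ?thesis using 2 by (simp add: bump_poly_def)
 next
  case 3
  \<comment> \<open>With y = 1/h the difference quotient at 0 from the right is y p(y) exp (-y);
    \<open>pCons 0 p\<close> supplies the factor y.\<close>
  have "((\<lambda>y. poly (pCons 0 p) y * exp (- y)) \<longlongrightarrow> 0) at_top" by (rule poly_times_exp_minus_tendsto_0)
  then have "((\<lambda>h. poly (pCons 0 p) (inverse h) * exp (- inverse h)) \<longlongrightarrow> 0) (at_right (0::real))"
   by (rule filterlim_compose[OF _ filterlim_inverse_at_top_right])
  then have "((\<lambda>h. bump_poly p h / h) \<longlongrightarrow> 0) (at_right 0)"
   by (rule Lim_transform_eventually)
    (auto simp: bump_poly_def eventually_at_filter field_simps)
  moreover have "((\<lambda>h. bump_poly p h / h) \<longlongrightarrow> 0) (at_left 0)"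
   by (rule Lim_transform_eventually[OF tendsto_const])
    (auto simp: bump_poly_def eventually_at_filter)
  ultimately have "((\<lambda>h. bump_poly p h / h) \<longlongrightarrow> 0) (at 0)"
   by (simp add: filterlim_split_at)
  then show ?thesis using 3 by (simp add: DERIV_def bump_poly_def)
 qed
qed

lemma isCont_bump_poly: "isCont (bump_poly p) x"
 by (rule DERIV_isCont[OF bump_poly_has_derivative])

lemma times_differentiable_on_bump_poly:
 assumes "open S" "times_differentiable_on k S g"
 shows "times_differentiable_on k S (\<lambda>z. bump_poly p (g z))"
 using assms(2)
proof (induction k arbitrary: p)
 case 0
 have "continuous_on UNIV (bump_poly p)"
  by (intro continuous_at_imp_continuous_on ballI isCont_bump_poly)
 then show ?case using 0 continuous_on_compose2 by fastforce
next
 case (Suc k)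
 note D = times_differentiable_on_SucD[OF Suc.prems]
 note I = times_differentiable_on_Suc_imp[OF Suc.prems]
 show ?case
 proof (rule times_differentiable_on_SucI[where
    D="\<lambda>z h. bump_poly ([:0,0,1:] * (p - pderiv p)) (g z) * frechet_derivative g (at z) h"])
  show "((\<lambda>z. bump_poly p (g z)) has_derivative
    (\<lambda>h. bump_poly ([:0,0,1:] * (p - pderiv p)) (g z) * frechet_derivative g (at z) h)) (at z)" if "z \<in> S" for z
   using has_derivative_compose[OF D(1)[OF that] bump_poly_has_derivative[unfolded has_field_derivative_def]] .
  show "times_differentiable_on k S
    (\<lambda>z. bump_poly ([:0,0,1:] * (p - pderiv p)) (g z) * frechet_derivative g (at z) h)" for h
   by (intro times_differentiable_on_mult assms(1) Suc.IH I D)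
 qed fact
qed

definition step_density :: "real => real" where
 "step_density x = bump_poly 1 x * bump_poly 1 (1 - x)"

text \<open>The lower limit -1 instead of 0 keeps every x \<ge> 0 inside the interval of
  integration, so the fundamental theorem of calculus gives a two-sided derivative there.\<close>

definition step_integral :: "real => real" where
 "step_integral x = integral {-1..x} step_density"

lemma isCont_step_density: "isCont step_density x"
 unfolding step_density_def[abs_def]
 by (intro isCont_mult isCont_bump_poly isCont_o2[OF _ isCont_bump_poly]) auto

lemma step_density_eq_0: "x \<le> 0 \<or> x \<ge> 1 ==> step_density x = 0"
 by (auto simp: step_density_def bump_poly_def)

lemma step_density_pos: "0 < x ==> x < 1 ==> step_density x > 0"
 by (auto simp: step_density_def bump_poly_def)

lemma step_density_nonneg: "step_density x \<ge> 0"
 using step_density_pos[of x] step_density_eq_0[of x] by fastforce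

lemma step_integral_eq_0: "x \<le> 0 ==> step_integral x = 0"
 unfolding step_integral_def
 by (subst integral_cong[where g="\<lambda>_. 0"]) (auto simp: step_density_eq_0)

lemma step_integral_has_derivative: "(step_integral has_real_derivative step_density x) (at x)"
proof (cases "x < 0")
 case True
 have "(step_integral has_real_derivative 0) (at x)"
  by (rule has_field_derivative_transform_within_open[OF DERIV_const[of 0], of "{..<0}"])
   (use True in \<open>auto simp: step_integral_eq_0\<close>)
 then show ?thesis using True by (simp add: step_density_eq_0)
next
 case False
 have "(step_integral has_real_derivative step_density x) (at x within {-1..x+1})"
  unfolding step_integral_def[abs_def]
  by (rule integral_has_real_derivative)
   (use False isCont_step_density in \<open>auto intro!: continuous_at_imp_continuous_on\<close>)
 moreover have "at x within {-1..x+1} = at x"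
  using False by (intro at_within_interior) (auto simp: interior_atLeastAtMost_real)
 ultimately show ?thesis by simp
qed

lemma step_integral_1_pos: "step_integral 1 > 0"
proof -
 obtain c where "0 < c" "c < 1" "step_integral 1 - step_integral 0 = (1 - 0) * step_density c"
  using MVT2[of 0 1 step_integral step_density] step_integral_has_derivative by auto
 then show ?thesis using step_density_pos[of c] step_integral_eq_0[of 0] by simp
qed

lemma step_integral_mono: "x \<le> y ==> step_integral x \<le> step_integral y"
 using DERIV_nonneg_imp_nondecreasing[of x y step_integral] step_integral_has_derivative
  step_density_nonneg by blast

lemma step_integral_ge_1:
 assumes "x \<ge> 1" shows "step_integral x = step_integral 1"
proof (cases "x = 1")
 case False
 then obtain c where "1 < c" "step_integral x - step_integral 1 = (x - 1) * step_density c"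
  using assms MVT2[of 1 x step_integral step_density] step_integral_has_derivative by auto
 then show ?thesis by (simp add: step_density_eq_0)
qed auto

definition smooth_step :: "real => real" where
 "smooth_step x = step_integral x / step_integral 1"

definition smooth_step1 :: "real => real" where
 "smooth_step1 x = step_density x / step_integral 1"

definition smooth_step2 :: "real => real" where
 "smooth_step2 x = (bump_poly 1 x * - bump_poly [:0,0,1:] (1 - x) +
   bump_poly [:0,0,1:] x * bump_poly 1 (1 - x)) / step_integral 1"

lemma smooth_step_has_derivative: "(smooth_step has_real_derivative smooth_step1 x) (at x)"
 unfolding smooth_step_def[abs_def] smooth_step1_def
 by (intro DERIV_cdivide step_integral_has_derivative)

lemma smooth_step1_has_derivative: "(smooth_step1 has_real_derivative smooth_step2 x) (at x)"
proof -
 have 1: "(bump_poly 1 has_real_derivative bump_poly [:0,0,1:] x) (at x)" for x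
  using bump_poly_has_derivative[of 1 x] by simp
 have "((\<lambda>x. bump_poly 1 (1 - x)) has_real_derivative bump_poly [:0,0,1:] (1 - x) * - 1) (at x)"
  by (rule DERIV_chain2[OF 1]) (auto intro!: derivative_eq_intros)
 from DERIV_cdivide[OF DERIV_mult'[OF 1 this], of "step_integral 1"]
 show ?thesis
  by (simp add: smooth_step1_def[abs_def] smooth_step2_def step_density_def algebra_simps)
qed

lemma smooth_step_0 [simp]: "x \<le> 0 ==> smooth_step x = 0"
 and smooth_step_1 [simp]: "x \<ge> 1 ==> smooth_step x = 1"
 and smooth_step1_0 [simp]: "x \<le> 0 \<or> x \<ge> 1 ==> smooth_step1 x = 0"
 and smooth_step2_0 [simp]: "x \<le> 0 \<or> x \<ge> 1 ==> smooth_step2 x = 0"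
proof -
 assume "x \<ge> 1"
 then show "smooth_step x = 1"
  using step_integral_1_pos step_integral_ge_1 unfolding smooth_step_def
  by (metis divide_self less_irrefl)
qed (auto simp: smooth_step_def smooth_step1_def smooth_step2_def step_integral_eq_0
   step_density_eq_0 bump_poly_def)

lemma smooth_step_bounds: "0 \<le> smooth_step x" "smooth_step x \<le> 1"
proof -
 show "0 \<le> smooth_step x"
  using step_integral_mono[of 0 x] step_integral_1_pos
  by (cases "x \<le> 0") (auto simp: smooth_step_def step_integral_eq_0)
 show "smooth_step x \<le> 1"
  using step_integral_mono[of x 1] step_integral_1_pos
  by (cases "x \<ge> 1", simp) (simp add: smooth_step_def)
qed

lemma isCont_smooth_step: "isCont smooth_step x" "isCont smooth_step1 x" "isCont smooth_step2 x"
proof -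
 show "isCont smooth_step x" "isCont smooth_step1 x"
  using DERIV_isCont smooth_step_has_derivative smooth_step1_has_derivative by blast+
 show "isCont smooth_step2 x"
  unfolding smooth_step2_def[abs_def]
  using step_integral_1_pos
  by (intro isCont_mult isCont_bump_poly isCont_o2[OF _ isCont_bump_poly] continuous_intros) auto
qed

lemma smooth_step_borel [measurable]:
 "smooth_step \<in> borel_fun" "smooth_step1 \<in> borel_fun"
 "smooth_step2 \<in> borel_fun"
 using isCont_smooth_step
 by (auto intro!: borel_measurable_continuous_onI continuous_at_imp_continuous_on)

lemma smooth_step_derivatives_bounded:
 obtains C where "C > 0" "\<And>x. \<bar>smooth_step1 x\<bar> \<le> C" "\<And>x. \<bar>smooth_step2 x\<bar> \<le> C"
proof -
 have "bounded (smooth_step1 ` {0..1})" "bounded (smooth_step2 ` {0..1})"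
  using isCont_smooth_step
  by (auto intro!: compact_imp_bounded compact_continuous_image continuous_at_imp_continuous_on)
 then obtain a b where a: "\<And>x. x \<in> {0..1} ==> \<bar>smooth_step1 x\<bar> \<le> a"
  and b: "\<And>x. x \<in> {0..1} ==> \<bar>smooth_step2 x\<bar> \<le> b"
  unfolding bounded_real by blast
 show thesis
 proof (rule that[of "1 + \<bar>a\<bar> + \<bar>b\<bar>"])
  show "\<bar>smooth_step1 x\<bar> \<le> 1 + \<bar>a\<bar> + \<bar>b\<bar>" for x
   using a[of x] by (cases "x \<in> {0..1}") auto
  show "\<bar>smooth_step2 x\<bar> \<le> 1 + \<bar>a\<bar> + \<bar>b\<bar>" for x
   using b[of x] by (cases "x \<in> {0..1}") auto
 qed auto
qed

lemma times_differentiable_on_smooth_step: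
 assumes "open S" "times_differentiable_on k S g"
 shows "times_differentiable_on k S (\<lambda>z. smooth_step (g z))"
proof (cases k)
 case 0
 have "continuous_on UNIV smooth_step"
  by (intro continuous_at_imp_continuous_on ballI isCont_smooth_step)
 then show ?thesis using assms 0 continuous_on_compose2 by fastforce
next
 case (Suc k')
 note D = times_differentiable_on_SucD[OF assms(2)[unfolded Suc]]
 note I = times_differentiable_on_Suc_imp[OF assms(2)[unfolded Suc]]
 have eq: "smooth_step1 x = bump_poly 1 x * bump_poly 1 (1 - x) * (1 / step_integral 1)" for x
  by (simp add: smooth_step1_def step_density_def)
 show ?thesis unfolding Suc
 proof (rule times_differentiable_on_SucI[where
    D="\<lambda>z h. smooth_step1 (g z) * frechet_derivative g (at z) h"])
  show "((\<lambda>z. smooth_step (g z)) has_derivative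
    (\<lambda>h. smooth_step1 (g z) * frechet_derivative g (at z) h)) (at z)" if "z \<in> S" for z
   using has_derivative_compose[OF D(1)[OF that] smooth_step_has_derivative[unfolded has_field_derivative_def]] .
  show "times_differentiable_on k' S (\<lambda>z. smooth_step1 (g z) * frechet_derivative g (at z) h)" for h
   unfolding eq
   by (intro times_differentiable_on_mult times_differentiable_on_bump_poly
     times_differentiable_on_diff times_differentiable_on_const assms(1) I D)
 qed fact
qed

text \<open>Radial cut-offs in logarithmic scale: all derivatives are explicit, and \<open>k \<rightarrow> 0\<close> makes
 \<open>\<bar>z\<bar> \<bar>\<partial>f\<bar>\<close> and \<open>\<bar>z\<bar>\<^sup>2 \<bar>\<partial>\<partial>\<bar>f\<bar>\<close> small.\<close>

definition log_cutoff :: "real => real => complex => complex" where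
 "log_cutoff k a z = (if z = 0 then 0 else of_real (smooth_step (k * ln ((cmod z)^2) + a)))"

lemma norm_square_has_derivative:
 "((\<lambda>z. (cmod z)^2) has_derivative (\<lambda>h. Re (2 * cnj z * h))) (at z)"
proof -
 have "((\<lambda>z. Re z * Re z + Im z * Im z) has_derivative (\<lambda>h. Re (2 * cnj z * h))) (at z)"
  by (auto intro!: derivative_eq_intros simp: algebra_simps)
 moreover have "(cmod z)^2 = Re z * Re z + Im z * Im z" for z
  using cmod_power2[of z] by (simp only: power2_eq_square)
 ultimately show ?thesis by simp
qed

lemma log_norm_has_derivative:
 assumes "z \<noteq> 0"
 shows "((\<lambda>z. k * ln ((cmod z)^2) + a) has_derivative (\<lambda>h. Re (2 * (of_real k / z) * h))) (at z)"
proof -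
 have "((\<lambda>z. ln ((cmod z)^2)) has_derivative (\<lambda>h. Re (2 * cnj z * h) * (inverse ((cmod z)^2)))) (at z)"
  using has_derivative_compose[OF norm_square_has_derivative,
    OF DERIV_ln[of "(cmod z)^2", unfolded has_field_derivative_def]] assms
  by (simp add: mult.commute)
 then have "((\<lambda>z. k * ln ((cmod z)^2) + a) has_derivative
   (\<lambda>h. k * (Re (2 * cnj z * h) * (inverse ((cmod z)^2))))) (at z)"
  using has_derivative_add[OF has_derivative_mult_right[of _ _ _ k] has_derivative_const[of a]] by simp
 moreover have "k * (Re (2 * cnj z * h) * (inverse ((cmod z)^2))) = Re (2 * (of_real k / z) * h)" for h
 proof -
  have "of_real k / z = of_real (k * inverse ((cmod z)^2)) * cnj z"
   using assms by (simp add: complex_norm_square divide_simps flip: of_real_power)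
  then have "2 * (of_real k / z) * h = of_real (k * inverse ((cmod z)^2)) * (2 * cnj z * h)" by simp
  then show ?thesis by (simp del: of_real_mult)
 qed
 ultimately show ?thesis by simp
qed

lemma times_differentiable_on_log_norm:
 "times_differentiable_on k (-{0}) (\<lambda>z. c * ln ((cmod z)^2) + a)"
proof (cases k)
 case 0
 then show ?thesis by (auto intro!: continuous_intros)
next
 case (Suc k')
 show ?thesis unfolding Suc
 proof (rule times_differentiable_on_SucI[OF _ log_norm_has_derivative])
  have "times_differentiable_on k' (-{0}) (\<lambda>z. 2 * (of_real c / z) * h)" for h
   by (intro times_differentiable_on_holomorphic holomorphic_intros) auto
  then show "times_differentiable_on k' (-{0}) (\<lambda>z. Re (2 * (of_real c / z) * h))" for h
   by (intro times_differentiable_on_compose_linear[OF _ bounded_linear_Re]) auto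
 qed auto
qed

lemma log_cutoff_smooth: "smooth_on (-{0}) (log_cutoff c a)"
 unfolding smooth_on_def
proof
 fix k
 have "times_differentiable_on k (-{0}) (\<lambda>z. complex_of_real (smooth_step (c * ln ((cmod z)^2) + a)))"
  by (intro times_differentiable_on_compose_linear[OF _ bounded_linear_of_real]
    times_differentiable_on_smooth_step times_differentiable_on_log_norm) auto
 then show "times_differentiable_on k (-{0}) (log_cutoff c a)"
  by (rule times_differentiable_on_cong[rotated 2]) (auto simp: log_cutoff_def)
qed

text \<open>Since ln |z|^2 is harmonic off 0, with z-derivative 1/z, the chain rule leaves only the
  second derivative of the step in the mixed derivative. Each derivative brings one factor k and one
  factor 1/|z|.\<close>

lemma wirtinger2_log_cutoff:
 "wirtinger2 (-{0}) (log_cutoff k a)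
  (\<lambda>z. of_real (k * smooth_step1 (k * ln ((cmod z)^2) + a)) / z)
  (\<lambda>z. of_real (k * smooth_step1 (k * ln ((cmod z)^2) + a)) / cnj z)
  (\<lambda>z. of_real (k^2 * smooth_step2 (k * ln ((cmod z)^2) + a)) / (z * cnj z))"
 unfolding wirtinger2_def
proof (intro ballI conjI)
 fix z :: complex assume "z \<in> -{0}"
 then have z: "z \<noteq> 0" by simp
 let ?g = "\<lambda>z. k * ln ((cmod z)^2) + a"
 have 1: "has_wirtinger (\<lambda>z. complex_of_real (smooth_step (?g z)))
   (of_real (smooth_step1 (?g z)) * (of_real k / z)) (of_real (smooth_step1 (?g z)) * cnj (of_real k / z)) z"
  by (rule has_wirtinger_real_compose[OF log_norm_has_derivative[OF z] smooth_step_has_derivative])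
 have 2: "has_wirtinger (\<lambda>z. complex_of_real (smooth_step1 (?g z)))
   (of_real (smooth_step2 (?g z)) * (of_real k / z)) (of_real (smooth_step2 (?g z)) * cnj (of_real k / z)) z"
  by (rule has_wirtinger_real_compose[OF log_norm_has_derivative[OF z] smooth_step1_has_derivative])
 have "has_wirtinger (log_cutoff k a)
   (of_real (smooth_step1 (?g z)) * (of_real k / z)) (of_real (smooth_step1 (?g z)) * cnj (of_real k / z)) z"
  by (rule has_wirtinger_cong[OF _ _ _ 1, of "-{0}"]) (use z in \<open>auto simp: log_cutoff_def\<close>)
 then show "has_wirtinger (log_cutoff k a) (of_real (k * smooth_step1 (?g z)) / z)
   (of_real (k * smooth_step1 (?g z)) / cnj z) z"
  by (simp add: mult.commute)
 have "((\<lambda>z. of_real k / z) has_field_derivative - of_real k / z^2) (at z)"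
  using z by (auto intro!: derivative_eq_intros simp: power2_eq_square)
 then have 3: "has_wirtinger (\<lambda>z. cnj (of_real k / z)) (cnj 0) (cnj (- of_real k / z^2)) z"
  by (intro has_wirtinger_cnj has_wirtinger_holomorphic)
 from has_wirtinger_mult[OF 2 3] obtain m where m: "has_wirtinger
   (\<lambda>z. of_real (smooth_step1 (?g z)) * cnj (of_real k / z))
   (of_real (smooth_step1 (?g z)) * cnj 0 + of_real (smooth_step2 (?g z)) * (of_real k / z) * cnj (of_real k / z)) m z"
  by blast
 have "(\<lambda>z. of_real (smooth_step1 (?g z)) * cnj (of_real k / z)) = (\<lambda>z. of_real (k * smooth_step1 (?g z)) / cnj z)"
  by (simp add: mult.commute)
 moreover have "of_real (smooth_step1 (?g z)) * cnj 0 + of_real (smooth_step2 (?g z)) * (of_real k / z) * cnj (of_real k / z)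
   = of_real (k^2 * smooth_step2 (?g z)) / (z * cnj z)"
  by (simp add: power2_eq_square)
 ultimately show "\<exists>m. has_wirtinger (\<lambda>z. of_real (k * smooth_step1 (?g z)) / cnj z)
   (of_real (k^2 * smooth_step2 (?g z)) / (z * cnj z)) m z"
  using m by metis
qed

section \<open>The regularised logarithmic potential\<close>

text \<open>A smooth regularisation of log |w|. The next two definitions are its z-derivative and
  its mixed derivative; four times the latter is the approximate identity
  \<open>approx_kernel\<close>, whose total mass need not be 1.\<close>

definition log_kernel :: "real => complex => complex" where
 "log_kernel e w = of_real (ln ((cmod w)^2 + e^2) / 2)"

definition log_kernel_p :: "real => complex => complex" where
 "log_kernel_p e w = cnj w / (2 * of_real ((cmod w)^2 + e^2))"

definition log_kernel_l :: "real => complex => complex" where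
 "log_kernel_l e w = of_real (e^2 / (2 * ((cmod w)^2 + e^2)^2))"

lemma norm_square_plus_has_derivative:
 "((\<lambda>z. (cmod z)^2 + c) has_derivative (\<lambda>h. Re (2 * cnj z * h))) (at z)"
 using has_derivative_add[OF norm_square_has_derivative has_derivative_const[of c]] by simp

lemma norm_square_plus_pos: "e > 0 ==> (cmod w)^2 + e^2 > 0"
 by (simp add: add_nonneg_pos)

lemma wirtinger2_log_kernel:
 assumes "e > 0"
 shows "wirtinger2 S (log_kernel e) (log_kernel_p e) (\<lambda>w. cnj (log_kernel_p e w)) (log_kernel_l e)"
 unfolding wirtinger2_def
proof (intro ballI conjI)
 fix z :: complex
 let ?g = "\<lambda>z. (cmod z)^2 + e^2"
 have g: "?g z > 0" by (rule norm_square_plus_pos[OF assms])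
 have "((\<lambda>x. ln x / 2) has_real_derivative 1 / (2 * ?g z)) (at (?g z))"
  using DERIV_cdivide[OF DERIV_ln[OF g], of 2] by (simp add: inverse_eq_divide mult.commute)
 from has_wirtinger_real_compose[OF norm_square_plus_has_derivative this]
 show "has_wirtinger (log_kernel e) (log_kernel_p e z) (cnj (log_kernel_p e z)) z"
  by (simp add: log_kernel_def[abs_def] log_kernel_p_def)
 have "((\<lambda>x. 1 / (2 * x)) has_real_derivative - 1 / (2 * (?g z)^2)) (at (?g z))"
 proof -
  have "((\<lambda>x. 1 / (2 * x)) has_real_derivative - 1 / (2 * x^2)) (at x)" if "x > 0" for x :: real
   using that by (auto intro!: derivative_eq_intros simp: power2_eq_square)
  then show ?thesis using g by blast
 qed
 from has_wirtinger_mult[OF has_wirtinger_holomorphic[OF DERIV_ident]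
   has_wirtinger_real_compose[OF norm_square_plus_has_derivative this]]
 obtain m where m: "has_wirtinger (\<lambda>z. z * of_real (1 / (2 * ?g z)))
   (z * (of_real (- 1 / (2 * (?g z)^2)) * cnj z) + 1 * of_real (1 / (2 * ?g z))) m z" by blast
 have "z * (of_real (- 1 / (2 * (?g z)^2)) * cnj z) + 1 * of_real (1 / (2 * ?g z))
  = of_real (- 1 / (2 * (?g z)^2)) * (z * cnj z) + of_real (1 / (2 * ?g z))" by simp
 also have "z * cnj z = of_real ((cmod z)^2)" by (rule complex_norm_square[symmetric])
 also have "of_real (- 1 / (2 * (?g z)^2)) * of_real ((cmod z)^2) + of_real (1 / (2 * ?g z))
  = complex_of_real (- 1 / (2 * (?g z)^2) * (cmod z)^2 + 1 / (2 * ?g z))" by simp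
 also have "- 1 / (2 * (?g z)^2) * (cmod z)^2 + 1 / (2 * ?g z) = e^2 / (2 * (?g z)^2)"
 proof -
  have "- 1 / (2 * G^2) * x + 1 / (2 * G) = (G - x) / (2 * G^2)" if "G > 0" for G x :: real
   using that by (simp add: field_simps power2_eq_square)
  from this[OF g, of "(cmod z)^2"] show ?thesis by simp
 qed
 finally have "has_wirtinger (\<lambda>z. z * of_real (1 / (2 * ?g z))) (log_kernel_l e z) m z"
  using m by (simp add: log_kernel_l_def)
 moreover have "(\<lambda>z. z * of_real (1 / (2 * ?g z))) = (\<lambda>w. cnj (log_kernel_p e w))"
  by (simp add: log_kernel_p_def)
 ultimately show "\<exists>m. has_wirtinger (\<lambda>w. cnj (log_kernel_p e w)) (log_kernel_l e z) m z" by metis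
qed

lemma times_differentiable_on_cnj:
 "open S ==> times_differentiable_on k S f ==> times_differentiable_on k S (\<lambda>z. cnj (f z))"
 by (rule times_differentiable_on_compose_linear[OF _ bounded_linear_cnj])

lemma log_kernel_smooth:
 assumes "e > 0"
 shows "smooth_on UNIV (log_kernel e)"
 unfolding smooth_on_def
proof
 fix k
 let ?g = "\<lambda>z. (cmod z)^2 + e^2"
 have pos: "?g z > 0" for z by (rule norm_square_plus_pos[OF assms])
 have id: "times_differentiable_on k UNIV (\<lambda>z::complex. z)" for k
  by (intro times_differentiable_on_linear bounded_linear_ident) auto
 have "times_differentiable_on k UNIV (\<lambda>z. Re (z * cnj z) + e^2)" for k
  by (intro times_differentiable_on_add times_differentiable_on_compose_linear[OF _ bounded_linear_Re]
    times_differentiable_on_mult times_differentiable_on_cnj id times_differentiable_on_const) auto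
 then have g: "times_differentiable_on k UNIV ?g" for k
  by (simp add: complex_norm_square[symmetric] flip: of_real_power)
 show "times_differentiable_on k UNIV (log_kernel e)"
 proof (cases k)
  case 0
  have "?g z \<noteq> 0" for z using pos[of z] by linarith
  then show ?thesis
   unfolding 0 log_kernel_def[abs_def] times_differentiable_on.simps
   by (intro continuous_intros) simp_all
 next
  case (Suc k')
  have "((\<lambda>z. ln (?g z) / 2) has_derivative (\<lambda>h. Re (cnj z * h) * inverse (?g z))) (at z)" for z
  proof -
   have "((\<lambda>x. ln x / 2) has_real_derivative inverse (?g z) / 2) (at (?g z))"
    using DERIV_cdivide[OF DERIV_ln[OF pos[of z]], of 2] .
   from has_derivative_compose[OF norm_square_plus_has_derivative this[unfolded has_field_derivative_def]]
   show ?thesis by (simp add: algebra_simps)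
  qed
  moreover have "times_differentiable_on k' UNIV (\<lambda>z. Re (cnj z * h) * inverse (?g z))" for h
  proof -
   have "?g z \<noteq> 0" for z using pos[of z] by linarith
   then show ?thesis
    by (intro times_differentiable_on_mult times_differentiable_on_inverse g
      times_differentiable_on_compose_linear[OF _ bounded_linear_Re]
      times_differentiable_on_cnj id times_differentiable_on_const) auto
  qed
  ultimately have "times_differentiable_on k UNIV (\<lambda>z. ln (?g z) / 2)"
   unfolding Suc by (intro times_differentiable_on_SucI) auto
  then show ?thesis
   unfolding log_kernel_def[abs_def]
   by (intro times_differentiable_on_compose_linear[OF _ bounded_linear_of_real]) auto
 qed
qed

section \<open>Integrals over the plane\<close>

lemma emeasure_cball_complex:
 "r \<ge> 0 ==> emeasure lborel (cball (c::complex) r) = ennreal (pi * r^2)"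
 by (simp add: emeasure_cball unit_ball_vol_2)

text \<open>A substitute for polar coordinates: a function dominated by a sum of multiples of disc
  indicators is integrable as soon as height times squared radius decays geometrically.\<close>

lemma nn_integral_le_geometric:
 fixes f :: "complex => ennreal"
 assumes f: "\<And>z. f z \<le> (\<Sum>k. ennreal (a k) * indicator (cball c (r k)) z)"
  and nonneg: "\<And>k. a k \<ge> 0" "\<And>k. r k \<ge> 0" "B \<ge> 0" and q: "0 \<le> q" "q < 1"
  and le: "\<And>k. a k * (r k)^2 \<le> B * q ^ k"
 shows "(\<integral>\<^sup>+z. f z \<partial>lborel) < \<infinity>"
proof -
 have "(\<integral>\<^sup>+z. f z \<partial>lborel) \<le> (\<integral>\<^sup>+z. (\<Sum>k. ennreal (a k) * indicator (cball c (r k)) z) \<partial>lborel)"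
  by (intro nn_integral_mono f)
 also have "\<dots> = (\<Sum>k. \<integral>\<^sup>+z. ennreal (a k) * indicator (cball c (r k)) z \<partial>lborel)"
  by (intro nn_integral_suminf borel_measurable_times_ennreal borel_measurable_const
    borel_measurable_indicator) auto
 also have "\<dots> = (\<Sum>k. ennreal (a k * (pi * (r k)^2)))"
  using nonneg by (simp add: nn_integral_cmult_indicator emeasure_cball_complex ennreal_mult)
 also have "\<dots> \<le> (\<Sum>k. ennreal (pi * B * q ^ k))"
 proof (intro suminf_le ennreal_leI)
  show "a k * (pi * (r k)^2) \<le> pi * B * q ^ k" for k
   using mult_left_mono[OF le[of k], of pi] by (simp add: mult_ac)
 qed auto
 also have "\<dots> = ennreal (\<Sum>k. pi * B * q ^ k)"
  using nonneg q by (intro suminf_ennreal2 summable_mult summable_geometric) auto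
 also have "\<dots> < \<infinity>" by simp
 finally show ?thesis .
qed

lemma exists_exp_shell:
 assumes "x > 0"
 obtains k :: nat where "x \<le> exp (real k)" "k = 0 \<or> x > exp (real k - 1)"
proof -
 obtain m :: nat where "ln x \<le> real m" using real_arch_simple by blast
 define k where "k = (LEAST m::nat. ln x \<le> real m)"
 have k: "ln x \<le> real k" unfolding k_def by (rule LeastI) fact
 have "k = 0 \<or> ln x > real k - 1"
 proof (rule disjCI)
  assume *: "\<not> ln x > real k - 1"
  show "k = 0"
  proof (rule ccontr)
   assume "k \<noteq> 0"
   then have "ln x \<le> real (k - 1)" "k - 1 < k" using * by (simp_all add: of_nat_diff)
   then show False using not_less_Least[of "k - 1" "\<lambda>m. ln x \<le> real m"] unfolding k_def by blast
  qed
 qed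
 moreover have "x \<le> exp (real k)" using k assms by (metis exp_le_cancel_iff exp_ln)
 moreover have "ln x > real k - 1 ==> x > exp (real k - 1)"
  using assms by (metis exp_less_cancel_iff exp_ln)
 ultimately show thesis using that by blast
qed

lemma suminf_ennreal_ge:
 fixes a :: "nat => ennreal" shows "a k \<le> (\<Sum>k. a k)"
proof -
 have "sum a {k} \<le> (\<Sum>k. a k)" by (rule sum_le_suminf[OF summableI]) auto
 then show ?thesis by simp
qed

text \<open>On the shell between radii R e^(-k-1) and R e^(-k) the power is comparable to its value
  at the inner radius, and the disc has area of order e^(-2k), so the shells form a geometric series
  of ratio e^(-(2-g)).\<close>

lemma nn_integral_powr_finite:
 fixes e r :: real
 assumes "e < 2"
 shows "(\<integral>\<^sup>+z\<in>cball 0 r. ennreal (cmod z powr - e) \<partial>lborel) < \<infinity>"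
proof -
 \<comment> \<open>A negative e means a bounded integrand; it is reduced to the exponent g = 0, with
   the bound R^(-e) absorbed into C.\<close>
 define g where "g = max e 0"
 define R where "R = max r 1"
 define C where "C = (max 1 (R powr (- e))) * R powr g"
 have g: "0 \<le> g" "g < 2" "R \<ge> 1" using assms by (auto simp: g_def R_def)
 have C0: "C > 0" using g by (simp add: C_def)
 have C: "cmod z powr - e \<le> C * cmod z powr - g" if "z \<noteq> 0" "cmod z \<le> R" for z
 proof (cases "e \<ge> 0")
  case True
  have "1 * 1 \<le> C" unfolding C_def using g by (intro mult_mono ge_one_powr_ge_zero) auto
  then have "C \<ge> 1" by simp
  then show ?thesis using True mult_right_mono[of 1 C "cmod z powr - e"] by (simp add: g_def)
 next
  case False
  then have "cmod z powr - e \<le> R powr - e" using that by (intro powr_mono2) auto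
  then show ?thesis using False that g by (simp add: g_def C_def)
 qed
 show ?thesis
 proof (rule nn_integral_le_geometric[where c=0 and a="\<lambda>k. C * (R * exp (- real k - 1)) powr - g"
    and r="\<lambda>k. R * exp (- real k)" and q="exp (- (2 - g))" and B="C * R powr (2 - g) * exp g"])
  fix z :: complex
  let ?S = "\<Sum>k. ennreal (C * (R * exp (- real k - 1)) powr - g) * indicator (cball 0 (R * exp (- real k))) z"
  show "ennreal (cmod z powr - e) * indicator (cball 0 r) z \<le> ?S"
  proof (cases "z \<noteq> 0 \<and> cmod z \<le> r")
   case True
   then have z: "z \<noteq> 0" "cmod z \<le> R" "cmod z > 0" by (auto simp: R_def)
   obtain m :: nat where m: "R / cmod z \<le> exp (real m)" "m = 0 \<or> R / cmod z > exp (real m - 1)"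
    using exists_exp_shell[of "R / cmod z"] z g by auto
   \<comment> \<open>Subtraction is truncated: m = 0 and m = 1 both give the outermost shell k = 0.
     In every case m \<le> k + 1, which is what the lower bound on |z| uses.\<close>
   define k where "k = m - 1"
   have up: "cmod z \<le> R * exp (- real k)"
   proof (cases "m = 0")
    case False
    then show ?thesis using m z by (simp add: k_def of_nat_diff exp_minus field_simps exp_diff)
   qed (use z in \<open>simp add: k_def\<close>)
   have low: "cmod z \<ge> R * exp (- real k - 1)"
   proof -
    have "exp (real m) \<le> exp (real k + 1)" by (simp add: k_def)
    then have "R / cmod z \<le> exp (real k + 1)" using m by linarith
    then have "R / exp (real k + 1) \<le> cmod z" using z by (simp add: field_simps)
    moreover have "exp (- real k - 1) = 1 / exp (real k + 1)"
     using exp_minus[of "real k + 1"] by (simp add: inverse_eq_divide)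
    ultimately show ?thesis by simp
   qed
   have "cmod z powr - g \<le> (R * exp (- real k - 1)) powr - g"
    using low g by (intro powr_mono2') auto
   then have "ennreal (cmod z powr - e) \<le> ennreal (C * (R * exp (- real k - 1)) powr - g)"
    using C[OF z(1,2)] C0 by (intro ennreal_leI) (meson less_imp_le mult_left_mono order_trans)
   also have "\<dots> = ennreal (C * (R * exp (- real k - 1)) powr - g) * indicator (cball 0 (R * exp (- real k))) z"
    using up by simp
   also have "\<dots> \<le> ?S" by (rule suminf_ennreal_ge)
   finally show ?thesis using True by simp
  qed auto
  show "C * (R * exp (- real k - 1)) powr - g * (R * exp (- real k))^2
    \<le> C * R powr (2 - g) * exp g * exp (- (2 - g)) ^ k" for k :: nat
  proof -
   have 1: "(R * exp (- real k - 1)) powr - g = R powr - g * exp ((real k + 1) * g)"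
    using g by (simp add: powr_def ln_mult algebra_simps flip: exp_add)
   have 2: "(R * exp (- real k))^2 = R powr 2 * exp (- 2 * real k)"
    using g by (simp add: power_mult_distrib flip: exp_of_nat_mult)
   have 3: "R powr - g * R powr 2 = R powr (2 - g)" by (simp flip: powr_add)
   have 4: "exp ((real k + 1) * g) * exp (- 2 * real k) = exp g * exp (- (2 - g)) ^ k"
    by (simp add: algebra_simps flip: exp_of_nat_mult exp_add)
   have "C * (R powr - g * exp ((real k + 1) * g)) * (R powr 2 * exp (- 2 * real k))
    = C * (R powr - g * R powr 2) * (exp ((real k + 1) * g) * exp (- 2 * real k))"
    by (simp only: mult_ac)
   then show ?thesis unfolding 1 2 3 4 by (simp only: mult.assoc order_refl)
  qed
 qed (use g C0 in auto)
qed

text \<open>The exponent -2 is critical: every shell e^(-k-1) \<le> |z| \<le> e^-k contributes the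
  same amount, at most pi e^2. The total therefore grows only linearly in K, which a factor 1/K^2
  from a logarithmic cut-off beats.\<close>

lemma nn_integral_powr_minus2_shells:
 "(\<integral>\<^sup>+z\<in>{z. exp (- real K) \<le> cmod z \<and> cmod z \<le> 1}. ennreal (cmod z powr - 2) \<partial>lborel)
  \<le> ennreal (pi * exp 2 * (real K + 1))"
proof -
 have "(\<integral>\<^sup>+z\<in>{z. exp (- real K) \<le> cmod z \<and> cmod z \<le> 1}. ennreal (cmod z powr - 2) \<partial>lborel)
  \<le> (\<integral>\<^sup>+z. (\<Sum>k\<le>K. ennreal (exp (2 * (real k + 1))) * indicator (cball (0::complex) (exp (- real k))) z) \<partial>lborel)"
 proof (rule nn_integral_mono)
  fix z :: complex
  let ?S = "\<Sum>k\<le>K. ennreal (exp (2 * (real k + 1))) * indicator (cball 0 (exp (- real k))) z"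
  show "ennreal (cmod z powr - 2) * indicator {z. exp (- real K) \<le> cmod z \<and> cmod z \<le> 1} z \<le> ?S"
  proof (cases "exp (- real K) \<le> cmod z \<and> cmod z \<le> 1")
   case True
   then have z: "cmod z > 0" by (meson exp_gt_zero less_le_trans)
   obtain m :: nat where m: "1 / cmod z \<le> exp (real m)" "m = 0 \<or> 1 / cmod z > exp (real m - 1)"
    using exists_exp_shell[of "1 / cmod z"] z by auto
   define k where "k = m - 1"
   have kK: "k \<le> K"
   proof (cases "m = 0")
    case False
    have "1 / cmod z \<le> exp (real K)" using True z by (simp add: exp_minus field_simps)
    then have "exp (real m - 1) < exp (real K)" using m False by linarith
    then show ?thesis by (auto simp: k_def)
   qed (simp add: k_def)
   have up: "cmod z \<le> exp (- real k)"
   proof (cases "m = 0")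
    case False
    then show ?thesis using m z by (simp add: k_def of_nat_diff exp_minus field_simps exp_diff)
   qed (use True in \<open>simp add: k_def\<close>)
   have "exp (real m) \<le> exp (real k + 1)" by (simp add: k_def)
   then have low: "1 / cmod z \<le> exp (real k + 1)" using m by linarith
   have "cmod z powr - 2 = (1 / cmod z)^2"
    using z by (simp add: powr_minus divide_inverse power_inverse)
   also have "\<dots> \<le> (exp (real k + 1))^2" using low z by (intro power_mono) auto
   also have "\<dots> = exp (2 * (real k + 1))" by (rule exp_double[symmetric])
   finally have "ennreal (cmod z powr - 2) \<le> ennreal (exp (2 * (real k + 1))) * indicator (cball 0 (exp (- real k))) z"
    using up by (simp add: ennreal_leI)
   also have "\<dots> \<le> ?S"
    by (rule member_le_sum[of k "{..K}" "\<lambda>k. ennreal (exp (2 * (real k + 1))) * indicator (cball 0 (exp (- real k))) z"]) (use kK in auto)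
   finally show ?thesis using True by simp
  qed auto
 qed
 also have "\<dots> = (\<Sum>k\<le>K. \<integral>\<^sup>+z. ennreal (exp (2 * (real k + 1))) * indicator (cball (0::complex) (exp (- real k))) z \<partial>lborel)"
  by (intro nn_integral_sum borel_measurable_times_ennreal borel_measurable_const
    borel_measurable_indicator) auto
 also have "\<dots> = (\<Sum>k\<le>K. ennreal (exp (2 * (real k + 1)) * (pi * (exp (- real k))^2)))"
  by (simp add: nn_integral_cmult_indicator emeasure_cball_complex ennreal_mult)
 also have "\<dots> = (\<Sum>k\<le>K. ennreal (pi * exp 2))"
 proof (rule sum.cong[OF refl], rule arg_cong[where f=ennreal])
  fix k
  have "exp (2 * (real k + 1)) * (exp (- real k))^2 = exp 2"
   by (simp add: exp_double[symmetric] flip: exp_add)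
  then show "exp (2 * (real k + 1)) * (pi * (exp (- real k))^2) = pi * exp 2" by (simp add: mult_ac)
 qed
 also have "\<dots> = ennreal (pi * exp 2 * (real K + 1))"
  by (subst sum_ennreal) (simp_all add: algebra_simps)
 finally show ?thesis .
qed

section \<open>The approximate identity produced by the regularised logarithm\<close>

definition approx_kernel :: "real => complex => real" where
 "approx_kernel e w = 2 * e^2 / ((cmod w)^2 + e^2)^2"

lemma log_kernel_l_eq: "4 * log_kernel_l e w = of_real (approx_kernel e w)"
 by (simp add: log_kernel_l_def approx_kernel_def)

lemma approx_kernel_nonneg: "approx_kernel e w \<ge> 0"
 by (simp add: approx_kernel_def)

lemma approx_kernel_borel [measurable]: "approx_kernel e \<in> borel_fun"
 unfolding approx_kernel_def[abs_def] by measurable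

lemma approx_kernel_scale:
 assumes "e > 0"
 shows "e^2 * approx_kernel e (e *\<^sub>R w) = approx_kernel 1 w"
proof -
 have "(cmod (e *\<^sub>R w))^2 + e^2 = e^2 * ((cmod w)^2 + 1)"
  using assms by (simp add: power_mult_distrib algebra_simps)
 then show ?thesis using assms unfolding approx_kernel_def
  by (simp only:) (simp add: power_mult_distrib power2_eq_square)
qed

text \<open>The kernel decays like |z|^-4, so the shell e^(k-1) < |z| \<le> e^k, of area of order
  e^(2k), contributes an amount of order e^(-2k).\<close>

lemma integrable_approx_kernel_1: "integrable lborel (approx_kernel 1)"
proof (rule integrableI_nonneg)
 show "(\<integral>\<^sup>+x. ennreal (approx_kernel 1 x) \<partial>lborel) < \<infinity>"
 proof (rule nn_integral_le_geometric[where c=0 and a="\<lambda>k. 2 * exp (4 - 4 * real k)"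
    and r="\<lambda>k. exp (real k)" and q="exp (- 2)" and B="2 * exp 4"])
  fix z :: complex
  let ?S = "\<Sum>k. ennreal (2 * exp (4 - 4 * real k)) * indicator (cball 0 (exp (real k))) z"
  obtain k :: nat where k: "cmod z \<le> exp (real k)" "k = 0 \<or> cmod z > exp (real k - 1)"
  proof (cases "z = 0")
   case True
   then show thesis using that[of 0] by simp
  next
   case False
   then show thesis using exists_exp_shell[of "cmod z"] that by auto
  qed
  have "exp (2 * (real k - 1)) \<le> (cmod z)^2 + 1"
  proof (cases "k = 0")
   case True
   then have "exp (2 * (real k - 1)) \<le> 1" by simp
   also have "\<dots> \<le> (cmod z)^2 + 1" by simp
   finally show ?thesis .
  next
   case False
   then have "(exp (real k - 1))^2 \<le> (cmod z)^2" using k by (intro power_mono) auto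
   then show ?thesis using exp_double[of "real k - 1"] by linarith
  qed
  then have "(exp (2 * (real k - 1)))^2 \<le> ((cmod z)^2 + 1)^2" by (intro power_mono) auto
  then have "exp (4 * (real k - 1)) \<le> ((cmod z)^2 + 1)^2"
   by (simp flip: exp_double)
  then have "2 / ((cmod z)^2 + 1)^2 \<le> 2 / exp (4 * (real k - 1))"
   by (intro divide_left_mono) (auto intro!: mult_pos_pos zero_less_power add_nonneg_pos)
  also have "\<dots> = 2 * exp (4 - 4 * real k)"
   using exp_minus[of "4 * (real k - 1)"] by (simp add: divide_inverse algebra_simps)
  finally have "ennreal (approx_kernel 1 z) \<le> ennreal (2 * exp (4 - 4 * real k)) * indicator (cball 0 (exp (real k))) z"
   using k by (simp add: approx_kernel_def ennreal_leI)
  also have "\<dots> \<le> ?S" by (rule suminf_ennreal_ge)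
  finally show "ennreal (approx_kernel 1 z) \<le> ?S" .
 next
  show "2 * exp (4 - 4 * real k) * (exp (real k))^2 \<le> 2 * exp 4 * exp (- 2) ^ k" for k
   by (simp flip: exp_double exp_of_nat_mult exp_add)
 qed auto
qed (auto simp: approx_kernel_nonneg)

text \<open>Its value is 2 pi, the constant of Green's formula for log |z|. It is carried along as
  an unevaluated integral and divided out in the representation formula, for which positivity
  suffices.\<close>

definition kernel_mass :: real where
 "kernel_mass = (LINT w|lborel. approx_kernel 1 w)"

lemma kernel_mass_pos: "kernel_mass > 0"
proof -
 have "kernel_mass \<noteq> 0"
 proof
  assume "kernel_mass = 0"
  then have "AE w in lborel. approx_kernel 1 w = 0"
   using integral_nonneg_eq_0_iff_AE[OF integrable_approx_kernel_1]
   by (simp add: kernel_mass_def approx_kernel_nonneg)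
  moreover have "approx_kernel 1 w \<noteq> 0" for w
   using norm_square_plus_pos[of 1 w] by (simp add: approx_kernel_def)
  ultimately have "AE w::complex in lborel. False" by simp
  then show False by (simp add: AE_iff_measurable[OF _ refl] trivial_limit_def[symmetric] ae_filter_eq_bot_iff)
 qed
 moreover have "kernel_mass \<ge> 0"
  unfolding kernel_mass_def by (intro integral_nonneg_AE) (simp add: approx_kernel_nonneg)
 ultimately show ?thesis by simp
qed

lemma lborel_complex_affine:
 assumes "e > 0"
 shows "(lborel :: complex measure) = density (distr lborel borel (\<lambda>w. y + e *\<^sub>R w)) (\<lambda>_. ennreal (e^2))"
 using lborel_affine[of e y] assms by simp

text \<open>The substitution z = y + e w moves the parameter from the kernel into q, so that bounds
  and limits for all e are controlled by the single integrable function
  \<open>approx_kernel 1\<close>.\<close>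

lemma approx_kernel_convolution_eq:
 fixes q :: "complex => complex"
 assumes [measurable]: "q \<in> borel_fun" and "e > 0"
 shows "(LINT z|lborel. q z * of_real (approx_kernel e (z - y)))
  = (LINT w|lborel. q (y + e *\<^sub>R w) * of_real (approx_kernel 1 w))"
  "integrable lborel (\<lambda>z. q z * of_real (approx_kernel e (z - y)))
  = integrable lborel (\<lambda>w. q (y + e *\<^sub>R w) * of_real (approx_kernel 1 w))"
proof -
 let ?f = "\<lambda>z. q z * of_real (approx_kernel e (z - y))"
 have eq: "e^2 *\<^sub>R ?f (y + e *\<^sub>R w) = q (y + e *\<^sub>R w) * of_real (approx_kernel 1 w)" for w
  by (simp add: approx_kernel_scale[OF assms(2), of w, symmetric] scaleR_conv_of_real)
 show "(LINT z|lborel. ?f z) = (LINT w|lborel. q (y + e *\<^sub>R w) * of_real (approx_kernel 1 w))"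
 proof -
  have "(LINT z|lborel. ?f z) = (LINT w|lborel. e^2 *\<^sub>R ?f (y + e *\<^sub>R w))"
   by (subst lborel_complex_affine[OF assms(2), of y]) (simp add: integral_density integral_distr)
  then show ?thesis by (simp only: eq)
 qed
 show "integrable lborel ?f = integrable lborel (\<lambda>w. q (y + e *\<^sub>R w) * of_real (approx_kernel 1 w))"
 proof -
  have "integrable lborel ?f = integrable lborel (\<lambda>w. e^2 *\<^sub>R ?f (y + e *\<^sub>R w))"
   by (subst lborel_complex_affine[OF assms(2), of y]) (simp add: integrable_density integrable_distr_eq)
  then show ?thesis by (simp only: eq)
 qed
qed

lemma approx_kernel_convolution_integrable:
 fixes q :: "complex => complex"
 assumes [measurable]: "q \<in> borel_fun" and "e > 0" "\<And>z. cmod (q z) \<le> N"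
 shows "integrable lborel (\<lambda>z. q z * of_real (approx_kernel e (z - y)))"
proof -
 have N: "N \<ge> 0" using order_trans[OF norm_ge_zero assms(3)] .
 have "integrable lborel (\<lambda>w. q (y + e *\<^sub>R w) * of_real (approx_kernel 1 w))"
  by (rule Bochner_Integration.integrable_bound[OF integrable_mult_right[OF integrable_approx_kernel_1, of N]])
   (use N assms(3) in \<open>auto simp: norm_mult abs_mult intro!: mult_right_mono AE_I2\<close>)
 then show ?thesis using approx_kernel_convolution_eq(2)[OF assms(1,2)] by simp
qed

lemma approx_kernel_convolution_bound:
 fixes q :: "complex => complex"
 assumes [measurable]: "q \<in> borel_fun" and "e > 0" "\<And>z. cmod (q z) \<le> N"
 shows "cmod (LINT z|lborel. q z * of_real (approx_kernel e (z - y))) \<le> kernel_mass * N"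
proof -
 have "cmod (LINT w|lborel. q (y + e *\<^sub>R w) * of_real (approx_kernel 1 w))
   \<le> (LINT w|lborel. N * approx_kernel 1 w)"
  by (rule Bochner_Integration.integral_norm_bound_integral)
   (use assms approx_kernel_convolution_integrable[OF assms, of y] approx_kernel_convolution_eq(2)[OF assms(1,2), of y]
    integrable_approx_kernel_1 approx_kernel_nonneg in \<open>auto simp: norm_mult intro!: mult_right_mono\<close>)
 then show ?thesis
  by (simp add: approx_kernel_convolution_eq(1)[OF assms(1,2)] kernel_mass_def mult.commute)
qed

lemma approx_kernel_convolution_tendsto:
 fixes q :: "complex => complex"
 assumes [measurable]: "q \<in> borel_fun" and bd: "\<And>z. cmod (q z) \<le> N"
  and cont: "isCont q y" and d: "\<And>j. d j > 0" "d \<longlonglongrightarrow> 0"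
 shows "(\<lambda>j. LINT z|lborel. q z * of_real (approx_kernel (d j) (z - y))) \<longlonglongrightarrow> of_real kernel_mass * q y"
proof -
 have "(\<lambda>j. LINT w|lborel. q (y + d j *\<^sub>R w) * of_real (approx_kernel 1 w))
  \<longlonglongrightarrow> (LINT w|lborel. q y * of_real (approx_kernel 1 w))"
 proof (rule integral_dominated_convergence[where w="\<lambda>w. N * approx_kernel 1 w"])
  show "AE w in lborel. (\<lambda>j. q (y + d j *\<^sub>R w) * of_real (approx_kernel 1 w))
    \<longlonglongrightarrow> q y * of_real (approx_kernel 1 w)"
  proof (intro AE_I2 tendsto_mult tendsto_const)
   fix w
   have "(\<lambda>j. y + d j *\<^sub>R w) \<longlonglongrightarrow> y + 0 *\<^sub>R w" by (intro tendsto_intros d)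
   then show "(\<lambda>j. q (y + d j *\<^sub>R w)) \<longlonglongrightarrow> q y"
    using isCont_tendsto_compose[OF cont] by simp
  qed
 qed (use integrable_approx_kernel_1 bd approx_kernel_nonneg in
   \<open>auto simp: norm_mult intro!: mult_right_mono AE_I2\<close>)
 moreover have "(LINT w|lborel. q y * of_real (approx_kernel 1 w)) = of_real kernel_mass * q y"
  by (simp add: kernel_mass_def mult.commute)
 ultimately show ?thesis by (simp only: approx_kernel_convolution_eq(1)[OF assms(1) d(1)])
qed

text \<open>A Lebesgue measurable function is an almost everywhere limit of continuous functions;
  composing these with a retraction onto a disc makes the approximants uniformly bounded.\<close>

lemma AE_lborel_lim_continuous:
 fixes f :: "complex => complex"
 assumes f: "f \<in> borel_fun" and bd: "\<And>z. cmod (f z) \<le> N"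
 obtains h where "\<And>j. continuous_on UNIV (h j)" "\<And>j z. cmod (h j z) \<le> N + 1"
  "AE z in lborel. (\<lambda>j. h j z) \<longlonglongrightarrow> f z"
proof -
 have N: "N \<ge> 0" using order_trans[OF norm_ge_zero bd] .
 have "f \<in> borel_measurable lebesgue" using f by (simp add: measurable_completion)
 then have "f measurable_on UNIV" by (rule lebesgue_measurable_imp_measurable_on) simp
 then obtain E g where E: "negligible E" and g: "\<And>n. continuous_on UNIV (g n)"
  and lim: "\<And>x. x \<notin> E ==> (\<lambda>n. g n x) \<longlonglongrightarrow> f x"
  unfolding measurable_on_def by auto
 \<comment> \<open>The radial retraction onto the disc of radius N + 1. It is continuous and fixes
   the values of f; the extra 1 keeps the denominator positive when N = 0.\<close>
 define cl where "cl y = y * of_real ((N + 1) / max (N + 1) (cmod y))" for y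
 have cl: "continuous_on UNIV cl" unfolding cl_def using N by (intro continuous_intros) auto
 have "AE x in lebesgue. x \<notin> E"
  using E by (intro AE_not_in) (simp add: negligible_iff_null_sets)
 then have "AE x in lborel. x \<notin> E" by (simp add: AE_completion_iff)
 moreover have "(\<lambda>n. cl (g n x)) \<longlonglongrightarrow> f x" if "x \<notin> E" for x
 proof -
  have "isCont cl (f x)" using cl by (simp add: continuous_on_eq_continuous_at)
  then have "(\<lambda>n. cl (g n x)) \<longlonglongrightarrow> cl (f x)" using lim[OF that] by (rule isCont_tendsto_compose)
  moreover have "cl (f x) = f x" using bd[of x] N by (simp add: cl_def max_def)
  ultimately show ?thesis by simp
 qed
 ultimately have "AE x in lborel. (\<lambda>n. cl (g n x)) \<longlonglongrightarrow> f x" by auto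
 moreover have "continuous_on UNIV (\<lambda>x. cl (g n x))" for n
  by (rule continuous_on_compose2[OF cl g]) auto
 moreover have "cmod (cl y) \<le> N + 1" for y
 proof -
  have "cmod (cl y) = cmod y * (N + 1) / max (N + 1) (cmod y)"
   using N by (simp add: cl_def norm_mult norm_divide)
  also have "\<dots> \<le> N + 1"
  proof (cases "cmod y \<le> N + 1")
   case True
   then show ?thesis using N by (simp add: max_def)
  next
   case False
   then have "cmod y > 0" "max (N + 1) (cmod y) = cmod y" using N by linarith+
   then show ?thesis by simp
  qed
  finally show ?thesis .
 qed
 ultimately show thesis using that[of "\<lambda>n x. cl (g n x)"] by blast
qed

text \<open>The fundamental lemma of the calculus of variations. The bounded function cnj f / |f| is
  approximated by continuous test functions, and in the limit the integral of |f| vanishes.\<close>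

lemma lborel_ident_integral_eq_zero:
 fixes f :: "complex => complex"
 assumes f: "integrable lborel f"
  and z: "\<And>q N. continuous_on UNIV q ==> (\<And>z. cmod (q z) \<le> N) ==> (LINT z|lborel. f z * q z) = 0"
 shows "AE z in lborel. f z = 0"
proof -
 have [measurable]: "f \<in> borel_fun" using f by simp
 define s where "s z = (if f z = 0 then 0 else cnj (f z) / of_real (cmod (f z)))" for z
 have s: "s \<in> borel_fun"
  unfolding s_def[abs_def] by (intro measurable_If borel_measurable_divide borel_measurable_continuous_on[OF continuous_on_cnj[OF continuous_on_id]]) measurable
 have "cmod (s z) \<le> 1" for z by (simp add: s_def norm_divide)
 from AE_lborel_lim_continuous[OF s this] obtain h where h: "\<And>j. continuous_on UNIV (h j)"
  "\<And>j z. cmod (h j z) \<le> 2" "AE z in lborel. (\<lambda>j. h j z) \<longlonglongrightarrow> s z" by auto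
 have [measurable]: "h j \<in> borel_fun" for j
  using h(1) by (rule borel_measurable_continuous_onI)
 have "(\<lambda>j. LINT z|lborel. f z * h j z) \<longlonglongrightarrow> (LINT z|lborel. f z * s z)"
 proof (rule integral_dominated_convergence[where w="\<lambda>z. 2 * cmod (f z)"])
  show "AE z in lborel. (\<lambda>j. f z * h j z) \<longlonglongrightarrow> f z * s z"
   using h(3) by eventually_elim (intro tendsto_mult tendsto_const)
  show "AE z in lborel. cmod (f z * h j z) \<le> 2 * cmod (f z)" for j
   using mult_left_mono[OF h(2)[of j], of "cmod (f z)" for z] by (auto simp: norm_mult mult.commute)
 qed (use f s in auto)
 moreover have "(LINT z|lborel. f z * h j z) = 0" for j
  by (rule z[of "h j" 2, OF h(1) h(2)])
 ultimately have "(LINT z|lborel. f z * s z) = 0" by (simp add: LIMSEQ_const_iff)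
 moreover have "f z * s z = of_real (cmod (f z))" for z
 proof (cases "f z = 0")
  case False
  have "f z * s z = (f z * cnj (f z)) / of_real (cmod (f z))" using False by (simp add: s_def)
  also have "f z * cnj (f z) = of_real ((cmod (f z))^2)" by (rule complex_norm_square[symmetric])
  also have "of_real ((cmod (f z))^2) / of_real (cmod (f z)) = complex_of_real (cmod (f z))"
   using False by (simp add: power2_eq_square)
  finally show ?thesis .
 qed simp
 ultimately have "(LINT z|lborel. cmod (f z)) = 0" by (simp only: integral_complex_of_real of_real_eq_0_iff)
 then have "AE z in lborel. cmod (f z) = 0"
  using integral_nonneg_eq_0_iff_AE[OF integrable_norm[OF f]] by simp
 then show ?thesis by simp
qed

section \<open>Convolution with a smooth kernel\<close>

lemma integrable_mult_continuous:
 fixes g k :: "complex => complex"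
 assumes g: "integrable lborel g" "\<And>y. cmod y > r ==> g y = 0" and k: "continuous_on UNIV k"
 shows "integrable lborel (\<lambda>y. g y * k (z - y))"
proof -
 have [measurable]: "k \<in> borel_fun" using k by (rule borel_measurable_continuous_onI)
 have [measurable]: "g \<in> borel_fun" using g by simp
 have "bounded (k ` cball 0 (cmod z + r))"
  by (intro compact_imp_bounded compact_continuous_image continuous_on_subset[OF k]) auto
 then obtain B where B: "\<And>w. cmod w \<le> cmod z + r ==> cmod (k w) \<le> B"
  unfolding bounded_iff by (metis imageI mem_cball_0)
 show ?thesis
 proof (rule Bochner_Integration.integrable_bound[OF integrable_mult_right[OF integrable_norm[OF g(1)], of B]])
  show "AE y in lborel. norm (g y * k (z - y)) \<le> norm (B * norm (g y))"
  proof (rule AE_I2)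
   fix y
   show "norm (g y * k (z - y)) \<le> norm (B * norm (g y))"
   proof (cases "cmod y > r")
    case False
    then have "cmod (k (z - y)) \<le> B" using norm_triangle_ineq4[of z y] by (intro B) linarith
    then have "cmod (k (z - y)) \<le> \<bar>B\<bar>" by linarith
    then have "cmod (g y) * cmod (k (z - y)) \<le> cmod (g y) * \<bar>B\<bar>" by (intro mult_left_mono) auto
    then show ?thesis by (simp add: norm_mult abs_mult mult.commute)
   qed (use g in simp)
  qed
 qed measurable
qed

text \<open>Differentiation under the integral. As g lives in a fixed disc, the derivatives p and q
  of k are needed only on a compact disc, where uniform continuity makes the linearisation error of
  k uniform in the integration variable.\<close>

lemma has_wirtinger_convolution:
 fixes g :: "complex => complex"
 assumes g: "integrable lborel g" "\<And>v. cmod v > r ==> g v = 0"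
  and k: "\<And>w. has_wirtinger k (p w) (q w) w" "continuous_on UNIV p" "continuous_on UNIV q"
 shows "has_wirtinger (\<lambda>z. LINT v|lborel. g v * k (z - v))
  (LINT v|lborel. g v * p (z - v)) (LINT v|lborel. g v * q (z - v)) z"
 unfolding has_wirtinger_def has_derivative_at_alt
proof (intro conjI allI impI)
 let ?P = "LINT v|lborel. g v * p (z - v)" and ?Q = "LINT v|lborel. g v * q (z - v)"
 show "bounded_linear (\<lambda>h. ?P * h + ?Q * cnj h)"
  by (intro bounded_linear_add bounded_linear_mult_right
    bounded_linear_compose[OF bounded_linear_mult_right bounded_linear_cnj])
 have kd: "(k has_derivative (\<lambda>h. p w * h + q w * cnj h)) (at w)" for w
  using k(1) by (simp add: has_wirtinger_def)
 have kc: "continuous_on UNIV k"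
  using kd has_derivative_continuous by (blast intro: continuous_at_imp_continuous_on)
 note int = integrable_mult_continuous[OF g kc] integrable_mult_continuous[OF g k(2)]
  integrable_mult_continuous[OF g k(3)]
 define M where "M = (LINT v|lborel. cmod (g v))"
 have M: "M \<ge> 0" by (simp add: M_def)
 fix e :: real assume "e > 0"
 \<comment> \<open>The oscillations of p and of q contribute e' each, and integration against |g|
   multiplies by M; M + 1 avoids division by 0.\<close>
 define e' where "e' = e / (2 * (M + 1))"
 have e': "e' > 0" using \<open>e > 0\<close> M by (simp add: e'_def)
 let ?C = "cball (0::complex) (cmod z + r + 1)"
 have u: "uniformly_continuous_on ?C p" "uniformly_continuous_on ?C q"
  using k(2,3) by (auto intro!: compact_uniformly_continuous elim: continuous_on_subset)
 obtain d1 where d1: "d1 > 0" "\<And>x y. x \<in> ?C ==> y \<in> ?C ==> dist y x < d1 ==> dist (p y) (p x) < e'"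
  by (rule uniformly_continuous_onE[OF u(1) e']) blast
 obtain d2 where d2: "d2 > 0" "\<And>x y. x \<in> ?C ==> y \<in> ?C ==> dist y x < d2 ==> dist (q y) (q x) < e'"
  by (rule uniformly_continuous_onE[OF u(2) e']) blast
 define d where "d = min 1 (min d1 d2)"
 show "\<exists>d>0. \<forall>y. norm (y - z) < d -->
   norm ((LINT v|lborel. g v * k (y - v)) - (LINT v|lborel. g v * k (z - v)) -
    (?P * (y - z) + ?Q * cnj (y - z))) \<le> e * norm (y - z)"
 proof (intro exI[of _ d] conjI allI impI)
  show "d > 0" using d1 d2 by (simp add: d_def)
  fix y assume y: "norm (y - z) < d"
  let ?h = "y - z"
  let ?r = "\<lambda>v. k (y - v) - k (z - v) - (p (z - v) * ?h + q (z - v) * cnj ?h)"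
  have rem: "norm (?r v) \<le> 2 * e' * norm ?h" if z: "cmod v \<le> r" for v
  proof -
   let ?S = "cball (z - v) (norm ?h)"
   have sub: "?S \<subseteq> ?C"
   proof
    fix x assume x: "x \<in> ?S"
    have "cmod x \<le> cmod (z - v) + cmod (x - (z - v))" by (metis add.commute diff_add_cancel norm_triangle_ineq)
    then show "x \<in> ?C" using x z y norm_triangle_ineq4[of z v] by (simp add: dist_norm d_def norm_minus_commute)
   qed
   have "norm (k (y - v) - k (z - v) - (\<lambda>h. p (z - v) * h + q (z - v) * cnj h) ((y - v) - (z - v)))
    \<le> norm ((y - v) - (z - v)) * (2 * e')"
   proof (rule differentiable_bound_linearization[where S="?S" and f'="\<lambda>x h. p x * h + q x * cnj h"])
    show "(z - v) + t *\<^sub>R ((y - v) - (z - v)) \<in> ?S" if "t \<in> {0..1}" for t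
     using that by (simp add: dist_norm mult_left_le_one_le norm_minus_commute)
    show "(k has_derivative (\<lambda>h. p x * h + q x * cnj h)) (at x within ?S)" if "x \<in> ?S" for x
     using kd has_derivative_at_withinI by blast
    show "z - v \<in> ?S" by simp
    fix x assume x: "x \<in> ?S"
    have "dist x (z - v) < d" using x y by (simp add: dist_commute)
    then have "dist x (z - v) < d1" "dist x (z - v) < d2" by (auto simp: d_def)
    then have b: "cmod (p x - p (z - v)) \<le> e'" "cmod (q x - q (z - v)) \<le> e'"
    proof -
     have "z - v \<in> ?C" "x \<in> ?C" using sub x by (meson centre_in_cball norm_ge_zero subsetD)+
     then show "cmod (p x - p (z - v)) \<le> e'" "cmod (q x - q (z - v)) \<le> e'"
      using d1(2)[of "z - v" x] d2(2)[of "z - v" x] \<open>dist x (z - v) < d1\<close> \<open>dist x (z - v) < d2\<close>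
      unfolding dist_norm by (blast intro: less_imp_le)+
    qed
    show "onorm ((\<lambda>h. p x * h + q x * cnj h) - (\<lambda>h. p (z - v) * h + q (z - v) * cnj h)) \<le> 2 * e'"
    proof (rule onorm_le)
     fix h
     have "cmod ((p x - p (z - v)) * h + (q x - q (z - v)) * cnj h)
      \<le> e' * cmod h + e' * cmod h"
      by (intro norm_triangle_le add_mono) (simp_all add: norm_mult mult_right_mono b)
     then show "norm (((\<lambda>h. p x * h + q x * cnj h) - (\<lambda>h. p (z - v) * h + q (z - v) * cnj h)) h) \<le> 2 * e' * norm h"
      by (simp add: algebra_simps)
    qed
   qed
   then show ?thesis by (simp add: mult_ac)
  qed
  have int': "integrable lborel (\<lambda>v. g v * k (y - v))" by (rule integrable_mult_continuous[OF g kc])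
  have i2: "integrable lborel (\<lambda>v. g v * p (z - v) * ?h + g v * q (z - v) * cnj ?h)"
   by (intro Bochner_Integration.integrable_add integrable_mult_left int)
  have eq: "(LINT v|lborel. g v * k (y - v)) - (LINT v|lborel. g v * k (z - v)) - (?P * ?h + ?Q * cnj ?h)
   = (LINT v|lborel. g v * ?r v)"
  proof -
   have "(LINT v|lborel. g v * p (z - v) * ?h + g v * q (z - v) * cnj ?h) = ?P * ?h + ?Q * cnj ?h"
    using int by (subst Bochner_Integration.integral_add) (auto intro!: integrable_mult_left)
   moreover have "(LINT v|lborel. g v * ?r v) = (LINT v|lborel. g v * k (y - v) - g v * k (z - v) -
     (g v * p (z - v) * ?h + g v * q (z - v) * cnj ?h))"
    by (intro Bochner_Integration.integral_cong) (auto simp: algebra_simps)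
   ultimately show ?thesis
    using int int' i2 by (simp only: Bochner_Integration.integral_diff Bochner_Integration.integrable_diff)
  qed
  have ir: "integrable lborel (\<lambda>v. g v * ?r v)"
  proof -
   have "integrable lborel (\<lambda>v. g v * k (y - v) - g v * k (z - v) -
     (g v * p (z - v) * ?h + g v * q (z - v) * cnj ?h))"
    by (intro Bochner_Integration.integrable_diff int int' i2)
   then show ?thesis by (simp add: algebra_simps)
  qed
  have "norm (LINT v|lborel. g v * ?r v) \<le> (LINT v|lborel. cmod (g v) * (2 * e' * norm ?h))"
  proof (rule Bochner_Integration.integral_norm_bound_integral[OF ir])
   show "integrable lborel (\<lambda>v. cmod (g v) * (2 * e' * norm ?h))"
    using g by (intro integrable_mult_left integrable_norm)
   show "norm (g v * ?r v) \<le> cmod (g v) * (2 * e' * norm ?h)" for v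
    using rem[of v] g(2)[of v] by (cases "cmod v > r") (auto simp: norm_mult intro: mult_left_mono)
  qed
  also have "\<dots> = M * (2 * e' * norm ?h)" by (simp add: M_def)
  also have "\<dots> = (M / (M + 1)) * (e * norm ?h)" using M by (simp add: e'_def divide_simps)
  also have "\<dots> \<le> 1 * (e * norm ?h)" using M \<open>e > 0\<close> by (intro mult_right_mono) auto
  finally show "norm ((LINT v|lborel. g v * k (y - v)) - (LINT v|lborel. g v * k (z - v)) -
    (?P * ?h + ?Q * cnj ?h)) \<le> e * norm ?h"
   unfolding eq by simp
 qed
qed

lemma smooth_on_d_z:
 assumes "open S" "smooth_on S f"
 shows "smooth_on S (d_z f)" "smooth_on S (d_zbar f)"
proof -
 have D: "times_differentiable_on k S (\<lambda>z. frechet_derivative f (at z) h)" for k h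
  using assms(2)[unfolded smooth_on_def, rule_format, of "Suc k"] by simp
 have "times_differentiable_on k S (\<lambda>z. (frechet_derivative f (at z) 1 - \<i> * frechet_derivative f (at z) \<i>) * (1 / 2))"
  "times_differentiable_on k S (\<lambda>z. (frechet_derivative f (at z) 1 + \<i> * frechet_derivative f (at z) \<i>) * (1 / 2))" for k
  by (intro times_differentiable_on_mult times_differentiable_on_diff times_differentiable_on_add
    times_differentiable_on_const assms(1) D)+
 then show "smooth_on S (d_z f)" "smooth_on S (d_zbar f)"
  by (simp_all add: smooth_on_def d_z_def[abs_def] d_zbar_def[abs_def])
qed

lemma smooth_on_imp_continuous: "smooth_on S f ==> continuous_on S f"
 by (auto simp: smooth_on_def dest: spec[of _ 0])

lemma smooth_on_imp_has_wirtinger: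
 "smooth_on S f ==> z \<in> S ==> has_wirtinger f (d_z f z) (d_zbar f z) z"
 by (rule has_wirtinger_diff) (auto simp: smooth_on_def dest: spec[of _ "Suc 0"])

lemma smooth_on_convolution:
 fixes g k :: "complex => complex"
 assumes g: "integrable lborel g" "\<And>w. cmod w > r ==> g w = 0" and k: "smooth_on UNIV k"
 shows "smooth_on UNIV (\<lambda>z. LINT w|lborel. g w * k (z - w))"
proof -
 have W: "has_wirtinger (\<lambda>z. LINT w|lborel. g w * k (z - w))
   (LINT w|lborel. g w * d_z k (z - w)) (LINT w|lborel. g w * d_zbar k (z - w)) z"
  if "smooth_on UNIV k" for k z
  by (rule has_wirtinger_convolution[OF g])
   (use that in \<open>auto intro: smooth_on_imp_has_wirtinger smooth_on_imp_continuous smooth_on_d_z\<close>)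
 have "times_differentiable_on n UNIV (\<lambda>z. LINT w|lborel. g w * k (z - w))" for n
  using k
 proof (induction n arbitrary: k)
  case 0
  then show ?case
   using W[OF 0] has_derivative_continuous unfolding has_wirtinger_def times_differentiable_on.simps
   by (blast intro: continuous_at_imp_continuous_on)
 next
  case (Suc n)
  note d = smooth_on_d_z[OF open_UNIV Suc.prems]
  show ?case
   by (rule times_differentiable_on_SucI[OF open_UNIV W[OF Suc.prems, unfolded has_wirtinger_def]])
    (intro times_differentiable_on_mult times_differentiable_on_add
     times_differentiable_on_const Suc.IH d open_UNIV)
 qed
 then show ?thesis by (simp add: smooth_on_def)
qed

section \<open>Weighted square norms\<close>

text \<open>The squared norm of L2 with weight |z|^(2s). Functions on the cone are measured with s =
  b, which is the area element. Flat Laplacians are measured with s = -b, because the surface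
  Laplacian divides them by |z|^(2b) before squaring.\<close>

definition wnorm :: "real => (complex => complex) => ennreal" where
 "wnorm s f = (\<integral>\<^sup>+z. ennreal ((cmod (f z))^2 * cmod z powr (2 * s)) \<partial>lborel)"

lemma norm_add_square_le: "(cmod (a + b))^2 \<le> 2 * (cmod a)^2 + 2 * (cmod b)^2"
proof -
 have "(cmod (a + b))^2 \<le> (cmod a + cmod b)^2" by (intro power_mono norm_triangle_ineq) auto
 also have "\<dots> \<le> 2 * (cmod a)^2 + 2 * (cmod b)^2"
  using sum_squares_bound[of "cmod a" "cmod b"] by (simp add: power2_sum)
 finally show ?thesis .
qed

lemma wnorm_add:
 assumes [measurable]: "f \<in> borel_fun" "g \<in> borel_fun"
 shows "wnorm s (\<lambda>z. f z + g z) \<le> 2 * wnorm s f + 2 * wnorm s g"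
proof -
 have "wnorm s (\<lambda>z. f z + g z) \<le> (\<integral>\<^sup>+z. 2 * ennreal ((cmod (f z))^2 * cmod z powr (2 * s))
   + 2 * ennreal ((cmod (g z))^2 * cmod z powr (2 * s)) \<partial>lborel)"
  unfolding wnorm_def
 proof (rule nn_integral_mono)
  fix z
  have "(cmod (f z + g z))^2 * cmod z powr (2 * s)
   \<le> 2 * ((cmod (f z))^2 * cmod z powr (2 * s)) + 2 * ((cmod (g z))^2 * cmod z powr (2 * s))"
   using mult_right_mono[OF norm_add_square_le[of "f z" "g z"], of "cmod z powr (2 * s)"]
   by (simp add: algebra_simps)
  then show "ennreal ((cmod (f z + g z))^2 * cmod z powr (2 * s)) \<le>
    2 * ennreal ((cmod (f z))^2 * cmod z powr (2 * s)) + 2 * ennreal ((cmod (g z))^2 * cmod z powr (2 * s))"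
   by (simp add: ennreal_leI ennreal_plus[symmetric] ennreal_mult'[symmetric] ennreal_numeral[symmetric]
     del: ennreal_plus ennreal_numeral)
 qed
 also have "\<dots> = 2 * wnorm s f + 2 * wnorm s g"
  unfolding wnorm_def by (subst nn_integral_add) (auto simp: nn_integral_cmult)
 finally show ?thesis .
qed

lemma wnorm_mono_AE:
 assumes "AE z in lborel. cmod (f z) \<le> c * cmod (g z)" "g \<in> borel_fun" "c \<ge> 0"
 shows "wnorm s f \<le> ennreal (c^2) * wnorm s g"
proof -
 note [measurable] = assms(2)
 have "wnorm s f \<le> (\<integral>\<^sup>+z. ennreal (c^2) * ennreal ((cmod (g z))^2 * cmod z powr (2 * s)) \<partial>lborel)"
  unfolding wnorm_def
 proof (rule nn_integral_mono_AE, use assms(1) in eventually_elim)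
  fix z assume "cmod (f z) \<le> c * cmod (g z)"
  then have "(cmod (f z))^2 \<le> (c * cmod (g z))^2" by (intro power_mono) auto
  then have "(cmod (f z))^2 * cmod z powr (2 * s) \<le> (c * cmod (g z))^2 * cmod z powr (2 * s)"
   by (intro mult_right_mono) auto
  then have "(cmod (f z))^2 * cmod z powr (2 * s) \<le> c^2 * ((cmod (g z))^2 * cmod z powr (2 * s))"
   by (simp only: power_mult_distrib mult.assoc)
  then show "ennreal ((cmod (f z))^2 * cmod z powr (2 * s)) \<le>
   ennreal (c^2) * ennreal ((cmod (g z))^2 * cmod z powr (2 * s))"
   by (simp add: ennreal_leI flip: ennreal_mult)
 qed
 also have "\<dots> = ennreal (c^2) * wnorm s g" unfolding wnorm_def by (simp add: nn_integral_cmult)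
 finally show ?thesis .
qed

lemma wnorm_mono:
 assumes "\<And>z. z \<noteq> 0 ==> cmod (f z) \<le> cmod (g z)"
 shows "wnorm s f \<le> wnorm s g"
 unfolding wnorm_def
proof (rule nn_integral_mono)
 fix z
 show "ennreal ((cmod (f z))^2 * cmod z powr (2 * s)) \<le> ennreal ((cmod (g z))^2 * cmod z powr (2 * s))"
  using assms[of z] by (cases "z = 0") (auto intro!: ennreal_leI mult_right_mono power_mono)
qed

lemma wnorm_tendsto_0:
 assumes [measurable]: "\<And>j. f j \<in> borel_fun" "h \<in> borel_fun"
  and bd: "\<And>j. AE z in lborel. cmod (f j z) \<le> cmod (h z)" and h: "wnorm s h < \<infinity>"
  and lim: "AE z in lborel. (\<lambda>j. f j z) \<longlonglongrightarrow> 0"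
 shows "(\<lambda>j. wnorm s (f j)) \<longlonglongrightarrow> 0"
proof -
 have "(\<lambda>j. wnorm s (f j)) \<longlonglongrightarrow> integral\<^sup>N lborel (\<lambda>_::complex. 0)"
  unfolding wnorm_def
 proof (rule nn_integral_dominated_convergence[where w="\<lambda>z. ennreal ((cmod (h z))^2 * cmod z powr (2 * s))"])
  show "AE z in lborel. ennreal ((cmod (f j z))^2 * cmod z powr (2 * s))
   \<le> ennreal ((cmod (h z))^2 * cmod z powr (2 * s))" for j
   using bd[of j] by eventually_elim (auto intro!: ennreal_leI mult_right_mono power_mono)
  show "AE z in lborel. (\<lambda>j. ennreal ((cmod (f j z))^2 * cmod z powr (2 * s))) \<longlonglongrightarrow> 0"
   using lim
  proof eventually_elim
   fix z assume "(\<lambda>j. f j z) \<longlonglongrightarrow> 0"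
   then have "(\<lambda>j. (cmod (f j z))^2 * cmod z powr (2 * s)) \<longlonglongrightarrow> (cmod 0)\<^sup>2 * cmod z powr (2 * s)"
    by (intro tendsto_intros)
   then show "(\<lambda>j. ennreal ((cmod (f j z))^2 * cmod z powr (2 * s))) \<longlonglongrightarrow> 0"
    using tendsto_ennrealI by fastforce
  qed
  show "(\<integral>\<^sup>+z. ennreal ((cmod (h z))^2 * cmod z powr (2 * s)) \<partial>lborel) < \<infinity>"
   using h by (simp add: wnorm_def)
 qed measurable
 then show ?thesis by simp
qed

section \<open>The potential with subtracted Taylor polynomial\<close>

text \<open>Logarithm of the modulus of the Weierstrass elementary factor of genus \<open>n\<close>.\<close>

definition kern :: "nat => complex => real" where
 "kern n t = ln (cmod (1 - t)) + (\<Sum>m=1..n. Re (t ^ m) / real m)"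

lemma kern_borel [measurable]: "kern n \<in> borel_fun"
 unfolding kern_def[abs_def] by measurable

lemma pred_mem_cball [measurable]:
 fixes f :: "'a => complex"
 assumes [measurable]: "f \<in> borel_measurable M"
 shows "Measurable.pred M (\<lambda>x. f x \<in> cball c r)"
 unfolding mem_cball by measurable

lemma powr_square: "(x powr a)^2 = (x::real) powr (2 * a)"
 by (simp add: power2_eq_square flip: powr_add)

lemma le_mult_one_plus: "0 \<le> x ==> 0 \<le> y ==> x \<le> x * (1 + y :: real)"
 by (simp add: algebra_simps)

text \<open>The sum in \<open>kern\<close> cancels the terms of degree at most n in the power series
  of log (1 - t); the tail is dominated by a geometric series of ratio at most 1/2.\<close>

lemma kern_small:
 assumes "cmod t \<le> 1 / 2"
 shows "\<bar>kern n t\<bar> \<le> 2 * cmod t ^ (n + 1)"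
proof -
 have t1: "1 - t \<noteq> 0" using assms by auto
 let ?f = "\<lambda>m. - (t ^ m) / of_nat m"
 have "?f sums Ln (1 - t)" using Ln_series'[of "- t"] assms by simp
 then have s: "(\<lambda>i. ?f (i + (n + 1))) sums (Ln (1 - t) - (\<Sum>i<n+1. ?f i))" by (rule sums_split_initial_segment)
 \<comment> \<open>The term of index 0 is a division by 0 and hence 0, so the series may be summed
   from 0.\<close>
 have eq: "(\<Sum>i<n+1. ?f i) = - (\<Sum>m=1..n. t ^ m / of_nat m)"
 proof -
  have "(\<Sum>i<n+1. ?f i) = (\<Sum>i\<in>insert 0 {1..n}. ?f i)" by (intro sum.cong) auto
  then show ?thesis by (simp add: sum_negf)
 qed
 have sg: "(\<lambda>i. cmod t ^ (n + 1) * cmod t ^ i) sums (cmod t ^ (n + 1) * (1 / (1 - cmod t)))"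
  using assms by (intro sums_mult geometric_sums) auto
 have le: "cmod (?f (i + (n + 1))) \<le> cmod t ^ (n + 1) * cmod t ^ i" for i
 proof -
  have "cmod (?f (i + (n + 1))) = cmod t ^ (i + (n + 1)) / real (i + (n + 1))"
   by (simp add: norm_divide norm_power del: power_add of_nat_add power_Suc of_nat_Suc add_Suc_right)
  also have "\<dots> \<le> cmod t ^ (i + (n + 1)) / 1" by (intro divide_left_mono) auto
  finally show ?thesis by (simp add: power_add mult_ac)
 qed
 have "cmod (Ln (1 - t) - (\<Sum>i<n+1. ?f i)) \<le> cmod t ^ (n + 1) * (1 / (1 - cmod t))"
  using norm_sums_le[OF s sg le] by simp
 also have "\<dots> \<le> cmod t ^ (n + 1) * 2"
  using assms by (intro mult_left_mono) (auto simp: field_simps)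
 finally have "cmod (Ln (1 - t) + (\<Sum>m=1..n. t ^ m / of_nat m)) \<le> 2 * cmod t ^ (n + 1)"
  unfolding eq by simp
 moreover have "kern n t = Re (Ln (1 - t) + (\<Sum>m=1..n. t ^ m / of_nat m))"
  using t1 by (simp add: kern_def Re_divide_of_nat)
 ultimately show ?thesis using abs_Re_le_cmod order_trans by metis
qed

lemma abs_ln_le_powr:
 fixes x s :: real
 assumes "x > 0" "s > 0"
 shows "\<bar>ln x\<bar> \<le> (x powr s + x powr - s) / s"
proof -
 have 1: "ln y \<le> y powr s / s" if "y > 0" for y :: real
 proof -
  have "s * ln y = ln (y powr s)" using that by (simp add: ln_powr)
  also have "\<dots> \<le> y powr s" using that by (intro ln_bound) auto
  finally show ?thesis using assms by (simp add: field_simps)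
 qed
 have "ln x \<le> x powr s / s" by (rule 1) fact
 moreover have "- ln x \<le> x powr - s / s" using 1[of "1 / x"] assms by (simp add: ln_div powr_minus powr_divide inverse_eq_divide)
 moreover have "x powr s / s \<ge> 0" "x powr - s / s \<ge> 0" using assms by auto
 ultimately show ?thesis by (simp add: add_divide_distrib)
qed

text \<open>Near 0 the order n + 1 of vanishing beats |t|^q. For |t| > 1/2 the polynomial part has
  degree at most n < q, the growth of the logarithm is absorbed by |t|^q, and its singularity at t =
  1 by the power -1/2.\<close>

lemma kern_bound:
 assumes "real n < q" "q < real n + 1"
 obtains C where "C > 0"
  "\<And>t. t \<noteq> 1 ==> \<bar>kern n t\<bar> \<le> C * cmod t powr q * (1 + cmod (1 - t) powr (- 1 / 2))"
proof -
 have q: "q > 0" using assms by simp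
 \<comment> \<open>The logarithm is bounded by powers s and -s of |1 - t|: s \<le> q lets the growth
   be absorbed by |t|^q, and s \<le> 1/2 lets the singularity be absorbed by |1 - t|^(-1/2).\<close>
 define s where "s = min q (1 / 2)"
 have s: "s > 0" "s \<le> q" "s \<le> 1 / 2" using q by (auto simp: s_def)
 define C where "C = 2 + (3 powr s * 2 powr q + 2 powr q + 2 powr q) / s + real n * 2 powr q"
 have "C > 0" using s by (simp add: C_def add_pos_nonneg)
 have C2: "2 \<le> C" using s by (simp add: C_def)
 have bd: "\<bar>kern n t\<bar> \<le> C * cmod t powr q * (1 + cmod (1 - t) powr (- 1 / 2))" if t: "t \<noteq> 1" for t
 proof (cases "cmod t \<le> 1 / 2")
  case True
  show ?thesis
  proof (cases "t = 0")
   case False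
   have "\<bar>kern n t\<bar> \<le> 2 * cmod t ^ (n + 1)" by (rule kern_small[OF True])
   also have "cmod t ^ (n + 1) = cmod t powr (real n + 1)"
    using False powr_realpow[of "cmod t" "n + 1"] by (simp add: add.commute)
   also have "\<dots> \<le> cmod t powr q" using assms True by (intro powr_mono') auto
   finally have "\<bar>kern n t\<bar> \<le> 2 * cmod t powr q * 1" by simp
   also have "\<dots> \<le> C * cmod t powr q * (1 + cmod (1 - t) powr (- 1 / 2))"
    using C2 by (intro mult_mono) auto
   finally show ?thesis .
  qed (use kern_small[of 0 n] in simp)
 next
  case False
  let ?A = "cmod t powr q" and ?B = "cmod (1 - t) powr (- 1 / 2)"
  have tp: "cmod t > 0" using False by linarith
  have w: "cmod (1 - t) > 0" using t by simp
  have big: "1 \<le> 2 powr q * ?A"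
  proof -
   have "1 \<le> (2 * cmod t) powr q" using False q by (intro ge_one_powr_ge_zero) auto
   then show ?thesis by (simp add: powr_mult)
  qed
  have pw: "cmod t powr x \<le> 2 powr q * ?A" if "0 \<le> x" "x \<le> q" for x
  proof -
   have "(2 * cmod t) powr x \<le> (2 * cmod t) powr q" using False that by (intro powr_mono) auto
   moreover have "cmod t powr x \<le> (2 * cmod t) powr x" using that by (intro powr_mono2) auto
   ultimately show ?thesis by (simp add: powr_mult)
  qed
  have l1: "cmod (1 - t) powr s \<le> 3 powr s * 2 powr q * ?A"
  proof -
   have "cmod (1 - t) \<le> 1 + cmod t" using norm_triangle_ineq4[of 1 t] by simp
   also have "\<dots> \<le> 3 * cmod t" using False by simp
   finally have "cmod (1 - t) powr s \<le> (3 * cmod t) powr s" using s by (intro powr_mono2) auto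
   also have "\<dots> = 3 powr s * cmod t powr s" by (simp add: powr_mult)
   also have "\<dots> \<le> 3 powr s * (2 powr q * ?A)" using pw[of s] s by (intro mult_left_mono) auto
   finally show ?thesis by simp
  qed
  have l2: "cmod (1 - t) powr - s \<le> 1 + ?B"
  proof (cases "cmod (1 - t) \<le> 1")
   case True
   then have "cmod (1 - t) powr - s \<le> cmod (1 - t) powr (- 1 / 2)" using s w by (intro powr_mono') auto
   then show ?thesis by simp
  next
   case False
   then have "cmod (1 - t) powr - s \<le> 1" using powr_mono2'[of "- s" 1 "cmod (1 - t)"] s by simp
   moreover have "0 \<le> ?B" by simp
   ultimately show ?thesis by linarith
  qed
  have "\<bar>ln (cmod (1 - t))\<bar> \<le> (cmod (1 - t) powr s + cmod (1 - t) powr - s) / s"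
   by (rule abs_ln_le_powr[OF w s(1)])
  also have "\<dots> \<le> (3 powr s * 2 powr q * ?A + (1 + ?B) * (2 powr q * ?A)) / s"
  proof (intro divide_right_mono add_mono l1)
   have "(1 + ?B) * 1 \<le> (1 + ?B) * (2 powr q * ?A)" using big by (intro mult_left_mono) auto
   then have "1 + ?B \<le> (1 + ?B) * (2 powr q * ?A)" by (simp only: mult_1_right)
   then show "cmod (1 - t) powr - s \<le> (1 + ?B) * (2 powr q * ?A)" by (rule order_trans[OF l2])
  qed (use s in auto)
  also have "\<dots> \<le> (3 powr s * 2 powr q + 2 powr q + 2 powr q) / s * ?A * (1 + ?B)"
  proof -
   have "3 powr s * 2 powr q * ?A \<le> 3 powr s * 2 powr q * ?A * (1 + ?B)"
    by (intro le_mult_one_plus) auto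
   moreover have "0 \<le> 2 powr q * ?A * (1 + ?B)" by simp
   ultimately have "3 powr s * 2 powr q * ?A + (1 + ?B) * (2 powr q * ?A)
     \<le> (3 powr s * 2 powr q + 2 powr q + 2 powr q) * ?A * (1 + ?B)"
    by (simp add: algebra_simps)
   then show ?thesis using s by (simp add: divide_right_mono field_simps)
  qed
  finally have L: "\<bar>ln (cmod (1 - t))\<bar> \<le> (3 powr s * 2 powr q + 2 powr q + 2 powr q) / s * ?A * (1 + ?B)" .
  have "\<bar>\<Sum>m=1..n. Re (t ^ m) / real m\<bar> \<le> (\<Sum>m=1..n. 2 powr q * ?A * (1 + ?B))"
  proof (rule order_trans[OF sum_abs sum_mono])
   fix m assume m: "m \<in> {1..n}"
   have "\<bar>Re (t ^ m) / real m\<bar> \<le> \<bar>Re (t ^ m)\<bar>" using m mult_right_mono[of 1 "real m" "\<bar>Re (t ^ m)\<bar>"] by (simp add: field_simps)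
   also have "\<dots> \<le> cmod t ^ m" using abs_Re_le_cmod[of "t ^ m"] by (simp add: norm_power)
   also have "\<dots> = cmod t powr real m" using tp by (simp add: powr_realpow)
   also have "\<dots> \<le> 2 powr q * ?A" using m assms by (intro pw) auto
   also have "\<dots> \<le> 2 powr q * ?A * (1 + ?B)" by (intro le_mult_one_plus) auto
   finally show "\<bar>Re (t ^ m) / real m\<bar> \<le> 2 powr q * ?A * (1 + ?B)" .
  qed
  then have S: "\<bar>\<Sum>m=1..n. Re (t ^ m) / real m\<bar> \<le> real n * 2 powr q * ?A * (1 + ?B)" by (simp add: mult_ac)
  have "\<bar>kern n t\<bar> \<le> ((3 powr s * 2 powr q + 2 powr q + 2 powr q) / s + real n * 2 powr q) * ?A * (1 + ?B)"
   using L S unfolding kern_def by (simp only: distrib_right)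
  also have "\<dots> \<le> C * ?A * (1 + ?B)" by (intro mult_right_mono) (auto simp: C_def)
  finally show ?thesis .
 qed
 show thesis by (rule that[OF \<open>C > 0\<close> bd])
qed

lemma wnorm_Cauchy_Schwarz:
 fixes g :: "complex => complex" and k :: "complex => real"
 assumes [measurable]: "g \<in> borel_fun" "k \<in> borel_fun"
 shows "(\<integral>\<^sup>+w. ennreal (cmod (g w) * \<bar>k w\<bar>) \<partial>lborel)^2
  \<le> wnorm (- s) g * (\<integral>\<^sup>+w. ennreal ((k w)^2 * cmod w powr (2 * s)) \<partial>lborel)"
proof -
 have "(\<integral>\<^sup>+w. ennreal (cmod (g w) * \<bar>k w\<bar>) \<partial>lborel)
  = (\<integral>\<^sup>+w. ennreal (cmod (g w) * cmod w powr - s) * ennreal (\<bar>k w\<bar> * cmod w powr s) \<partial>lborel)"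
 proof (rule nn_integral_cong_AE)
  have "AE w::complex in lborel. w \<noteq> 0" by (rule AE_lborel_singleton)
  then show "AE w in lborel. ennreal (cmod (g w) * \<bar>k w\<bar>) =
    ennreal (cmod (g w) * cmod w powr - s) * ennreal (\<bar>k w\<bar> * cmod w powr s)"
   by eventually_elim (simp add: powr_minus divide_simps flip: ennreal_mult)
 qed
 also have "\<dots>\<^sup>2 \<le> (\<integral>\<^sup>+w. (ennreal (cmod (g w) * cmod w powr - s))^2 \<partial>lborel)
   * (\<integral>\<^sup>+w. (ennreal (\<bar>k w\<bar> * cmod w powr s))^2 \<partial>lborel)"
  by (rule Cauchy_Schwarz_nn_integral) measurable
 also have "(\<integral>\<^sup>+w. (ennreal (cmod (g w) * cmod w powr - s))^2 \<partial>lborel) = wnorm (- s) g"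
  unfolding wnorm_def
  by (intro nn_integral_cong)
   (simp add: ennreal_power power_mult_distrib powr_square)
 also have "(\<integral>\<^sup>+w. (ennreal (\<bar>k w\<bar> * cmod w powr s))^2 \<partial>lborel)
   = (\<integral>\<^sup>+w. ennreal ((k w)^2 * cmod w powr (2 * s)) \<partial>lborel)"
  by (intro nn_integral_cong) (simp add: ennreal_power power_mult_distrib powr_square)
 finally show ?thesis .
qed

lemma nn_integral_lborel_shift:
 fixes f :: "complex => ennreal"
 assumes [measurable]: "f \<in> borel_fun"
 shows "(\<integral>\<^sup>+y. f (y - z) \<partial>lborel) = (\<integral>\<^sup>+w. f w \<partial>lborel)"
 by (subst (2) lborel_distr_plus[of "- z", symmetric]) (simp add: nn_integral_distr)

lemma nn_integral_powr_shift_le: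
 assumes "c < 2"
 obtains J where "J \<ge> 0" "\<And>z. cmod z \<le> 1 ==>
  (\<integral>\<^sup>+y\<in>cball 0 1. ennreal (cmod (y - z) powr - c) \<partial>lborel) \<le> ennreal J"
proof -
 let ?I = "\<integral>\<^sup>+w\<in>cball (0::complex) 2. ennreal (cmod w powr - c) \<partial>lborel"
 have fin: "?I < \<infinity>" by (rule nn_integral_powr_finite[OF assms])
 have "(\<integral>\<^sup>+y\<in>cball 0 1. ennreal (cmod (y - z) powr - c) \<partial>lborel) \<le> ennreal (enn2real ?I)"
  if z: "cmod z \<le> 1" for z
 proof -
  have "(\<integral>\<^sup>+y\<in>cball 0 1. ennreal (cmod (y - z) powr - c) \<partial>lborel)
   \<le> (\<integral>\<^sup>+y. ennreal (cmod (y - z) powr - c) * indicator (cball 0 2) (y - z) \<partial>lborel)"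
  proof (rule nn_integral_mono)
   fix y :: complex
   have "cmod y \<le> 1 ==> cmod (y - z) \<le> 2" using norm_triangle_ineq4[of y z] z by linarith
   then show "ennreal (cmod (y - z) powr - c) * indicator (cball 0 1) y
     \<le> ennreal (cmod (y - z) powr - c) * indicator (cball 0 2) (y - z)"
    by (auto simp: indicator_def)
  qed
  also have "\<dots> = ?I"
   by (rule nn_integral_lborel_shift[where f="\<lambda>w. ennreal (cmod w powr - c) * indicator (cball 0 2) w"]) auto
  also have "\<dots> = ennreal (enn2real ?I)" using fin by simp
  finally show ?thesis .
 qed
 then show thesis by (intro that[of "enn2real ?I"]) auto
qed

lemma integral_powr_shift_le:
 assumes "c < 2"
 obtains J where "J \<ge> 0" "\<And>z. cmod z \<le> 1 ==> integrable lborel (\<lambda>w. cmod (w - z) powr - c * indicator (cball 0 1) w)"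
  "\<And>z. cmod z \<le> 1 ==> (LINT w|lborel. cmod (w - z) powr - c * indicator (cball 0 1) w) \<le> J"
proof -
 let ?m = "\<lambda>z w. cmod (w - z) powr - c * indicator (cball 0 1) w"
 obtain J where J: "J \<ge> 0" "\<And>z. cmod z \<le> 1 ==> (\<integral>\<^sup>+w\<in>cball 0 1. ennreal (cmod (w - z) powr - c) \<partial>lborel) \<le> ennreal J"
  using nn_integral_powr_shift_le[OF assms] by blast
 have nn: "(\<integral>\<^sup>+w. ennreal (?m z w) \<partial>lborel) \<le> ennreal J" if "cmod z \<le> 1" for z
 proof -
  have "(\<integral>\<^sup>+w. ennreal (?m z w) \<partial>lborel) = (\<integral>\<^sup>+w\<in>cball 0 1. ennreal (cmod (w - z) powr - c) \<partial>lborel)"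
   by (intro nn_integral_cong) (auto simp: indicator_def)
  then show ?thesis using J(2)[OF that] by simp
 qed
 show thesis
 proof (rule that[OF J(1)])
  fix z :: complex assume z: "cmod z \<le> 1"
  show "integrable lborel (?m z)"
   by (rule integrableI_nonneg) (use le_less_trans[OF nn[OF z] ennreal_less_top] in auto)
  show "(LINT w|lborel. ?m z w) \<le> J"
   by (subst integral_eq_nn_integral) (use nn[OF z] J(1) in \<open>auto intro!: enn2real_leI\<close>)
 qed
qed

text \<open>Both exponents on the left are non-positive, so replacing the larger base by the smaller
  one does not decrease the product.\<close>

lemma powr_product_le:
 fixes x y :: real
 assumes "x > 0" "y > 0" "c \<ge> 1"
 shows "x powr (1 - c) * y powr - 1 \<le> x powr - c + y powr - c"
proof (cases "x \<le> y")
 case True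
 then have "x powr (1 - c) * y powr - 1 \<le> x powr (1 - c) * x powr - 1"
  using assms by (intro mult_left_mono powr_mono2') auto
 also have "\<dots> = x powr - c" by (subst powr_add[symmetric]) simp
 finally show ?thesis by (simp add: add_increasing2)
next
 case False
 then have "x powr (1 - c) * y powr - 1 \<le> y powr (1 - c) * y powr - 1"
  using assms by (intro mult_right_mono powr_mono2') auto
 also have "\<dots> = y powr - c" by (subst powr_add[symmetric]) simp
 finally show ?thesis by (simp add: add_increasing)
qed

text \<open>By \<open>kern_bound\<close> with exponent x the integrand is, up to a constant, at most
  |z|^(2x) times |w|^-q + |w|^(1-q) |w - z|^-1 with q = 2x - 2b. The last product is split by
  \<open>powr_product_le\<close> into the separate singularities |w|^-q and |w - z|^-q, which are
  integrable uniformly in z.\<close>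

lemma kern_square_integral_bound:
 assumes "real n < x" "x < real n + 1" "b + 1 / 2 \<le> x" "x < b + 1"
 obtains C where "C > 0" "\<And>z. z \<noteq> 0 ==> cmod z \<le> 1 ==>
  (\<integral>\<^sup>+w\<in>cball 0 1. ennreal ((kern n (z / w))^2 * cmod w powr (2 * b)) \<partial>lborel)
   \<le> ennreal (C * cmod z powr (2 * x))"
proof -
 obtain C where C: "C > 0" "\<And>t. t \<noteq> 1 ==> \<bar>kern n t\<bar> \<le> C * cmod t powr x * (1 + cmod (1 - t) powr (- 1 / 2))"
  using kern_bound[OF assms(1,2)] by blast
 \<comment> \<open>The condition b + 1/2 \<le> x gives q \<ge> 1, as needed to split the product of
   singularities; x < b + 1 gives q < 2, which is integrability in the plane.\<close>
 define q where "q = 2 * x - 2 * b"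
 have q: "1 \<le> q" "q < 2" using assms by (auto simp: q_def)
 obtain J where J: "J \<ge> 0" "\<And>z. cmod z \<le> 1 ==>
  (\<integral>\<^sup>+w\<in>cball 0 1. ennreal (cmod (w - z) powr - q) \<partial>lborel) \<le> ennreal J"
  using nn_integral_powr_shift_le[OF q(2)] by blast
 show thesis
 proof (rule that[of "2 * C^2 * (3 * J + 1)"])
  show "2 * C^2 * (3 * J + 1) > 0" using C J by (auto intro!: mult_pos_pos add_nonneg_pos)
  fix z :: complex assume z: "z \<noteq> 0" "cmod z \<le> 1"
  let ?c = "2 * C^2 * cmod z powr (2 * x)"
  have pt: "(kern n (z / w))^2 * cmod w powr (2 * b)
    \<le> ?c * (2 * cmod (w - 0) powr - q + cmod (w - z) powr - q)" if w: "w \<noteq> 0" "w \<noteq> z" for w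
  proof -
   let ?t = "z / w"
   let ?B = "cmod (1 - ?t) powr (- 1 / 2)"
   have t: "?t \<noteq> 1" using w by auto
   have pos: "cmod w > 0" "cmod (w - z) > 0" using w by auto
   have "(kern n ?t)^2 \<le> (C * cmod ?t powr x * (1 + ?B))^2"
    using power_mono[OF C(2)[OF t] abs_ge_zero, of 2] by simp
   also have "\<dots> = C^2 * cmod ?t powr (2 * x) * (1 + ?B)^2"
    by (simp add: power_mult_distrib powr_square)
   also have "\<dots> \<le> C^2 * cmod ?t powr (2 * x) * (2 * (1 + cmod (1 - ?t) powr - 1))"
   proof (rule mult_left_mono)
    have "(1 + ?B)^2 \<le> 2 * (1 + ?B^2)" using sum_squares_bound[of 1 ?B] by (simp add: power2_sum)
    also have "?B^2 = cmod (1 - ?t) powr - 1" by (simp add: powr_square)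
    finally show "(1 + ?B)^2 \<le> 2 * (1 + cmod (1 - ?t) powr - 1)" .
   qed simp
   finally have "(kern n ?t)^2 * cmod w powr (2 * b)
    \<le> C^2 * cmod ?t powr (2 * x) * (2 * (1 + cmod (1 - ?t) powr - 1)) * cmod w powr (2 * b)"
    by (rule mult_right_mono) simp
   also have "\<dots> = ?c * (cmod w powr - q + cmod w powr (1 - q) * cmod (w - z) powr - 1)"
   proof -
    have 1: "cmod ?t powr (2 * x) * cmod w powr (2 * b) = cmod z powr (2 * x) * cmod w powr - q"
     using pos by (simp add: norm_divide powr_divide q_def powr_diff powr_minus field_simps)
    have e: "cmod (1 - ?t) = cmod (w - z) / cmod w"
    proof -
     have "1 - ?t = (w - z) / w" using w by (simp add: diff_divide_distrib)
     then show ?thesis by (simp only: norm_divide)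
    qed
    have 2: "cmod (1 - ?t) powr - 1 = cmod w * cmod (w - z) powr - 1"
     unfolding e using pos by (simp add: powr_minus divide_simps)
    have 3: "cmod w powr (1 - q) = cmod w * cmod w powr - q"
     using pos by (simp add: powr_diff powr_minus divide_inverse)
    have "C^2 * cmod ?t powr (2 * x) * (2 * (1 + cmod (1 - ?t) powr - 1)) * cmod w powr (2 * b)
     = 2 * C^2 * (cmod ?t powr (2 * x) * cmod w powr (2 * b)) * (1 + cmod (1 - ?t) powr - 1)"
     by (simp only: mult_ac)
    also have "\<dots> = ?c * (cmod w powr - q + cmod w powr (1 - q) * cmod (w - z) powr - 1)"
     unfolding 1 2 3 by (simp add: algebra_simps)
    finally show ?thesis .
   qed
   also have "\<dots> \<le> ?c * (cmod w powr - q + (cmod w powr - q + cmod (w - z) powr - q))"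
    using powr_product_le[OF pos q(1)] by (intro mult_left_mono add_left_mono) auto
   finally show ?thesis by simp
  qed
  have "(\<integral>\<^sup>+w\<in>cball 0 1. ennreal ((kern n (z / w))^2 * cmod w powr (2 * b)) \<partial>lborel)
   \<le> (\<integral>\<^sup>+w. ennreal ?c * (2 * (ennreal (cmod (w - 0) powr - q) * indicator (cball 0 1) w)
     + ennreal (cmod (w - z) powr - q) * indicator (cball 0 1) w) \<partial>lborel)"
  proof (rule nn_integral_mono_AE)
   have "AE w::complex in lborel. w \<noteq> 0" "AE w::complex in lborel. w \<noteq> z" by (rule AE_lborel_singleton)+
   then show "AE w in lborel. ennreal ((kern n (z / w))^2 * cmod w powr (2 * b)) * indicator (cball 0 1) w
    \<le> ennreal ?c * (2 * (ennreal (cmod (w - 0) powr - q) * indicator (cball 0 1) w)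
     + ennreal (cmod (w - z) powr - q) * indicator (cball 0 1) w)"
   proof eventually_elim
    fix w :: complex assume w: "w \<noteq> 0" "w \<noteq> z"
    have "ennreal ((kern n (z / w))^2 * cmod w powr (2 * b))
     \<le> ennreal (?c * (2 * cmod (w - 0) powr - q + cmod (w - z) powr - q))"
     by (intro ennreal_leI pt w)
    also have "\<dots> = ennreal ?c * (2 * ennreal (cmod (w - 0) powr - q) + ennreal (cmod (w - z) powr - q))"
     by (simp add: ennreal_mult ennreal_plus)
    finally show "ennreal ((kern n (z / w))^2 * cmod w powr (2 * b)) * indicator (cball 0 1) w
     \<le> ennreal ?c * (2 * (ennreal (cmod (w - 0) powr - q) * indicator (cball 0 1) w)
      + ennreal (cmod (w - z) powr - q) * indicator (cball 0 1) w)"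
     by (auto simp: indicator_def)
   qed
  qed
  also have "\<dots> = ennreal ?c * (2 * (\<integral>\<^sup>+w\<in>cball 0 1. ennreal (cmod (w - 0) powr - q) \<partial>lborel)
    + (\<integral>\<^sup>+w\<in>cball 0 1. ennreal (cmod (w - z) powr - q) \<partial>lborel))"
   by (simp add: nn_integral_cmult nn_integral_add)
  also have "\<dots> \<le> ennreal ?c * (2 * ennreal J + ennreal J)"
   using J(2)[of 0] J(2)[OF z(2)] by (intro mult_left_mono add_mono) auto
  also have "\<dots> = ennreal (?c * (3 * J))"
  proof -
   have 3: "2 * ennreal J + ennreal J = ennreal (3 * J)"
    using J(1) ennreal_plus[of "2 * J" J] by (simp add: ennreal_mult)
   show ?thesis unfolding 3 by (rule ennreal_mult[symmetric]) (use J in auto)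
  qed
  also have "\<dots> \<le> ennreal (2 * C^2 * (3 * J + 1) * cmod z powr (2 * x))"
   by (intro ennreal_leI) (simp add: algebra_simps)
  finally show "(\<integral>\<^sup>+w\<in>cball 0 1. ennreal ((kern n (z / w))^2 * cmod w powr (2 * b)) \<partial>lborel)
   \<le> ennreal (2 * C^2 * (3 * J + 1) * cmod z powr (2 * x))" .
 qed
qed

text \<open>The logarithmic potential of g with the Taylor polynomial of degree n at z = 0 of z
  \<mapsto> log |w - z| subtracted from the kernel.\<close>

definition potential :: "nat => (complex => complex) => complex => complex" where
 "potential n g z = (LINT w|lborel. g w * of_real (kern n (z / w)))"

lemma potential_borel [measurable]:
 assumes [measurable]: "g \<in> borel_fun"
 shows "potential n g \<in> borel_fun"
 unfolding potential_def[abs_def] by measurable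

text \<open>The absolute value stands inside the integral, so the same estimate yields both
  convergence of the potential and its decay like |z|^x with x > n.\<close>

lemma potential_bound:
 assumes "real n < x" "x < real n + 1" "b + 1 / 2 \<le> x" "x < b + 1"
 obtains C where "C > 0"
  "\<And>g z. g \<in> borel_fun ==> (\<And>w. cmod w > 1 ==> g w = 0) ==> z \<noteq> 0 ==> cmod z \<le> 1 ==>
   (\<integral>\<^sup>+w. ennreal (cmod (g w * of_real (kern n (z / w)))) \<partial>lborel)^2 \<le> ennreal (C * cmod z powr (2 * x)) * wnorm (- b) g"
proof -
 obtain C where C: "C > 0" "\<And>z. z \<noteq> 0 ==> cmod z \<le> 1 ==>
  (\<integral>\<^sup>+w\<in>cball 0 1. ennreal ((kern n (z / w))^2 * cmod w powr (2 * b)) \<partial>lborel)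
   \<le> ennreal (C * cmod z powr (2 * x))" using kern_square_integral_bound[OF assms] by blast
 show thesis
 proof (rule that[OF C(1)])
  fix g :: "complex => complex" and z
  assume [measurable]: "g \<in> borel_fun" and g: "\<And>w. cmod w > 1 ==> g w = 0"
   and z: "z \<noteq> 0" "cmod z \<le> 1"
  let ?k = "\<lambda>w. kern n (z / w) * indicator (cball 0 1) w"
  have "(\<integral>\<^sup>+w. ennreal (cmod (g w * of_real (kern n (z / w)))) \<partial>lborel)
   = (\<integral>\<^sup>+w. ennreal (cmod (g w) * \<bar>?k w\<bar>) \<partial>lborel)"
   by (intro nn_integral_cong) (use g in \<open>auto simp: norm_mult indicator_def\<close>)
  also have "\<dots>\<^sup>2 \<le> wnorm (- b) g * (\<integral>\<^sup>+w. ennreal ((?k w)^2 * cmod w powr (2 * b)) \<partial>lborel)"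
   by (rule wnorm_Cauchy_Schwarz) measurable
  also have "(\<integral>\<^sup>+w. ennreal ((?k w)^2 * cmod w powr (2 * b)) \<partial>lborel)
   = (\<integral>\<^sup>+w\<in>cball 0 1. ennreal ((kern n (z / w))^2 * cmod w powr (2 * b)) \<partial>lborel)"
   by (intro nn_integral_cong) (auto simp: indicator_def)
  also have "wnorm (- b) g * \<dots> \<le> wnorm (- b) g * ennreal (C * cmod z powr (2 * x))"
   by (intro mult_left_mono C z) auto
  finally show "(\<integral>\<^sup>+w. ennreal (cmod (g w * of_real (kern n (z / w)))) \<partial>lborel)^2
    \<le> ennreal (C * cmod z powr (2 * x)) * wnorm (- b) g"
   by (simp add: mult.commute)
 qed
qed

lemma ennreal_square_less_top: "(x::ennreal)^2 < \<infinity> ==> x < \<infinity>"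
 by (cases x) (auto simp: power2_eq_square ennreal_mult_eq_top_iff top.not_eq_extremum)

lemma ennreal_norm_integral_square_le:
 fixes f :: "complex => complex"
 shows "ennreal ((cmod (LINT w|lborel. f w))^2) \<le> (\<integral>\<^sup>+w. ennreal (cmod (f w)) \<partial>lborel)^2"
proof (cases "integrable lborel f")
 case True
 then have "ennreal (cmod (LINT w|lborel. f w)) \<le> (\<integral>\<^sup>+w. ennreal (cmod (f w)) \<partial>lborel)"
  by (rule integral_norm_bound_ennreal)
 then have "(ennreal (cmod (LINT w|lborel. f w)))^2 \<le> (\<integral>\<^sup>+w. ennreal (cmod (f w)) \<partial>lborel)^2"
  by (intro power_mono) auto
 then show ?thesis by (simp add: ennreal_power)
qed (simp add: not_integrable_integral_eq)

section \<open>Potentials of distant charges\<close>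

lemma borel_measurable_cnj [measurable (raw)]:
 "f \<in> borel_measurable M ==> (\<lambda>x. cnj (f x)) \<in> borel_measurable M"
 by (rule borel_measurable_continuous_on[OF continuous_on_cnj[OF continuous_on_id]])

text \<open>As q vanishes for |w| < r, the expansion in powers of z converges geometrically for |z|
  < r, uniformly in the relevant w, and may be integrated term by term.\<close>

lemma power_series_integral:
 fixes q :: "complex => complex"
 assumes q: "integrable lborel q" "\<And>w. cmod w < r ==> q w = 0" and r: "r > 0"
  and meas: "\<And>m. c m \<in> borel_fun"
  and bd: "\<And>m w. cmod w \<ge> r ==> cmod (c m w) \<le> C / r ^ m"
  and sm: "\<And>z w. cmod w \<ge> r ==> cmod z < r ==> (\<lambda>m. c m w * z ^ m) sums k z w"
 shows "(\<lambda>z. LINT w|lborel. q w * k z w) holomorphic_on ball 0 r"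
  "\<And>z. cmod z < r ==> integrable lborel (\<lambda>w. q w * k z w)"
proof -
 note [measurable] = meas
 have C: "C \<ge> 0" using order_trans[OF norm_ge_zero bd[of "of_real r" 0]] r by simp
 have bd': "cmod (q w * c m w) \<le> cmod (q w) * (C / r ^ m)" for m w
 proof (cases "cmod w < r")
  case False
  then show ?thesis using mult_left_mono[OF bd[of w m], of "cmod (q w)"] by (simp add: norm_mult)
 qed (use q(2) in simp)
 have i0: "integrable lborel (\<lambda>w. cmod (q w) * (C / r ^ m))" for m
  using q(1) by (intro integrable_mult_left integrable_norm)
 have i1: "integrable lborel (\<lambda>w. q w * c m w)" for m
  by (rule Bochner_Integration.integrable_bound[OF i0[of m]])
   (use q(1) bd' C r in \<open>auto intro!: AE_I2 simp: abs_mult\<close>)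
 have main: "integrable lborel (\<lambda>w. q w * k z w)"
  "(\<lambda>m. (LINT w|lborel. q w * c m w) * z ^ m) sums (LINT w|lborel. q w * k z w)"
  if z: "cmod z < r" for z
 proof -
  let ?f = "\<lambda>m w. q w * c m w * z ^ m"
  let ?x = "cmod z / r"
  have x: "0 \<le> ?x" "?x < 1" using z r by auto
  have fs: "(\<lambda>m. ?f m w) sums (q w * k z w)" for w
   using q(2)[of w] sums_mult[OF sm[OF _ z], of w "q w"] by (cases "cmod w < r") (auto simp: mult.assoc)
  have nb: "norm (?f m w) \<le> cmod (q w) * C * ?x ^ m" for m w
  proof -
   have "norm (?f m w) = cmod (q w * c m w) * cmod z ^ m" by (simp add: norm_mult norm_power)
   also have "\<dots> \<le> (cmod (q w) * (C / r ^ m)) * cmod z ^ m" by (intro mult_right_mono bd') auto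
   finally show ?thesis by (simp add: power_divide)
  qed
  have fi: "integrable lborel (?f m)" for m by (intro integrable_mult_left i1)
  have su1: "AE w in lborel. summable (\<lambda>m. norm (?f m w))"
  proof (rule AE_I2)
   fix w :: complex
   show "summable (\<lambda>m. norm (?f m w))"
    by (rule summable_comparison_test'[of "\<lambda>m. cmod (q w) * C * ?x ^ m" 0])
     (use x nb in \<open>auto intro!: summable_mult summable_geometric\<close>)
  qed
  have su2: "summable (\<lambda>m. LINT w|lborel. norm (?f m w))"
  proof (rule summable_comparison_test'[of "\<lambda>m. (LINT w|lborel. cmod (q w)) * C * ?x ^ m" 0])
   show "summable (\<lambda>m. (LINT w|lborel. cmod (q w)) * C * ?x ^ m)"
    using x by (intro summable_mult summable_geometric) auto
   fix m
   have "(LINT w|lborel. norm (?f m w)) \<le> (LINT w|lborel. cmod (q w) * (C * ?x ^ m))"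
   proof (rule integral_mono)
    show "integrable lborel (\<lambda>w. norm (?f m w))" by (rule integrable_norm[OF fi])
    show "integrable lborel (\<lambda>w. cmod (q w) * (C * ?x ^ m))"
     using q(1) by (intro integrable_mult_left integrable_norm)
    show "norm (?f m w) \<le> cmod (q w) * (C * ?x ^ m)" for w
     using nb[of w m] by (simp only: mult.assoc)
   qed
   then show "norm (LINT w|lborel. norm (?f m w)) \<le> (LINT w|lborel. cmod (q w)) * C * ?x ^ m"
    by (simp add: mult.assoc)
  qed
  have eq: "(\<lambda>w. \<Sum>m. ?f m w) = (\<lambda>w. q w * k z w)" using fs by (simp add: sums_iff)
  show "integrable lborel (\<lambda>w. q w * k z w)" using integrable_suminf[OF fi su1 su2] unfolding eq .
  have "(\<lambda>m. integral\<^sup>L lborel (?f m)) sums (LINT w|lborel. q w * k z w)"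
   using sums_integral[OF fi su1 su2] unfolding eq .
  then show "(\<lambda>m. (LINT w|lborel. q w * c m w) * z ^ m) sums (LINT w|lborel. q w * k z w)" by simp
 qed
 show "(\<lambda>z. LINT w|lborel. q w * k z w) holomorphic_on ball 0 r"
  by (rule power_series_holomorphic[where a="\<lambda>m. LINT w|lborel. q w * c m w"]) (use main(2) in simp)
 show "\<And>z. cmod z < r ==> integrable lborel (\<lambda>w. q w * k z w)" using main(1) .
qed

lemma cauchy_transform_holomorphic:
 fixes q :: "complex => complex"
 assumes q: "integrable lborel q" "\<forall>w. cmod w < r --> q w = 0" and r: "r > 0"
 shows "(\<lambda>z. LINT w|lborel. q w * (1 / (2 * (w - z)))) holomorphic_on ball 0 r"
  "\<And>z. cmod z < r ==> integrable lborel (\<lambda>w. q w * (1 / (2 * (w - z))))"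
proof -
 have bd: "cmod (1 / (2 * w ^ Suc m)) \<le> (1 / (2 * r)) / r ^ m" if "cmod w \<ge> r" for w m
 proof -
  have "r ^ Suc m \<le> cmod w ^ Suc m" using that r by (intro power_mono) auto
  then have "1 / (2 * cmod w ^ Suc m) \<le> 1 / (2 * r ^ Suc m)"
   using r by (intro divide_left_mono mult_left_mono mult_pos_pos zero_less_power)
    (use less_le_trans[OF r that] in auto)
  then show ?thesis by (simp add: norm_divide norm_mult norm_power)
 qed
 have sm: "(\<lambda>m. 1 / (2 * w ^ Suc m) * z ^ m) sums (1 / (2 * (w - z)))"
  if "cmod w \<ge> r" "cmod z < r" for z w
 proof -
  have w: "w \<noteq> 0" "w \<noteq> z" using that r by auto
  have "cmod w > 0" "cmod z < cmod w" using that r by linarith+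
  then have "cmod (z / w) < 1" by (simp add: norm_divide divide_less_eq)
  then have "(\<lambda>m. 1 / (2 * w) * (z / w) ^ m) sums (1 / (2 * w) * (1 / (1 - z / w)))"
   by (intro sums_mult geometric_sums)
  moreover have "1 / (2 * w) * (1 / (1 - z / w)) = 1 / (2 * (w - z))"
   using w by (simp add: field_simps)
  moreover have "1 / (2 * w) * (z / w) ^ m = 1 / (2 * w ^ Suc m) * z ^ m" for m
   by (simp add: power_divide)
  ultimately show ?thesis by simp
 qed
 show "(\<lambda>z. LINT w|lborel. q w * (1 / (2 * (w - z)))) holomorphic_on ball 0 r"
  by (rule power_series_integral(1)[OF q(1) q(2)[rule_format] r _ bd sm]) auto
 show "\<And>z. cmod z < r ==> integrable lborel (\<lambda>w. q w * (1 / (2 * (w - z))))"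
  by (rule power_series_integral(2)[OF q(1) q(2)[rule_format] r _ bd sm]) auto
qed

lemma integral_mult_cnj:
 fixes q k :: "complex => complex"
 shows "(LINT w|lborel. q w * cnj (k w)) = cnj (LINT w|lborel. cnj (q w) * k w)"
  "integrable lborel (\<lambda>w. cnj (q w) * k w) ==> integrable lborel (\<lambda>w. q w * cnj (k w))"
proof -
 show "(LINT w|lborel. q w * cnj (k w)) = cnj (LINT w|lborel. cnj (q w) * k w)"
  using Bochner_Integration.integral_cnj[of lborel "\<lambda>w. cnj (q w) * k w"] by simp
 assume "integrable lborel (\<lambda>w. cnj (q w) * k w)"
 then have "integrable lborel (\<lambda>w. cnj (cnj (q w) * k w))" by (simp only: integrable_cnj)
 then show "integrable lborel (\<lambda>w. q w * cnj (k w))" by simp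
qed

text \<open>For the outer commutator terms of Green's formula: seen from the disc, a Cauchy
  transform of distant charge is holomorphic, and a transform with conjugated kernel is the
  conjugate of one.\<close>

lemma distant_cauchy_potential:
 fixes q1 q2 :: "complex => complex"
 assumes q: "integrable lborel q1" "integrable lborel q2"
  and supp: "\<And>w. cmod w < r ==> q1 w = 0 \<and> q2 w = 0" and r: "r > 0"
 obtains A B where "A holomorphic_on ball 0 r" "B holomorphic_on ball 0 r"
  "\<And>z. cmod z < r ==> integrable lborel (\<lambda>w. q1 w * (1 / (2 * (w - z))) + q2 w * (1 / (2 * cnj (w - z))))"
  "\<And>z. cmod z < r ==> (LINT w|lborel. q1 w * (1 / (2 * (w - z))) + q2 w * (1 / (2 * cnj (w - z)))) = A z + cnj (B z)"
proof -
 have s: "\<forall>w. cmod w < r --> q1 w = 0" "\<forall>w. cmod w < r --> cnj (q2 w) = 0" using supp by auto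
 have cq: "integrable lborel (\<lambda>w. cnj (q2 w))" using q by auto
 note H1 = cauchy_transform_holomorphic[OF q(1) s(1) r]
 note H2 = cauchy_transform_holomorphic[OF cq s(2) r]
 have e: "1 / (2 * cnj (w - z)) = cnj (1 / (2 * (w - z)))" for w z by simp
 show thesis
 proof (rule that[OF H1(1) H2(1)])
  fix z assume z: "cmod z < r"
  note i = H1(2)[OF z] integral_mult_cnj(2)[OF H2(2)[OF z]]
  show "integrable lborel (\<lambda>w. q1 w * (1 / (2 * (w - z))) + q2 w * (1 / (2 * cnj (w - z))))"
   unfolding e by (rule Bochner_Integration.integrable_add[OF i])
  show "(LINT w|lborel. q1 w * (1 / (2 * (w - z))) + q2 w * (1 / (2 * cnj (w - z)))) =
    (LINT w|lborel. q1 w * (1 / (2 * (w - z)))) + cnj (LINT w|lborel. cnj (q2 w) * (1 / (2 * (w - z))))"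
   unfolding e Bochner_Integration.integral_add[OF i] integral_mult_cnj(1) ..
 qed
qed

lemma holomorphic_taylor_split:
 assumes "f holomorphic_on ball 0 r"
 obtains a g where "g holomorphic_on ball 0 r"
  "\<And>z. z \<in> ball 0 r ==> f z = (\<Sum>m\<le>n. a m * z ^ m) + z ^ (n + 1) * g z"
proof -
 have step: "\<exists>c g. g holomorphic_on ball 0 r \<and> (\<forall>z. f z = c + z * g z)"
  if "f holomorphic_on ball 0 r" for f :: "complex => complex"
 proof (intro exI conjI allI)
  show "(\<lambda>z. if z = 0 then deriv f 0 else (f z - f 0) / (z - 0)) holomorphic_on ball 0 r"
   by (rule pole_lemma_open[OF that]) simp
  show "f z = f 0 + z * (if z = 0 then deriv f 0 else (f z - f 0) / (z - 0))" for z by simp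
 qed
 have "\<exists>a g. g holomorphic_on ball 0 r \<and> (\<forall>z\<in>ball 0 r. f z = (\<Sum>m\<le>n. a m * z ^ m) + z ^ (n + 1) * g z)"
 proof (induction n)
  case 0
  obtain c g where "g holomorphic_on ball 0 r" "\<And>z. f z = c + z * g z" using step[OF assms] by blast
  then show ?case by (intro exI[of _ "\<lambda>_. c"] exI[of _ g]) auto
 next
  case (Suc n)
  then obtain a g where g: "g holomorphic_on ball 0 r"
   "\<And>z. z \<in> ball 0 r ==> f z = (\<Sum>m\<le>n. a m * z ^ m) + z ^ (n + 1) * g z" by blast
  obtain c g' where g': "g' holomorphic_on ball 0 r" "\<And>z. g z = c + z * g' z" using step[OF g(1)] by blast
  let ?a = "a(Suc n := c)"
  have "f z = (\<Sum>m\<le>Suc n. ?a m * z ^ m) + z ^ (Suc n + 1) * g' z" if "z \<in> ball 0 r" for z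
  proof -
   have "(\<Sum>m\<le>n. ?a m * z ^ m) = (\<Sum>m\<le>n. a m * z ^ m)" by (intro sum.cong) auto
   then show ?thesis using g(2)[OF that] g'(2)[of z] by (simp add: algebra_simps)
  qed
  then show ?case using g'(1) by blast
 qed
 then show thesis using that by blast
qed

section \<open>Removing the regularisation\<close>

text \<open>Majorants that do not depend on the regularisation. The power -1/2 is chosen because its
  square is still integrable, so that it pairs with square integrable charges.\<close>

lemma log_kernel_bounds:
 assumes "0 < e" "e \<le> 1" "w \<noteq> 0" "cmod w \<le> 2"
 shows "cmod (log_kernel e w) \<le> 8 * cmod w powr (- 1 / 2)"
  "\<bar>ln (cmod w)\<bar> \<le> 8 * cmod w powr (- 1 / 2)"
  "cmod (log_kernel_p e w) \<le> 1 / (2 * cmod w)"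
proof -
 let ?x = "cmod w"
 have x: "?x > 0" "?x \<le> 2" using assms by auto
 have one: "1 \<le> 2 * ?x powr (- 1 / 2)"
 proof -
  have "(2::real) powr (- 1 / 2) \<le> ?x powr (- 1 / 2)" using x by (intro powr_mono2') auto
  moreover have "(2::real) powr (- 1) \<le> 2 powr (- 1 / 2)" by (intro powr_mono) auto
  ultimately show ?thesis by simp
 qed
 have "?x powr (1 / 2) = ?x * ?x powr (- 1 / 2)"
  using x powr_add[of ?x 1 "- 1 / 2"] by simp
 also have "\<dots> \<le> 2 * ?x powr (- 1 / 2)" using x by (intro mult_right_mono) auto
 finally have "\<bar>ln ?x\<bar> \<le> 6 * ?x powr (- 1 / 2)"
  using abs_ln_le_powr[OF x(1), of "1 / 2"] by simp
 with one have L: "\<bar>ln ?x\<bar> + 1 \<le> 8 * ?x powr (- 1 / 2)" by linarith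
 then show "\<bar>ln ?x\<bar> \<le> 8 * ?x powr (- 1 / 2)" by linarith
 have pos: "?x^2 > 0" using x by simp
 have "?x^2 \<le> 2^2" "e^2 \<le> 1^2" using x assms by (intro power_mono; simp)+
 then have "?x^2 + e^2 \<le> 5" by simp
 then have "ln (?x^2 + e^2) \<le> ln (exp 2)"
  using exp_ge_add_one_self[of 1] exp_double[of "1::real"] power_mono[of 2 "exp (1::real)" 2] pos
   exp_lower_Taylor_quadratic[of "2::real"]
  by (subst ln_le_cancel_iff) (auto intro: add_pos_nonneg)
 then have up: "ln (?x^2 + e^2) / 2 \<le> 1" by simp
 have "ln (?x^2) \<le> ln (?x^2 + e^2)" using pos by (subst ln_le_cancel_iff) (auto intro: add_pos_nonneg)
 then have "ln ?x \<le> ln (?x^2 + e^2) / 2" using x by (simp add: ln_realpow)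
 with up have "\<bar>ln (?x^2 + e^2) / 2\<bar> \<le> \<bar>ln ?x\<bar> + 1" by linarith
 moreover have "cmod (log_kernel e w) = \<bar>ln (?x^2 + e^2) / 2\<bar>" unfolding log_kernel_def norm_of_real ..
 ultimately show "cmod (log_kernel e w) \<le> 8 * ?x powr (- 1 / 2)" using L by linarith
 have "cmod (log_kernel_p e w) = ?x / (2 * (?x^2 + e^2))"
 proof -
  have "\<bar>?x\<^sup>2 + e\<^sup>2\<bar> = ?x^2 + e^2" using pos by (simp add: abs_of_pos add_pos_nonneg)
  then show ?thesis unfolding log_kernel_p_def norm_divide norm_mult norm_of_real by simp
 qed
 also have "\<dots> \<le> ?x / (2 * ?x^2)"
  using x pos by (intro divide_left_mono) (auto intro!: mult_pos_pos add_pos_nonneg)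
 also have "\<dots> = 1 / (2 * ?x)" using x by (simp add: power2_eq_square)
 finally show "cmod (log_kernel_p e w) \<le> 1 / (2 * ?x)" .
qed

lemma log_kernel_tendsto:
 assumes "d \<longlonglongrightarrow> 0" "w \<noteq> 0"
 shows "(\<lambda>j. log_kernel (d j) w) \<longlonglongrightarrow> of_real (ln (cmod w))"
  "(\<lambda>j. log_kernel_p (d j) w) \<longlonglongrightarrow> 1 / (2 * w)"
proof -
 have pos: "(cmod w)^2 + 0^2 > 0" using assms by simp
 have "(\<lambda>j. log_kernel (d j) w) \<longlonglongrightarrow> of_real (ln ((cmod w)^2 + 0^2) / 2)"
  unfolding log_kernel_def using assms pos by (intro tendsto_intros) auto
 then show "(\<lambda>j. log_kernel (d j) w) \<longlonglongrightarrow> of_real (ln (cmod w))"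
  using assms by (simp add: ln_realpow)
 have "(\<lambda>j. log_kernel_p (d j) w) \<longlonglongrightarrow> cnj w / (2 * of_real ((cmod w)^2 + 0^2))"
  unfolding log_kernel_p_def using assms pos by (intro tendsto_intros) auto
 moreover have "cnj w / (2 * of_real ((cmod w)^2 + 0^2)) = 1 / (2 * w)"
 proof -
  have "complex_of_real ((cmod w)^2 + 0^2) = w * cnj w" using complex_norm_square[of w] by simp
  then show ?thesis using assms by (simp only:) (simp add: divide_simps)
 qed
 ultimately show "(\<lambda>j. log_kernel_p (d j) w) \<longlonglongrightarrow> 1 / (2 * w)" by simp
qed

lemma log_kernel_borel [measurable]:
 "log_kernel e \<in> borel_fun" "log_kernel_p e \<in> borel_fun"
proof -
 show "log_kernel e \<in> borel_fun" unfolding log_kernel_def[abs_def] by measurable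
 have "log_kernel_p e = (\<lambda>w. cnj w * of_real (inverse (2 * ((cmod w)^2 + e^2))))"
  by (simp add: log_kernel_p_def divide_inverse fun_eq_iff)
 also have "\<dots> \<in> borel_fun" by measurable
 finally show "log_kernel_p e \<in> borel_fun" .
qed

lemma approx_kernel_minus: "approx_kernel e (w - z) = approx_kernel e (z - w)"
 by (simp add: approx_kernel_def norm_minus_commute)

text \<open>By symmetry of the kernel the smoothing passes from f, which is only integrable, to the
  bounded function q, where it can be controlled pointwise.\<close>

lemma approx_kernel_fubini:
 fixes f q :: "complex => complex"
 assumes f: "integrable lborel f" and [measurable]: "q \<in> borel_fun"
  and bd: "\<And>z. cmod (q z) \<le> N" and d: "e > 0"
 shows "(LINT z|lborel. q z * (LINT w|lborel. f w * of_real (approx_kernel e (w - z))))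
  = (LINT w|lborel. f w * (LINT z|lborel. q z * of_real (approx_kernel e (z - w))))"
proof -
 have [measurable]: "f \<in> borel_fun" using f by simp
 let ?F = "\<lambda>w z. f w * (q z * of_real (approx_kernel e (z - w)))"
 have N: "N \<ge> 0" using order_trans[OF norm_ge_zero bd] .
 have i: "integrable lborel (\<lambda>z. q z * of_real (approx_kernel e (z - w)))" for w
  by (rule approx_kernel_convolution_integrable[OF _ d bd]) measurable
 have "integrable (lborel \<Otimes>\<^sub>M lborel) (case_prod ?F)"
 proof (rule lborel_pair.Fubini_integrable)
  show "AE x in lborel. integrable lborel (\<lambda>y. case_prod ?F (x, y))"
   using i by (auto intro!: integrable_mult_right AE_I2)
  have eq: "(LINT y|lborel. norm (case_prod ?F (x, y))) = cmod (f x) * (LINT y|lborel. cmod (q y) * approx_kernel e (y - x))" for x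
   by (simp add: norm_mult approx_kernel_nonneg)
  have "norm (LINT y|lborel. cmod (q y) * approx_kernel e (y - x)) \<le> kernel_mass * N" for x
  proof -
   have "norm (LINT y|lborel. complex_of_real (cmod (q y)) * of_real (approx_kernel e (y - x))) \<le> kernel_mass * N"
    by (rule approx_kernel_convolution_bound[OF _ d]) (use bd in auto)
   then show ?thesis by (simp flip: of_real_mult)
  qed
  then have b: "norm (cmod (f x) * (LINT y|lborel. cmod (q y) * approx_kernel e (y - x))) \<le> norm (cmod (f x) * (kernel_mass * N))" for x
   using kernel_mass_pos N by (auto simp: abs_mult intro!: mult_left_mono)
  have f': "integrable lborel (\<lambda>x. cmod (f x) * (kernel_mass * N))"
   using f by (intro integrable_mult_left integrable_norm)
  show "integrable lborel (\<lambda>x. LINT y|lborel. norm (case_prod ?F (x, y)))"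
   unfolding eq by (rule Bochner_Integration.integrable_bound[OF f' _ AE_I2[OF b]]) measurable
 qed measurable
 from lborel_pair.Fubini_integral[OF this]
 have "(LINT z|lborel. LINT w|lborel. ?F w z) = (LINT w|lborel. LINT z|lborel. ?F w z)" by simp
 moreover have "(LINT w|lborel. ?F w z) = q z * (LINT w|lborel. f w * of_real (approx_kernel e (w - z)))" for z
 proof -
  have "?F w z = q z * (f w * of_real (approx_kernel e (w - z)))" for w
   by (simp only: approx_kernel_minus[of e z w] mult.left_commute)
  then show ?thesis by (simp only: integral_mult_right_zero)
 qed
 moreover have "(LINT z|lborel. ?F w z) = f w * (LINT z|lborel. q z * of_real (approx_kernel e (z - w)))" for w
  by (simp only: integral_mult_right_zero)
 ultimately show ?thesis by (simp only:)
qed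

text \<open>The hypothesis is Green's formula smoothed at scale e. Tested against q times a bounded
  continuous function, its left side tends to \<open>kernel_mass\<close> times the integral of f,
  because the smoothing may be moved to the test function. The right side converges by dominated
  convergence, the gradient charges a1 and a2 staying at distance d from the points where q is
  non-zero. Equality for all test functions is equality almost everywhere on that set.\<close>

lemma weak_identification:
 fixes f a0 a1 a2 :: "complex => complex" and q :: "complex => real"
 assumes f: "integrable lborel f"
  and a0: "a0 \<in> borel_fun" "integrable lborel (\<lambda>y. (cmod (a0 y))^2)"
  and a12: "integrable lborel a1" "integrable lborel a2"
  and supp: "\<And>y. cmod y > 1 ==> a0 y = 0 \<and> a1 y = 0 \<and> a2 y = 0"
  and d: "d > 0" and q: "continuous_on UNIV q" "\<And>z. \<bar>q z\<bar> \<le> 1"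
  and qs: "\<And>z. q z \<noteq> 0 ==> cmod z \<le> 1"
   "\<And>z y. q z \<noteq> 0 ==> a1 y \<noteq> 0 \<or> a2 y \<noteq> 0 ==> d \<le> cmod (y - z)"
  and eq: "\<And>e z. 0 < e ==> e \<le> 1 ==> q z \<noteq> 0 ==>
   (LINT y|lborel. f y * of_real (approx_kernel e (y - z))) =
   (LINT y|lborel. a0 y * log_kernel e (y - z) + a1 y * log_kernel_p e (y - z) + a2 y * cnj (log_kernel_p e (y - z)))"
 shows "AE z in lborel. q z \<noteq> 0 --> of_real kernel_mass * f z =
   (LINT y|lborel. a0 y * of_real (ln (cmod (y - z))) + a1 y * (1 / (2 * (y - z))) + a2 y * (1 / (2 * cnj (y - z))))"
proof -
 have [measurable]: "f \<in> borel_fun" "a1 \<in> borel_fun" "a2 \<in> borel_fun"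
  using f a12 by simp_all
 note [measurable] = a0(1) borel_measurable_continuous_onI[OF q(1)]
 define dj where "dj j = 1 / real (Suc j)" for j
 have dj: "dj j > 0" "dj j \<le> 1" for j by (auto simp: dj_def)
 have dj0: "dj \<longlonglongrightarrow> 0" unfolding dj_def by (rule lim_1_over_n[THEN LIMSEQ_Suc])
 let ?F = "\<lambda>e z y. a0 y * log_kernel e (y - z) + a1 y * log_kernel_p e (y - z) + a2 y * cnj (log_kernel_p e (y - z))"
 let ?Flim = "\<lambda>z y. a0 y * of_real (ln (cmod (y - z))) + a1 y * (1 / (2 * (y - z))) + a2 y * (1 / (2 * cnj (y - z)))"
 define V where "V j z = (LINT y|lborel. ?F (dj j) z y)" for j z
 define V0 where "V0 z = (LINT y|lborel. ?Flim z y)" for z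
 have [measurable]: "V j \<in> borel_fun" for j unfolding V_def[abs_def] by measurable
 have [measurable]: "V0 \<in> borel_fun" unfolding V0_def[abs_def] by measurable
 \<comment> \<open>The a0 term is at most 2 |a0| times 4 |y - z|^(-1/2), hence at most |a0|^2 + 16
   |y - z|^-1; the gradient kernels are at most 1 / (2 |y - z|) \<le> 1 / (2 d).\<close>
 let ?maj = "\<lambda>z y. (cmod (a0 y))^2 + 16 * (cmod (y - z) powr - 1 * indicator (cball 0 1) y)
   + (cmod (a1 y) + cmod (a2 y)) / (2 * d)"
 obtain J where J: "J \<ge> 0" and Ji: "\<And>z. cmod z \<le> 1 ==> integrable lborel (\<lambda>y. cmod (y - z) powr - 1 * indicator (cball 0 1) y)"
  and JB: "\<And>z. cmod z \<le> 1 ==> (LINT y|lborel. cmod (y - z) powr - 1 * indicator (cball 0 1) y) \<le> J"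
  by (rule integral_powr_shift_le[of 1]) (simp, rule that)
 have maji: "integrable lborel (?maj z)" if "cmod z \<le> 1" for z
  using that by (intro Bochner_Integration.integrable_add integrable_mult_right integrable_divide integrable_norm a0 a12 Ji)
 define B where "B = (LINT y|lborel. (cmod (a0 y))^2) + 16 * J + ((LINT y|lborel. cmod (a1 y)) + (LINT y|lborel. cmod (a2 y))) / (2 * d)"
 have majB: "(LINT y|lborel. ?maj z y) \<le> B" if z: "cmod z \<le> 1" for z
 proof -
  have "(LINT y|lborel. ?maj z y) = (LINT y|lborel. (cmod (a0 y))^2) +
    16 * (LINT y|lborel. cmod (y - z) powr - 1 * indicator (cball 0 1) y) +
    ((LINT y|lborel. cmod (a1 y)) + (LINT y|lborel. cmod (a2 y))) / (2 * d)"
  proof -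
   have i: "integrable lborel (\<lambda>y. 16 * (cmod (y - z) powr - 1 * indicator (cball 0 1) y))"
    "integrable lborel (\<lambda>y. cmod (a1 y))" "integrable lborel (\<lambda>y. cmod (a2 y))"
    by (intro integrable_mult_right integrable_norm Ji z a12)+
   have i': "integrable lborel (\<lambda>y. (cmod (a1 y) + cmod (a2 y)) / (2 * d))"
    by (intro integrable_divide Bochner_Integration.integrable_add i)
   show ?thesis
    unfolding Bochner_Integration.integral_add[OF Bochner_Integration.integrable_add[OF a0(2) i(1)] i']
     Bochner_Integration.integral_add[OF a0(2) i(1)]
    by (simp only: Bochner_Integration.integral_add[OF i(2,3)] integral_mult_right_zero
      integral_divide_zero)
  qed
  then show ?thesis using JB[OF z] by (simp add: B_def)
 qed
 have bound: "cmod (?F e z y) \<le> ?maj z y" if e: "0 < e" "e \<le> 1" and k: "q z \<noteq> 0" and ne: "y \<noteq> z" for e z y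
 proof (cases "cmod y > 1")
  case True
  then show ?thesis using supp[OF True] d by simp
 next
  case False
  let ?x = "cmod (y - z)"
  have x: "y - z \<noteq> 0" "?x \<le> 2" "?x > 0"
   using ne False qs(1)[OF k] norm_triangle_ineq4[of y z] by auto
  note L = log_kernel_bounds[OF e x(1,2)]
  have "cmod (a0 y * log_kernel e (y - z)) \<le> cmod (a0 y) * (8 * ?x powr (- 1 / 2))"
   unfolding norm_mult by (intro mult_left_mono L) auto
  also have "\<dots> \<le> (cmod (a0 y))^2 + (4 * ?x powr (- 1 / 2))^2"
   using sum_squares_bound[of "cmod (a0 y)" "4 * ?x powr (- 1 / 2)"] by simp
  also have "(4 * ?x powr (- 1 / 2))^2 = 16 * ?x powr - 1" by (simp add: power_mult_distrib powr_square)
  finally have 0: "cmod (a0 y * log_kernel e (y - z)) \<le> (cmod (a0 y))^2 + 16 * (?x powr - 1 * indicator (cball 0 1) y)"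
   using False by simp
  have p: "cmod a * cmod (log_kernel_p e (y - z)) \<le> cmod a / (2 * d)" if "a \<noteq> 0 ==> d \<le> ?x" for a :: complex
  proof (cases "a = 0")
   case False
   have "cmod (log_kernel_p e (y - z)) \<le> 1 / (2 * ?x)" by (rule L)
   also have "\<dots> \<le> 1 / (2 * d)" using that[OF False] d by (intro frac_le) auto
   finally show ?thesis using mult_left_mono[of _ "1 / (2 * d)" "cmod a"] by simp
  qed simp
  have 1: "cmod (a1 y * log_kernel_p e (y - z)) \<le> cmod (a1 y) / (2 * d)"
   unfolding norm_mult by (rule p) (use qs(2)[OF k] in auto)
  have 2: "cmod (a2 y * cnj (log_kernel_p e (y - z))) \<le> cmod (a2 y) / (2 * d)"
   unfolding norm_mult complex_mod_cnj by (rule p) (use qs(2)[OF k] in auto)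
  have "cmod (?F e z y) \<le> cmod (a0 y * log_kernel e (y - z)) + cmod (a1 y * log_kernel_p e (y - z)) + cmod (a2 y * cnj (log_kernel_p e (y - z)))"
   by (intro norm_triangle_le add_right_mono norm_triangle_ineq)
  then show ?thesis using 0 1 2 by (simp only: add_divide_distrib)
 qed
 have ne: "AE y in lborel. y \<noteq> z" for z :: complex by (rule AE_lborel_singleton)
 have Fi: "integrable lborel (?F (dj j) z)" if k: "q z \<noteq> 0" for j z
 proof (rule Bochner_Integration.integrable_bound[OF maji[OF qs(1)[OF k]]])
  show "AE y in lborel. norm (?F (dj j) z y) \<le> norm (?maj z y)"
   using ne[of z]
  proof eventually_elim
   fix y assume "y \<noteq> z"
   then show "norm (?F (dj j) z y) \<le> norm (?maj z y)"
    unfolding real_norm_def using bound[OF dj k] by (intro order_trans[OF _ abs_ge_self]) blast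
  qed
 qed measurable
 have VB: "cmod (V j z) \<le> B" if k: "q z \<noteq> 0" for j z
 proof -
  have "cmod (V j z) \<le> (LINT y|lborel. cmod (?F (dj j) z y))" unfolding V_def by (rule integral_norm_bound)
  also have "\<dots> \<le> (LINT y|lborel. ?maj z y)"
  proof (rule integral_mono_AE[OF integrable_norm[OF Fi[OF k]] maji[OF qs(1)[OF k]]])
   show "AE y in lborel. cmod (?F (dj j) z y) \<le> ?maj z y"
    using ne[of z] by eventually_elim (rule bound[OF dj k])
  qed
  finally show ?thesis using majB[OF qs(1)[OF k]] by linarith
 qed
 have VV0: "(\<lambda>j. V j z) \<longlonglongrightarrow> V0 z" if k: "q z \<noteq> 0" for z
  unfolding V_def V0_def
 proof (rule integral_dominated_convergence[where w="?maj z"])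
  show "integrable lborel (?maj z)" by (rule maji[OF qs(1)[OF k]])
  show "AE y in lborel. norm (?F (dj j) z y) \<le> ?maj z y" for j
   using ne[of z] by eventually_elim (rule bound[OF dj k])
  show "AE y in lborel. (\<lambda>j. ?F (dj j) z y) \<longlonglongrightarrow> ?Flim z y"
   using ne[of z]
  proof eventually_elim
   fix y assume "y \<noteq> z"
   then have nz: "y - z \<noteq> 0" by simp
   have "(\<lambda>j. cnj (log_kernel_p (dj j) (y - z))) \<longlonglongrightarrow> cnj (1 / (2 * (y - z)))"
    by (intro tendsto_cnj log_kernel_tendsto dj0 nz)
   then have "(\<lambda>j. cnj (log_kernel_p (dj j) (y - z))) \<longlonglongrightarrow> 1 / (2 * cnj (y - z))" by simp
   then show "(\<lambda>j. ?F (dj j) z y) \<longlonglongrightarrow> ?Flim z y"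
    by (intro tendsto_add tendsto_mult tendsto_const log_kernel_tendsto dj0 nz)
  qed
 qed measurable
 have V0B: "cmod (V0 z) \<le> B" if k: "q z \<noteq> 0" for z
  by (rule Lim_bounded[OF tendsto_norm[OF VV0[OF k]], of 0]) (use VB[OF k] in auto)
 have B: "B \<ge> 0" using J d by (auto simp: B_def intro!: add_nonneg_nonneg divide_nonneg_pos integral_nonneg_AE)
 let ?h = "\<lambda>z. of_real (q z) * (of_real kernel_mass * f z - V0 z)"
 have fi: "integrable lborel (\<lambda>z. of_real (q z) * f z)"
  by (rule Bochner_Integration.integrable_bound[OF f])
   (use q(2) in \<open>auto simp: norm_mult intro!: mult_left_le_one_le\<close>)
 have ci: "integrable lborel (\<lambda>z. c * indicator (cball (0::complex) 1) z :: real)" for c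
  by (intro integrable_mult_right integrable_real_indicator) (auto simp: emeasure_cball_complex)
 have V0i: "integrable lborel (\<lambda>z. of_real (q z) * V0 z)"
 proof (rule Bochner_Integration.integrable_bound[OF ci[of B]])
  show "AE z in lborel. norm (of_real (q z) * V0 z) \<le> norm (B * indicator (cball 0 1) z)"
  proof (rule AE_I2)
   fix z
   show "norm (of_real (q z) * V0 z) \<le> norm (B * indicator (cball 0 1) z)"
    using q(2)[of z] qs(1)[of z] V0B[of z] B
    by (cases "q z = 0") (auto simp: norm_mult intro: order_trans[OF mult_left_le_one_le])
  qed
 qed measurable
 have hi: "integrable lborel ?h"
 proof -
  have "integrable lborel (\<lambda>z. of_real kernel_mass * (of_real (q z) * f z) - of_real (q z) * V0 z)"
   by (intro Bochner_Integration.integrable_diff integrable_mult_right fi V0i)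
  then show ?thesis by (simp add: algebra_simps)
 qed
 have "AE z in lborel. ?h z = 0"
 proof (rule lborel_ident_integral_eq_zero[OF hi])
  fix \<phi> :: "complex => complex" and N
  assume \<phi>: "continuous_on UNIV \<phi>" and N: "\<And>z. cmod (\<phi> z) \<le> N"
  note [measurable] = borel_measurable_continuous_onI[OF \<phi>]
  have N0: "N \<ge> 0" using order_trans[OF norm_ge_zero N] .
  let ?\<psi> = "\<lambda>z. of_real (q z) * \<phi> z"
  have \<psi>N: "cmod (?\<psi> z) \<le> N" for z
  proof -
   have "cmod (?\<psi> z) \<le> 1 * cmod (\<phi> z)" unfolding norm_mult by (intro mult_right_mono) (use q(2) in auto)
   then show ?thesis using N[of z] by linarith
  qed
  have 1: "(\<lambda>j. LINT z|lborel. ?\<psi> z * V j z) \<longlonglongrightarrow> (LINT z|lborel. ?\<psi> z * V0 z)"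
  proof (rule integral_dominated_convergence[where w="\<lambda>z. N * B * indicator (cball (0::complex) 1) z"])
   show "integrable lborel (\<lambda>z. N * B * indicator (cball (0::complex) 1) z)" by (rule ci)
   show "AE z in lborel. norm (?\<psi> z * V j z) \<le> N * B * indicator (cball 0 1) z" for j
   proof (rule AE_I2)
    fix z
    show "norm (?\<psi> z * V j z) \<le> N * B * indicator (cball 0 1) z"
    proof (cases "q z = 0")
     case False
     have "norm (?\<psi> z * V j z) \<le> N * B" unfolding norm_mult[of "?\<psi> z"]
      by (intro mult_mono \<psi>N VB False N0) auto
     then show ?thesis using qs(1)[OF False] by simp
    qed (use N0 B in auto)
   qed
   show "AE z in lborel. (\<lambda>j. ?\<psi> z * V j z) \<longlonglongrightarrow> ?\<psi> z * V0 z"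
   proof (rule AE_I2)
    fix z
    show "(\<lambda>j. ?\<psi> z * V j z) \<longlonglongrightarrow> ?\<psi> z * V0 z"
     by (cases "q z = 0") (auto intro!: tendsto_mult VV0)
   qed
  qed measurable
  have 2: "(LINT z|lborel. ?\<psi> z * V j z) = (LINT y|lborel. f y * (LINT z|lborel. ?\<psi> z * of_real (approx_kernel (dj j) (z - y))))" for j
  proof -
   have "?\<psi> z * V j z = ?\<psi> z * (LINT y|lborel. f y * of_real (approx_kernel (dj j) (y - z)))" for z
    using eq[OF dj[of j], of z] by (cases "q z = 0") (auto simp: V_def)
   then have "(LINT z|lborel. ?\<psi> z * V j z) = (LINT z|lborel. ?\<psi> z * (LINT y|lborel. f y * of_real (approx_kernel (dj j) (y - z))))"
    by (rule Bochner_Integration.integral_cong[OF refl])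
   also have "\<dots> = (LINT y|lborel. f y * (LINT z|lborel. ?\<psi> z * of_real (approx_kernel (dj j) (z - y))))"
    by (rule approx_kernel_fubini[OF f _ \<psi>N dj(1)]) measurable
   finally show ?thesis .
  qed
  have 3: "(\<lambda>j. LINT y|lborel. f y * (LINT z|lborel. ?\<psi> z * of_real (approx_kernel (dj j) (z - y))))
    \<longlonglongrightarrow> (LINT y|lborel. f y * (of_real kernel_mass * ?\<psi> y))"
  proof (rule integral_dominated_convergence[where w="\<lambda>y. cmod (f y) * (kernel_mass * N)"])
   show "integrable lborel (\<lambda>y. cmod (f y) * (kernel_mass * N))" using f by (intro integrable_mult_left integrable_norm)
   show "AE y in lborel. norm (f y * (LINT z|lborel. ?\<psi> z * of_real (approx_kernel (dj j) (z - y)))) \<le> cmod (f y) * (kernel_mass * N)" for j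
    unfolding norm_mult
    by (intro AE_I2 mult_left_mono approx_kernel_convolution_bound[OF _ dj(1)] \<psi>N) auto
   have \<psi>c: "isCont ?\<psi> y" for y
    using \<phi> q(1) by (auto simp: continuous_on_eq_continuous_at intro!: continuous_intros)
   show "AE y in lborel. (\<lambda>j. f y * (LINT z|lborel. ?\<psi> z * of_real (approx_kernel (dj j) (z - y))))
     \<longlonglongrightarrow> f y * (of_real kernel_mass * ?\<psi> y)"
    by (intro AE_I2 tendsto_mult tendsto_const approx_kernel_convolution_tendsto[OF _ \<psi>N \<psi>c dj(1) dj0]) measurable
  qed measurable
  have "(LINT z|lborel. ?\<psi> z * V0 z) = (LINT y|lborel. f y * (of_real kernel_mass * ?\<psi> y))"
   using LIMSEQ_unique[OF 1[unfolded 2] 3] .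
  moreover have "(LINT z|lborel. ?h z * \<phi> z) = (LINT y|lborel. f y * (of_real kernel_mass * ?\<psi> y)) - (LINT z|lborel. ?\<psi> z * V0 z)"
  proof -
   have i1: "integrable lborel (\<lambda>z. f z * (of_real kernel_mass * ?\<psi> z))"
   proof (rule Bochner_Integration.integrable_bound[OF integrable_mult_right[OF f, of "of_real (kernel_mass * N)"]])
    have "cmod (f z) * (kernel_mass * cmod (?\<psi> z)) \<le> cmod (f z) * (kernel_mass * N)" for z
     using kernel_mass_pos by (intro mult_left_mono \<psi>N) auto
    then have "norm (f z * (of_real kernel_mass * ?\<psi> z)) \<le> norm (of_real (kernel_mass * N) * f z)" for z
     using kernel_mass_pos N0 by (simp add: norm_mult abs_mult mult_ac)
    then show "AE z in lborel. norm (f z * (of_real kernel_mass * ?\<psi> z)) \<le> norm (of_real (kernel_mass * N) * f z)"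
     by (rule AE_I2)
   qed measurable
   have i2: "integrable lborel (\<lambda>z. ?\<psi> z * V0 z)"
   proof (rule Bochner_Integration.integrable_bound[OF integrable_mult_right[OF V0i, of "of_real N"]])
    show "AE z in lborel. norm (?\<psi> z * V0 z) \<le> norm (of_real N * (of_real (q z) * V0 z))"
    proof (rule AE_I2)
     fix z
     have "cmod (\<phi> z) * (\<bar>q z\<bar> * cmod (V0 z)) \<le> N * (\<bar>q z\<bar> * cmod (V0 z))"
      by (intro mult_right_mono N) auto
     then show "norm (?\<psi> z * V0 z) \<le> norm (of_real N * (of_real (q z) * V0 z))"
      using N0 by (simp add: norm_mult mult_ac)
    qed
   qed measurable
   show ?thesis
    by (subst Bochner_Integration.integral_diff[OF i1 i2, symmetric]) (simp add: algebra_simps)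
  qed
  ultimately show "(LINT z|lborel. ?h z * \<phi> z) = 0" by simp
 qed
 then show ?thesis by eventually_elim (auto simp: V0_def)
qed

section \<open>Representation of weak solutions near a conical point\<close>

definition planar_test :: "real => (complex => complex) set" where
 "planar_test R = {f. smooth_on (-{0}) f \<and> (\<exists>a>0. \<exists>r<R. \<forall>z. f z \<noteq> 0 --> a \<le> cmod z \<and> cmod z \<le> r)}"

lemma smooth_on_mult:
 "open S ==> smooth_on S f ==> smooth_on S g ==> smooth_on S (\<lambda>z. f z * g z :: complex)"
 by (simp add: smooth_on_def times_differentiable_on_mult)

lemma smooth_on_add: "open S ==> smooth_on S f ==> smooth_on S g ==> smooth_on S (\<lambda>z. f z + g z)"
 by (simp add: smooth_on_def times_differentiable_on_add)

lemma smooth_on_subset: "smooth_on S f ==> T \<subseteq> S ==> smooth_on T f"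
 by (auto simp: smooth_on_def intro: times_differentiable_on_subset)

lemma smooth_on_holomorphic: "open S ==> f holomorphic_on S ==> smooth_on S f"
 by (simp add: smooth_on_def times_differentiable_on_holomorphic)

lemma smooth_on_cnj: "open S ==> smooth_on S f ==> smooth_on S (\<lambda>z. cnj (f z))"
 by (simp add: smooth_on_def times_differentiable_on_cnj)

definition log_cutoff_p :: "real => real => complex => complex" where
 "log_cutoff_p k a z = of_real (k * smooth_step1 (k * ln ((cmod z)^2) + a)) / z"

definition log_cutoff_l :: "real => real => complex => complex" where
 "log_cutoff_l k a z = of_real (k^2 * smooth_step2 (k * ln ((cmod z)^2) + a)) / (z * cnj z)"

lemma wirtinger2_log_cutoff':
 "wirtinger2 (-{0}) (log_cutoff k a) (log_cutoff_p k a) (\<lambda>z. cnj (log_cutoff_p k a z)) (log_cutoff_l k a)"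
 using wirtinger2_log_cutoff[of k a] by (simp add: log_cutoff_p_def[abs_def] log_cutoff_l_def[abs_def])

lemma log_cutoff_borel [measurable]:
 "log_cutoff k a \<in> borel_fun" "log_cutoff_p k a \<in> borel_fun"
 "log_cutoff_l k a \<in> borel_fun"
 unfolding log_cutoff_def[abs_def] log_cutoff_p_def[abs_def] log_cutoff_l_def[abs_def] by measurable

lemma log_cutoff_norm_le: "cmod (log_cutoff k a z) \<le> 1"
 using smooth_step_bounds[of "k * ln ((cmod z)^2) + a"] by (simp add: log_cutoff_def)

lemma log_cutoff_derivatives_bound:
 obtains C where "C > 0" "\<And>k a z. cmod (log_cutoff_p k a z) \<le> C * \<bar>k\<bar> / cmod z"
  "\<And>k a z. cmod (log_cutoff_l k a z) \<le> C * k^2 / (cmod z)^2"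
proof -
 obtain C where C: "C > 0" "\<And>x. \<bar>smooth_step1 x\<bar> \<le> C" "\<And>x. \<bar>smooth_step2 x\<bar> \<le> C"
  using smooth_step_derivatives_bounded by blast
 show thesis
 proof (rule that[OF C(1)])
  fix k a z
  show "cmod (log_cutoff_p k a z) \<le> C * \<bar>k\<bar> / cmod z"
   unfolding log_cutoff_p_def norm_divide norm_of_real abs_mult
   using C(2)[of "k * ln ((cmod z)^2) + a"] by (intro divide_right_mono) (auto simp: mult.commute[of C] intro!: mult_left_mono)
  show "cmod (log_cutoff_l k a z) \<le> C * k^2 / (cmod z)^2"
   unfolding log_cutoff_l_def norm_divide norm_of_real abs_mult norm_mult complex_mod_cnj power2_eq_square[of "cmod z"]
   using C(3)[of "k * ln ((cmod z * cmod z)) + a"] by (intro divide_right_mono) (auto simp: mult.commute[of C] intro!: mult_left_mono)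
 qed
qed

text \<open>\<open>inner_cutoff K\<close> vanishes for \<open>\<bar>z\<bar> \<le> e\<^sup>-\<^sup>K\<close> and equals 1 for \<open>\<bar>z\<bar> \<ge> e\<^sup>-\<^sup>K\<^sup>/\<^sup>2\<close>;
 \<open>outer_cutoff r s\<close> equals 1 for \<open>0 < \<bar>z\<bar> \<le> r\<close> and vanishes for \<open>\<bar>z\<bar> \<ge> s\<close>.\<close>

abbreviation "inner_cutoff K \<equiv> log_cutoff (1 / real K) 2"
abbreviation "inner_cutoff_p K \<equiv> log_cutoff_p (1 / real K) 2"
abbreviation "inner_cutoff_l K \<equiv> log_cutoff_l (1 / real K) 2"

text \<open>Chosen so that the argument of the step, an affine function of ln |z|^2, equals 1 at |z|
  = r and 0 at |z| = s.\<close>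

definition outer_slope :: "real => real => real" where
 "outer_slope r s = - 1 / (ln (s^2) - ln (r^2))"

abbreviation "outer_cutoff r s \<equiv> log_cutoff (outer_slope r s) (- outer_slope r s * ln (s^2))"
abbreviation "outer_cutoff_p r s \<equiv> log_cutoff_p (outer_slope r s) (- outer_slope r s * ln (s^2))"
abbreviation "outer_cutoff_l r s \<equiv> log_cutoff_l (outer_slope r s) (- outer_slope r s * ln (s^2))"

lemma ln_square_le_iff: "0 < x ==> 0 < y ==> ln (x^2) \<le> ln (y^2) \<longleftrightarrow> x \<le> (y::real)"
 by (simp add: ln_realpow)

lemma inner_cutoff_zero:
 assumes "K > 0" "cmod z \<le> exp (- real K)"
 shows "inner_cutoff K z = 0" "inner_cutoff_p K z = 0" "inner_cutoff_l K z = 0"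
proof -
 have "z = 0 \<or> 1 / real K * ln ((cmod z)^2) + 2 \<le> 0"
 proof (cases "z = 0")
  case False
  then have "ln (cmod z) \<le> - real K" using assms by (metis ln_exp ln_le_cancel_iff exp_gt_zero zero_less_norm_iff)
  then show ?thesis using False assms by (simp add: ln_realpow field_simps)
 qed simp
 then show "inner_cutoff K z = 0" "inner_cutoff_p K z = 0" "inner_cutoff_l K z = 0"
  by (auto simp: log_cutoff_def log_cutoff_p_def log_cutoff_l_def)
qed

lemma inner_cutoff_one:
 assumes "K > 0" "cmod z \<ge> exp (- real K / 2)"
 shows "inner_cutoff K z = 1" "inner_cutoff_p K z = 0" "inner_cutoff_l K z = 0"
proof -
 have z: "cmod z > 0" using assms(2) by (meson exp_gt_zero less_le_trans)
 then have "ln (cmod z) \<ge> - real K / 2" using assms by (metis ln_exp ln_le_cancel_iff exp_gt_zero)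
 then have "1 / real K * ln ((cmod z)^2) + 2 \<ge> 1" using z assms by (simp add: ln_realpow field_simps)
 then show "inner_cutoff K z = 1" "inner_cutoff_p K z = 0" "inner_cutoff_l K z = 0"
  using z by (auto simp: log_cutoff_def log_cutoff_p_def log_cutoff_l_def)
qed

lemma outer_slope_neg: "0 < r ==> r < s ==> outer_slope r s < 0"
 by (simp add: outer_slope_def ln_realpow)

lemma outer_cutoff_zero:
 assumes "0 < r" "r < s" "s \<le> cmod z"
 shows "outer_cutoff r s z = 0" "outer_cutoff_p r s z = 0" "outer_cutoff_l r s z = 0"
proof -
 have "ln (s^2) \<le> ln ((cmod z)^2)" using assms by (subst ln_square_le_iff) auto
 then have "outer_slope r s * ln ((cmod z)^2) \<le> outer_slope r s * ln (s^2)"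
  using outer_slope_neg[OF assms(1,2)] by (intro mult_left_mono_neg) auto
 then have "outer_slope r s * ln ((cmod z)^2) + - outer_slope r s * ln (s^2) \<le> 0" by simp
 then show "outer_cutoff r s z = 0" "outer_cutoff_p r s z = 0" "outer_cutoff_l r s z = 0"
  by (auto simp: log_cutoff_def log_cutoff_p_def log_cutoff_l_def)
qed

lemma outer_cutoff_one:
 assumes "0 < r" "r < s" "cmod z \<le> r" "z \<noteq> 0"
 shows "outer_cutoff r s z = 1" "outer_cutoff_p r s z = 0" "outer_cutoff_l r s z = 0"
proof -
 have "ln ((cmod z)^2) \<le> ln (r^2)" using assms by (subst ln_square_le_iff) auto
 then have "outer_slope r s * ln ((cmod z)^2) \<ge> outer_slope r s * ln (r^2)"
  using outer_slope_neg[OF assms(1,2)] by (intro mult_left_mono_neg) auto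
 moreover have "outer_slope r s * ln (r^2) - outer_slope r s * ln (s^2) = 1"
 proof -
  have "ln (s^2) - ln (r^2) \<noteq> 0" using assms by (simp add: ln_realpow)
  moreover have "- 1 / (A - B) * B - - 1 / (A - B) * A = (A - B) / (A - B)" for A B :: real
   by (simp flip: diff_divide_distrib)
  ultimately show ?thesis unfolding outer_slope_def by simp
 qed
 ultimately have "outer_slope r s * ln ((cmod z)^2) + - outer_slope r s * ln (s^2) \<ge> 1" by simp
 then show "outer_cutoff r s z = 1" "outer_cutoff_p r s z = 0" "outer_cutoff_l r s z = 0"
  using assms by (auto simp: log_cutoff_def log_cutoff_p_def log_cutoff_l_def)
qed

lemma wnorm_mult_bounded_integrable:
 fixes f k :: "complex => complex"
 assumes [measurable]: "f \<in> borel_fun" "k \<in> borel_fun"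
  and f: "wnorm s f < \<infinity>" "\<And>w. cmod w > 1 ==> f w = 0"
  and k: "\<And>w. cmod (k w) \<le> C" "\<And>w. cmod w < a ==> k w = 0" and a: "a > 0"
 shows "integrable lborel (\<lambda>w. (cmod (f w * k w))^2)" "integrable lborel (\<lambda>w. f w * k w)"
proof -
 have C: "C \<ge> 0" using order_trans[OF norm_ge_zero k(1)] .
 \<comment> \<open>A lower bound of the weight on a \<le> |w| \<le> 1 for either sign of s.\<close>
 define m where "m = min 1 (a powr (2 * s))"
 have m: "m > 0" using a by (simp add: m_def)
 have low: "m \<le> cmod w powr (2 * s)" if "a \<le> cmod w" "cmod w \<le> 1" for w
 proof (cases "s \<ge> 0")
  case True
  then have "a powr (2 * s) \<le> cmod w powr (2 * s)" using that a by (intro powr_mono2) auto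
  then show ?thesis by (simp add: m_def)
 next
  case False
  then have "1 powr (2 * s) \<le> cmod w powr (2 * s)" using that a by (intro powr_mono2') auto
  then show ?thesis by (simp add: m_def)
 qed
 show sq: "integrable lborel (\<lambda>w. (cmod (f w * k w))^2)"
 proof (rule integrableI_nonneg)
  have "(\<integral>\<^sup>+w. ennreal ((cmod (f w * k w))^2) \<partial>lborel)
   \<le> (\<integral>\<^sup>+w. ennreal (C^2 / m) * ennreal ((cmod (f w))^2 * cmod w powr (2 * s)) \<partial>lborel)"
  proof (rule nn_integral_mono)
   fix w
   show "ennreal ((cmod (f w * k w))^2) \<le> ennreal (C^2 / m) * ennreal ((cmod (f w))^2 * cmod w powr (2 * s))"
   proof (cases "a \<le> cmod w \<and> cmod w \<le> 1")
    case True
    have "(cmod (f w * k w))^2 = (cmod (f w))^2 * (cmod (k w))^2" by (simp add: norm_mult power_mult_distrib)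
    also have "\<dots> \<le> (cmod (f w))^2 * C^2" by (intro mult_left_mono power_mono k) auto
    also have "\<dots> = (C^2 / m) * ((cmod (f w))^2 * m)" using m by simp
    also have "\<dots> \<le> (C^2 / m) * ((cmod (f w))^2 * cmod w powr (2 * s))"
     using m True by (intro mult_left_mono low) auto
    finally show ?thesis using m by (simp add: ennreal_leI flip: ennreal_mult)
   next
    case False
    then have e: "f w * k w = 0" using f(2)[of w] k(2)[of w] by (cases "cmod w < a") auto
    show ?thesis unfolding e by simp
   qed
  qed
  also have "\<dots> = ennreal (C^2 / m) * wnorm s f" unfolding wnorm_def by (simp add: nn_integral_cmult)
  also have "\<dots> < \<infinity>" using f(1) by (simp add: ennreal_mult_less_top)
  finally show "(\<integral>\<^sup>+w. ennreal ((cmod (f w * k w))^2) \<partial>lborel) < \<infinity>" .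
 qed auto
 have "integrable lborel (\<lambda>w. indicator (cball (0::complex) 1) w + (cmod (f w * k w))^2)"
  by (intro Bochner_Integration.integrable_add sq integrable_real_indicator) (auto simp: emeasure_cball_complex)
 then show "integrable lborel (\<lambda>w. f w * k w)"
 proof (rule Bochner_Integration.integrable_bound)
  show "AE w in lborel. norm (f w * k w) \<le> norm (indicator (cball 0 1) w + (cmod (f w * k w))^2)"
  proof (rule AE_I2)
   fix w
   have "x \<le> 1 + x^2" for x :: real using sum_squares_bound[of x 1] zero_le_power2[of x] by (cases "x \<ge> 0") (simp, linarith)+
   then show "norm (f w * k w) \<le> norm (indicator (cball 0 1) w + (cmod (f w * k w))^2)"
    using f(2)[of w] by (cases "cmod w > 1") auto
  qed
 qed measurable
qed

text \<open>Cauchy-Schwarz leaves the integral of |w|^(2b - 2t) over the disc, finite exactly for t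
  < b + 1. With n < b + 1 this makes the moments of the charge against w^-m finite for all m \<le>
  n.\<close>

lemma wnorm_powr_integrable:
 fixes f :: "complex => complex"
 assumes [measurable]: "f \<in> borel_fun"
  and f: "wnorm (- b) f < \<infinity>" "\<And>w. cmod w > 1 ==> f w = 0" and t: "t < b + 1"
 shows "integrable lborel (\<lambda>w. cmod (f w) * cmod w powr - t)"
proof (rule integrableI_nonneg)
 let ?k = "\<lambda>w. cmod w powr - t * indicator (cball 0 1) w"
 have "(\<integral>\<^sup>+w. ennreal (cmod (f w) * \<bar>?k w\<bar>) \<partial>lborel)^2
  \<le> wnorm (- b) f * (\<integral>\<^sup>+w. ennreal ((?k w)^2 * cmod w powr (2 * b)) \<partial>lborel)"
  by (rule wnorm_Cauchy_Schwarz) measurable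
 also have "(\<integral>\<^sup>+w. ennreal ((?k w)^2 * cmod w powr (2 * b)) \<partial>lborel)
  = (\<integral>\<^sup>+w\<in>cball 0 1. ennreal (cmod w powr - (2 * t - 2 * b)) \<partial>lborel)"
 proof (intro nn_integral_cong)
  fix w :: complex
  have "(cmod w powr - t)^2 * cmod w powr (2 * b) = cmod w powr - (2 * t - 2 * b)"
   unfolding powr_square powr_add[symmetric] by simp
  then show "ennreal ((?k w)^2 * cmod w powr (2 * b))
    = ennreal (cmod w powr - (2 * t - 2 * b)) * indicator (cball 0 1) w"
   by (auto simp: indicator_def)
 qed
 also have "wnorm (- b) f * \<dots> < \<infinity>"
  using f(1) nn_integral_powr_finite[of "2 * t - 2 * b" 1] t unfolding infinity_ennreal_def ennreal_mult_less_top by simp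
 finally have "(\<integral>\<^sup>+w. ennreal (cmod (f w) * \<bar>?k w\<bar>) \<partial>lborel) < \<infinity>" by (rule ennreal_square_less_top)
 moreover have "(\<integral>\<^sup>+w. ennreal (cmod (f w) * \<bar>?k w\<bar>) \<partial>lborel) = (\<integral>\<^sup>+w. ennreal (cmod (f w) * cmod w powr - t) \<partial>lborel)"
  by (intro nn_integral_cong) (use f(2) in \<open>auto simp: indicator_def\<close>)
 ultimately show "(\<integral>\<^sup>+w. ennreal (cmod (f w) * cmod w powr - t) \<partial>lborel) < \<infinity>" by simp
qed auto

lemma exists_powr_exponent:
 assumes "real n < b + 1" "b + 1 \<le> real n + 1"
 obtains x where "real n < x" "x < real n + 1" "b + 1 / 2 \<le> x" "x < b + 1"
 using that[of "max ((real n + b + 1) / 2) (b + 1 / 2)"] assms by (auto simp: max_def)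

lemma potential_kernel_integrable:
 fixes f :: "complex => complex"
 assumes b: "real n < b + 1" "b + 1 \<le> real n + 1" and [measurable]: "f \<in> borel_fun"
  and f: "wnorm (- b) f < \<infinity>" "\<And>w. cmod w > 1 ==> f w = 0" and z: "z \<noteq> 0" "cmod z \<le> 1"
 shows "integrable lborel (\<lambda>w. f w * of_real (kern n (z / w)))"
proof (rule integrableI_bounded)
 obtain x where x: "real n < x" "x < real n + 1" "b + 1 / 2 \<le> x" "x < b + 1"
  using exists_powr_exponent[OF b] by blast
 obtain C where "C > 0" and C: "\<And>g z. g \<in> borel_fun ==> (\<And>w. cmod w > 1 ==> g w = 0) ==> z \<noteq> 0 ==> cmod z \<le> 1 ==>
   (\<integral>\<^sup>+w. ennreal (cmod (g w * of_real (kern n (z / w)))) \<partial>lborel)^2 \<le> ennreal (C * cmod z powr (2 * x)) * wnorm (- b) g"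
  using potential_bound[OF x] by blast
 have "(\<integral>\<^sup>+w. ennreal (cmod (f w * of_real (kern n (z / w)))) \<partial>lborel)^2
   \<le> ennreal (C * cmod z powr (2 * x)) * wnorm (- b) f"
  by (rule C[OF assms(3) f(2) z])
 also have "\<dots> < \<infinity>" using f(1) by (simp add: ennreal_mult_less_top)
 finally have "(\<integral>\<^sup>+w. ennreal (cmod (f w * of_real (kern n (z / w)))) \<partial>lborel)^2 < \<infinity>" .
 then show "(\<integral>\<^sup>+w. ennreal (norm (f w * of_real (kern n (z / w)))) \<partial>lborel) < \<infinity>"
  by (rule ennreal_square_less_top)
qed measurable

lemma ln_norm_diff_eq_kern:
 assumes "w \<noteq> 0" "w \<noteq> z"
 shows "ln (cmod (w - z)) = ln (cmod w) + kern n (z / w) - (\<Sum>m=1..n. Re ((z / w) ^ m) / real m)"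
proof -
 have "w - z = w * (1 - z / w)" using assms by (simp add: field_simps)
 moreover have "1 - z / w \<noteq> 0" using assms by simp
 ultimately have "ln (cmod (w - z)) = ln (cmod w) + ln (cmod (1 - z / w))"
  using assms by (simp only: norm_mult) (simp add: ln_mult)
 then show ?thesis by (simp add: kern_def)
qed

lemma of_real_Re_div_eq:
 "complex_of_real (Re w / real m) = 1 / (2 * of_nat m) * w + 1 / (2 * of_nat m) * cnj w"
proof -
 have "complex_of_real (Re w) = (w + cnj w) / 2" by (simp add: complex_add_cnj)
 then show ?thesis by (simp add: add_divide_distrib mult.commute)
qed

text \<open>The logarithm splits into log |w|, the polynomial terms Re ((z/w)^m) / m with m \<le> n,
  and \<open>kern\<close>. Each part is integrable against f by itself, so the polynomial in z and
  cnj z can be split off from the potential.\<close>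

lemma ln_norm_diff_decomposition:
 fixes f :: "complex => complex"
 assumes b: "real n < b + 1" "b + 1 \<le> real n + 1" and [measurable]: "f \<in> borel_fun"
  and f: "wnorm (- b) f < \<infinity>" "\<And>w. cmod w > 1 ==> f w = 0"
 obtains c h h' where
  "\<And>z. z \<noteq> 0 ==> cmod z \<le> 1 ==> integrable lborel (\<lambda>w. f w * of_real (ln (cmod (w - z))))"
  "\<And>z. z \<noteq> 0 ==> cmod z \<le> 1 ==> (LINT w|lborel. f w * of_real (ln (cmod (w - z))))
   = potential n f z + (c + (\<Sum>m=1..n. h m * z ^ m) + (\<Sum>m=1..n. h' m * cnj z ^ m))"
proof -
 have b0: "0 < b + 1" using b(1) by (meson le_less_trans of_nat_0_le_iff)
 have ne0: "AE w::complex in lborel. w \<noteq> 0" by (rule AE_lborel_singleton)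
 have bnd: "integrable lborel (\<lambda>w. f w * k w)"
  if [measurable]: "k \<in> borel_fun" and "\<And>w. w \<noteq> 0 ==> cmod w \<le> 1 ==> cmod (k w) \<le> D * cmod w powr - t" "t < b + 1" "D \<ge> 0"
  for k :: "complex => complex" and D t
 proof (rule Bochner_Integration.integrable_bound[OF integrable_mult_right[OF wnorm_powr_integrable[OF assms(3) f that(3)], of D]])
  show "AE w in lborel. norm (f w * k w) \<le> norm (D * (cmod (f w) * cmod w powr - t))"
   using ne0
  proof eventually_elim
   fix w :: complex assume w: "w \<noteq> 0"
   show "norm (f w * k w) \<le> norm (D * (cmod (f w) * cmod w powr - t))"
   proof (cases "cmod w \<le> 1")
    case True
    then show ?thesis using mult_left_mono[OF that(2)[OF w True], of "cmod (f w)"] that(4)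
     by (simp add: norm_mult abs_mult mult_ac)
   qed (use f in simp)
  qed
 qed measurable
 have i_ln: "integrable lborel (\<lambda>w. f w * of_real (ln (cmod w)))"
 proof -
  \<comment> \<open>Any exponent strictly between 0 and b + 1 would do: |w|^-t dominates the
    logarithm near 0 and is integrable against f.\<close>
  define t where "t = (b + 1) / 2"
  have t: "t > 0" "t < b + 1" using b0 by (auto simp: t_def)
  show ?thesis
  proof (rule bnd[OF _ _ t(2)])
   fix w :: complex assume "w \<noteq> 0" "cmod w \<le> 1"
   moreover from this have "cmod w powr t \<le> cmod w powr - t" using t by (intro powr_mono') auto
   ultimately have "\<bar>ln (cmod w)\<bar> \<le> (2 * cmod w powr - t) / t"
    using abs_ln_le_powr[of "cmod w" t] t by (smt (verit) divide_right_mono zero_less_norm_iff)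
   then show "cmod (of_real (ln (cmod w))) \<le> (2 / t) * cmod w powr - t" by simp
  qed (use t in auto)
 qed
 have i_pow: "integrable lborel (\<lambda>w. f w * (1 / w ^ m))" "integrable lborel (\<lambda>w. f w * (1 / cnj w ^ m))" if "m \<le> n" for m
 proof -
  have tm: "real m < b + 1" using b that by linarith
  have "cmod (1 / w ^ m) \<le> 1 * cmod w powr - real m" "cmod (1 / cnj w ^ m) \<le> 1 * cmod w powr - real m" if "w \<noteq> 0" for w
   using that by (simp_all add: norm_divide norm_power powr_minus powr_realpow inverse_eq_divide)
  then show "integrable lborel (\<lambda>w. f w * (1 / w ^ m))" "integrable lborel (\<lambda>w. f w * (1 / cnj w ^ m))"
   by (intro bnd[OF _ _ tm, of _ 1]; simp)+
 qed
 define c where "c = (LINT w|lborel. f w * of_real (ln (cmod w)))"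
 define h where "h m = - (1 / (2 * of_nat m) * (LINT w|lborel. f w * (1 / w ^ m)))" for m :: nat
 define h' where "h' m = - (1 / (2 * of_nat m) * (LINT w|lborel. f w * (1 / cnj w ^ m)))" for m :: nat
 have main: "has_bochner_integral lborel (\<lambda>w. f w * of_real (ln (cmod (w - z))))
   (potential n f z + (c + (\<Sum>m=1..n. h m * z ^ m) + (\<Sum>m=1..n. h' m * cnj z ^ m)))"
  if z: "z \<noteq> 0" "cmod z \<le> 1" for z
 proof -
  let ?S = "\<lambda>w. \<Sum>m=1..n. 1 / (2 * of_nat m) * z ^ m * (f w * (1 / w ^ m)) + 1 / (2 * of_nat m) * cnj z ^ m * (f w * (1 / cnj w ^ m))"
  let ?T = "\<Sum>m=1..n. 1 / (2 * of_nat m) * z ^ m * (LINT w|lborel. f w * (1 / w ^ m)) + 1 / (2 * of_nat m) * cnj z ^ m * (LINT w|lborel. f w * (1 / cnj w ^ m))"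
  have S: "has_bochner_integral lborel ?S ?T"
   by (intro has_bochner_integral_sum has_bochner_integral_add has_bochner_integral_mult_right
     has_bochner_integral_integrable i_pow) auto
  have H: "has_bochner_integral lborel (\<lambda>w. f w * of_real (ln (cmod w)) + f w * of_real (kern n (z / w)) - ?S w)
   (c + potential n f z - ?T)"
   unfolding c_def potential_def
   by (intro has_bochner_integral_diff has_bochner_integral_add S has_bochner_integral_integrable i_ln
     potential_kernel_integrable[OF b assms(3) f z])
  have E: "c + potential n f z - ?T = potential n f z + (c + (\<Sum>m=1..n. h m * z ^ m) + (\<Sum>m=1..n. h' m * cnj z ^ m))"
   by (simp add: h_def h'_def sum.distrib sum_negf mult_ac)
  have A: "AE w in lborel. f w * of_real (ln (cmod w)) + f w * of_real (kern n (z / w)) - ?S w = f w * of_real (ln (cmod (w - z)))"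
   using ne0 AE_lborel_singleton[of z]
  proof eventually_elim
   fix w :: complex assume w: "w \<noteq> 0" "w \<noteq> z"
   have "complex_of_real (\<Sum>m=1..n. Re ((z / w) ^ m) / real m) =
     (\<Sum>m=1..n. 1 / (2 * of_nat m) * (z / w) ^ m + 1 / (2 * of_nat m) * cnj ((z / w) ^ m))"
    unfolding of_real_sum of_real_Re_div_eq ..
   then have "f w * complex_of_real (\<Sum>m=1..n. Re ((z / w) ^ m) / real m) = ?S w"
    by (simp add: sum_distrib_left power_divide algebra_simps)
   then show "f w * of_real (ln (cmod w)) + f w * of_real (kern n (z / w)) - ?S w = f w * of_real (ln (cmod (w - z)))"
    unfolding ln_norm_diff_eq_kern[OF w, of n] by (simp only: of_real_diff of_real_add distrib_left right_diff_distrib)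
  qed
  show ?thesis by (rule has_bochner_integral_cong_AE[THEN iffD1, OF _ _ A H[unfolded E]]) measurable
 qed
 show thesis
  by (rule that[of c h h']) (use main in \<open>auto simp: has_bochner_integral_iff\<close>)
qed

lemma wirtinger2_shift:
 assumes "wirtinger2 UNIV f p q l"
 shows "wirtinger2 S (\<lambda>y. f (y - z)) (\<lambda>y. p (y - z)) (\<lambda>y. q (y - z)) (\<lambda>y. l (y - z))"
 unfolding wirtinger2_def
proof (intro ballI conjI)
 fix w
 have d: "((\<lambda>y. y - z) has_field_derivative 1) (at w)" by (auto intro!: derivative_eq_intros)
 have "has_wirtinger f (p (w - z)) (q (w - z)) (w - z)" using assms by (simp add: wirtinger2_def)
 from has_wirtinger_compose_holomorphic[OF d this]
 show "has_wirtinger (\<lambda>y. f (y - z)) (p (w - z)) (q (w - z)) w" by simp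
 obtain m where "has_wirtinger q (l (w - z)) m (w - z)" using assms by (auto simp: wirtinger2_def)
 from has_wirtinger_compose_holomorphic[OF d this]
 show "\<exists>m. has_wirtinger (\<lambda>y. q (y - z)) (l (w - z)) m w" by auto
qed

lemma smooth_on_shift: "smooth_on UNIV f ==> open S ==> smooth_on S (\<lambda>w. f (w - z) :: complex)"
 unfolding smooth_on_def
 by (auto intro!: times_differentiable_on_compose_holomorphic[where T=UNIV and f=f and h="\<lambda>w. w - z"] holomorphic_intros)

lemma wirtinger2_product_planar:
 assumes f: "f = (\<lambda>z. ct z * F z)" and z0: "\<forall>z. cmod z < a --> ct z = 0" and a: "a > 0"
  and W: "wirtinger2 (-{0}) ct p q l" "wirtinger2 (-{0}) F p' q' l'"
 shows "d_z (d_zbar f) 0 = 0"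
  "z \<noteq> 0 ==> d_z (d_zbar f) z = ct z * l' z + p z * q' z + q z * p' z + l z * F z"
proof -
 have "has_wirtinger f 0 0 z" if "z \<in> ball 0 a" for z
  by (rule has_wirtinger_cong[OF open_ball that _ has_wirtinger_const[of 0]]) (simp add: f z0)
 then have "wirtinger2 (ball 0 a) f (\<lambda>_. 0) (\<lambda>_. 0) (\<lambda>_. 0)"
  using has_wirtinger_const by (auto simp: wirtinger2_def)
 from wirtinger2D(3)[OF open_ball this, of 0] show "d_z (d_zbar f) 0 = 0" using a by simp
 show "d_z (d_zbar f) z = ct z * l' z + p z * q' z + q z * p' z + l z * F z" if "z \<noteq> 0"
  unfolding f using wirtinger2D(3)[OF _ wirtinger2_mult[OF W], of z] that by auto
qed

text \<open>Because b \<le> n and |w| \<le> 1, the square of the bound times the weight is at most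
  D^2 / K^2 times the critical power |w|^-2, whose integral over the shells is linear in K. The
  result is of order 1/K.\<close>

lemma shell_square_integral:
 fixes k :: "complex => real"
 assumes b: "b \<le> real n" and K: "K > 0"
  and bd: "\<And>w. \<bar>k w\<bar> \<le> D / real K * cmod w powr (real n - 1)"
  and supp: "\<And>w. k w \<noteq> 0 ==> exp (- real K) \<le> cmod w \<and> cmod w \<le> 1"
 shows "(\<integral>\<^sup>+w. ennreal ((k w)^2 * cmod w powr (2 * - b)) \<partial>lborel)
  \<le> ennreal (D^2 * (pi * exp 2 * (real K + 1)) / (real K)^2)"
proof -
 let ?S = "{z. exp (- real K) \<le> cmod z \<and> cmod z \<le> 1}"
 have "(\<integral>\<^sup>+w. ennreal ((k w)^2 * cmod w powr (2 * - b)) \<partial>lborel)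
  \<le> (\<integral>\<^sup>+w. ennreal (D^2 / (real K)^2) * (ennreal (cmod w powr - 2) * indicator ?S w) \<partial>lborel)"
 proof (rule nn_integral_mono)
  fix w
  show "ennreal ((k w)^2 * cmod w powr (2 * - b))
   \<le> ennreal (D^2 / (real K)^2) * (ennreal (cmod w powr - 2) * indicator ?S w)"
  proof (cases "k w = 0")
   case False
   note w = supp[OF False]
   then have pos: "cmod w > 0" by (meson exp_gt_zero less_le_trans)
   have "(k w)^2 \<le> (D / real K * cmod w powr (real n - 1))^2"
    using power_mono[OF bd[of w] abs_ge_zero, of 2] by simp
   then have "(k w)^2 * cmod w powr (2 * - b) \<le> (D / real K * cmod w powr (real n - 1))^2 * cmod w powr (2 * - b)"
    by (intro mult_right_mono) auto
   also have "\<dots> = D^2 / (real K)^2 * (cmod w powr (2 * (real n - 1)) * cmod w powr (2 * - b))"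
    by (simp add: power_mult_distrib power_divide powr_square)
   also have "\<dots> \<le> D^2 / (real K)^2 * cmod w powr - 2"
   proof (rule mult_left_mono)
    show "cmod w powr (2 * (real n - 1)) * cmod w powr (2 * - b) \<le> cmod w powr - 2"
     unfolding powr_add[symmetric] using pos w b by (intro powr_mono') auto
   qed simp
   finally have "(k w)^2 * cmod w powr (2 * - b) \<le> D^2 / (real K)^2 * cmod w powr - 2" .
   then have "ennreal ((k w)^2 * cmod w powr (2 * - b)) \<le> ennreal (D^2 / (real K)^2 * cmod w powr - 2)"
    by (rule ennreal_leI)
   also have "\<dots> = ennreal (D^2 / (real K)^2) * ennreal (cmod w powr - 2)" by (rule ennreal_mult) auto
   finally show ?thesis using w by simp
  qed simp
 qed
 also have "\<dots> = ennreal (D^2 / (real K)^2) * (\<integral>\<^sup>+w. ennreal (cmod w powr - 2) * indicator ?S w \<partial>lborel)"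
  by (rule nn_integral_cmult) measurable
 also have "\<dots> \<le> ennreal (D^2 / (real K)^2) * ennreal (pi * exp 2 * (real K + 1))"
  by (intro mult_left_mono nn_integral_powr_minus2_shells) auto
 also have "\<dots> = ennreal (D^2 * (pi * exp 2 * (real K + 1)) / (real K)^2)"
  by (subst ennreal_mult[symmetric]) auto
 finally show ?thesis .
qed

lemma shell_constant_tendsto: "(\<lambda>K. ennreal (D^2 * (pi * exp 2 * (real K + 1)) / (real K)^2)) \<longlonglongrightarrow> 0"
proof -
 have "(\<lambda>K. D^2 * (pi * exp 2 * (real K + 1)) / (real K)^2) \<longlonglongrightarrow> 0" by real_asymp
 then show ?thesis using tendsto_ennrealI by fastforce
qed

lemma inner_cutoff_eventually_one:
 assumes "z \<noteq> 0" shows "eventually (\<lambda>K. exp (- real K / 2) < cmod z) sequentially"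
proof -
 have "(\<lambda>K. exp (- real K / 2)) \<longlonglongrightarrow> 0" by real_asymp
 then show ?thesis using assms by (intro order_tendstoD(2)[of _ 0]) auto
qed

lemma inner_cutoff_tendsto:
 assumes "z \<noteq> 0" shows "(\<lambda>K. inner_cutoff K z) \<longlonglongrightarrow> 1"
proof (rule tendsto_eventually)
 show "eventually (\<lambda>K. inner_cutoff K z = 1) sequentially"
  using inner_cutoff_eventually_one[OF assms] eventually_gt_at_top[of 0]
  by eventually_elim (simp add: inner_cutoff_one(1))
qed

lemma cutoff_p_bounded:
 assumes "a > 0" "\<And>z. cmod z < a ==> log_cutoff_p k \<beta> z = 0" "\<And>z. cmod z < a ==> log_cutoff_l k \<beta> z = 0"
 obtains D where "\<And>z. cmod (log_cutoff_p k \<beta> z) \<le> D" "\<And>z. cmod (log_cutoff_l k \<beta> z) \<le> D"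
proof -
 obtain C where C: "C > 0" "\<And>k a z. cmod (log_cutoff_p k a z) \<le> C * \<bar>k\<bar> / cmod z"
  "\<And>k a z. cmod (log_cutoff_l k a z) \<le> C * k^2 / (cmod z)^2" using log_cutoff_derivatives_bound by blast
 have p: "cmod (log_cutoff_p k \<beta> z) \<le> C * \<bar>k\<bar> / a" for z
 proof (cases "cmod z < a")
  case False
  then have "C * \<bar>k\<bar> / cmod z \<le> C * \<bar>k\<bar> / a" using assms(1) C(1) by (intro frac_le) auto
  then show ?thesis using C(2)[of k \<beta> z] by linarith
 qed (use assms C in simp)
 have l: "cmod (log_cutoff_l k \<beta> z) \<le> C * k^2 / a^2" for z
 proof (cases "cmod z < a")
  case False
  then have "a^2 \<le> (cmod z)^2" using assms(1) by (intro power_mono) auto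
  then have "C * k^2 / (cmod z)^2 \<le> C * k^2 / a^2" using assms(1) C(1) by (intro frac_le) auto
  then show ?thesis using C(3)[of k \<beta> z] by linarith
 qed (use assms C in simp)
 show thesis
  by (rule that[of "max (C * \<bar>k\<bar> / a) (C * k^2 / a^2)"]) (use p l in \<open>auto simp: le_max_iff_disj\<close>)
qed

text \<open>In this locale \<open>ps\<close>, \<open>pp\<close> and \<open>pl\<close> are a fixed
  radial cut-off, its z-derivative and its mixed derivative; the zbar-derivative is the conjugate of
  \<open>pp\<close> because the cut-off is real. All three get the value 0 at the origin.\<close>

locale radial_cutoff =
 fixes r s :: real
 assumes rs: "0 < r" "r < s" "s < 1"
begin

definition "ps = outer_cutoff r s"
definition "pp = outer_cutoff_p r s"
definition "pl = outer_cutoff_l r s"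

lemma one: "cmod z \<le> r ==> z \<noteq> 0 ==> ps z = 1" "cmod z \<le> r ==> pp z = 0" "cmod z \<le> r ==> pl z = 0"
 using outer_cutoff_one[OF rs(1,2), of z]
 by (cases "z = 0"; simp_all only: ps_def pp_def pl_def; simp add: log_cutoff_p_def log_cutoff_l_def)+

lemma at0: "ps 0 = 0" "pp 0 = 0" "pl 0 = 0"
 by (simp_all add: ps_def pp_def pl_def log_cutoff_def log_cutoff_p_def log_cutoff_l_def)

lemma ps_smooth: "smooth_on (-{0}) ps"
 unfolding ps_def by (rule log_cutoff_smooth)

lemma zero: "s \<le> cmod z ==> ps z = 0" "s \<le> cmod z ==> pp z = 0" "s \<le> cmod z ==> pl z = 0"
 using outer_cutoff_zero[OF rs(1,2), of z] by (simp_all only: ps_def pp_def pl_def)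

lemma psW: "wirtinger2 (-{0}) ps pp (\<lambda>z. cnj (pp z)) pl"
 unfolding ps_def pp_def pl_def by (rule wirtinger2_log_cutoff')

lemma borel [measurable]: "ps \<in> borel_fun" "pp \<in> borel_fun" "pl \<in> borel_fun"
 unfolding ps_def pp_def pl_def by (rule log_cutoff_borel)+

lemma ps1: "cmod (ps z) \<le> 1"
 unfolding ps_def by (rule log_cutoff_norm_le)

lemma pp_bound: obtains D where "\<And>z. cmod (pp z) \<le> D" "\<And>z. cmod (pl z) \<le> D"
proof -
 have "pp z = 0" "pl z = 0" if "cmod z < r" for z using one(2,3)[of z] that by auto
 with rs(1) show thesis using that unfolding pp_def pl_def by (rule cutoff_p_bounded)
qed

end

text \<open>A weak solution of 4 \<open>d_z\<close> \<open>d_zbar\<close> U = G on the punctured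
  disc. Test functions vanish near 0, so the equation carries no information at the origin, where
  the singular terms arise.\<close>

locale weak_cone_solution =
 fixes b R :: real and n :: nat and U G :: "complex => complex"
 assumes bn: "real n < b + 1" "b + 1 \<le> real n + 1" and R: "0 < R" "R \<le> 1"
  and U_meas [measurable]: "U \<in> borel_fun" and G_meas [measurable]: "G \<in> borel_fun"
  and U0: "\<And>z. R \<le> cmod z ==> U z = 0" and G0: "\<And>z. R \<le> cmod z ==> G z = 0"
  and Uw: "wnorm b U < \<infinity>" and Gw: "wnorm (- b) G < \<infinity>"
  and weak: "\<And>f. f \<in> planar_test R ==>
   (LINT z|lborel. U z * (4 * d_z (d_zbar f) z)) = (LINT z|lborel. G z * f z)"
begin

sublocale radial_cutoff "R / 2" "3 * R / 4"
 by unfold_locales (use R in auto)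

text \<open>The inner cut-off is already 1 before the outer one starts to decrease, so their
  derivatives have disjoint supports.\<close>

definition good :: "nat => bool" where
 "good K \<longleftrightarrow> K > 0 \<and> exp (- real K / 2) \<le> R / 2"

lemma U1: "cmod z > 1 ==> U z = 0" and G1: "cmod z > 1 ==> G z = 0"
 using U0[of z] G0[of z] R by auto

lemma eventually_good: "eventually good sequentially"
proof -
 have "cmod (of_real (R / 2)) = R / 2" "complex_of_real (R / 2) \<noteq> 0" using R by (simp_all only: norm_of_real) auto
 then have "eventually (\<lambda>K. exp (- real K / 2) < R / 2) sequentially"
  using inner_cutoff_eventually_one[of "of_real (R / 2)"] by simp
 then show ?thesis using eventually_gt_at_top[of 0]
  by eventually_elim (simp add: good_def)
qed

lemma U_integrable:
 assumes "k \<in> borel_fun" "\<And>w. cmod (k w) \<le> C" "\<And>w. cmod w < a ==> k w = 0" "a > 0"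
 shows "integrable lborel (\<lambda>w. (cmod (U w * k w))^2)" "integrable lborel (\<lambda>w. U w * k w)"
 using wnorm_mult_bounded_integrable[OF U_meas assms(1) Uw U1 assms(2-4)] by auto

lemma G_integrable:
 assumes "k \<in> borel_fun" "\<And>w. cmod (k w) \<le> C" "\<And>w. cmod w < a ==> k w = 0" "a > 0"
 shows "integrable lborel (\<lambda>w. (cmod (G w * k w))^2)" "integrable lborel (\<lambda>w. G w * k w)"
 using wnorm_mult_bounded_integrable[OF G_meas assms(1) Gw G1 assms(2-4)] by auto

definition ct :: "nat => complex => complex" where "ct K z = inner_cutoff K z * ps z"

lemma ct_borel [measurable]: "ct K \<in> borel_fun" unfolding ct_def[abs_def] by measurable

lemma ct_le_1: "cmod (ct K z) \<le> 1"
 using mult_mono[OF log_cutoff_norm_le[of "1 / real K" 2 z] ps1] by (simp add: ct_def norm_mult)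

lemma ct_zero: "K > 0 ==> cmod z < exp (- real K) ==> ct K z = 0"
 by (simp add: ct_def inner_cutoff_zero)

lemma ct_one: "good K ==> exp (- real K / 2) \<le> cmod z ==> cmod z \<le> R / 2 ==> ct K z = 1"
 using one[of z] inner_cutoff_one(1)[of K z] order_less_le_trans[OF exp_gt_zero, of "- real K / 2" "cmod z"]
 by (auto simp: ct_def good_def)

text \<open>The weak equation for F multiplied by the product of both cut-offs. For good K the
  derivatives of the product are sums of an inner and an outer contribution, without cross
  terms.\<close>

lemma weak_apply:
 assumes K: "good K" and F: "smooth_on (-{0}) F" "wirtinger2 (-{0}) F p' q' l'"
 shows "(LINT z|lborel. U z * (4 * (ct K z * l' z + (inner_cutoff_p K z + pp z) * q' z +
   cnj (inner_cutoff_p K z + pp z) * p' z + (inner_cutoff_l K z + pl z) * F z))) = (LINT z|lborel. G z * (ct K z * F z))"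
proof -
 have K0: "K > 0" using K by (simp add: good_def)
 let ?f = "\<lambda>z. ct K z * F z"
 have "smooth_on (-{0}) ?f"
  unfolding ct_def by (intro smooth_on_mult log_cutoff_smooth ps_smooth F) auto
 moreover have "exp (- real K) \<le> cmod z \<and> cmod z \<le> 3 * R / 4" if "?f z \<noteq> 0" for z
 proof -
  have "\<not> cmod z < exp (- real K)" "\<not> 3 * R / 4 \<le> cmod z"
   using that ct_zero[OF K0, of z] zero[of z] by (auto simp: ct_def)
  then show ?thesis by linarith
 qed
 ultimately have "?f \<in> planar_test R"
  unfolding planar_test_def using R
  by (intro CollectI conjI exI[of _ "exp (- real K)"] exI[of _ "3 * R / 4"] allI impI) auto
 note W = weak[OF this]
 have WC: "wirtinger2 (-{0}) (ct K) (\<lambda>z. inner_cutoff K z * pp z + inner_cutoff_p K z * ps z)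
   (\<lambda>z. inner_cutoff K z * cnj (pp z) + cnj (inner_cutoff_p K z) * ps z)
   (\<lambda>z. inner_cutoff K z * pl z + inner_cutoff_p K z * cnj (pp z) + cnj (inner_cutoff_p K z) * pp z + inner_cutoff_l K z * ps z)"
  unfolding ct_def[abs_def] by (rule wirtinger2_mult[OF wirtinger2_log_cutoff' psW])
 have zz: "\<forall>z. cmod z < exp (- real K) --> ct K z = 0" using ct_zero[OF K0] by blast
 note P = wirtinger2_product_planar[where f="?f" and ct="ct K" and F=F and a="exp (- real K)", OF refl zz exp_gt_zero WC F(2)]
 have "d_z (d_zbar ?f) z = ct K z * l' z + (inner_cutoff_p K z + pp z) * q' z +
   cnj (inner_cutoff_p K z + pp z) * p' z + (inner_cutoff_l K z + pl z) * F z" for z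
 proof (cases "z = 0")
  case True
  then show ?thesis using P(1) by (simp add: ct_def at0 log_cutoff_p_def log_cutoff_l_def)
 next
  case False
  show ?thesis
  proof (cases "exp (- real K / 2) \<le> cmod z")
   case True
   note 1 = inner_cutoff_one[OF K0 True]
   show ?thesis unfolding P(2)[OF False] by (simp add: 1)
  next
   case F: False
   then have "cmod z \<le> R / 2" using K by (simp add: good_def)
   note 1 = one(1)[OF this False] one(2,3)[OF this]
   show ?thesis unfolding P(2)[OF False] by (simp add: 1)
  qed
 qed
 then show ?thesis using W by simp
qed

end

lemma inverse_diff_expansion:
 fixes w z :: complex
 assumes "z \<noteq> 0" "w \<noteq> z"
 shows "1 / (w - z) = w ^ n / (z ^ n * (w - z)) - (\<Sum>m=1..n. w ^ (m - 1) / z ^ m)"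
proof (induction n)
 case (Suc n)
 have "w ^ n / (z ^ n * (w - z)) = w ^ Suc n / (z ^ Suc n * (w - z)) - w ^ n / z ^ Suc n"
  using assms by (simp add: divide_simps) (simp add: algebra_simps)
 with Suc show ?case by simp
qed simp

lemma ln_norm_diff_eq_kern':
 assumes "z \<noteq> 0" "w \<noteq> z"
 shows "ln (cmod (w - z)) = ln (cmod z) + kern n (w / z) - (\<Sum>m=1..n. Re ((w / z) ^ m) / real m)"
proof -
 have "w - z = - (z * (1 - w / z))" using assms by (simp add: field_simps)
 moreover have "1 - w / z \<noteq> 0" using assms by simp
 ultimately have "ln (cmod (w - z)) = ln (cmod z) + ln (cmod (1 - w / z))"
  using assms by (simp only: norm_mult norm_minus_cancel) (simp add: ln_mult)
 then show ?thesis by (simp add: kern_def)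
qed

section \<open>Green's formula on the annulus between the two cut-offs\<close>

context weak_cone_solution
begin

text \<open>The commutator term of the cut-off \<open>c\<close> with derivatives \<open>p, cnj p, l\<close>, against \<open>log \<bar>w - z\<bar>\<close>.\<close>

definition comm :: "(complex => complex) => (complex => complex) => complex => complex => complex" where
 "comm p l z w = (4 * U w * l w) * of_real (ln (cmod (w - z))) +
  (4 * U w * cnj (p w)) * (1 / (2 * (w - z))) + (4 * U w * p w) * (1 / (2 * cnj (w - z)))"

abbreviation "pK \<equiv> inner_cutoff_p"
abbreviation "lK \<equiv> inner_cutoff_l"

lemma inner_supp:
 assumes "K > 0" "pK K w \<noteq> 0 \<or> lK K w \<noteq> 0"
 shows "exp (- real K) < cmod w" "cmod w < exp (- real K / 2)"
 using inner_cutoff_zero[OF assms(1), of w] inner_cutoff_one[OF assms(1), of w] assms(2) by (auto simp: not_le[symmetric])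

lemma inner_bounded:
 assumes "K > 0"
 obtains D where "\<And>z. cmod (pK K z) \<le> D" "\<And>z. cmod (lK K z) \<le> D"
 using cutoff_p_bounded[of "exp (- real K)" "1 / real K" 2] inner_cutoff_zero[OF assms] by (metis exp_gt_zero less_imp_le)

lemma inner_integrable:
 assumes "K > 0"
 shows "integrable lborel (\<lambda>w. U w * pK K w)" "integrable lborel (\<lambda>w. U w * cnj (pK K w))"
  "integrable lborel (\<lambda>w. U w * lK K w)" "integrable lborel (\<lambda>w. (cmod (U w * lK K w))^2)"
proof -
 obtain D where D: "\<And>z. cmod (pK K z) \<le> D" "\<And>z. cmod (lK K z) \<le> D" using inner_bounded[OF assms] by blast
 have z: "cmod w < exp (- real K) ==> pK K w = 0" "cmod w < exp (- real K) ==> lK K w = 0"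
  "cmod w < exp (- real K) ==> cnj (pK K w) = 0" for w
  using inner_cutoff_zero[OF assms, of w] by auto
 show "integrable lborel (\<lambda>w. U w * pK K w)" by (rule U_integrable(2)[OF _ D(1) z(1)]) auto
 show "integrable lborel (\<lambda>w. U w * cnj (pK K w))" by (rule U_integrable(2)[where C=D, OF _ _ z(3)]) (use D in auto)
 show "integrable lborel (\<lambda>w. U w * lK K w)" by (rule U_integrable(2)[OF _ D(2) z(2)]) auto
 show "integrable lborel (\<lambda>w. (cmod (U w * lK K w))^2)" by (rule U_integrable(1)[OF _ D(2) z(2)]) auto
qed

lemma outer_integrable:
 "integrable lborel (\<lambda>w. U w * pp w)" "integrable lborel (\<lambda>w. U w * cnj (pp w))"
 "integrable lborel (\<lambda>w. U w * pl w)" "integrable lborel (\<lambda>w. (cmod (U w * pl w))^2)"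
proof -
 obtain D where D: "\<And>z. cmod (pp z) \<le> D" "\<And>z. cmod (pl z) \<le> D" using pp_bound by blast
 have z: "cmod w < R / 2 ==> pp w = 0" "cmod w < R / 2 ==> pl w = 0" "cmod w < R / 2 ==> cnj (pp w) = 0" for w
  using one(2,3)[of w] by auto
 have R2: "R / 2 > 0" using R by simp
 show "integrable lborel (\<lambda>w. U w * pp w)" by (rule U_integrable(2)[OF _ D(1) z(1) R2]) auto
 show "integrable lborel (\<lambda>w. U w * cnj (pp w))" by (rule U_integrable(2)[where C=D, OF _ _ z(3) R2]) (use D in auto)
 show "integrable lborel (\<lambda>w. U w * pl w)" by (rule U_integrable(2)[OF _ D(2) z(2) R2]) auto
 show "integrable lborel (\<lambda>w. (cmod (U w * pl w))^2)" by (rule U_integrable(1)[OF _ D(2) z(2) R2]) auto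
qed

lemma ct_integrable:
 assumes "K > 0"
 shows "integrable lborel (\<lambda>w. U w * ct K w)" "integrable lborel (\<lambda>w. G w * ct K w)"
  "integrable lborel (\<lambda>w. (cmod (G w * ct K w))^2)"
proof -
 note z = ct_zero[OF assms]
 show "integrable lborel (\<lambda>w. U w * ct K w)" by (rule U_integrable(2)[OF _ ct_le_1 z exp_gt_zero]) auto
 show "integrable lborel (\<lambda>w. G w * ct K w)" by (rule G_integrable(2)[OF _ ct_le_1 z exp_gt_zero]) auto
 show "integrable lborel (\<lambda>w. (cmod (G w * ct K w))^2)" by (rule G_integrable(1)[OF _ ct_le_1 z exp_gt_zero]) auto
qed

text \<open>The weak equation is tested with the regularised logarithm centred at z, whose flat
  Laplacian is the approximate identity there.\<close>

lemma weak_log_kernel: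
 assumes K: "good K" and e: "e > 0"
 shows "(LINT y|lborel. U y * ct K y * of_real (approx_kernel e (y - z))) =
  (LINT y|lborel. (G y * ct K y - 4 * (U y * (lK K y + pl y))) * log_kernel e (y - z) +
    (- 4 * (U y * cnj (pK K y + pp y))) * log_kernel_p e (y - z) +
    (- 4 * (U y * (pK K y + pp y))) * cnj (log_kernel_p e (y - z)))"
proof -
 have K0: "K > 0" using K by (simp add: good_def)
 let ?L = "\<lambda>y. log_kernel e (y - z)" and ?P = "\<lambda>y. log_kernel_p e (y - z)" and ?l = "\<lambda>y. log_kernel_l e (y - z)"
 have cL: "continuous_on UNIV (log_kernel e)" using log_kernel_smooth[OF e] by (rule smooth_on_imp_continuous)
 have nz: "(cmod w)^2 + e^2 \<noteq> 0" for w using norm_square_plus_pos[OF e, of w] by linarith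
 have nz': "complex_of_real ((cmod w)^2 + e^2) \<noteq> 0" for w using nz[of w] by (simp only: of_real_eq_0_iff not_False_eq_True)
 have cP: "continuous_on UNIV (log_kernel_p e)"
  unfolding log_kernel_p_def[abs_def] by (intro continuous_intros) (simp_all only: mult_eq_0_iff nz' ; simp)
 have cl: "continuous_on UNIV (log_kernel_l e)"
  unfolding log_kernel_l_def[abs_def] by (intro continuous_intros) (use nz in auto)
 have neg: "continuous_on UNIV (\<lambda>w. k (- w))" if "continuous_on UNIV k" for k :: "complex => complex"
  by (rule continuous_on_compose2[OF that]) (auto intro: continuous_intros)
 have I: "integrable lborel (\<lambda>y. (U y * c y) * k (y - z))"
  if "integrable lborel (\<lambda>y. U y * c y)" "continuous_on UNIV k" for c k
  using integrable_mult_continuous[OF that(1) _ neg[OF that(2)], of 1 z] U1 by simp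
 have IG: "integrable lborel (\<lambda>y. (G y * ct K y) * ?L y)"
  using integrable_mult_continuous[OF ct_integrable(2)[OF K0] _ neg[OF cL], of 1 z] G1 by simp
 have ccP: "continuous_on UNIV (\<lambda>w. cnj (log_kernel_p e w))" by (intro continuous_intros cP)
 have s1: "integrable lborel (\<lambda>y. U y * (lK K y + pl y))" "integrable lborel (\<lambda>y. U y * (pK K y + pp y))"
  "integrable lborel (\<lambda>y. U y * cnj (pK K y + pp y))"
  using inner_integrable[OF K0] outer_integrable by (simp_all add: distrib_left)
 note ints = I[OF ct_integrable(1)[OF K0] cl] I[OF s1(1) cL] I[OF s1(2) ccP] I[OF s1(3) cP]
 have W: "(LINT y|lborel. U y * (4 * (ct K y * ?l y + (pK K y + pp y) * cnj (?P y) +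
   cnj (pK K y + pp y) * ?P y + (lK K y + pl y) * ?L y))) = (LINT y|lborel. G y * (ct K y * ?L y))"
  by (rule weak_apply[OF K]) (auto intro!: smooth_on_shift log_kernel_smooth e wirtinger2_shift wirtinger2_log_kernel)
 have i1: "integrable lborel (\<lambda>y. 4 * ((U y * (pK K y + pp y)) * cnj (?P y)) +
   4 * ((U y * cnj (pK K y + pp y)) * ?P y) + 4 * ((U y * (lK K y + pl y)) * ?L y))"
  by (intro Bochner_Integration.integrable_add integrable_mult_right ints)
 have i0: "integrable lborel (\<lambda>y. 4 * ((U y * ct K y) * ?l y))" by (intro integrable_mult_right ints)
 have e1: "(LINT y|lborel. U y * (4 * (ct K y * ?l y + (pK K y + pp y) * cnj (?P y) +
   cnj (pK K y + pp y) * ?P y + (lK K y + pl y) * ?L y)))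
  = (LINT y|lborel. 4 * ((U y * ct K y) * ?l y)) + (LINT y|lborel. 4 * ((U y * (pK K y + pp y)) * cnj (?P y)) +
   4 * ((U y * cnj (pK K y + pp y)) * ?P y) + 4 * ((U y * (lK K y + pl y)) * ?L y))"
  by (subst Bochner_Integration.integral_add[OF i0 i1, symmetric], rule Bochner_Integration.integral_cong) (simp_all add: algebra_simps)
 have e2: "(LINT y|lborel. 4 * ((U y * ct K y) * ?l y)) = (LINT y|lborel. U y * ct K y * of_real (approx_kernel e (y - z)))"
  unfolding log_kernel_l_eq[symmetric] by (rule Bochner_Integration.integral_cong) auto
 have e3: "(LINT y|lborel. (G y * ct K y - 4 * (U y * (lK K y + pl y))) * ?L y +
    (- 4 * (U y * cnj (pK K y + pp y))) * ?P y + (- 4 * (U y * (pK K y + pp y))) * cnj (?P y))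
  = (LINT y|lborel. (G y * ct K y) * ?L y) - (LINT y|lborel. 4 * ((U y * (pK K y + pp y)) * cnj (?P y)) +
   4 * ((U y * cnj (pK K y + pp y)) * ?P y) + 4 * ((U y * (lK K y + pl y)) * ?L y))"
  by (subst Bochner_Integration.integral_diff[OF IG i1, symmetric], rule Bochner_Integration.integral_cong) (simp_all add: algebra_simps)
 show ?thesis using W unfolding e1 e2 e3 by (simp add: mult.assoc eq_diff_eq)
qed

text \<open>Green's formula in the limit of vanishing regularisation. For z in the annulus 2
  e^(-K/2) < |z| < R/4 the commutator charges, which lie in |w| < e^(-K/2) or |w| > R/2, stay at
  positive distance, as \<open>weak_identification\<close> requires.\<close>

lemma identification:
 assumes K: "good K"
 shows "AE z in lborel. 2 * exp (- real K / 2) < cmod z \<and> cmod z < R / 4 --> of_real kernel_mass * U z =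
  (LINT w|lborel. G w * ct K w * of_real (ln (cmod (w - z))) - comm (pK K) (lK K) z w - comm pp pl z w)"
proof -
 have K0: "K > 0" using K by (simp add: good_def)
 let ?e = "exp (- real K / 2)"
 let ?d = "min ?e (R / 4)"
 \<comment> \<open>A continuous tent function of |z|, positive exactly on the annulus of z for which
   the formula is claimed.\<close>
 let ?k = "\<lambda>z::complex. max 0 (min (cmod z - 2 * ?e) (R / 4 - cmod z))"
 let ?a0 = "\<lambda>w. G w * ct K w - 4 * (U w * (lK K w + pl w))"
 let ?a1 = "\<lambda>w. - 4 * (U w * cnj (pK K w + pp w))"
 let ?a2 = "\<lambda>w. - 4 * (U w * (pK K w + pp w))"
 have k: "?k z \<noteq> 0 \<longleftrightarrow> 2 * ?e < cmod z \<and> cmod z < R / 4" for z by (auto simp: max_def min_def)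
 have "AE z in lborel. ?k z \<noteq> 0 --> of_real kernel_mass * (U z * ct K z) =
   (LINT w|lborel. ?a0 w * of_real (ln (cmod (w - z))) + ?a1 w * (1 / (2 * (w - z))) + ?a2 w * (1 / (2 * cnj (w - z))))"
 proof (rule weak_identification[where d="?d"])
  show "integrable lborel (\<lambda>z. U z * ct K z)" by (rule ct_integrable(1)[OF K0])
  show a0m: "?a0 \<in> borel_fun" by measurable
  show "integrable lborel (\<lambda>w. (cmod (?a0 w))^2)"
  proof (rule Bochner_Integration.integrable_bound)
   show "integrable lborel (\<lambda>w. 2 * (cmod (G w * ct K w))^2 + 64 * (cmod (U w * lK K w))^2 + 64 * (cmod (U w * pl w))^2)"
    by (intro Bochner_Integration.integrable_add integrable_mult_right ct_integrable(3)[OF K0] inner_integrable(4)[OF K0] outer_integrable(4))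
   have "(cmod (?a0 w))^2 \<le> 2 * (cmod (G w * ct K w))^2 + 64 * (cmod (U w * lK K w))^2 + 64 * (cmod (U w * pl w))^2" for w
   proof -
    have "(cmod (?a0 w))^2 \<le> 2 * (cmod (G w * ct K w))^2 + 2 * (cmod (- 4 * (U w * (lK K w + pl w))))^2"
     using norm_add_square_le[of "G w * ct K w" "- 4 * (U w * (lK K w + pl w))"] by simp
    also have "(cmod (- 4 * (U w * (lK K w + pl w))))^2 = 16 * (cmod (U w * lK K w + U w * pl w))^2"
     by (simp add: norm_mult power_mult_distrib flip: distrib_left)
    finally show ?thesis using norm_add_square_le[of "U w * lK K w" "U w * pl w"] by linarith
   qed
   then show "AE w in lborel. norm ((cmod (?a0 w))^2) \<le> norm (2 * (cmod (G w * ct K w))^2 + 64 * (cmod (U w * lK K w))^2 + 64 * (cmod (U w * pl w))^2)"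
    by (intro AE_I2) (simp only: real_norm_def abs_power2 abs_of_nonneg[OF add_nonneg_nonneg[OF add_nonneg_nonneg]]; smt (verit) zero_le_power2)
  qed measurable
  show "integrable lborel ?a1" "integrable lborel ?a2"
   using inner_integrable[OF K0] outer_integrable by (auto simp: distrib_left intro!: integrable_minus)
  show "?a0 w = 0 \<and> ?a1 w = 0 \<and> ?a2 w = 0" if "cmod w > 1" for w using U1[OF that] G1[OF that] by simp
  show "?d > 0" using R by simp
  show "continuous_on UNIV ?k" by (intro continuous_intros)
  show "\<bar>?k z\<bar> \<le> 1" for z
  proof -
   have "R / 4 - cmod z \<le> 1" using R norm_ge_zero[of z] by linarith
   then show ?thesis by (simp add: max_def min_def)
  qed
  show "cmod z \<le> 1" if "?k z \<noteq> 0" for z using that R unfolding k by linarith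
  show "?d \<le> cmod (w - z)" if "?k z \<noteq> 0" "?a1 w \<noteq> 0 \<or> ?a2 w \<noteq> 0" for z w
  proof -
   have "pK K w \<noteq> 0 \<or> pp w \<noteq> 0" using that(2) by auto
   then have "cmod w < ?e \<or> R / 2 < cmod w"
    using inner_supp(2)[OF K0, of w] one(2,3)[of w] by (auto simp: not_le[symmetric])
   moreover have "cmod z - cmod w \<le> cmod (w - z)" "cmod w - cmod z \<le> cmod (w - z)"
    using norm_triangle_ineq2[of z w] norm_triangle_ineq2[of w z] by (simp_all add: norm_minus_commute)
   ultimately show ?thesis using that(1) unfolding k by (auto simp: min_def)
  qed
  show "(LINT w|lborel. U w * ct K w * of_real (approx_kernel h (w - z))) =
   (LINT w|lborel. ?a0 w * log_kernel h (w - z) + ?a1 w * log_kernel_p h (w - z) + ?a2 w * cnj (log_kernel_p h (w - z)))"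
   if "h > 0" for h z by (rule weak_log_kernel[OF K that])
 qed
 then show ?thesis
 proof eventually_elim
  fix z
  assume *: "?k z \<noteq> 0 --> of_real kernel_mass * (U z * ct K z) =
   (LINT w|lborel. ?a0 w * of_real (ln (cmod (w - z))) + ?a1 w * (1 / (2 * (w - z))) + ?a2 w * (1 / (2 * cnj (w - z))))"
  show "2 * ?e < cmod z \<and> cmod z < R / 4 --> of_real kernel_mass * U z =
   (LINT w|lborel. G w * ct K w * of_real (ln (cmod (w - z))) - comm (pK K) (lK K) z w - comm pp pl z w)"
  proof
   assume z: "2 * ?e < cmod z \<and> cmod z < R / 4"
   have "?e > 0" by simp
   then have c1: "ct K z = 1" using z R by (intro ct_one[OF K]) linarith+
   have "of_real kernel_mass * U z = (LINT w|lborel. ?a0 w * of_real (ln (cmod (w - z))) + ?a1 w * (1 / (2 * (w - z))) + ?a2 w * (1 / (2 * cnj (w - z))))"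
    using mp[OF * iffD2[OF k z]] unfolding c1 mult_1_right .
   also have "\<dots> = (LINT w|lborel. G w * ct K w * of_real (ln (cmod (w - z))) - comm (pK K) (lK K) z w - comm pp pl z w)"
    by (rule Bochner_Integration.integral_cong) (simp_all add: comm_def algebra_simps)
   finally show "of_real kernel_mass * U z =
    (LINT w|lborel. G w * ct K w * of_real (ln (cmod (w - z))) - comm (pK K) (lK K) z w - comm pp pl z w)" .
  qed
 qed
qed

end

lemma integrable_mult_continuous':
 fixes g k :: "complex => complex"
 assumes "integrable lborel g" "\<And>y. cmod y > 1 ==> g y = 0" "continuous_on UNIV k"
 shows "integrable lborel (\<lambda>y. g y * k y)"
proof -
 have "continuous_on UNIV (\<lambda>w. k (- w))"
  by (rule continuous_on_compose2[OF assms(3)]) (auto intro: continuous_intros)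
 from integrable_mult_continuous[OF assms(1) _ this, of 1 0] assms(2) show ?thesis by simp
qed

lemma wirtinger2_power:
 "wirtinger2 S (\<lambda>z. z ^ m) (\<lambda>z. of_nat m * z ^ (m - 1)) (\<lambda>_. 0) (\<lambda>_. 0)"
 unfolding wirtinger2_def
proof (intro ballI conjI)
 fix z :: complex
 show "has_wirtinger (\<lambda>z. z ^ m) (of_nat m * z ^ (m - 1)) 0 z"
  by (intro has_wirtinger_holomorphic) (auto intro!: derivative_eq_intros)
 show "\<exists>k. has_wirtinger (\<lambda>_. 0) 0 k z" using has_wirtinger_const by blast
qed

lemma wirtinger2_cnj_power:
 "wirtinger2 S (\<lambda>z. cnj z ^ m) (\<lambda>_. 0) (\<lambda>z. of_nat m * cnj z ^ (m - 1)) (\<lambda>_. 0)"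
 unfolding wirtinger2_def
proof (intro ballI conjI)
 fix z :: complex
 have "has_wirtinger (\<lambda>z. z ^ m) (of_nat m * z ^ (m - 1)) 0 z"
  by (intro has_wirtinger_holomorphic) (auto intro!: derivative_eq_intros)
 from has_wirtinger_cnj[OF this] show "has_wirtinger (\<lambda>z. cnj z ^ m) 0 (of_nat m * cnj z ^ (m - 1)) z" by simp
 have "\<exists>d. ((\<lambda>z. of_nat m * z ^ (m - 1)) has_field_derivative d) (at z)"
  by (rule exI) (auto intro!: derivative_eq_intros)
 then obtain d where "has_wirtinger (\<lambda>z. of_nat m * z ^ (m - 1)) d 0 z" using has_wirtinger_holomorphic by blast
 from has_wirtinger_cnj[OF this] show "\<exists>k. has_wirtinger (\<lambda>z. of_nat m * cnj z ^ (m - 1)) 0 k z" by auto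
qed

section \<open>Moments of the inner commutator and the remainder of their expansion\<close>

context weak_cone_solution
begin

text \<open>Four times the integral of U against the commutator of the mixed derivative with a
  cut-off, applied to F. The cut-off has derivatives p, cnj p and mixed derivative l; F has
  derivatives p' and q'.\<close>

definition mom :: "(complex => complex) => (complex => complex) => (complex => complex) =>
  (complex => complex) => (complex => complex) => complex" where
 "mom p l F p' q' = (LINT w|lborel. 4 * ((U w * l w) * F w + (U w * cnj (p w)) * p' w + (U w * p w) * q' w))"

lemma mom_integrable:
 assumes "integrable lborel (\<lambda>w. U w * l w)" "integrable lborel (\<lambda>w. U w * cnj (p w))" "integrable lborel (\<lambda>w. U w * p w)"
  and "continuous_on UNIV F" "continuous_on UNIV p'" "continuous_on UNIV q'"
 shows "integrable lborel (\<lambda>w. 4 * ((U w * l w) * F w + (U w * cnj (p w)) * p' w + (U w * p w) * q' w))"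
 by (intro integrable_mult_right Bochner_Integration.integrable_add integrable_mult_continuous' assms) (auto simp: U1)

lemma G_L1: "integrable lborel G"
proof -
 have "0 < b + 1" using bn(1) by (meson le_less_trans of_nat_0_le_iff)
 from wnorm_powr_integrable[OF G_meas Gw G1 this]
 have "integrable lborel (\<lambda>w. cmod (G w) * cmod w powr - 0)" by simp
 then show ?thesis
 proof (rule Bochner_Integration.integrable_bound)
  show "AE w in lborel. norm (G w) \<le> norm (cmod (G w) * cmod w powr - 0)"
   using AE_lborel_singleton[of "0::complex"] by eventually_elim simp
 qed measurable
qed

lemma ct_tendsto: "w \<noteq> 0 ==> (\<lambda>K. ct K w) \<longlonglongrightarrow> ps w"
 unfolding ct_def using tendsto_mult[OF inner_cutoff_tendsto tendsto_const[of "ps w"]] by simp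

text \<open>For harmonic F the weak equation turns the inner moment into an integral of G over the
  cut-off region minus the outer moment. The former converges because G is integrable, and the
  latter does not depend on K. No direct estimate of the inner moment is made.\<close>

lemma mom_tendsto:
 assumes F: "smooth_on UNIV F" "wirtinger2 (-{0}) F p' q' (\<lambda>_. 0)" and c: "continuous_on UNIV p'" "continuous_on UNIV q'"
  and F1: "\<And>y. cmod y \<le> 1 ==> cmod (F y) \<le> 1"
 shows "(\<lambda>K. mom (pK K) (lK K) F p' q') \<longlonglongrightarrow> (LINT y|lborel. G y * (ps y * F y)) - mom pp pl F p' q'"
proof -
 have cF: "continuous_on UNIV F" by (rule smooth_on_imp_continuous[OF F(1)])
 have [measurable]: "F \<in> borel_fun" by (rule borel_measurable_continuous_onI[OF cF])
 have eq: "mom (pK K) (lK K) F p' q' = (LINT y|lborel. G y * (ct K y * F y)) - mom pp pl F p' q'" if K: "good K" for K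
 proof -
  have K0: "K > 0" using K by (simp add: good_def)
  note i = mom_integrable[OF inner_integrable(3,2,1)[OF K0] cF c] mom_integrable[OF outer_integrable(3,2,1) cF c]
  have "(LINT y|lborel. G y * (ct K y * F y)) = (LINT y|lborel. U y * (4 * (ct K y * 0 + (pK K y + pp y) * q' y +
    cnj (pK K y + pp y) * p' y + (lK K y + pl y) * F y)))"
   by (rule weak_apply[OF K smooth_on_subset[OF F(1)] F(2), symmetric]) simp
  also have "\<dots> = mom (pK K) (lK K) F p' q' + mom pp pl F p' q'"
   unfolding mom_def by (subst Bochner_Integration.integral_add[OF i, symmetric], rule Bochner_Integration.integral_cong) (simp_all add: algebra_simps)
  finally show ?thesis by simp
 qed
 have "(\<lambda>K. LINT y|lborel. G y * (ct K y * F y)) \<longlonglongrightarrow> (LINT y|lborel. G y * (ps y * F y))"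
 proof (rule integral_dominated_convergence[where w="\<lambda>y. cmod (G y)"])
  show "AE y in lborel. (\<lambda>K. G y * (ct K y * F y)) \<longlonglongrightarrow> G y * (ps y * F y)"
   using AE_lborel_singleton[of "0::complex"] by eventually_elim (intro tendsto_mult tendsto_const ct_tendsto)
  show "AE y in lborel. norm (G y * (ct K y * F y)) \<le> cmod (G y)" for K
  proof (rule AE_I2)
   fix y
   show "norm (G y * (ct K y * F y)) \<le> cmod (G y)"
   proof (cases "cmod y \<le> 1")
    case True
    have "cmod (ct K y * F y) \<le> 1 * 1" unfolding norm_mult by (intro mult_mono ct_le_1 F1 True) auto
    then show ?thesis using mult_left_mono[of "cmod (ct K y * F y)" 1 "cmod (G y)"] by (simp add: norm_mult)
   qed (use G1 in simp)
  qed
 qed (use G_L1 in auto)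
 then have "(\<lambda>K. (LINT y|lborel. G y * (ct K y * F y)) - mom pp pl F p' q') \<longlonglongrightarrow> (LINT y|lborel. G y * (ps y * F y)) - mom pp pl F p' q'"
  by (intro tendsto_diff tendsto_const)
 then show ?thesis
  by (rule Lim_transform_eventually) (use eventually_good in \<open>eventually_elim, simp add: eq\<close>)
qed

abbreviation "momI p l m \<equiv> mom p l (\<lambda>w. w ^ m) (\<lambda>w. of_nat m * w ^ (m - 1)) (\<lambda>_. 0)"
abbreviation "momJ p l m \<equiv> mom p l (\<lambda>w. cnj w ^ m) (\<lambda>_. 0) (\<lambda>w. of_nat m * cnj w ^ (m - 1))"

lemma mom_limits:
 obtains LI LJ where "\<And>m. (\<lambda>K. momI (pK K) (lK K) m) \<longlonglongrightarrow> LI m" "\<And>m. (\<lambda>K. momJ (pK K) (lK K) m) \<longlonglongrightarrow> LJ m"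
proof -
 have id: "smooth_on UNIV (\<lambda>z::complex. z ^ m)" for m by (intro smooth_on_holomorphic holomorphic_intros) auto
 have "smooth_on UNIV (\<lambda>z. cnj (z ^ m))" for m by (rule smooth_on_cnj[OF open_UNIV id])
 then have id': "smooth_on UNIV (\<lambda>z. cnj z ^ m)" for m by simp
 have "(\<lambda>K. momI (pK K) (lK K) m) \<longlonglongrightarrow> (LINT w|lborel. G w * (ps w * w ^ m)) - momI pp pl m" for m
  by (rule mom_tendsto[OF id wirtinger2_power]) (auto intro!: continuous_intros simp: norm_power power_le_one)
 moreover have "(\<lambda>K. momJ (pK K) (lK K) m) \<longlonglongrightarrow> (LINT w|lborel. G w * (ps w * cnj w ^ m)) - momJ pp pl m" for m
  by (rule mom_tendsto[OF id' wirtinger2_cnj_power]) (auto intro!: continuous_intros simp: norm_power power_le_one)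
 ultimately show thesis
  by (intro that[of "\<lambda>m. (LINT w|lborel. G w * (ps w * w ^ m)) - momI pp pl m"
    "\<lambda>m. (LINT w|lborel. G w * (ps w * cnj w ^ m)) - momJ pp pl m"])
qed

text \<open>What remains of the inner commutator kernel after the expansion of log |w - z| and of
  its derivatives in powers of w/z up to order n has been removed.\<close>

definition kr :: "nat => complex => complex => complex" where
 "kr K z w = lK K w * of_real (kern n (w / z)) + cnj (pK K w) * (w ^ n / (2 * z ^ n * (w - z))) +
   pK K w * cnj (w ^ n / (2 * z ^ n * (w - z)))"

lemma kr_borel [measurable]: "kr K z \<in> borel_fun"
 unfolding kr_def[abs_def] by measurable

lemma kr_supp: "K > 0 ==> kr K z w \<noteq> 0 ==> exp (- real K) < cmod w \<and> cmod w < exp (- real K / 2)"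
 using inner_supp[of K w] unfolding kr_def by (metis add_0 complex_cnj_zero mult_zero_left)

text \<open>The gradient of the cut-off is O(1 / (K |w|)) and meets a remainder of order |w|^n; its
  mixed derivative is O(1 / (K |w|^2)) and meets one of order |w|^(n+1). The condition on K ensures
  |w| \<le> |z| / 2 on the shell, so that \<open>kern_small\<close> applies to w/z.\<close>

lemma kr_bound:
 assumes "z \<noteq> 0"
 obtains D where "D > 0" "\<And>K w. K > 0 ==> 2 * exp (- real K / 2) < cmod z ==>
  cmod (kr K z w) \<le> D / real K * cmod w powr (real n - 1)"
proof -
 obtain C where C: "C > 0" "\<And>c a z. cmod (log_cutoff_p c a z) \<le> C * \<bar>c\<bar> / cmod z"
  "\<And>c a z. cmod (log_cutoff_l c a z) \<le> C * c^2 / (cmod z)^2" using log_cutoff_derivatives_bound by blast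
 \<comment> \<open>The logarithmic term contributes 2 and each of the two gradient terms contributes
   1.\<close>
 define D where "D = 4 * C / cmod z ^ (n + 1)"
 have D: "D > 0" using C assms by (simp add: D_def)
 show thesis
 proof (rule that[OF D])
  fix K :: nat and w
  assume K: "K > 0" and z: "2 * exp (- real K / 2) < cmod z"
  show "cmod (kr K z w) \<le> D / real K * cmod w powr (real n - 1)"
  proof (cases "kr K z w = 0")
   case False
   note s = kr_supp[OF K False]
   have x: "cmod w > 0" using s by (meson exp_gt_zero less_trans)
   have half: "cmod w \<le> cmod z / 2" using s z by linarith
   have pw: "cmod w ^ n / cmod w = cmod w powr (real n - 1)"
    using x by (simp add: powr_diff powr_realpow)
   have zp: "cmod z > 0" using assms by simp
   have K1: "1 \<le> real K" using K by simp
   have d: "cmod (w - z) \<ge> cmod z / 2"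
    using norm_triangle_ineq2[of z w] half by (simp add: norm_minus_commute)
   have e: "cmod (w ^ n / (2 * z ^ n * (w - z))) \<le> cmod w ^ n / cmod z ^ (n + 1)"
   proof -
    have "cmod (w ^ n / (2 * z ^ n * (w - z))) = cmod w ^ n / (2 * cmod z ^ n * cmod (w - z))"
     by (simp add: norm_divide norm_mult norm_power)
    also have "\<dots> \<le> cmod w ^ n / (2 * cmod z ^ n * (cmod z / 2))"
     using d zp by (intro divide_left_mono mult_left_mono mult_pos_pos) auto
    finally show ?thesis by (simp add: mult.commute)
   qed
   have p: "cmod (pK K w) \<le> C / real K / cmod w" using C(2)[of "1 / real K" 2 w] by simp
   have P: "cmod (pK K w) * cmod (w ^ n / (2 * z ^ n * (w - z))) \<le> (C / cmod z ^ (n + 1)) / real K * cmod w powr (real n - 1)"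
   proof -
    have "cmod (pK K w) * cmod (w ^ n / (2 * z ^ n * (w - z))) \<le> (C / real K / cmod w) * (cmod w ^ n / cmod z ^ (n + 1))"
     using C(1) by (intro mult_mono p e) auto
    also have "\<dots> = (C / cmod z ^ (n + 1)) / real K * (cmod w ^ n / cmod w)" by (simp add: field_simps)
    finally show ?thesis unfolding pw .
   qed
   have "cmod (w / z) \<le> 1 / 2" using half zp by (simp add: norm_divide field_simps)
   from kern_small[OF this, of n]
   have k: "\<bar>kern n (w / z)\<bar> \<le> 2 * cmod w ^ (n + 1) / cmod z ^ (n + 1)" by (simp add: norm_divide power_divide)
   have l: "cmod (lK K w) \<le> C / real K / (cmod w)^2"
   proof -
    have "(1 / real K)^2 \<le> 1 / real K" using K1 by (simp add: power2_eq_square field_simps)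
    then have "C * (1 / real K)^2 / (cmod w)^2 \<le> C * (1 / real K) / (cmod w)^2"
     using C(1) by (intro divide_right_mono mult_left_mono) auto
    then show ?thesis using C(3)[of "1 / real K" 2 w] by simp
   qed
   have L: "cmod (lK K w) * \<bar>kern n (w / z)\<bar> \<le> 2 * (C / cmod z ^ (n + 1)) / real K * cmod w powr (real n - 1)"
   proof -
    have "cmod (lK K w) * \<bar>kern n (w / z)\<bar> \<le> (C / real K / (cmod w)^2) * (2 * cmod w ^ (n + 1) / cmod z ^ (n + 1))"
     using C(1) by (intro mult_mono l k) auto
    also have "\<dots> = 2 * (C / cmod z ^ (n + 1)) / real K * (cmod w ^ n / cmod w)"
     using x by (simp add: power2_eq_square mult_ac)
    finally show ?thesis unfolding pw .
   qed
   have "cmod (kr K z w) \<le> cmod (lK K w) * \<bar>kern n (w / z)\<bar> +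
     cmod (pK K w) * cmod (w ^ n / (2 * z ^ n * (w - z))) + cmod (pK K w) * cmod (w ^ n / (2 * z ^ n * (w - z)))"
   proof -
    have "cmod (kr K z w) \<le> cmod (lK K w * of_real (kern n (w / z))) + cmod (cnj (pK K w) * (w ^ n / (2 * z ^ n * (w - z)))) +
     cmod (pK K w * cnj (w ^ n / (2 * z ^ n * (w - z))))"
     unfolding kr_def by (intro norm_triangle_le add_right_mono norm_triangle_ineq)
    then show ?thesis by (simp only: norm_mult complex_mod_cnj norm_of_real)
   qed
   also have "\<dots> \<le> 2 * (C / cmod z ^ (n + 1)) / real K * cmod w powr (real n - 1) +
     (C / cmod z ^ (n + 1)) / real K * cmod w powr (real n - 1) + (C / cmod z ^ (n + 1)) / real K * cmod w powr (real n - 1)"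
    by (intro add_mono L P)
   also have "\<dots> = D / real K * cmod w powr (real n - 1)" by (simp add: D_def field_simps)
   finally show ?thesis .
  qed (use D in simp)
 qed
qed

lemma kr_integrable:
 assumes z: "z \<noteq> 0" and K: "K > 0" "2 * exp (- real K / 2) < cmod z"
 shows "integrable lborel (\<lambda>w. U w * kr K z w)"
proof -
 obtain D where D: "D > 0" "\<And>K w. K > 0 ==> 2 * exp (- real K / 2) < cmod z ==>
  cmod (kr K z w) \<le> D / real K * cmod w powr (real n - 1)" using kr_bound[OF z] by blast
 show ?thesis
 proof (rule U_integrable(2))
  \<comment> \<open>On the shell |w|^(n-1) \<le> |w|^-1 \<le> e^K. This crude bound serves only
    integrability for fixed K.\<close>
  show "cmod (kr K z w) \<le> D / real K * exp (real K)" for w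
  proof (cases "kr K z w = 0")
   case False
   note s = kr_supp[OF K(1) False]
   have x: "cmod w > 0" using s by (meson exp_gt_zero less_trans)
   have "exp (- real K / 2) \<le> 1" by simp
   then have x1: "cmod w \<le> 1" using s by linarith
   have "cmod w powr (real n - 1) \<le> cmod w powr (- 1)" using x x1 by (intro powr_mono') auto
   also have "\<dots> \<le> exp (- real K) powr (- 1)" using s by (intro powr_mono2') auto
   also have "\<dots> = exp (real K)" by (simp add: powr_minus exp_minus)
   finally have "D / real K * cmod w powr (real n - 1) \<le> D / real K * exp (real K)"
    using D(1) by (intro mult_left_mono) auto
   then show ?thesis using D(2)[OF K, of w] by linarith
  qed (use D in simp)
  show "kr K z w = 0" if "cmod w < exp (- real K)" for w using kr_supp[OF K(1), of z w] that by force
 qed auto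
qed

text \<open>Cauchy-Schwarz between U in the weight b and the remainder in the weight -b; by
  \<open>shell_square_integral\<close> the second factor is of order 1/K.\<close>

lemma kr_remainder_tendsto:
 assumes z: "z \<noteq> 0"
 shows "(\<lambda>K. LINT w|lborel. U w * kr K z w) \<longlonglongrightarrow> 0"
proof -
 obtain D where D: "D > 0" "\<And>K w. K > 0 ==> 2 * exp (- real K / 2) < cmod z ==>
  cmod (kr K z w) \<le> D / real K * cmod w powr (real n - 1)" using kr_bound[OF z] by blast
 let ?I = "\<lambda>K. LINT w|lborel. U w * kr K z w"
 let ?c = "\<lambda>K. ennreal (D^2 * (pi * exp 2 * (real K + 1)) / (real K)^2)"
 have bnd: "ennreal ((cmod (?I K))^2) \<le> wnorm b U * ?c K" if K: "K > 0" "2 * exp (- real K / 2) < cmod z" for K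
 proof -
  have "ennreal ((cmod (?I K))^2) \<le> (\<integral>\<^sup>+w. ennreal (cmod (U w * kr K z w)) \<partial>lborel)^2"
   by (rule ennreal_norm_integral_square_le)
  also have "\<dots> = (\<integral>\<^sup>+w. ennreal (cmod (U w) * \<bar>cmod (kr K z w)\<bar>) \<partial>lborel)^2" by (simp add: norm_mult)
  also have "\<dots> \<le> wnorm (- (- b)) U * (\<integral>\<^sup>+w. ennreal ((cmod (kr K z w))^2 * cmod w powr (2 * - b)) \<partial>lborel)"
   by (rule wnorm_Cauchy_Schwarz) measurable
  also have "\<dots> \<le> wnorm (- (- b)) U * ?c K"
  proof (intro mult_left_mono shell_square_integral[of b n K])
   show "b \<le> real n" using bn by simp
   show "\<bar>cmod (kr K z w)\<bar> \<le> D / real K * cmod w powr (real n - 1)" for w using D(2)[OF K] by simp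
   show "exp (- real K) \<le> cmod w \<and> cmod w \<le> 1" if "cmod (kr K z w) \<noteq> 0" for w
   proof -
    have "exp (- real K / 2) \<le> 1" by simp
    moreover have "kr K z w \<noteq> 0" using that by simp
    ultimately show ?thesis using kr_supp[OF K(1), of z w] by linarith
   qed
  qed (use K in auto)
  finally show ?thesis by simp
 qed
 have "(\<lambda>K. wnorm b U * ?c K) \<longlonglongrightarrow> wnorm b U * 0"
  using Uw by (intro ennreal_tendsto_cmult shell_constant_tendsto) auto
 then have A: "(\<lambda>K. wnorm b U * ?c K) \<longlonglongrightarrow> 0" by simp
 have E: "eventually (\<lambda>K. ennreal ((cmod (?I K))^2) \<le> wnorm b U * ?c K) sequentially"
 proof -
  have "z / 2 \<noteq> 0" using z by simp
  from inner_cutoff_eventually_one[OF this] eventually_gt_at_top[of 0] show ?thesis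
   by eventually_elim (auto intro!: bnd simp: norm_divide)
 qed
 have "(\<lambda>K. ennreal ((cmod (?I K))^2)) \<longlonglongrightarrow> 0"
  by (rule tendsto_sandwich[OF _ E tendsto_const A]) simp
 then have "(\<lambda>K. ennreal ((cmod (?I K))^2)) \<longlonglongrightarrow> ennreal 0" by simp
 then have "(\<lambda>K. (cmod (?I K))^2) \<longlonglongrightarrow> 0"
  by (intro tendsto_ennrealD) auto
 then have "(\<lambda>K. sqrt ((cmod (?I K))^2)) \<longlonglongrightarrow> sqrt 0" by (rule tendsto_real_sqrt)
 then show ?thesis by (simp add: tendsto_norm_zero_iff)
qed

text \<open>For |w| < |z| the logarithm and its two derivatives are expanded in w/z and cnj (w/z) up
  to order n. Collecting equal powers of z, the coefficient of log |z| is the moment of order 0, and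
  those of z^-m and cnj z^-m are -1/(2m) times the moments of order m.\<close>

lemma comm_inner_expansion:
 assumes K: "K > 0" and z: "2 * exp (- real K / 2) < cmod z"
 shows "integrable lborel (comm (pK K) (lK K) z)"
  "(LINT w|lborel. comm (pK K) (lK K) z w) = of_real (ln (cmod z)) * momI (pK K) (lK K) 0 -
   (\<Sum>m=1..n. 1 / (2 * of_nat m) * (1 / z ^ m * momI (pK K) (lK K) m + 1 / cnj z ^ m * momJ (pK K) (lK K) m)) +
   4 * (LINT w|lborel. U w * kr K z w)"
proof -
 have "exp (- real K / 2) > 0" by simp
 then have z0: "z \<noteq> 0" using z by auto
 let ?p = "pK K" and ?l = "lK K"
 let ?fI = "\<lambda>m w. 4 * ((U w * ?l w) * w ^ m + (U w * cnj (?p w)) * (of_nat m * w ^ (m - 1)) + (U w * ?p w) * 0)"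
 let ?fJ = "\<lambda>m w. 4 * ((U w * ?l w) * cnj w ^ m + (U w * cnj (?p w)) * 0 + (U w * ?p w) * (of_nat m * cnj w ^ (m - 1)))"
 have I: "has_bochner_integral lborel (?fI m) (momI ?p ?l m)" for m
  unfolding mom_def by (intro has_bochner_integral_integrable mom_integrable inner_integrable K continuous_intros)
 have J: "has_bochner_integral lborel (?fJ m) (momJ ?p ?l m)" for m
  unfolding mom_def by (intro has_bochner_integral_integrable mom_integrable inner_integrable K continuous_intros)
 have R: "has_bochner_integral lborel (\<lambda>w. U w * kr K z w) (LINT w|lborel. U w * kr K z w)"
  by (intro has_bochner_integral_integrable kr_integrable z0 K z)
 let ?tot = "\<lambda>w. of_real (ln (cmod z)) * ?fI 0 w - (\<Sum>m=1..n. 1 / (2 * of_nat m) * (1 / z ^ m * ?fI m w + 1 / cnj z ^ m * ?fJ m w)) + 4 * (U w * kr K z w)"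
 have tot: "has_bochner_integral lborel ?tot (of_real (ln (cmod z)) * momI ?p ?l 0 -
   (\<Sum>m=1..n. 1 / (2 * of_nat m) * (1 / z ^ m * momI ?p ?l m + 1 / cnj z ^ m * momJ ?p ?l m)) + 4 * (LINT w|lborel. U w * kr K z w))"
  by (intro has_bochner_integral_add has_bochner_integral_diff has_bochner_integral_sum has_bochner_integral_mult_right I J R)
 have eq: "comm ?p ?l z w = ?tot w" for w
 proof (cases "?p w = 0 \<and> ?l w = 0")
  case True
  then show ?thesis by (simp add: comm_def kr_def)
 next
  case False
  then have "cmod w < exp (- real K / 2)" using inner_supp(2)[OF K] by blast
  then have "cmod w < cmod z" using z \<open>exp (- real K / 2) > 0\<close> by linarith
  then have w: "w \<noteq> z" by blast
  define u p l where "u = 4 * U w" and "p = ?p w" and "l = ?l w"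
  have L: "complex_of_real (ln (cmod (w - z))) = of_real (ln (cmod z)) + of_real (kern n (w / z)) -
    (\<Sum>m=1..n. 1 / (2 * of_nat m) * (w ^ m / z ^ m) + 1 / (2 * of_nat m) * (cnj w ^ m / cnj z ^ m))"
   unfolding ln_norm_diff_eq_kern'[OF z0 w, of n] of_real_diff of_real_add of_real_sum of_real_Re_div_eq
   by (simp add: power_divide)
  have P: "1 / (2 * (w - z)) = w ^ n / (2 * z ^ n * (w - z)) - (\<Sum>m=1..n. w ^ (m - 1) / (2 * z ^ m))"
  proof -
   have "1 / (2 * (w - z)) = (1 / (w - z)) / 2" by simp
   also have "\<dots> = w ^ n / (z ^ n * (w - z)) / 2 - (\<Sum>m=1..n. w ^ (m - 1) / z ^ m) / 2"
    unfolding inverse_diff_expansion[OF z0 w, of n] by (rule diff_divide_distrib)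
   finally show ?thesis by (simp add: sum_divide_distrib mult.commute mult.left_commute)
  qed
  have Q: "1 / (2 * cnj (w - z)) = cnj (w ^ n / (2 * z ^ n * (w - z))) - (\<Sum>m=1..n. cnj w ^ (m - 1) / (2 * cnj z ^ m))"
   using arg_cong[OF P, of cnj] by simp
  have S: "u * l * (\<Sum>m=1..n. 1 / (2 * of_nat m) * (w ^ m / z ^ m) + 1 / (2 * of_nat m) * (cnj w ^ m / cnj z ^ m)) +
    u * cnj p * (\<Sum>m=1..n. w ^ (m - 1) / (2 * z ^ m)) + u * p * (\<Sum>m=1..n. cnj w ^ (m - 1) / (2 * cnj z ^ m))
   = (\<Sum>m=1..n. 1 / (2 * of_nat m) * (1 / z ^ m * ?fI m w + 1 / cnj z ^ m * ?fJ m w))"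
   unfolding sum_distrib_left sum.distrib[symmetric]
  proof (rule sum.cong[OF refl])
   fix m assume "m \<in> {1..n}"
   then have m: "(of_nat m :: complex) \<noteq> 0" by simp
   \<comment> \<open>Multiplying by m/m produces the factor m of the derivative of w^m, as it occurs
     in the moments.\<close>
   have h: "x / (2 * y) = 1 / (2 * of_nat m) * (1 / y * (of_nat m * x))" for x y :: complex using m by simp
   show "u * l * (1 / (2 * of_nat m) * (w ^ m / z ^ m) + 1 / (2 * of_nat m) * (cnj w ^ m / cnj z ^ m)) +
     u * cnj p * (w ^ (m - 1) / (2 * z ^ m)) + u * p * (cnj w ^ (m - 1) / (2 * cnj z ^ m)) =
    1 / (2 * of_nat m) * (1 / z ^ m * ?fI m w + 1 / cnj z ^ m * ?fJ m w)"
    unfolding h[of "w ^ (m - 1)" "z ^ m"] h[of "cnj w ^ (m - 1)" "cnj z ^ m"] u_def p_def l_def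
    by (simp add: algebra_simps add_divide_distrib)
  qed
  have "comm ?p ?l z w = u * l * of_real (ln (cmod (w - z))) + u * cnj p * (1 / (2 * (w - z))) + u * p * (1 / (2 * cnj (w - z)))"
   by (simp add: comm_def u_def p_def l_def)
  also have "\<dots> = u * l * of_real (ln (cmod z)) -
    (u * l * (\<Sum>m=1..n. 1 / (2 * of_nat m) * (w ^ m / z ^ m) + 1 / (2 * of_nat m) * (cnj w ^ m / cnj z ^ m)) +
    u * cnj p * (\<Sum>m=1..n. w ^ (m - 1) / (2 * z ^ m)) + u * p * (\<Sum>m=1..n. cnj w ^ (m - 1) / (2 * cnj z ^ m))) +
    (u * l * of_real (kern n (w / z)) + u * cnj p * (w ^ n / (2 * z ^ n * (w - z))) + u * p * cnj (w ^ n / (2 * z ^ n * (w - z))))"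
   unfolding L P Q by (simp only: distrib_left right_diff_distrib) (simp only: algebra_simps)
  also have "\<dots> = ?tot w"
   unfolding S by (simp add: kr_def u_def p_def l_def algebra_simps)
  finally show ?thesis .
 qed
 have "has_bochner_integral lborel (comm ?p ?l z) (of_real (ln (cmod z)) * momI ?p ?l 0 -
   (\<Sum>m=1..n. 1 / (2 * of_nat m) * (1 / z ^ m * momI ?p ?l m + 1 / cnj z ^ m * momJ ?p ?l m)) + 4 * (LINT w|lborel. U w * kr K z w))"
  using tot unfolding eq[symmetric] by simp
 then show "integrable lborel (comm ?p ?l z)"
  "(LINT w|lborel. comm ?p ?l z w) = of_real (ln (cmod z)) * momI ?p ?l 0 -
   (\<Sum>m=1..n. 1 / (2 * of_nat m) * (1 / z ^ m * momI ?p ?l m + 1 / cnj z ^ m * momJ ?p ?l m)) + 4 * (LINT w|lborel. U w * kr K z w)"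
  by (auto simp: has_bochner_integral_iff)
qed

end

lemma wnorm_cmult_le:
 assumes "\<And>z. cmod (k z) \<le> C" "C \<ge> 0" "f \<in> borel_fun"
 shows "wnorm s (\<lambda>z. f z * k z) \<le> ennreal (C^2) * wnorm s f"
 by (rule wnorm_mono_AE)
  (use assms mult_right_mono[OF assms(1), of "cmod (f z)" for z] in \<open>auto simp: norm_mult mult.commute\<close>)

lemma wnorm_cmult_finite:
 assumes "\<And>z. cmod (k z) \<le> C" "C \<ge> 0" "f \<in> borel_fun" "wnorm s f < \<infinity>"
 shows "wnorm s (\<lambda>z. f z * k z) < \<infinity>"
proof -
 have "wnorm s (\<lambda>z. f z * k z) \<le> ennreal (C^2) * wnorm s f"
  by (rule wnorm_cmult_le) (use assms in auto)
 also have "\<dots> < \<infinity>" using assms(4) by (simp add: ennreal_mult_less_top)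
 finally show ?thesis .
qed

definition singular_part :: "nat => complex => (nat => complex) => (nat => complex) => complex => complex" where
 "singular_part n l H H' z = l * of_real (ln (cmod z)) + (\<Sum>m=1..n. H m * (1 / z ^ m)) + (\<Sum>m=1..n. H' m * (1 / cnj z ^ m))"

definition regular_part :: "nat => complex => (nat => complex) => (nat => complex) => complex => complex" where
 "regular_part n c h h' z = c + (\<Sum>m=1..n. h m * z ^ m) + (\<Sum>m=1..n. h' m * cnj z ^ m)"

section \<open>The representation formula after the inner cut-off is removed\<close>

context weak_cone_solution
begin

lemma outer_charge_finite: "wnorm (- b) (\<lambda>w. U w * pl w) < \<infinity>"
proof -
 let ?c = "1 + (R / 2) powr (- 2 * b)"
 have "(cmod (U w * pl w))^2 * cmod w powr (2 * - b) \<le> ?c * (cmod (U w * pl w))^2" for w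
 proof (cases "cmod w \<le> R / 2 \<or> 3 * R / 4 \<le> cmod w")
  case False
  then have z: "R / 2 \<le> cmod w" "cmod w \<le> 1" "0 < cmod w" using R by auto
  have "cmod w powr (2 * - b) \<le> ?c"
  proof (cases "b \<ge> 0")
   case True
   then have "cmod w powr (2 * - b) \<le> (R / 2) powr (2 * - b)" using z R by (intro powr_mono2') auto
   then show ?thesis by simp
  next
   case False
   then have "cmod w powr (2 * - b) \<le> 1" using z by (intro powr_le1) auto
   then show ?thesis using powr_ge_zero[of "R / 2" "- 2 * b"] by linarith
  qed
  then show ?thesis by (subst mult.commute) (rule mult_right_mono, auto)
 qed (use one(2,3)[of w] zero[of w] in auto)
 then have "wnorm (- b) (\<lambda>w. U w * pl w) \<le> (\<integral>\<^sup>+w. ennreal (?c * (cmod (U w * pl w))^2) \<partial>lborel)"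
  unfolding wnorm_def by (intro nn_integral_mono ennreal_leI)
 also have "\<dots> < \<infinity>"
  by (subst nn_integral_eq_integral[OF integrable_mult_right[OF outer_integrable(4)]]) auto
 finally show ?thesis .
qed

text \<open>The limit K \<rightarrow> \<infinity> of \<open>identification\<close>. The charge
  paired with the logarithm becomes f, that is G times the outer cut-off minus four times U times
  its mixed derivative. The outer gradient terms give a harmonic function, and the inner commutator
  converges to the singular part by \<open>comm_inner_expansion\<close>, \<open>mom_limits\<close>
  and \<open>kr_remainder_tendsto\<close>.\<close>

lemma representation:
 obtains l H H' g A B where "g \<in> borel_fun" "wnorm (- b) g < \<infinity>"
  "\<And>y. cmod y > 3 * R / 4 ==> g y = 0" "A holomorphic_on ball 0 (R / 4)" "B holomorphic_on ball 0 (R / 4)"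
  "AE z in lborel. z \<noteq> 0 \<and> cmod z < R / 4 --> U z = singular_part n l H H' z + potential n g z + A z + cnj (B z)"
proof -
 define f where "f y = G y * ps y + U y * pl y * (- 4)" for y
 have [measurable]: "f \<in> borel_fun" unfolding f_def[abs_def] by measurable
 have fw: "wnorm (- b) f < \<infinity>"
 proof -
  have "wnorm (- b) f \<le> 2 * wnorm (- b) (\<lambda>y. G y * ps y) + 2 * wnorm (- b) (\<lambda>y. U y * pl y * (- 4))"
   unfolding f_def by (rule wnorm_add) measurable
  also have "\<dots> < \<infinity>"
   using wnorm_cmult_finite[OF ps1 _ G_meas Gw] wnorm_cmult_finite[of "\<lambda>_. - 4" 4, OF _ _ _ outer_charge_finite]
   by (simp add: ennreal_mult_less_top)
  finally show ?thesis .
 qed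
 have fs: "f y = 0" if "cmod y > 3 * R / 4" for y using zero[of y] that by (simp add: f_def)
 have fs': "\<And>y. cmod y > 1 ==> f y = 0" by (rule fs) (use R in simp)
 obtain c h h' where
  i1: "\<And>z. z \<noteq> 0 ==> cmod z \<le> 1 ==> integrable lborel (\<lambda>y. f y * of_real (ln (cmod (y - z))))" and
  e1: "\<And>z. z \<noteq> 0 ==> cmod z \<le> 1 ==> (LINT y|lborel. f y * of_real (ln (cmod (y - z))))
   = potential n f z + (c + (\<Sum>m=1..n. h m * z ^ m) + (\<Sum>m=1..n. h' m * cnj z ^ m))"
  by (rule ln_norm_diff_decomposition[OF bn _ fw fs']) auto
 have iG: "integrable lborel (\<lambda>y. G y * of_real (ln (cmod (y - z))))" if "z \<noteq> 0" "cmod z \<le> 1" for z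
  by (rule ln_norm_diff_decomposition[OF bn G_meas Gw G1]) (use that in auto)
 let ?q1 = "\<lambda>y. - 4 * (U y * cnj (pp y))" and ?q2 = "\<lambda>y. - 4 * (U y * pp y)"
 have qi: "integrable lborel ?q1" "integrable lborel ?q2"
  by (intro integrable_mult_right outer_integrable)+
 have qs: "cmod y < R / 4 ==> ?q1 y = 0 \<and> ?q2 y = 0" for y
  using one(2,3)[of y] R by auto
 have R4: "R / 4 > 0" using R by simp
 let ?D = "\<lambda>z y. ?q1 y * (1 / (2 * (y - z))) + ?q2 y * (1 / (2 * cnj (y - z)))"
 obtain A B where AB: "A holomorphic_on ball 0 (R / 4)" "B holomorphic_on ball 0 (R / 4)"
  and i2: "\<And>z. cmod z < R / 4 ==> integrable lborel (?D z)"
  and e2: "\<And>z. cmod z < R / 4 ==> (LINT y|lborel. ?D z y) = A z + cnj (B z)"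
  using distant_cauchy_potential[OF qi qs R4] by blast
 obtain LI LJ where L: "\<And>m. (\<lambda>K. momI (pK K) (lK K) m) \<longlonglongrightarrow> LI m" "\<And>m. (\<lambda>K. momJ (pK K) (lK K) m) \<longlonglongrightarrow> LJ m"
  using mom_limits by blast
 define M where "M = complex_of_real kernel_mass"
 have M: "M \<noteq> 0" using kernel_mass_pos by (simp add: M_def)
 let ?S = "\<lambda>z. \<Sum>m=1..n. 1 / (2 * of_nat m) * (1 / z ^ m * LI m + 1 / cnj z ^ m * LJ m)"
 have main: "AE z in lborel. z \<noteq> 0 \<and> cmod z < R / 4 --> M * U z =
  (LINT y|lborel. f y * of_real (ln (cmod (y - z)))) + (A z + cnj (B z)) - (of_real (ln (cmod z)) * LI 0 - ?S z)"
 proof -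
  \<comment> \<open>There are countably many K, so one null set serves them all and the limit can be
    taken for fixed z.\<close>
  have "AE z in lborel. \<forall>K. good K --> 2 * exp (- real K / 2) < cmod z \<and> cmod z < R / 4 --> of_real kernel_mass * U z =
   (LINT y|lborel. G y * ct K y * of_real (ln (cmod (y - z))) - comm (pK K) (lK K) z y - comm pp pl z y)"
   unfolding AE_all_countable using identification by (auto intro: AE_mp AE_I2)
  then show ?thesis
  proof eventually_elim
   fix z
   assume *: "\<forall>K. good K --> 2 * exp (- real K / 2) < cmod z \<and> cmod z < R / 4 --> of_real kernel_mass * U z =
    (LINT y|lborel. G y * ct K y * of_real (ln (cmod (y - z))) - comm (pK K) (lK K) z y - comm pp pl z y)"
   show "z \<noteq> 0 \<and> cmod z < R / 4 --> M * U z =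
    (LINT y|lborel. f y * of_real (ln (cmod (y - z)))) + (A z + cnj (B z)) - (of_real (ln (cmod z)) * LI 0 - ?S z)"
   proof
    assume z: "z \<noteq> 0 \<and> cmod z < R / 4"
    then have z1: "z \<noteq> 0" "cmod z \<le> 1" "cmod z < R / 4" using R by auto
    let ?ln = "\<lambda>y. complex_of_real (ln (cmod (y - z)))"
    \<comment> \<open>The error of replacing the doubly cut-off charge by its limit. It is dominated
      by twice |G log|, which is integrable by the decomposition lemma applied to G.\<close>
    let ?d = "\<lambda>K. LINT y|lborel. (G y * ?ln y) * (ct K y - ps y)"
    let ?X = "(LINT y|lborel. f y * ?ln y) + (A z + cnj (B z))"
    have bd: "cmod (ct K y - ps y) \<le> 2" for K y
     using norm_triangle_ineq4[of "ct K y" "ps y"] ct_le_1[of K y] ps1[of y] by linarith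
    have bd': "norm ((G y * ?ln y) * (ct K y - ps y)) \<le> norm (G y * ?ln y) * 2" for K y
     unfolding norm_mult[of "G y * ?ln y"] by (intro mult_left_mono bd) auto
    have iw: "integrable lborel (\<lambda>y. norm (G y * ?ln y) * 2)" by (intro integrable_mult_left integrable_norm iG z1)
    have id: "integrable lborel (\<lambda>y. (G y * ?ln y) * (ct K y - ps y))" for K
     by (rule Bochner_Integration.integrable_bound[OF iw]) (use bd' in auto)
    have d0: "?d \<longlonglongrightarrow> 0"
    proof -
     have "?d \<longlonglongrightarrow> (LINT y::complex|lborel. 0)"
     proof (rule integral_dominated_convergence[where w="\<lambda>y. norm (G y * ?ln y) * 2"])
      show "AE y in lborel. (\<lambda>K. (G y * ?ln y) * (ct K y - ps y)) \<longlonglongrightarrow> 0"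
       using AE_lborel_singleton[of "0::complex"]
      proof eventually_elim
       fix y :: complex assume "y \<noteq> 0"
       then have "(\<lambda>K. (G y * ?ln y) * (ct K y - ps y)) \<longlonglongrightarrow> (G y * ?ln y) * (ps y - ps y)"
        by (intro tendsto_intros ct_tendsto)
       then show "(\<lambda>K. (G y * ?ln y) * (ct K y - ps y)) \<longlonglongrightarrow> 0" by simp
      qed
     qed (use iw bd' in auto)
     then show ?thesis by simp
    qed
    let ?E = "\<lambda>K. of_real (ln (cmod z)) * momI (pK K) (lK K) 0 -
     (\<Sum>m=1..n. 1 / (2 * of_nat m) * (1 / z ^ m * momI (pK K) (lK K) m + 1 / cnj z ^ m * momJ (pK K) (lK K) m)) +
     4 * (LINT y|lborel. U y * kr K z y)"
    have E: "?E \<longlonglongrightarrow> of_real (ln (cmod z)) * LI 0 - ?S z + 4 * 0"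
     by (intro tendsto_add tendsto_diff tendsto_sum tendsto_mult tendsto_const L kr_remainder_tendsto z1)
    have eq: "M * U z = ?d K + ?X - ?E K" if K: "good K" "2 * exp (- real K / 2) < cmod z" for K
    proof -
     have K0: "K > 0" using K by (simp add: good_def)
     have pt: "G y * ct K y * ?ln y - comm (pK K) (lK K) z y - comm pp pl z y
      = (G y * ?ln y) * (ct K y - ps y) + (f y * ?ln y + ?D z y) - comm (pK K) (lK K) z y" for y
      unfolding f_def comm_def[of pp] by (simp add: algebra_simps)
     have fi: "integrable lborel (\<lambda>y. f y * ?ln y)" by (intro i1 z1)
     have "M * U z = (LINT y|lborel. (G y * ?ln y) * (ct K y - ps y) + (f y * ?ln y + ?D z y) - comm (pK K) (lK K) z y)"
      using mp[OF mp[OF spec[OF *] K(1)] conjI[OF K(2) z1(3)]]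
      unfolding pt M_def[symmetric] .
     also have "\<dots> = (LINT y|lborel. (G y * ?ln y) * (ct K y - ps y) + (f y * ?ln y + ?D z y)) - (LINT y|lborel. comm (pK K) (lK K) z y)"
      by (intro Bochner_Integration.integral_diff Bochner_Integration.integrable_add id fi i2 z1 comm_inner_expansion(1) K0 K)
     also have "(LINT y|lborel. (G y * ?ln y) * (ct K y - ps y) + (f y * ?ln y + ?D z y))
       = ?d K + (LINT y|lborel. f y * ?ln y + ?D z y)"
      by (rule Bochner_Integration.integral_add[OF id Bochner_Integration.integrable_add[OF fi i2[OF z1(3)]]])
     also have "(LINT y|lborel. f y * ?ln y + ?D z y) = (LINT y|lborel. f y * ?ln y) + (LINT y|lborel. ?D z y)"
      by (rule Bochner_Integration.integral_add[OF fi i2[OF z1(3)]])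
     finally show ?thesis unfolding comm_inner_expansion(2)[OF K0 K(2)] e2[OF z1(3)] .
    qed
    have "eventually (\<lambda>K. good K \<and> 2 * exp (- real K / 2) < cmod z) sequentially"
    proof -
     have "z / 2 \<noteq> 0" using z1 by simp
     from inner_cutoff_eventually_one[OF this] eventually_good show ?thesis
      by eventually_elim (auto simp: norm_divide)
    qed
    then have ev: "eventually (\<lambda>K. ?d K + ?X - ?E K = M * U z) sequentially"
     by eventually_elim (use eq in auto)
    have "(\<lambda>K. ?d K + ?X - ?E K) \<longlonglongrightarrow> 0 + ?X - (of_real (ln (cmod z)) * LI 0 - ?S z + 4 * 0)"
     by (intro tendsto_add tendsto_diff d0 E tendsto_const)
    moreover have "(\<lambda>K. ?d K + ?X - ?E K) \<longlonglongrightarrow> M * U z" by (rule tendsto_eventually[OF ev])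
    ultimately have "M * U z = 0 + ?X - (of_real (ln (cmod z)) * LI 0 - ?S z + 4 * 0)"
     by (rule LIMSEQ_unique[THEN sym])
    then show "M * U z = ?X - (of_real (ln (cmod z)) * LI 0 - ?S z)" by simp
   qed
  qed
 qed
 define g where "g y = f y * (1 / M)" for y
 have g: "potential n g z = potential n f z / M" for z
 proof -
  have "potential n g z = (LINT y|lborel. (1 / M) * (f y * of_real (kern n (z / y))))"
   unfolding potential_def g_def by (intro Bochner_Integration.integral_cong) auto
  also have "\<dots> = (1 / M) * potential n f z" unfolding potential_def by (rule integral_mult_right_zero)
  finally show ?thesis by simp
 qed
 \<comment> \<open>The Taylor polynomial of the potential is absorbed into the harmonic part; its
   antiholomorphic half enters ?B with conjugated coefficients.\<close>
 let ?A = "\<lambda>z. (A z + c + (\<Sum>m=1..n. h m * z ^ m)) / M" and ?B = "\<lambda>z. (B z + (\<Sum>m=1..n. cnj (h' m) * z ^ m)) / M"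
 let ?s = "singular_part n (- LI 0 / M) (\<lambda>m. LI m / (2 * of_nat m * M)) (\<lambda>m. LJ m / (2 * of_nat m * M))"
 show thesis
 proof (rule that[of g ?A ?B "- LI 0 / M" "\<lambda>m. LI m / (2 * of_nat m * M)" "\<lambda>m. LJ m / (2 * of_nat m * M)"])
  show "g \<in> borel_fun" unfolding g_def[abs_def] by measurable
  show "wnorm (- b) g < \<infinity>" unfolding g_def by (rule wnorm_cmult_finite[of _ "cmod (1 / M)"]) (use fw in auto)
  show "g y = 0" if "cmod y > 3 * R / 4" for y using fs[OF that] by (simp add: g_def)
  show "?A holomorphic_on ball 0 (R / 4)" "?B holomorphic_on ball 0 (R / 4)"
   using M by (intro holomorphic_intros AB; simp)+
  have M': "cnj M = M" by (simp add: M_def)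
  have "U z = ?s z + potential n g z + ?A z + cnj (?B z)" if z: "z \<noteq> 0" "cmod z < R / 4" and MU: "M * U z =
    (LINT y|lborel. f y * of_real (ln (cmod (y - z)))) + (A z + cnj (B z)) - (of_real (ln (cmod z)) * LI 0 - ?S z)" for z
  proof -
   have z1: "z \<noteq> 0" "cmod z \<le> 1" using z R by auto
   have S: "?S z = M * ((\<Sum>m=1..n. LI m / (2 * of_nat m * M) * (1 / z ^ m)) + (\<Sum>m=1..n. LJ m / (2 * of_nat m * M) * (1 / cnj z ^ m)))"
    unfolding sum.distrib[symmetric] sum_distrib_left using M
    by (intro sum.cong) (simp_all add: distrib_left mult.commute)
   have "M * U z = M * (?s z + potential n g z + ?A z + cnj (?B z))"
    unfolding MU e1[OF z1] S g singular_part_def using M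
    by (simp add: distrib_left right_diff_distrib add_divide_distrib M' mult.commute)
   then show ?thesis using M by (simp only: mult_cancel_left) simp
  qed
  then show "AE z in lborel. z \<noteq> 0 \<and> cmod z < R / 4 --> U z = ?s z + potential n g z + ?A z + cnj (?B z)"
   using main by (auto elim!: eventually_mono)
 qed
qed

end

section \<open>The closure in the local coordinate\<close>

lemma borel_measurable_off_0:
 fixes f :: "complex => complex"
 assumes "continuous_on (-{0}) f"
 shows "f \<in> borel_fun"
proof -
 have "(\<lambda>z. if z \<in> -{0} then f z else f 0) \<in> borel_fun"
  by (rule borel_measurable_continuous_on_if[OF _ assms]) auto
 moreover have "(\<lambda>z. if z \<in> -{0} then f z else f 0) = f" by auto
 ultimately show ?thesis by simp
qed

lemma planar_test_borel:
 assumes "f \<in> planar_test R"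
 shows "f \<in> borel_fun" "(\<lambda>z. d_z (d_zbar f) z) \<in> borel_fun"
proof -
 have s: "smooth_on (-{0}) f" using assms by (simp add: planar_test_def)
 have o: "open (-{0::complex})" by auto
 show "f \<in> borel_fun" by (intro borel_measurable_off_0 smooth_on_imp_continuous s)
 show "(\<lambda>z. d_z (d_zbar f) z) \<in> borel_fun"
  by (intro borel_measurable_off_0 smooth_on_imp_continuous smooth_on_d_z(1)[OF o] smooth_on_d_z(2)[OF o s])
qed

text \<open>The closure of the graph of the flat Laplacian on test functions of the punctured disc,
  in the weighted norms b and -b that correspond to L2 on the cone.\<close>

definition planar_closure :: "real => real => ((complex => complex) \<times> (complex => complex)) set" where
 "planar_closure b R = {(v, w). v \<in> borel_fun \<and> w \<in> borel_fun \<and>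
   wnorm b v < \<infinity> \<and> wnorm (- b) w < \<infinity> \<and>
   (\<forall>e>0. \<exists>f\<in>planar_test R. wnorm b (\<lambda>z. f z - v z) < e \<and> wnorm (- b) (\<lambda>z. 4 * d_z (d_zbar f) z - w z) < e)}"

lemma wnorm_triangle:
 assumes "f \<in> borel_fun" "g \<in> borel_fun" "h \<in> borel_fun"
 shows "wnorm s (\<lambda>z. f z - h z) \<le> 2 * wnorm s (\<lambda>z. f z - g z) + 2 * wnorm s (\<lambda>z. g z - h z)"
 using wnorm_add[of "\<lambda>z. f z - g z" "\<lambda>z. g z - h z" s] assms by simp

lemma ennreal_quarter: "e > 0 ==> \<exists>d>0. d \<noteq> top \<and> 2 * d + 2 * d \<le> (e::ennreal)"
proof (cases e)
 case (real r)
 assume "e > 0"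
 then have "r > 0" using real by simp
 then have "ennreal (r / 4) > 0" "2 * ennreal (r / 4) + 2 * ennreal (r / 4) = ennreal r"
  by (auto simp: ennreal_mult[symmetric] ennreal_plus[symmetric] ennreal_numeral[symmetric]
    simp del: ennreal_plus ennreal_numeral)
 then show ?thesis using real by (intro exI[of _ "ennreal (r / 4)"]) auto
next
 case top
 then show ?thesis by (intro exI[of _ 1]) auto
qed

lemma ennreal_double_less: "a < d ==> b < d ==> d \<noteq> top ==> 2 * d + 2 * d \<le> e ==> 2 * a + 2 * b < (e::ennreal)"
proof -
 assume *: "a < d" "b < d" "d \<noteq> top" "2 * d + 2 * d \<le> e"
 have "2 * a + 2 * b < 2 * d + 2 * d"
  using * by (intro add_strict_mono ennreal_mult_strict_left_mono) (auto simp: less_top)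
 then show ?thesis using *(4) by simp
qed

lemma planar_closure_limit:
 assumes vw: "v \<in> borel_fun" "w \<in> borel_fun" "wnorm b v < \<infinity>" "wnorm (- b) w < \<infinity>"
  and ap: "\<And>e. e > 0 ==> \<exists>(v', w')\<in>planar_closure b R. wnorm b (\<lambda>z. v' z - v z) < e \<and> wnorm (- b) (\<lambda>z. w' z - w z) < e"
 shows "(v, w) \<in> planar_closure b R"
 unfolding planar_closure_def
proof (simp only: mem_Collect_eq split_conv, intro conjI vw allI impI)
 fix e :: ennreal assume "e > 0"
 then obtain d where d: "d > 0" "d \<noteq> top" "2 * d + 2 * d \<le> e" using ennreal_quarter by blast
 obtain v' w' where v': "(v', w') \<in> planar_closure b R" "wnorm b (\<lambda>z. v' z - v z) < d" "wnorm (- b) (\<lambda>z. w' z - w z) < d"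
  using ap[OF d(1)] by blast
 have m: "v' \<in> borel_fun" "w' \<in> borel_fun" using v'(1) by (auto simp: planar_closure_def)
 obtain f where f: "f \<in> planar_test R" "wnorm b (\<lambda>z. f z - v' z) < d" "wnorm (- b) (\<lambda>z. 4 * d_z (d_zbar f) z - w' z) < d"
  using v'(1) d(1) unfolding planar_closure_def by blast
 have fm: "f \<in> borel_fun" "(\<lambda>z. 4 * d_z (d_zbar f) z) \<in> borel_fun"
  using planar_test_borel[OF f(1)] by auto
 show "\<exists>f\<in>planar_test R. wnorm b (\<lambda>z. f z - v z) < e \<and> wnorm (- b) (\<lambda>z. 4 * d_z (d_zbar f) z - w z) < e"
 proof (intro bexI[OF _ f(1)] conjI)
  show "wnorm b (\<lambda>z. f z - v z) < e"
   by (rule le_less_trans[OF wnorm_triangle[OF fm(1) m(1) vw(1)]]) (rule ennreal_double_less[OF f(2) v'(2) d(2,3)])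
  show "wnorm (- b) (\<lambda>z. 4 * d_z (d_zbar f) z - w z) < e"
   by (rule le_less_trans[OF wnorm_triangle[OF fm(2) m(2) vw(2)]]) (rule ennreal_double_less[OF f(3) v'(3) d(2,3)])
 qed
qed

lemma planar_closure_limit_seq:
 assumes "v \<in> borel_fun" "w \<in> borel_fun" "wnorm b v < \<infinity>" "wnorm (- b) w < \<infinity>"
  and "eventually (\<lambda>j. (v' j, w' j) \<in> planar_closure b R) sequentially"
  and "(\<lambda>j. wnorm b (\<lambda>z. v' j z - v z)) \<longlonglongrightarrow> 0" "(\<lambda>j. wnorm (- b) (\<lambda>z. w' j z - w z)) \<longlonglongrightarrow> 0"
 shows "(v, w) \<in> planar_closure b R"
proof (rule planar_closure_limit[OF assms(1-4)])
 fix e :: ennreal assume e: "e > 0"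
 have "eventually (\<lambda>j. (v' j, w' j) \<in> planar_closure b R \<and> wnorm b (\<lambda>z. v' j z - v z) < e \<and>
   wnorm (- b) (\<lambda>z. w' j z - w z) < e) sequentially"
  using assms(5) order_tendstoD(2)[OF assms(6) e] order_tendstoD(2)[OF assms(7) e] by eventually_elim auto
 then show "\<exists>(v', w')\<in>planar_closure b R. wnorm b (\<lambda>z. v' z - v z) < e \<and> wnorm (- b) (\<lambda>z. w' z - w z) < e"
  using eventually_happens'[OF sequentially_bot] by fast
qed

lemma planar_closure_add:
 assumes "(v, w) \<in> planar_closure b R" "(v', w') \<in> planar_closure b R"
 shows "(\<lambda>z. v z + v' z, \<lambda>z. w z + w' z) \<in> planar_closure b R"
proof -
 have m [measurable]: "v \<in> borel_fun" "w \<in> borel_fun" "v' \<in> borel_fun" "w' \<in> borel_fun"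
  and fin: "wnorm b v < \<infinity>" "wnorm (- b) w < \<infinity>" "wnorm b v' < \<infinity>" "wnorm (- b) w' < \<infinity>"
  using assms by (auto simp: planar_closure_def)
 have fin': "2 * x + 2 * y < \<infinity>" if "x < \<infinity>" "y < \<infinity>" for x y :: ennreal
  using that by (auto simp: ennreal_mult_less_top ennreal_add_less_top)
 have main: "\<exists>f\<in>planar_test R. wnorm b (\<lambda>z. f z - (v z + v' z)) < e \<and> wnorm (- b) (\<lambda>z. 4 * d_z (d_zbar f) z - (w z + w' z)) < e"
  if e0: "e > 0" for e
 proof -
  obtain d where d: "d > 0" "d \<noteq> top" "2 * d + 2 * d \<le> e" using ennreal_quarter[OF e0] by blast
  obtain f where f: "f \<in> planar_test R" "wnorm b (\<lambda>z. f z - v z) < d" "wnorm (- b) (\<lambda>z. 4 * d_z (d_zbar f) z - w z) < d"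
   using assms(1) d(1) unfolding planar_closure_def by blast
  obtain f' where f': "f' \<in> planar_test R" "wnorm b (\<lambda>z. f' z - v' z) < d" "wnorm (- b) (\<lambda>z. 4 * d_z (d_zbar f') z - w' z) < d"
   using assms(2) d(1) unfolding planar_closure_def by blast
  note [measurable] = planar_test_borel[OF f(1)] planar_test_borel[OF f'(1)]
  have o: "open (-{0::complex})" by auto
  have s: "smooth_on (-{0}) f" "smooth_on (-{0}) f'" using f(1) f'(1) by (auto simp: planar_test_def)
  obtain a r a' r' where ar: "a > 0" "r < R" "\<And>z. f z \<noteq> 0 ==> a \<le> cmod z \<and> cmod z \<le> r"
   "a' > 0" "r' < R" "\<And>z. f' z \<noteq> 0 ==> a' \<le> cmod z \<and> cmod z \<le> r'"
   using f(1) f'(1) unfolding planar_test_def by blast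
  have ff: "(\<lambda>z. f z + f' z) \<in> planar_test R"
  proof -
   have "smooth_on (-{0}) (\<lambda>z. f z + f' z)" by (rule smooth_on_add[OF o s])
   moreover have "min a a' \<le> cmod z \<and> cmod z \<le> max r r'" if "f z + f' z \<noteq> 0" for z
   proof -
    have "f z \<noteq> 0 \<or> f' z \<noteq> 0" using that by auto
    then show ?thesis using ar(3,6)[of z] by auto
   qed
   moreover have "min a a' > 0" "max r r' < R" using ar by auto
   ultimately show ?thesis unfolding planar_test_def by blast
  qed
  have dd: "d_z (d_zbar (\<lambda>z. f z + f' z)) z = d_z (d_zbar f) z + d_z (d_zbar f') z" if "z \<noteq> 0" for z
   using wirtinger2D(3)[OF o wirtinger2_add[OF wirtinger2_smooth[OF o s(1)] wirtinger2_smooth[OF o s(2)]], of z] that by auto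
  have "wnorm b (\<lambda>z. f z + f' z - (v z + v' z)) \<le> 2 * wnorm b (\<lambda>z. f z - v z) + 2 * wnorm b (\<lambda>z. f' z - v' z)"
   using wnorm_add[of "\<lambda>z. f z - v z" "\<lambda>z. f' z - v' z" b] by (simp add: algebra_simps)
  also have "\<dots> < e" by (rule ennreal_double_less[OF f(2) f'(2) d(2,3)])
  finally have 1: "wnorm b (\<lambda>z. f z + f' z - (v z + v' z)) < e" .
  have "wnorm (- b) (\<lambda>z. 4 * d_z (d_zbar (\<lambda>z. f z + f' z)) z - (w z + w' z))
   \<le> wnorm (- b) (\<lambda>z. (4 * d_z (d_zbar f) z - w z) + (4 * d_z (d_zbar f') z - w' z))"
  proof (rule wnorm_mono)
   fix z :: complex assume z: "z \<noteq> 0"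
   show "cmod (4 * d_z (d_zbar (\<lambda>z. f z + f' z)) z - (w z + w' z))
    \<le> cmod ((4 * d_z (d_zbar f) z - w z) + (4 * d_z (d_zbar f') z - w' z))"
    unfolding dd[OF z] by (simp add: algebra_simps)
  qed
  also have "\<dots> \<le> 2 * wnorm (- b) (\<lambda>z. 4 * d_z (d_zbar f) z - w z) + 2 * wnorm (- b) (\<lambda>z. 4 * d_z (d_zbar f') z - w' z)"
   by (rule wnorm_add) measurable
  also have "\<dots> < e" by (rule ennreal_double_less[OF f(3) f'(3) d(2,3)])
  finally have 2: "wnorm (- b) (\<lambda>z. 4 * d_z (d_zbar (\<lambda>z. f z + f' z)) z - (w z + w' z)) < e" .
  show ?thesis by (rule bexI[where x="\<lambda>z. f z + f' z"]) (rule conjI[OF 1 2], rule ff)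
 qed
 have "wnorm b (\<lambda>z. v z + v' z) < \<infinity>" "wnorm (- b) (\<lambda>z. w z + w' z) < \<infinity>"
  using le_less_trans[OF wnorm_add[OF m(1,3)] fin'[OF fin(1,3)]] le_less_trans[OF wnorm_add[OF m(2,4)] fin'[OF fin(2,4)]] by auto
 then show ?thesis using main m by (simp add: planar_closure_def)
qed

lemma wnorm_0: "wnorm s (\<lambda>z. 0) = 0" by (simp add: wnorm_def)

lemma wnorm_cong: "(\<And>z. z \<noteq> 0 ==> f z = g z) ==> wnorm s f = wnorm s g"
 by (intro antisym wnorm_mono) auto

text \<open>A planar test function together with any formula for its Laplacian off the origin.\<close>

lemma planar_test_in_closure:
 assumes f: "f \<in> planar_test R" and w: "w \<in> borel_fun" "\<And>z. z \<noteq> 0 ==> w z = 4 * d_z (d_zbar f) z"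
  and fin: "wnorm b f < \<infinity>" "wnorm (- b) w < \<infinity>"
 shows "(f, w) \<in> planar_closure b R"
proof -
 have "wnorm b (\<lambda>z. f z - f z) = 0" by (simp add: wnorm_0)
 moreover have "wnorm (- b) (\<lambda>z. 4 * d_z (d_zbar f) z - w z) = wnorm (- b) (\<lambda>z. 0)"
  by (rule wnorm_cong) (simp add: w(2))
 ultimately show ?thesis
  using planar_test_borel[OF f] w f fin by (auto simp: planar_closure_def wnorm_0 intro!: bexI[OF _ f])
qed

lemma wnorm_bounded_finite:
 assumes [measurable]: "h \<in> borel_fun" and a: "a > 0"
  and h: "\<And>z. cmod (h z) \<le> C" "\<And>z. cmod z < a \<or> cmod z > 1 ==> h z = 0"
 shows "wnorm s h < \<infinity>"
proof -
 have C: "C \<ge> 0" using order_trans[OF norm_ge_zero h(1)] .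
 define D where "D = C^2 * max 1 (a powr (2 * s))"
 have "wnorm s h \<le> (\<integral>\<^sup>+z. ennreal D * indicator (cball (0::complex) 1) z \<partial>lborel)"
  unfolding wnorm_def
 proof (rule nn_integral_mono)
  fix z
  show "ennreal ((cmod (h z))^2 * cmod z powr (2 * s)) \<le> ennreal D * indicator (cball 0 1) z"
  proof (cases "cmod z < a \<or> cmod z > 1")
   case False
   then have z: "a \<le> cmod z" "cmod z \<le> 1" by auto
   have "cmod z powr (2 * s) \<le> max 1 (a powr (2 * s))"
   proof (cases "s \<ge> 0")
    case True
    then have "cmod z powr (2 * s) \<le> 1 powr (2 * s)" using z by (intro powr_mono2) auto
    then show ?thesis by simp
   next
    case False
    then have "cmod z powr (2 * s) \<le> a powr (2 * s)" using z a by (intro powr_mono2') auto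
    then show ?thesis by simp
   qed
   moreover have "(cmod (h z))^2 \<le> C^2" by (intro power_mono h) auto
   ultimately have "(cmod (h z))^2 * cmod z powr (2 * s) \<le> D" unfolding D_def by (intro mult_mono) auto
   then show ?thesis using z by (simp add: ennreal_leI)
  next
   case True
   from h(2)[OF this] show ?thesis by simp
  qed
 qed
 also have "\<dots> = ennreal D * emeasure lborel (cball (0::complex) 1)" by (rule nn_integral_cmult_indicator) simp
 also have "\<dots> < \<infinity>" by (simp add: emeasure_cball_complex ennreal_mult_less_top)
 finally show ?thesis .
qed

lemma wnorm_bounded_finite':
 assumes [measurable]: "h \<in> borel_fun" and s: "s > -1"
  and h: "\<And>z. cmod (h z) \<le> C" "\<And>z. cmod z > 1 ==> h z = 0"
 shows "wnorm s h < \<infinity>"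
proof -
 have "wnorm s h \<le> (\<integral>\<^sup>+z. ennreal (C^2) * (ennreal (cmod z powr - (- 2 * s)) * indicator (cball 0 1) z) \<partial>lborel)"
  unfolding wnorm_def
 proof (rule nn_integral_mono)
  fix z
  show "ennreal ((cmod (h z))^2 * cmod z powr (2 * s)) \<le> ennreal (C^2) * (ennreal (cmod z powr - (- 2 * s)) * indicator (cball 0 1) z)"
  proof (cases "cmod z > 1")
   case False
   have "(cmod (h z))^2 \<le> C^2" by (intro power_mono h) auto
   then have "(cmod (h z))^2 * cmod z powr (2 * s) \<le> C^2 * cmod z powr (2 * s)" by (intro mult_right_mono) auto
   then show ?thesis using False by (simp add: ennreal_leI flip: ennreal_mult)
  next
   case True
   from h(2)[OF this] show ?thesis by simp
  qed
 qed
 also have "\<dots> = ennreal (C^2) * (\<integral>\<^sup>+z\<in>cball 0 1. ennreal (cmod z powr - (- 2 * s)) \<partial>lborel)"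
  by (rule nn_integral_cmult) measurable
 also have "\<dots> < \<infinity>" using nn_integral_powr_finite[of "- 2 * s" 1] s by (simp add: ennreal_mult_less_top)
 finally show ?thesis .
qed

lemma inner_cutoff_le_1: "cmod (inner_cutoff K z) \<le> 1" by (rule log_cutoff_norm_le)

text \<open>Cutting off at the cone point: the commutator terms vanish in the limit because of the factor
 \<open>1/K\<close> gained by the logarithmic cut-off.\<close>

lemma planar_closure_inner_limit:
 assumes bn: "b \<le> real n" and b: "b > -1" and a: "a > 0" "a \<le> 1"
  and [measurable]: "f \<in> borel_fun" "p \<in> borel_fun" "q \<in> borel_fun" "w \<in> borel_fun"
  and fin: "wnorm b f < \<infinity>" "wnorm (- b) w < \<infinity>"
  and bd: "\<And>z. cmod z < a ==> z \<noteq> 0 ==> cmod (f z) \<le> C * cmod z ^ (n + 1) \<and> cmod (p z) \<le> C * cmod z ^ n \<and> cmod (q z) \<le> C * cmod z ^ n"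
  and ap: "\<And>K. K > 0 ==> (\<lambda>z. inner_cutoff K z * f z, \<lambda>z. inner_cutoff K z * w z +
   4 * (inner_cutoff_p K z * q z + cnj (inner_cutoff_p K z) * p z + inner_cutoff_l K z * f z)) \<in> planar_closure b R"
 shows "(f, w) \<in> planar_closure b R"
proof -
 let ?rest = "\<lambda>K z. 4 * (inner_cutoff_p K z * q z + cnj (inner_cutoff_p K z) * p z + inner_cutoff_l K z * f z)"
 have ic2: "cmod (inner_cutoff K z - 1) \<le> 2" for K z
  using norm_triangle_ineq4[of "inner_cutoff K z" 1] inner_cutoff_le_1[of K z] by simp
 have lim0: "AE z in lborel. (\<lambda>K. h z * (inner_cutoff K z - 1)) \<longlonglongrightarrow> 0" for h :: "complex => complex"
  using AE_lborel_singleton[of "0::complex"]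
 proof eventually_elim
  fix z :: complex assume "z \<noteq> 0"
  then have "(\<lambda>K. h z * (inner_cutoff K z - 1)) \<longlonglongrightarrow> h z * (1 - 1)" by (intro tendsto_intros inner_cutoff_tendsto)
  then show "(\<lambda>K. h z * (inner_cutoff K z - 1)) \<longlonglongrightarrow> 0" by simp
 qed
 have ic_lim: "(\<lambda>K. wnorm s (\<lambda>z. h z * (inner_cutoff K z - 1))) \<longlonglongrightarrow> 0"
  if [measurable]: "h \<in> borel_fun" and hf: "wnorm s h < \<infinity>" for h s
 proof (rule wnorm_tendsto_0[where h="\<lambda>z. h z * 2", OF _ _ _ _ lim0])
  show "wnorm s (\<lambda>z. h z * 2) < \<infinity>" by (rule wnorm_cmult_finite[of _ 2]) (use hf in auto)
  show "AE z in lborel. cmod (h z * (inner_cutoff K z - 1)) \<le> cmod (h z * 2)" for K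
   using ic2 by (auto simp: norm_mult intro!: mult_left_mono AE_I2)
 qed measurable
 have rest_lim: "(\<lambda>K. wnorm (- b) (?rest K)) \<longlonglongrightarrow> 0"
 proof -
  obtain C' where C': "C' > 0" "\<And>k a z. cmod (log_cutoff_p k a z) \<le> C' * \<bar>k\<bar> / cmod z"
   "\<And>k a z. cmod (log_cutoff_l k a z) \<le> C' * k^2 / (cmod z)^2" using log_cutoff_derivatives_bound by blast
  \<comment> \<open>The factor 4 times three commutator terms, each at most C' |C| / K times
    |z|^(n-1).\<close>
  define D where "D = 12 * C' * \<bar>C\<bar>"
  let ?c = "\<lambda>K. ennreal (D^2 * (pi * exp 2 * (real K + 1)) / (real K)^2)"
  have bnd: "wnorm (- b) (?rest K) \<le> ?c K" if K: "K > 0" "exp (- real K / 2) < a" for K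
  proof -
   have supp: "exp (- real K) < cmod z \<and> cmod z < exp (- real K / 2)" if "?rest K z \<noteq> 0" for z
   proof -
    have "\<not> cmod z \<le> exp (- real K)" "\<not> exp (- real K / 2) \<le> cmod z"
     using that inner_cutoff_zero[OF K(1), of z] inner_cutoff_one[OF K(1), of z] by auto
    then show ?thesis by linarith
   qed
   have le: "cmod (?rest K z) \<le> D / real K * cmod z powr (real n - 1)" for z
   proof (cases "?rest K z = 0")
    case False
    note s = supp[OF False]
    then have x: "cmod z > 0" by (meson exp_gt_zero less_trans)
    then have "z \<noteq> 0" "cmod z < a" using s K by auto
    note B = bd[OF this(2,1)]
    have B': "cmod (f z) \<le> \<bar>C\<bar> * cmod z ^ (n + 1)" "cmod (p z) \<le> \<bar>C\<bar> * cmod z ^ n" "cmod (q z) \<le> \<bar>C\<bar> * cmod z ^ n"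
     using B by (auto intro: order_trans[OF _ mult_right_mono[OF abs_ge_self]])
    have pw: "cmod z ^ n / cmod z = cmod z powr (real n - 1)" using x by (simp add: powr_diff powr_realpow)
    have K1: "1 \<le> real K" using K by simp
    have ip: "cmod (inner_cutoff_p K z) \<le> C' / real K / cmod z" using C'(2)[of "1 / real K" 2 z] by simp
    have il: "cmod (inner_cutoff_l K z) \<le> C' / real K / (cmod z)^2"
    proof -
     have "(1 / real K)^2 \<le> 1 / real K" using K1 by (simp add: power2_eq_square field_simps)
     then have "C' * (1 / real K)^2 / (cmod z)^2 \<le> C' * (1 / real K) / (cmod z)^2"
      using C'(1) by (intro divide_right_mono mult_left_mono) auto
     then show ?thesis using C'(3)[of "1 / real K" 2 z] by simp
    qed
    have P: "cmod (inner_cutoff_p K z) * y \<le> C' * \<bar>C\<bar> / real K * cmod z powr (real n - 1)" if "y \<le> \<bar>C\<bar> * cmod z ^ n" "0 \<le> y" for y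
    proof -
     have "cmod (inner_cutoff_p K z) * y \<le> (C' / real K / cmod z) * (\<bar>C\<bar> * cmod z ^ n)"
      using C'(1) that by (intro mult_mono ip) auto
     also have "\<dots> = C' * \<bar>C\<bar> / real K * (cmod z ^ n / cmod z)" by simp
     finally show ?thesis unfolding pw .
    qed
    have L: "cmod (inner_cutoff_l K z) * cmod (f z) \<le> C' * \<bar>C\<bar> / real K * cmod z powr (real n - 1)"
    proof -
     have "cmod (inner_cutoff_l K z) * cmod (f z) \<le> (C' / real K / (cmod z)^2) * (\<bar>C\<bar> * cmod z ^ (n + 1))"
      using C'(1) B' by (intro mult_mono il) auto
     also have "\<dots> = C' * \<bar>C\<bar> / real K * (cmod z ^ n / cmod z)" using x by (simp add: power2_eq_square)
     finally show ?thesis unfolding pw .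
    qed
    have "cmod (?rest K z) = 4 * cmod (inner_cutoff_p K z * q z + cnj (inner_cutoff_p K z) * p z + inner_cutoff_l K z * f z)"
     unfolding norm_mult[of 4] by simp
    also have "cmod (inner_cutoff_p K z * q z + cnj (inner_cutoff_p K z) * p z + inner_cutoff_l K z * f z)
     \<le> cmod (inner_cutoff_p K z * q z) + cmod (cnj (inner_cutoff_p K z) * p z) + cmod (inner_cutoff_l K z * f z)"
     by (intro norm_triangle_le add_right_mono norm_triangle_ineq)
    also have "\<dots> = cmod (inner_cutoff_p K z) * cmod (q z) + cmod (inner_cutoff_p K z) * cmod (p z) + cmod (inner_cutoff_l K z) * cmod (f z)"
     by (simp only: norm_mult complex_mod_cnj)
    also have "\<dots> \<le> C' * \<bar>C\<bar> / real K * cmod z powr (real n - 1) + C' * \<bar>C\<bar> / real K * cmod z powr (real n - 1) + C' * \<bar>C\<bar> / real K * cmod z powr (real n - 1)"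
     using B' by (intro add_mono P L) auto
    finally show ?thesis by (simp add: D_def field_simps)
   qed (use C' in \<open>simp add: D_def\<close>)
   have "wnorm (- b) (?rest K) = (\<integral>\<^sup>+z. ennreal ((cmod (?rest K z))^2 * cmod z powr (2 * - b)) \<partial>lborel)" by (simp add: wnorm_def)
   also have "\<dots> \<le> ?c K"
   proof (rule shell_square_integral[OF bn K(1)])
    show "\<bar>cmod (?rest K z)\<bar> \<le> D / real K * cmod z powr (real n - 1)" for z using le by simp
    show "exp (- real K) \<le> cmod z \<and> cmod z \<le> 1" if "cmod (?rest K z) \<noteq> 0" for z
     using supp[of z] that K a by auto
   qed
   finally show ?thesis .
  qed
  have a0: "complex_of_real a \<noteq> 0" using a by simp
  have E: "eventually (\<lambda>K. wnorm (- b) (?rest K) \<le> ?c K) sequentially"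
   using inner_cutoff_eventually_one[OF a0] eventually_gt_at_top[of 0]
   by eventually_elim (rule bnd, use a in auto)
  show ?thesis by (rule tendsto_sandwich[OF _ E tendsto_const shell_constant_tendsto]) simp
 qed
 show ?thesis
 proof (rule planar_closure_limit_seq[OF _ _ fin])
  show "eventually (\<lambda>K. (\<lambda>z. inner_cutoff K z * f z, \<lambda>z. inner_cutoff K z * w z + ?rest K z) \<in> planar_closure b R) sequentially"
   using eventually_gt_at_top[of 0] by eventually_elim (rule ap)
  have "(\<lambda>z. inner_cutoff K z * f z - f z) = (\<lambda>z. f z * (inner_cutoff K z - 1))" for K by (simp add: algebra_simps)
  then show "(\<lambda>K. wnorm b (\<lambda>z. inner_cutoff K z * f z - f z)) \<longlonglongrightarrow> 0" using ic_lim[OF _ fin(1)] by simp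
  have le: "wnorm (- b) (\<lambda>z. inner_cutoff K z * w z + ?rest K z - w z) \<le> 2 * wnorm (- b) (\<lambda>z. w z * (inner_cutoff K z - 1)) + 2 * wnorm (- b) (?rest K)" for K
  proof -
   have eq: "(\<lambda>z. inner_cutoff K z * w z + ?rest K z - w z) = (\<lambda>z. w z * (inner_cutoff K z - 1) + ?rest K z)"
    by (simp add: algebra_simps)
   show ?thesis unfolding eq by (rule wnorm_add) measurable
  qed
  have w0: "(\<lambda>K. wnorm (- b) (\<lambda>z. w z * (inner_cutoff K z - 1))) \<longlonglongrightarrow> 0" by (rule ic_lim[OF _ fin(2)]) measurable
  have "(\<lambda>K. 2 * wnorm (- b) (\<lambda>z. w z * (inner_cutoff K z - 1)) + 2 * wnorm (- b) (?rest K)) \<longlonglongrightarrow> 2 * 0 + 2 * 0"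
   by (intro tendsto_add ennreal_tendsto_cmult w0 rest_lim) auto
  then have S: "(\<lambda>K. 2 * wnorm (- b) (\<lambda>z. w z * (inner_cutoff K z - 1)) + 2 * wnorm (- b) (?rest K)) \<longlonglongrightarrow> 0" by simp
  show "(\<lambda>K. wnorm (- b) (\<lambda>z. inner_cutoff K z * w z + ?rest K z - w z)) \<longlonglongrightarrow> 0"
   by (rule tendsto_sandwich[OF _ _ tendsto_const S]) (use le in auto)
 qed measurable
qed

lemma wirtinger2_cong_open:
 assumes "open S" "wirtinger2 S f p q l" "\<And>z. z \<in> S ==> f' z = f z" "\<And>z. z \<in> S ==> p' z = p z"
  "\<And>z. z \<in> S ==> q' z = q z" "\<And>z. z \<in> S ==> l' z = l z"
 shows "wirtinger2 S f' p' q' l'"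
 unfolding wirtinger2_def
proof (intro ballI conjI)
 fix z assume z: "z \<in> S"
 have "has_wirtinger f (p z) (q z) z" using assms(2) z by (simp add: wirtinger2_def)
 then show "has_wirtinger f' (p' z) (q' z) z"
  using has_wirtinger_cong[OF assms(1) z, of f f'] assms z by simp
 obtain m where "has_wirtinger q (l z) m z" using assms(2) z by (auto simp: wirtinger2_def)
 then show "\<exists>m. has_wirtinger q' (l' z) m z"
  using has_wirtinger_cong[OF assms(1) z, of q q'] assms z by auto
qed

lemma wirtinger2_Un: "wirtinger2 S f p q l ==> wirtinger2 T f p q l ==> wirtinger2 (S \<union> T) f p q l"
 by (auto simp: wirtinger2_def)

lemma smooth_on_local:
 assumes "\<And>z. z \<in> S ==> \<exists>T. open T \<and> z \<in> T \<and> smooth_on T f"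
 shows "smooth_on S f"
 unfolding smooth_on_def using assms by (meson smooth_on_def times_differentiable_on_local)

lemma smooth_on_cong: "open S ==> smooth_on S f ==> (\<And>z. z \<in> S ==> f z = g z) ==> smooth_on S g"
 unfolding smooth_on_def using times_differentiable_on_cong by blast

lemma planar_test_wnorm_finite:
 assumes f: "f \<in> planar_test R" and R: "R \<le> 1"
 shows "wnorm s f < \<infinity>" "wnorm s (\<lambda>z. 4 * d_z (d_zbar f) z) < \<infinity>"
proof -
 obtain a r where ar: "a > 0" "r < R" "\<And>z. f z \<noteq> 0 ==> a \<le> cmod z \<and> cmod z \<le> r"
  and sm: "smooth_on (-{0}) f" using f unfolding planar_test_def by blast
 have o: "open (-{0::complex})" by auto
 note [measurable] = planar_test_borel[OF f]
 define h where "h z = (if z = 0 then 0 else 4 * d_z (d_zbar f) z)" for z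
 have [measurable]: "h \<in> borel_fun" unfolding h_def[abs_def] by measurable
 have z0: "d_z (d_zbar f) z = 0" if "cmod z < a \<or> cmod z > r" for z
 proof -
  let ?S = "{z. cmod z < a} \<union> {z. r < cmod z}"
  have S: "open ?S" by (intro open_Un open_Collect_less continuous_intros)
  have "wirtinger2 ?S f (\<lambda>_. 0) (\<lambda>_. 0) (\<lambda>_. 0)"
   by (rule wirtinger2_cong_open[OF S wirtinger2_const[of ?S 0]]) (use ar(3) in force)+
  from wirtinger2D(3)[OF S this, of z] show ?thesis using that by auto
 qed
 let ?A = "cball 0 r - ball (0::complex) a"
 have cA: "compact ?A" by (intro compact_diff) auto
 have A0: "?A \<subseteq> -{0}" using ar(1) by auto
 have bounded: "\<exists>C. \<forall>z. cmod (k z) \<le> C" if "continuous_on (-{0}) k" "\<And>z. cmod z < a \<or> cmod z > r ==> k z = 0" for k :: "complex => complex"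
 proof -
  have "bounded (k ` ?A)" by (intro compact_imp_bounded compact_continuous_image[OF _ cA] continuous_on_subset[OF that(1) A0])
  then obtain C where C: "\<And>z. z \<in> ?A ==> cmod (k z) \<le> C" unfolding bounded_iff by blast
  have "cmod (k z) \<le> \<bar>C\<bar>" for z
   using C[of z] that(2)[of z] by (cases "cmod z < a \<or> cmod z > r") auto
  then show ?thesis by blast
 qed
 have f0: "f z = 0" if "cmod z < a \<or> cmod z > r" for z using ar(3)[of z] that by (cases "f z = 0") auto
 obtain C where C: "\<And>z. cmod (f z) \<le> C" using bounded[OF smooth_on_imp_continuous[OF sm] f0] by blast
 show "wnorm s f < \<infinity>" by (rule wnorm_bounded_finite[OF _ ar(1) C]) (use f0 ar R in auto)
 have "continuous_on (-{0}) (\<lambda>z. 4 * d_z (d_zbar f) z)"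
  by (intro continuous_intros smooth_on_imp_continuous smooth_on_d_z(1)[OF o] smooth_on_d_z(2)[OF o sm])
 then have "continuous_on (-{0}) h" by (rule continuous_on_eq) (simp add: h_def)
 moreover have h0: "h z = 0" if "cmod z < a \<or> cmod z > r" for z using z0[OF that] by (simp add: h_def)
 ultimately obtain C' where C': "\<And>z. cmod (h z) \<le> C'" using bounded[of h] by blast
 have "wnorm s h < \<infinity>" by (rule wnorm_bounded_finite[OF _ ar(1) C']) (use h0 ar R in auto)
 moreover have "wnorm s (\<lambda>z. 4 * d_z (d_zbar f) z) = wnorm s h" by (rule wnorm_cong) (simp add: h_def)
 ultimately show "wnorm s (\<lambda>z. 4 * d_z (d_zbar f) z) < \<infinity>" by simp
qed

lemma planar_test_in_closure':
 assumes f: "f \<in> planar_test R" and R: "R \<le> 1" and w: "w \<in> borel_fun" "\<And>z. z \<noteq> 0 ==> w z = 4 * d_z (d_zbar f) z"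
 shows "(f, w) \<in> planar_closure b R"
proof (rule planar_test_in_closure[OF f w planar_test_wnorm_finite(1)[OF f R]])
 have "wnorm (- b) w = wnorm (- b) (\<lambda>z. 4 * d_z (d_zbar f) z)" by (rule wnorm_cong) (rule w(2))
 then show "wnorm (- b) w < \<infinity>" using planar_test_wnorm_finite(2)[OF f R] by simp
qed auto

text \<open>For harmonic F the Laplacian of the outer cut-off times F consists of commutator terms
  only, which are bounded and live away from 0. The order of vanishing at 0 is what
  \<open>planar_closure_inner_limit\<close> asks for.\<close>

lemma harmonic_cutoff_in_planar_closure:
 fixes F p q :: "complex => complex"
 assumes bn: "b \<le> real n" "b > -1" and r: "0 < r" "r < R" "R \<le> 1"
  and F: "smooth_on (ball 0 r - {0}) F" "wirtinger2 (ball 0 r - {0}) F p q (\<lambda>_. 0)"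
  and cont: "continuous_on (ball 0 r) p" "continuous_on (ball 0 r) q" "continuous_on (ball 0 r) F"
  and bd: "\<And>z. cmod z \<le> r / 2 ==> cmod (F z) \<le> C * cmod z ^ (n + 1) \<and> cmod (p z) \<le> C * cmod z ^ n \<and> cmod (q z) \<le> C * cmod z ^ n"
 shows "\<exists>v w. (v, w) \<in> planar_closure b R \<and> (\<forall>z. z \<noteq> 0 \<and> cmod z \<le> r / 4 --> v z = F z)"
proof -
 interpret radial_cutoff "r / 4" "r / 2" by unfold_locales (use r in auto)
 have rr: "0 < r / 4" using r by simp
 obtain D where D: "\<And>z. cmod (pp z) \<le> D" "\<And>z. cmod (pl z) \<le> D" by (rule pp_bound) blast
 \<comment> \<open>F, p and q are given on the disc only. Extension by 0 makes them total and
   measurable and leaves their products with the cut-off intact, since that vanishes for |z| \<ge>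
   r/2.\<close>
 define ext where "ext h z = (if z \<in> ball 0 r then h z else 0)" for h :: "complex => complex" and z
 have ext_m: "ext h \<in> borel_fun" if "continuous_on (ball 0 r) h" for h
  unfolding ext_def[abs_def] by (rule borel_measurable_continuous_on_if[OF _ that]) auto
 note [measurable] = ext_m[OF cont(1)] ext_m[OF cont(2)] ext_m[OF cont(3)]
 define f where "f z = ps z * ext F z" for z
 define fp where "fp z = ps z * ext p z + pp z * ext F z" for z
 define fq where "fq z = ps z * ext q z + cnj (pp z) * ext F z" for z
 define fl where "fl z = ps z * 0 + pp z * ext q z + cnj (pp z) * ext p z + pl z * ext F z" for z
 have [measurable]: "f \<in> borel_fun" "fp \<in> borel_fun" "fq \<in> borel_fun" "fl \<in> borel_fun"
  unfolding f_def[abs_def] fp_def[abs_def] fq_def[abs_def] fl_def[abs_def] by measurable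
 let ?B = "ball 0 r - {0::complex}" and ?E = "{z::complex. r / 2 < cmod z}"
 have oB: "open ?B" by (intro open_Diff) auto
 have oE: "open ?E" by (intro open_Collect_less continuous_intros)
 have o: "open (-{0::complex})" by auto
 have cover: "-{0} = ?B \<union> ?E"
 proof -
  have "cmod z < r \<or> r / 2 < cmod z" for z :: complex using r by linarith
  then show ?thesis using r by auto
 qed
 have fW: "wirtinger2 (-{0}) f fp fq fl"
  unfolding cover
 proof (rule wirtinger2_Un)
  show "wirtinger2 ?B f fp fq fl"
   by (rule wirtinger2_cong_open[OF oB wirtinger2_mult[OF wirtinger2_subset[OF psW] F(2)]])
    (auto simp: f_def fp_def fq_def fl_def ext_def)
  show "wirtinger2 ?E f fp fq fl"
   by (rule wirtinger2_cong_open[OF oE wirtinger2_const[of ?E 0]]) (auto simp: f_def fp_def fq_def fl_def zero)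
 qed
 have fS: "smooth_on (-{0}) f"
 proof (rule smooth_on_local)
  fix z :: complex assume "z \<in> -{0}"
  then consider "z \<in> ?B" | "z \<in> ?E" using cover by blast
  then show "\<exists>T. open T \<and> z \<in> T \<and> smooth_on T f"
  proof cases
   case 1
   have "smooth_on ?B f"
    by (rule smooth_on_cong[OF oB smooth_on_mult[OF oB smooth_on_subset[OF ps_smooth] F(1)]]) (auto simp: f_def ext_def)
   then show ?thesis using oB 1 by blast
  next
   case 2
   have "smooth_on ?E (\<lambda>_. 0::complex)"
    unfolding smooth_on_def by (intro allI times_differentiable_on_const oE)
   then have "smooth_on ?E f" by (rule smooth_on_cong[OF oE]) (simp add: f_def zero)
   then show ?thesis using oE 2 by blast
  qed
 qed
 have ext_bd: "cmod (ext F z) \<le> \<bar>C\<bar>" "cmod (ext p z) \<le> \<bar>C\<bar>" "cmod (ext q z) \<le> \<bar>C\<bar>" if z: "cmod z \<le> r / 2" for z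
 proof -
  have "cmod z ^ k \<le> 1" for k using z r by (intro power_le_one) auto
  then have "C * cmod z ^ k \<le> \<bar>C\<bar> * 1" for k
   by (intro order_trans[OF mult_right_mono[OF abs_ge_self] mult_left_mono]) auto
  then have "cmod (F z) \<le> \<bar>C\<bar>" "cmod (p z) \<le> \<bar>C\<bar>" "cmod (q z) \<le> \<bar>C\<bar>"
   using bd[OF z] by (metis mult_1_right order_trans)+
  then show "cmod (ext F z) \<le> \<bar>C\<bar>" "cmod (ext p z) \<le> \<bar>C\<bar>" "cmod (ext q z) \<le> \<bar>C\<bar>" by (auto simp: ext_def)
 qed
 have fb: "cmod (f z) \<le> \<bar>C\<bar>" for z
 proof (cases "cmod z \<le> r / 2")
  case True
  have "cmod (f z) \<le> 1 * \<bar>C\<bar>" unfolding f_def norm_mult by (intro mult_mono ps1 ext_bd True) auto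
  then show ?thesis by simp
 qed (simp add: f_def zero)
 have D0: "D \<ge> 0" using order_trans[OF norm_ge_zero D(1)] .
 have flb: "cmod (4 * fl z) \<le> 4 * (D * \<bar>C\<bar> + D * \<bar>C\<bar> + D * \<bar>C\<bar>)" for z
 proof (cases "cmod z \<le> r / 2")
  case True
  have "cmod (fl z) \<le> cmod (pp z * ext q z) + cmod (cnj (pp z) * ext p z) + cmod (pl z * ext F z)"
   unfolding fl_def by (simp add: norm_triangle_le norm_triangle_ineq)
  also have "\<dots> \<le> D * \<bar>C\<bar> + D * \<bar>C\<bar> + D * \<bar>C\<bar>"
   unfolding norm_mult complex_mod_cnj by (intro add_mono mult_mono D ext_bd True D0) auto
  finally show ?thesis unfolding norm_mult by simp
 qed (use D0 in \<open>simp add: fl_def zero\<close>)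
 have fl0: "fl z = 0" if "cmod z < r / 4 \<or> cmod z > 1" for z
 proof (cases "cmod z < r / 4")
  case True
  then show ?thesis using one[of z] at0 by (cases "z = 0") (auto simp: fl_def)
 next
  case False
  then have "r / 2 \<le> cmod z" using that r by linarith
  then show ?thesis by (simp add: fl_def zero)
 qed
 have "(f, \<lambda>z. 4 * fl z) \<in> planar_closure b R"
 proof (rule planar_closure_inner_limit[where a="r / 4" and p=fp and q=fq and C=C, OF bn(1,2)])
  show "wnorm b f < \<infinity>" by (rule wnorm_bounded_finite'[OF _ bn(2) fb]) (use r in \<open>auto simp: f_def intro!: zero\<close>)
  show "wnorm (- b) (\<lambda>z. 4 * fl z) < \<infinity>" by (rule wnorm_bounded_finite[OF _ rr flb]) (auto simp: fl0)
  show "cmod (f z) \<le> C * cmod z ^ (n + 1) \<and> cmod (fp z) \<le> C * cmod z ^ n \<and> cmod (fq z) \<le> C * cmod z ^ n"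
   if "cmod z < r / 4" "z \<noteq> 0" for z
   using that bd[of z] one[of z] r by (auto simp: f_def fp_def fq_def ext_def)
  fix K :: nat assume K: "K > 0"
  have W: "wirtinger2 (-{0}) (\<lambda>z. inner_cutoff K z * f z) (\<lambda>z. inner_cutoff K z * fp z + inner_cutoff_p K z * f z)
    (\<lambda>z. inner_cutoff K z * fq z + cnj (inner_cutoff_p K z) * f z)
    (\<lambda>z. inner_cutoff K z * fl z + inner_cutoff_p K z * fq z + cnj (inner_cutoff_p K z) * fp z + inner_cutoff_l K z * f z)"
   by (rule wirtinger2_mult[OF wirtinger2_log_cutoff' fW])
  show "(\<lambda>z. inner_cutoff K z * f z, \<lambda>z. inner_cutoff K z * (4 * fl z) +
   4 * (inner_cutoff_p K z * fq z + cnj (inner_cutoff_p K z) * fp z + inner_cutoff_l K z * f z)) \<in> planar_closure b R"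
  proof (rule planar_test_in_closure'[OF _ r(3)])
   have "exp (- real K) \<le> cmod z \<and> cmod z \<le> r / 2" if "inner_cutoff K z * f z \<noteq> 0" for z
   proof -
    have "\<not> cmod z \<le> exp (- real K)" "\<not> r / 2 \<le> cmod z"
     using that inner_cutoff_zero(1)[OF K, of z] zero(1)[of z] by (auto simp: f_def)
    then show ?thesis by linarith
   qed
   moreover have "smooth_on (-{0}) (\<lambda>z. inner_cutoff K z * f z)" by (rule smooth_on_mult[OF o log_cutoff_smooth fS])
   moreover have "r / 2 < R" using r by linarith
   ultimately show "(\<lambda>z. inner_cutoff K z * f z) \<in> planar_test R"
    unfolding planar_test_def using exp_gt_zero by blast
   fix z :: complex assume "z \<noteq> 0"
   then show "inner_cutoff K z * (4 * fl z) + 4 * (inner_cutoff_p K z * fq z + cnj (inner_cutoff_p K z) * fp z + inner_cutoff_l K z * f z)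
    = 4 * d_z (d_zbar (\<lambda>z. inner_cutoff K z * f z)) z"
    using wirtinger2D(3)[OF o W, of z] by (simp add: algebra_simps)
  qed measurable
 qed (use r in auto)
 moreover have "f z = F z" if "z \<noteq> 0 \<and> cmod z \<le> r / 4" for z
  using that r one[of z] by (auto simp: f_def ext_def)
 ultimately show ?thesis by blast
qed

text \<open>Taylor tails are harmonic, vanish to order n + 1 and have derivative of order n, so
  \<open>harmonic_cutoff_in_planar_closure\<close> applies to them and to their conjugates.\<close>

lemma holomorphic_tail_in_planar_closure:
 fixes A :: "complex => complex"
 assumes bn: "b \<le> real n" "b > -1" and r: "0 < r" "r < R" "R \<le> 1" and A: "A holomorphic_on ball 0 r"
 shows "\<exists>v w. (v, w) \<in> planar_closure b R \<and> (\<forall>z. z \<noteq> 0 \<and> cmod z \<le> r / 4 --> v z = z ^ (n + 1) * A z)"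
  "\<exists>v w. (v, w) \<in> planar_closure b R \<and> (\<forall>z. z \<noteq> 0 \<and> cmod z \<le> r / 4 --> v z = cnj (z ^ (n + 1) * A z))"
proof -
 let ?F = "\<lambda>z. z ^ (n + 1) * A z"
 let ?p = "\<lambda>z. z ^ n * (of_nat (n + 1) * A z + z * deriv A z)"
 have Fh: "?F holomorphic_on ball 0 r" by (intro holomorphic_intros A)
 have dA: "deriv A holomorphic_on ball 0 r" by (intro holomorphic_deriv A) auto
 have dF: "deriv ?F z = ?p z" if "z \<in> ball 0 r" for z
 proof (rule DERIV_imp_deriv)
  have "((\<lambda>z. z ^ (n + 1)) has_field_derivative of_nat (n + 1) * z ^ n) (at z)"
   using DERIV_power[OF DERIV_ident, of "n + 1" z] by simp
  from DERIV_mult'[OF this holomorphic_derivI[OF A open_ball that]]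
  show "(?F has_field_derivative ?p z) (at z)" by (simp add: algebra_simps)
 qed
 let ?B = "ball 0 r - {0::complex}"
 have oB: "open ?B" by (intro open_Diff) auto
 have "bounded (A ` cball 0 (r / 2))" "bounded (deriv A ` cball 0 (r / 2))"
  using r by (intro compact_imp_bounded compact_continuous_image holomorphic_on_imp_continuous_on
    holomorphic_on_subset[OF A] holomorphic_on_subset[OF dA]; auto)+
 then obtain a a' where a: "\<And>z. cmod z \<le> r / 2 ==> cmod (A z) \<le> a" "\<And>z. cmod z \<le> r / 2 ==> cmod (deriv A z) \<le> a'"
  unfolding bounded_iff by (metis imageI mem_cball_0)
 define C where "C = real (n + 1) * \<bar>a\<bar> + \<bar>a'\<bar>"
 have b1: "cmod (?F z) \<le> C * cmod z ^ (n + 1)" "cmod (?p z) \<le> C * cmod z ^ n" if z: "cmod z \<le> r / 2" for z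
 proof -
  have "cmod (A z) \<le> \<bar>a\<bar>" using a(1)[OF z] by linarith
  also have "\<bar>a\<bar> \<le> C" unfolding C_def using mult_right_mono[of 1 "real (n + 1)" "\<bar>a\<bar>"] by simp
  finally have "cmod z ^ (n + 1) * cmod (A z) \<le> cmod z ^ (n + 1) * C" by (intro mult_left_mono) auto
  then show "cmod (?F z) \<le> C * cmod z ^ (n + 1)" by (simp only: norm_mult norm_power mult.commute)
  have "cmod (of_nat (n + 1) * A z + z * deriv A z) \<le> cmod (of_nat (n + 1) * A z) + cmod (z * deriv A z)"
   by (rule norm_triangle_ineq)
  also have "\<dots> \<le> real (n + 1) * \<bar>a\<bar> + 1 * \<bar>a'\<bar>"
   unfolding norm_mult norm_of_nat using a(1)[OF z] a(2)[OF z] z r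
   by (intro add_mono mult_mono) auto
  finally have "cmod z ^ n * cmod (of_nat (n + 1) * A z + z * deriv A z) \<le> cmod z ^ n * C"
   unfolding C_def by (intro mult_left_mono) auto
  then show "cmod (?p z) \<le> C * cmod z ^ n" by (simp only: norm_mult[of "z ^ n"] norm_power mult.commute)
 qed
 have cp: "continuous_on (ball 0 r) ?p"
  by (intro continuous_intros holomorphic_on_imp_continuous_on A dA)
 have cF: "continuous_on (ball 0 r) ?F" by (rule holomorphic_on_imp_continuous_on[OF Fh])
 have C0: "0 \<le> C" by (simp add: C_def)
 have FhB: "?F holomorphic_on ?B" by (rule holomorphic_on_subset[OF Fh]) auto
 show "\<exists>v w. (v, w) \<in> planar_closure b R \<and> (\<forall>z. z \<noteq> 0 \<and> cmod z \<le> r / 4 --> v z = ?F z)"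
 proof (rule harmonic_cutoff_in_planar_closure[OF bn r, where p="?p" and q="\<lambda>_. 0" and C=C])
  show "smooth_on ?B ?F" by (rule smooth_on_holomorphic[OF oB FhB])
  show "wirtinger2 ?B ?F ?p (\<lambda>_. 0) (\<lambda>_. 0)"
   by (rule wirtinger2_cong_open[OF oB wirtinger2_holomorphic[OF oB FhB]]) (use dF in auto)
 qed (use b1 C0 cp cF in auto)
 show "\<exists>v w. (v, w) \<in> planar_closure b R \<and> (\<forall>z. z \<noteq> 0 \<and> cmod z \<le> r / 4 --> v z = cnj (?F z))"
 proof (rule harmonic_cutoff_in_planar_closure[OF bn r, where p="\<lambda>_. 0" and q="\<lambda>z. cnj (?p z)" and C=C])
  show "smooth_on ?B (\<lambda>z. cnj (?F z))" by (rule smooth_on_cnj[OF oB smooth_on_holomorphic[OF oB FhB]])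
  show "wirtinger2 ?B (\<lambda>z. cnj (?F z)) (\<lambda>_. 0) (\<lambda>z. cnj (?p z)) (\<lambda>_. 0)"
   by (rule wirtinger2_cong_open[OF oB wirtinger2_cnj_holomorphic[OF oB FhB]]) (use dF in auto)
  show "cmod (cnj (?F z)) \<le> C * cmod z ^ (n + 1) \<and> cmod 0 \<le> C * cmod z ^ n \<and> cmod (cnj (?p z)) \<le> C * cmod z ^ n"
   if "cmod z \<le> r / 2" for z
   using b1[OF that] C0 unfolding complex_mod_cnj by simp
  show "continuous_on (ball 0 r) (\<lambda>z. cnj (?p z))" by (rule continuous_on_cnj[OF cp])
  show "continuous_on (ball 0 r) (\<lambda>z. cnj (?F z))" by (rule continuous_on_cnj[OF cF])
 qed auto
qed

section \<open>Potentials belong to the closure\<close>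

text \<open>The derivative of \<open>kern n (z / w)\<close> in z in closed form: 1 / (2 (z - w))
  plus half the sum of z^(m-1) / w^m for m from 1 to n, a finite geometric sum. Accordingly
  \<open>potential_p\<close> and \<open>potential_q\<close> are the formal first derivatives of the
  potential.\<close>

definition kern_p :: "nat => complex => complex => complex" where
 "kern_p n z w = z ^ n / (2 * w ^ n * (z - w))"

definition potential_p :: "nat => (complex => complex) => complex => complex" where
 "potential_p n g z = (LINT w|lborel. g w * kern_p n z w)"

definition potential_q :: "nat => (complex => complex) => complex => complex" where
 "potential_q n g z = (LINT w|lborel. g w * cnj (kern_p n z w))"

lemma potential_pq_borel [measurable]:
 assumes [measurable]: "g \<in> borel_fun"
 shows "potential_p n g \<in> borel_fun" "potential_q n g \<in> borel_fun"
 unfolding potential_p_def[abs_def] potential_q_def[abs_def] kern_p_def by measurable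

lemma DERIV_sum_power:
 "((\<lambda>z. c0 + (\<Sum>m=1..n. c m / (2 * of_nat m) * z ^ m)) has_field_derivative (\<Sum>m=1..n. c m / 2 * z ^ (m - 1))) (at (z::complex))"
proof -
 have "((\<lambda>z. c m / (2 * of_nat m) * z ^ m) has_field_derivative c m / 2 * z ^ (m - 1)) (at z)" if "m \<in> {1..n}" for m
 proof -
  have "((\<lambda>z. z ^ m) has_field_derivative of_nat m * z ^ (m - 1)) (at z)" using DERIV_power[OF DERIV_ident, of m z] by simp
  from DERIV_cmult[OF this, of "c m / (2 * of_nat m)"] show ?thesis using that by simp
 qed
 then have "((\<lambda>z. \<Sum>m=1..n. c m / (2 * of_nat m) * z ^ m) has_field_derivative (\<Sum>m=1..n. c m / 2 * z ^ (m - 1))) (at z)"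
  by (rule DERIV_sum)
 from DERIV_add[OF DERIV_const[of c0] this] show ?thesis by simp
qed

text \<open>Almost everywhere continuity makes the approximate identity converge almost everywhere.
  Full continuity would exclude continuous functions cut to an annulus, whose jumps lie on two
  circles; these are the charges used later.\<close>

locale nice_charge =
 fixes n :: nat and g :: "complex => complex" and N a :: real
 assumes g_meas [measurable]: "g \<in> borel_fun" and gN: "\<And>z. cmod (g z) \<le> N"
  and a: "a > 0" and g0: "\<And>w. cmod w < a \<or> cmod w > 1 ==> g w = 0" and cont: "AE z in lborel. isCont g z"
begin

lemma N0: "N \<ge> 0" using order_trans[OF norm_ge_zero gN] .

lemma bounded_integrable:
 assumes [measurable]: "k \<in> borel_fun" and k: "\<And>w. a \<le> cmod w ==> cmod w \<le> 1 ==> cmod (k w) \<le> C"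
 shows "integrable lborel (\<lambda>w. g w * k w)"
proof (rule Bochner_Integration.integrable_bound)
 show "integrable lborel (\<lambda>w. N * \<bar>C\<bar> * indicator (cball (0::complex) 1) w :: real)"
  by (intro integrable_mult_right integrable_real_indicator) (auto simp: emeasure_cball_complex)
 show "AE w in lborel. norm (g w * k w) \<le> norm (N * \<bar>C\<bar> * indicator (cball (0::complex) 1) w :: real)"
 proof (rule AE_I2)
  fix w :: complex
  show "norm (g w * k w) \<le> norm (N * \<bar>C\<bar> * indicator (cball (0::complex) 1) w :: real)"
  proof (cases "cmod w < a \<or> cmod w > 1")
   case False
   then have "cmod (k w) \<le> \<bar>C\<bar>" using k[of w] by auto
   then have "cmod (g w) * cmod (k w) \<le> N * \<bar>C\<bar>" by (intro mult_mono gN N0) auto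
   then show ?thesis using False N0 by (simp add: norm_mult abs_mult)
  next
   case True
   from g0[OF this] show ?thesis by simp
  qed
 qed
qed measurable

lemma g_int: "integrable lborel g"
 using bounded_integrable[of "\<lambda>_. 1" 1] by simp

lemma singular_integrable:
 assumes [measurable]: "k \<in> borel_fun" and z: "cmod z \<le> 1" and c: "c < 2" and D: "D \<ge> 0"
  and k: "\<And>w. w \<noteq> z ==> cmod w \<le> 1 ==> cmod (k w) \<le> D * cmod (w - z) powr - c"
 shows "integrable lborel (\<lambda>w. g w * k w)"
  "AE w in lborel. cmod (g w * k w) \<le> N * D * (cmod (w - z) powr - c * indicator (cball 0 1) w)"
  "integrable lborel (\<lambda>w. N * D * (cmod (w - z) powr - c * indicator (cball 0 1) w))"
  "(LINT w|lborel. cmod (w - z) powr - c * indicator (cball 0 1) w) \<le> J ==> cmod (LINT w|lborel. g w * k w) \<le> N * D * J"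
proof -
 let ?m = "\<lambda>w. cmod (w - z) powr - c * indicator (cball 0 1) w"
 have "integrable lborel ?m" by (rule integral_powr_shift_le[OF c]) (use z in auto)
 then show i3: "integrable lborel (\<lambda>w. N * D * ?m w)" by (rule integrable_mult_right)
 show b: "AE w in lborel. cmod (g w * k w) \<le> N * D * ?m w"
  using AE_lborel_singleton[of z]
 proof eventually_elim
  fix w assume "w \<noteq> z"
  show "cmod (g w * k w) \<le> N * D * ?m w"
  proof (cases "cmod w \<le> 1")
   case True
   have "cmod (g w) * cmod (k w) \<le> N * (D * cmod (w - z) powr - c)" by (intro mult_mono gN N0 k \<open>w \<noteq> z\<close> True) auto
   then show ?thesis using True by (simp add: norm_mult)
  next
   case False
   then have "g w = 0" by (intro g0) auto
   then show ?thesis using False by simp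
  qed
 qed
 show i1: "integrable lborel (\<lambda>w. g w * k w)"
 proof (rule Bochner_Integration.integrable_bound[OF i3])
  show "AE w in lborel. norm (g w * k w) \<le> norm (N * D * ?m w)"
   using b by eventually_elim (unfold real_norm_def, erule order_trans[OF _ abs_ge_self])
 qed measurable
 assume J: "(LINT w|lborel. ?m w) \<le> J"
 have "cmod (LINT w|lborel. g w * k w) \<le> (LINT w|lborel. cmod (g w * k w))" by (rule integral_norm_bound)
 also have "\<dots> \<le> (LINT w|lborel. N * D * ?m w)" by (rule integral_mono_AE[OF integrable_norm[OF i1] i3 b])
 also have "\<dots> = N * D * (LINT w|lborel. ?m w)" by (rule integral_mult_right_zero)
 also have "\<dots> \<le> N * D * J" using N0 D by (intro mult_left_mono J) auto
 finally show "cmod (LINT w|lborel. g w * k w) \<le> N * D * J" .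
qed

text \<open>\<open>hA\<close> plus the conjugate of \<open>hB\<close> is minus the Taylor polynomial
  of degree n of the logarithmic potential of g, so adding it to that potential gives
  \<open>potential n g\<close>. \<open>hAp\<close> and \<open>hBp\<close> are their
  derivatives.\<close>

definition hA :: "complex => complex" where
 "hA z = - (LINT w|lborel. g w * of_real (ln (cmod w))) + (\<Sum>m=1..n. (LINT w|lborel. g w * (1 / w ^ m)) / (2 * of_nat m) * z ^ m)"

definition hB :: "complex => complex" where
 "hB z = 0 + (\<Sum>m=1..n. cnj (LINT w|lborel. g w * (1 / cnj w ^ m)) / (2 * of_nat m) * z ^ m)"

definition hAp :: "complex => complex" where
 "hAp z = (\<Sum>m=1..n. (LINT w|lborel. g w * (1 / w ^ m)) / 2 * z ^ (m - 1))"

definition hBp :: "complex => complex" where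
 "hBp z = (\<Sum>m=1..n. cnj (LINT w|lborel. g w * (1 / cnj w ^ m)) / 2 * z ^ (m - 1))"

lemma hAB_deriv: "(hA has_field_derivative hAp z) (at z)" "(hB has_field_derivative hBp z) (at z)"
 unfolding hA_def[abs_def] hB_def[abs_def] hAp_def hBp_def by (rule DERIV_sum_power)+

lemma hAB_holomorphic: "hA holomorphic_on S" "hB holomorphic_on S"
 unfolding hA_def[abs_def] hB_def[abs_def] by (intro holomorphic_intros; simp)+

text \<open>The potential with the logarithm regularised at scale e. It is smooth, and the next
  three functions are its two first derivatives and its mixed derivative.\<close>

definition reg :: "real => complex => complex" where
 "reg e z = (LINT w|lborel. g w * log_kernel e (z - w)) + (hA z + cnj (hB z))"

definition reg_p :: "real => complex => complex" where
 "reg_p e z = (LINT w|lborel. g w * log_kernel_p e (z - w)) + hAp z"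

definition reg_q :: "real => complex => complex" where
 "reg_q e z = (LINT w|lborel. g w * cnj (log_kernel_p e (z - w))) + cnj (hBp z)"

definition reg_l :: "real => complex => complex" where
 "reg_l e z = (LINT w|lborel. g w * log_kernel_l e (z - w))"

lemma reg_smooth_wirtinger2:
 assumes e: "e > 0"
 shows "smooth_on UNIV (reg e)" "wirtinger2 UNIV (reg e) (reg_p e) (reg_q e) (reg_l e)"
proof -
 have g1: "cmod y > 1 ==> g y = 0" for y by (rule g0) auto
 let ?G = "\<lambda>z. LINT y|lborel. g y * log_kernel e (z - y)"
 have Ls: "smooth_on UNIV (log_kernel e)" by (rule log_kernel_smooth[OF e])
 have Gs: "smooth_on UNIV ?G" by (rule smooth_on_convolution[OF g_int g1 Ls])
 have d: "d_z (log_kernel e) = log_kernel_p e" "d_zbar (log_kernel e) = (\<lambda>w. cnj (log_kernel_p e w))"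
  "d_z (d_zbar (log_kernel e)) = log_kernel_l e"
  using wirtinger2D[OF open_UNIV wirtinger2_log_kernel[OF e]] by (auto simp: fun_eq_iff)
 note d3 = d(3)[unfolded d(2)]
 have conv: "has_wirtinger (\<lambda>z. LINT y|lborel. g y * k (z - y)) (LINT y|lborel. g y * d_z k (z - y)) (LINT y|lborel. g y * d_zbar k (z - y)) z"
  if "smooth_on UNIV k" for k z
  by (rule has_wirtinger_convolution[OF g_int g1])
   (use that in \<open>auto intro: smooth_on_imp_has_wirtinger smooth_on_imp_continuous smooth_on_d_z\<close>)
 have GW: "wirtinger2 UNIV ?G (\<lambda>z. LINT y|lborel. g y * log_kernel_p e (z - y))
   (\<lambda>z. LINT y|lborel. g y * cnj (log_kernel_p e (z - y))) (reg_l e)"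
  unfolding wirtinger2_def
 proof (intro ballI conjI)
  fix z
  show "has_wirtinger ?G (LINT y|lborel. g y * log_kernel_p e (z - y)) (LINT y|lborel. g y * cnj (log_kernel_p e (z - y))) z"
   using conv[OF Ls, of z] unfolding d .
  show "\<exists>m. has_wirtinger (\<lambda>z. LINT y|lborel. g y * cnj (log_kernel_p e (z - y))) (reg_l e z) m z"
   using conv[OF smooth_on_d_z(2)[OF open_UNIV Ls], of z] unfolding d(2) d3 reg_l_def by blast
 qed
 have dA: "deriv hA = hAp" "deriv hB = hBp" using DERIV_imp_deriv[OF hAB_deriv(1)] DERIV_imp_deriv[OF hAB_deriv(2)] by auto
 show "smooth_on UNIV (reg e)"
  unfolding reg_def[abs_def]
  by (intro smooth_on_add Gs smooth_on_cnj smooth_on_holomorphic hAB_holomorphic open_UNIV)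
 have "wirtinger2 UNIV (reg e) (\<lambda>z. (LINT y|lborel. g y * log_kernel_p e (z - y)) + (hAp z + 0))
   (\<lambda>z. (LINT y|lborel. g y * cnj (log_kernel_p e (z - y))) + (0 + cnj (hBp z))) (\<lambda>z. reg_l e z + (0 + 0))"
  unfolding reg_def[abs_def]
  using wirtinger2_add[OF GW wirtinger2_add[OF wirtinger2_holomorphic[OF open_UNIV hAB_holomorphic(1)]
     wirtinger2_cnj_holomorphic[OF open_UNIV hAB_holomorphic(2)]]] unfolding dA .
 then show "wirtinger2 UNIV (reg e) (reg_p e) (reg_q e) (reg_l e)"
  by (simp add: reg_p_def[abs_def] reg_q_def[abs_def])
qed

lemma pow_integrable: "integrable lborel (\<lambda>w. g w * (1 / w ^ m))" "integrable lborel (\<lambda>w. g w * (1 / cnj w ^ m))"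
proof -
 have "cmod (1 / w ^ m) \<le> 1 / a ^ m" "cmod (1 / cnj w ^ m) \<le> 1 / a ^ m" if "a \<le> cmod w" for w
 proof -
  have "a ^ m \<le> cmod w ^ m" using that a by (intro power_mono) auto
  then show "cmod (1 / w ^ m) \<le> 1 / a ^ m" "cmod (1 / cnj w ^ m) \<le> 1 / a ^ m"
   using a by (auto simp: norm_divide norm_power intro!: frac_le)
 qed
 then show "integrable lborel (\<lambda>w. g w * (1 / w ^ m))" "integrable lborel (\<lambda>w. g w * (1 / cnj w ^ m))"
  by (intro bounded_integrable[of _ "1 / a ^ m"]; simp)+
qed

lemma ln_integrable: "integrable lborel (\<lambda>w. g w * of_real (ln (cmod w)))"
proof (rule bounded_integrable[of _ "\<bar>ln a\<bar>"])
 fix w :: complex assume "a \<le> cmod w" "cmod w \<le> 1"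
 moreover from this have "cmod w > 0" using a by linarith
 ultimately have "ln a \<le> ln (cmod w)" "ln (cmod w) \<le> 0" using a by simp_all
 then show "cmod (complex_of_real (ln (cmod w))) \<le> \<bar>ln a\<bar>" by simp
qed measurable

lemma ln_diff_bounds:
 assumes "cmod z \<le> 1" "y \<noteq> z" "cmod y \<le> 1"
 shows "cmod (of_real (ln (cmod (z - y)))) \<le> 8 * cmod (y - z) powr - (1 / 2)"
  "0 < e ==> e \<le> 1 ==> cmod (log_kernel e (z - y)) \<le> 8 * cmod (y - z) powr - (1 / 2)"
  "cmod (1 / (2 * (z - y))) \<le> 1 / 2 * cmod (y - z) powr - 1"
  "0 < e ==> e \<le> 1 ==> cmod (log_kernel_p e (z - y)) \<le> 1 / 2 * cmod (y - z) powr - 1"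
proof -
 have w: "z - y \<noteq> 0" "cmod (z - y) \<le> 2" using assms norm_triangle_ineq4[of z y] by auto
 have c: "cmod (y - z) = cmod (z - y)" by (rule norm_minus_commute)
 have p1: "cmod (z - y) powr - 1 = 1 / cmod (z - y)" by (simp add: powr_minus inverse_eq_divide)
 have h: "- (1 / 2) = (- 1 / 2 :: real)" by simp
 show "cmod (of_real (ln (cmod (z - y)))) \<le> 8 * cmod (y - z) powr - (1 / 2)"
  unfolding c norm_of_real h using log_kernel_bounds(2)[of 1, OF _ _ w] by simp
 show "0 < e ==> e \<le> 1 ==> cmod (log_kernel e (z - y)) \<le> 8 * cmod (y - z) powr - (1 / 2)"
  unfolding c h by (rule log_kernel_bounds(1)[OF _ _ w])
 show "cmod (1 / (2 * (z - y))) \<le> 1 / 2 * cmod (y - z) powr - 1"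
  unfolding c p1 norm_divide norm_mult by simp
 show "0 < e ==> e \<le> 1 ==> cmod (log_kernel_p e (z - y)) \<le> 1 / 2 * cmod (y - z) powr - 1"
  unfolding c p1 using log_kernel_bounds(3)[OF _ _ w, of e] by simp
qed

lemma potential_eq:
 assumes z: "cmod z \<le> 1"
 shows "potential n g z = (LINT w|lborel. g w * of_real (ln (cmod (z - w)))) + (hA z + cnj (hB z))"
proof -
 have iln: "integrable lborel (\<lambda>w. g w * of_real (ln (cmod (z - w))))"
  by (rule singular_integrable(1)[OF _ z, of _ "1 / 2" 8]) (use ln_diff_bounds(1)[OF z] in auto)
 let ?S = "\<lambda>w. \<Sum>m=1..n. 1 / (2 * of_nat m) * z ^ m * (g w * (1 / w ^ m)) + 1 / (2 * of_nat m) * cnj z ^ m * (g w * (1 / cnj w ^ m))"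
 let ?T = "\<Sum>m=1..n. 1 / (2 * of_nat m) * z ^ m * (LINT w|lborel. g w * (1 / w ^ m)) + 1 / (2 * of_nat m) * cnj z ^ m * (LINT w|lborel. g w * (1 / cnj w ^ m))"
 have S: "has_bochner_integral lborel ?S ?T"
  by (intro has_bochner_integral_sum has_bochner_integral_add has_bochner_integral_mult_right
    has_bochner_integral_integrable pow_integrable)
 have H: "has_bochner_integral lborel (\<lambda>w. g w * of_real (ln (cmod (z - w))) - g w * of_real (ln (cmod w)) + ?S w)
   ((LINT w|lborel. g w * of_real (ln (cmod (z - w)))) - (LINT w|lborel. g w * of_real (ln (cmod w))) + ?T)"
  by (intro has_bochner_integral_add has_bochner_integral_diff S has_bochner_integral_integrable iln ln_integrable)
 have "AE w in lborel. g w * of_real (kern n (z / w)) = g w * of_real (ln (cmod (z - w))) - g w * of_real (ln (cmod w)) + ?S w"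
  using AE_lborel_singleton[of "0::complex"] AE_lborel_singleton[of z]
 proof eventually_elim
  fix w :: complex assume w: "w \<noteq> 0" "w \<noteq> z"
  have "complex_of_real (\<Sum>m=1..n. Re ((z / w) ^ m) / real m) =
    (\<Sum>m=1..n. 1 / (2 * of_nat m) * (z / w) ^ m + 1 / (2 * of_nat m) * cnj ((z / w) ^ m))"
   unfolding of_real_sum of_real_Re_div_eq ..
  then have S': "g w * complex_of_real (\<Sum>m=1..n. Re ((z / w) ^ m) / real m) = ?S w"
   by (simp add: sum_distrib_left power_divide algebra_simps)
  have "kern n (z / w) = ln (cmod (z - w)) - ln (cmod w) + (\<Sum>m=1..n. Re ((z / w) ^ m) / real m)"
   using ln_norm_diff_eq_kern[OF w, of n] by (simp add: norm_minus_commute)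
  then show "g w * of_real (kern n (z / w)) = g w * of_real (ln (cmod (z - w))) - g w * of_real (ln (cmod w)) + ?S w"
   unfolding S'[symmetric] by (simp only: of_real_diff of_real_add distrib_left right_diff_distrib)
 qed
 then have "potential n g z = (LINT w|lborel. g w * of_real (ln (cmod (z - w))) - g w * of_real (ln (cmod w)) + ?S w)"
  unfolding potential_def by (intro integral_cong_AE) measurable
 also have "\<dots> = (LINT w|lborel. g w * of_real (ln (cmod (z - w)))) - (LINT w|lborel. g w * of_real (ln (cmod w))) + ?T"
  by (rule has_bochner_integral_integral_eq[OF H])
 also have "\<dots> = (LINT w|lborel. g w * of_real (ln (cmod (z - w)))) + (hA z + cnj (hB z))"
  unfolding hA_def hB_def sum.distrib by (simp add: mult_ac)
 finally show ?thesis .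
qed

lemma kern_p_expansion:
 assumes "w \<noteq> 0" "w \<noteq> z"
 shows "kern_p n z w = 1 / (2 * (z - w)) + (\<Sum>m=1..n. 1 / 2 * z ^ (m - 1) * (1 / w ^ m))"
proof -
 have "1 / (z - w) = z ^ n / (w ^ n * (z - w)) - (\<Sum>m=1..n. z ^ (m - 1) / w ^ m)"
  by (rule inverse_diff_expansion) (use assms in auto)
 then have "z ^ n / (w ^ n * (z - w)) = 1 / (z - w) + (\<Sum>m=1..n. z ^ (m - 1) / w ^ m)" by simp
 then have "z ^ n / (w ^ n * (z - w)) / 2 = 1 / (z - w) / 2 + (\<Sum>m=1..n. z ^ (m - 1) / w ^ m) / 2"
  by (simp only: add_divide_distrib)
 then show ?thesis by (simp add: kern_p_def sum_divide_distrib mult_ac)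
qed

lemma potential_pq_eq:
 assumes z: "cmod z \<le> 1"
 shows "potential_p n g z = (LINT w|lborel. g w * (1 / (2 * (z - w)))) + hAp z"
  "potential_q n g z = (LINT w|lborel. g w * cnj (1 / (2 * (z - w)))) + cnj (hBp z)"
proof -
 have i: "integrable lborel (\<lambda>w. g w * (1 / (2 * (z - w))))" "integrable lborel (\<lambda>w. g w * cnj (1 / (2 * (z - w))))"
 proof -
  have b: "w \<noteq> z ==> cmod w \<le> 1 ==> cmod (cnj (1 / (2 * (z - w)))) \<le> 1 / 2 * cmod (w - z) powr - 1" for w
   unfolding complex_mod_cnj by (rule ln_diff_bounds(3)[OF z])
  show "integrable lborel (\<lambda>w. g w * (1 / (2 * (z - w))))"
   by (rule singular_integrable(1)[OF _ z, of _ 1 "1 / 2"]) (use ln_diff_bounds(3)[OF z] in auto)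
  show "integrable lborel (\<lambda>w. g w * cnj (1 / (2 * (z - w))))"
   by (rule singular_integrable(1)[OF _ z _ _ b]) auto
 qed
 let ?S = "\<lambda>w. \<Sum>m=1..n. 1 / 2 * z ^ (m - 1) * (g w * (1 / w ^ m))"
 let ?S' = "\<lambda>w. \<Sum>m=1..n. 1 / 2 * cnj z ^ (m - 1) * (g w * (1 / cnj w ^ m))"
 have H: "has_bochner_integral lborel (\<lambda>w. g w * (1 / (2 * (z - w))) + ?S w)
   ((LINT w|lborel. g w * (1 / (2 * (z - w)))) + (\<Sum>m=1..n. 1 / 2 * z ^ (m - 1) * (LINT w|lborel. g w * (1 / w ^ m))))"
  by (intro has_bochner_integral_add has_bochner_integral_sum has_bochner_integral_mult_right has_bochner_integral_integrable i pow_integrable)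
 have H': "has_bochner_integral lborel (\<lambda>w. g w * cnj (1 / (2 * (z - w))) + ?S' w)
   ((LINT w|lborel. g w * cnj (1 / (2 * (z - w)))) + (\<Sum>m=1..n. 1 / 2 * cnj z ^ (m - 1) * (LINT w|lborel. g w * (1 / cnj w ^ m))))"
  by (intro has_bochner_integral_add has_bochner_integral_sum has_bochner_integral_mult_right has_bochner_integral_integrable i pow_integrable)
 have A: "AE w in lborel. g w * kern_p n z w = g w * (1 / (2 * (z - w))) + ?S w"
  using AE_lborel_singleton[of "0::complex"] AE_lborel_singleton[of z]
  by eventually_elim (simp add: kern_p_expansion distrib_left sum_distrib_left mult_ac)
 have A': "AE w in lborel. g w * cnj (kern_p n z w) = g w * cnj (1 / (2 * (z - w))) + ?S' w"
  using AE_lborel_singleton[of "0::complex"] AE_lborel_singleton[of z]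
  by eventually_elim (simp add: kern_p_expansion distrib_left sum_distrib_left mult_ac)
 have m: "(\<lambda>w. kern_p n z w) \<in> borel_fun" unfolding kern_p_def by measurable
 note [measurable] = m
 have "potential_p n g z = (LINT w|lborel. g w * (1 / (2 * (z - w))) + ?S w)"
  unfolding potential_p_def by (intro integral_cong_AE A) measurable
 also have "\<dots> = (LINT w|lborel. g w * (1 / (2 * (z - w)))) + hAp z"
  unfolding has_bochner_integral_integral_eq[OF H] hAp_def by (simp add: mult_ac)
 finally show "potential_p n g z = (LINT w|lborel. g w * (1 / (2 * (z - w)))) + hAp z" .
 have "potential_q n g z = (LINT w|lborel. g w * cnj (1 / (2 * (z - w))) + ?S' w)"
  unfolding potential_q_def by (intro integral_cong_AE A') measurable
 also have "\<dots> = (LINT w|lborel. g w * cnj (1 / (2 * (z - w)))) + cnj (hBp z)"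
  unfolding has_bochner_integral_integral_eq[OF H'] hBp_def by (simp add: mult_ac)
 finally show "potential_q n g z = (LINT w|lborel. g w * cnj (1 / (2 * (z - w)))) + cnj (hBp z)" .
qed

definition dj :: "nat => real" where "dj j = 1 / real (Suc j)"

lemma dj: "dj j > 0" "dj j \<le> 1" "dj \<longlonglongrightarrow> 0"
 unfolding dj_def by (simp, simp) (rule lim_1_over_n[THEN LIMSEQ_Suc])

text \<open>The singularities |y - z|^(-1/2) and |y - z|^-1 dominate the kernels of the potential
  and its first derivatives uniformly in the regularisation. The mixed derivative has no such
  majorant; it converges as an approximate identity where g is continuous.\<close>

lemma reg_tendsto:
 assumes z: "cmod z \<le> 1"
 shows "(\<lambda>j. reg (dj j) z) \<longlonglongrightarrow> potential n g z" "(\<lambda>j. reg_p (dj j) z) \<longlonglongrightarrow> potential_p n g z"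
  "(\<lambda>j. reg_q (dj j) z) \<longlonglongrightarrow> potential_q n g z"
  "isCont g z ==> (\<lambda>j. 4 * reg_l (dj j) z) \<longlonglongrightarrow> of_real kernel_mass * g z"
proof -
 have D: "(\<lambda>j. LINT y|lborel. g y * k j y) \<longlonglongrightarrow> (LINT y|lborel. g y * k' y)"
  if k: "\<And>j. k j \<in> borel_fun" "k' \<in> borel_fun" "c < 2" "D \<ge> 0"
   "\<And>j y. y \<noteq> z ==> cmod y \<le> 1 ==> cmod (k j y) \<le> D * cmod (y - z) powr - c"
   "\<And>y. y \<noteq> z ==> (\<lambda>j. k j y) \<longlonglongrightarrow> k' y" for k k' c D
 proof -
  note [measurable] = k(1,2)
  show ?thesis
  proof (rule integral_dominated_convergence[where w="\<lambda>y. N * D * (cmod (y - z) powr - c * indicator (cball 0 1) y)"])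
   show "integrable lborel (\<lambda>y. N * D * (cmod (y - z) powr - c * indicator (cball 0 1) y))"
    by (rule singular_integrable(3)[OF k(1) z k(3,4) k(5)])
   show "AE y in lborel. norm (g y * k j y) \<le> N * D * (cmod (y - z) powr - c * indicator (cball 0 1) y)" for j
    by (rule singular_integrable(2)[OF k(1) z k(3,4) k(5)])
   show "AE y in lborel. (\<lambda>j. g y * k j y) \<longlonglongrightarrow> g y * k' y"
    using AE_lborel_singleton[of z] by eventually_elim (intro tendsto_mult tendsto_const k(6))
  qed measurable
 qed
 have 1: "(\<lambda>j. LINT y|lborel. g y * log_kernel (dj j) (z - y)) \<longlonglongrightarrow> (LINT y|lborel. g y * of_real (ln (cmod (z - y))))"
  by (rule D[of _ _ "1 / 2" 8]) (use dj ln_diff_bounds(2)[OF z] in \<open>auto intro!: log_kernel_tendsto\<close>)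
 have 2: "(\<lambda>j. LINT y|lborel. g y * log_kernel_p (dj j) (z - y)) \<longlonglongrightarrow> (LINT y|lborel. g y * (1 / (2 * (z - y))))"
 proof (rule D[of _ _ 1 "1 / 2"])
  show "(\<lambda>j. log_kernel_p (dj j) (z - y)) \<longlonglongrightarrow> 1 / (2 * (z - y))" if "y \<noteq> z" for y
   by (rule log_kernel_tendsto) (use that dj in auto)
 qed (use dj ln_diff_bounds(4)[OF z] in auto)
 have 3: "(\<lambda>j. LINT y|lborel. g y * cnj (log_kernel_p (dj j) (z - y))) \<longlonglongrightarrow> (LINT y|lborel. g y * cnj (1 / (2 * (z - y))))"
 proof (rule D[of _ _ 1 "1 / 2"])
  show "(\<lambda>j. cnj (log_kernel_p (dj j) (z - y))) \<longlonglongrightarrow> cnj (1 / (2 * (z - y)))" if "y \<noteq> z" for y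
   using that by (intro tendsto_cnj log_kernel_tendsto dj) auto
  show "cmod (cnj (log_kernel_p (dj j) (z - y))) \<le> 1 / 2 * cmod (y - z) powr - 1" if "y \<noteq> z" "cmod y \<le> 1" for j y
   unfolding complex_mod_cnj by (rule ln_diff_bounds(4)[OF z that dj(1,2)])
 qed auto
 show "(\<lambda>j. reg (dj j) z) \<longlonglongrightarrow> potential n g z" unfolding reg_def potential_eq[OF z] by (intro tendsto_add 1 tendsto_const)
 show "(\<lambda>j. reg_p (dj j) z) \<longlonglongrightarrow> potential_p n g z" unfolding reg_p_def potential_pq_eq[OF z] by (intro tendsto_add 2 tendsto_const)
 show "(\<lambda>j. reg_q (dj j) z) \<longlonglongrightarrow> potential_q n g z" unfolding reg_q_def potential_pq_eq[OF z] by (intro tendsto_add 3 tendsto_const)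
 assume "isCont g z"
 from approx_kernel_convolution_tendsto[OF g_meas gN this dj(1,3)]
 show "(\<lambda>j. 4 * reg_l (dj j) z) \<longlonglongrightarrow> of_real kernel_mass * g z"
  unfolding reg_l_def integral_mult_right_zero[symmetric]
  by (simp only: mult.left_commute[of 4] log_kernel_l_eq approx_kernel_minus[of _ z])
qed

lemma reg_bounded:
 obtains B where "\<And>j z. cmod z \<le> 1 ==> cmod (reg (dj j) z) \<le> B" "\<And>j z. cmod z \<le> 1 ==> cmod (reg_p (dj j) z) \<le> B"
  "\<And>j z. cmod z \<le> 1 ==> cmod (reg_q (dj j) z) \<le> B" "\<And>j z. cmod (4 * reg_l (dj j) z) \<le> kernel_mass * N"
proof -
 obtain J where J: "J \<ge> 0" "\<And>z. cmod z \<le> 1 ==> (LINT w|lborel. cmod (w - z) powr - (1 / 2) * indicator (cball 0 1) w) \<le> J"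
  by (rule integral_powr_shift_le[of "1 / 2"]) (simp, rule that)
 obtain J' where J': "J' \<ge> 0" "\<And>z. cmod z \<le> 1 ==> (LINT w|lborel. cmod (w - z) powr - 1 * indicator (cball 0 1) w) \<le> J'"
  by (rule integral_powr_shift_le[of 1]) (simp, rule that)
 have bdd: "\<exists>B. \<forall>z. cmod z \<le> 1 --> cmod (h z) \<le> B" if "h holomorphic_on UNIV" for h
 proof -
  have "bounded (h ` cball 0 1)"
   by (intro compact_imp_bounded compact_continuous_image holomorphic_on_imp_continuous_on holomorphic_on_subset[OF that]) auto
  then show ?thesis unfolding bounded_iff by (metis imageI mem_cball_0)
 qed
 have "hAp holomorphic_on UNIV" "hBp holomorphic_on UNIV"
  unfolding hAp_def[abs_def] hBp_def[abs_def] by (intro holomorphic_intros)+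
 then obtain b1 b2 b3 b4 where hb: "\<And>z. cmod z \<le> 1 ==> cmod (hA z) \<le> b1" "\<And>z. cmod z \<le> 1 ==> cmod (hB z) \<le> b2"
  "\<And>z. cmod z \<le> 1 ==> cmod (hAp z) \<le> b3" "\<And>z. cmod z \<le> 1 ==> cmod (hBp z) \<le> b4"
  using bdd[OF hAB_holomorphic(1)] bdd[OF hAB_holomorphic(2)] bdd by metis
 define B where "B = N * 8 * J + N * (1 / 2) * J' + \<bar>b1\<bar> + \<bar>b2\<bar> + \<bar>b3\<bar> + \<bar>b4\<bar>"
 have nn: "N * 8 * J \<ge> 0" "N * (1 / 2) * J' \<ge> 0" using N0 J(1) J'(1) by auto
 show thesis
 proof (rule that[of B])
  fix j and z :: complex assume z: "cmod z \<le> 1"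
  have "cmod (LINT w|lborel. g w * log_kernel (dj j) (z - w)) \<le> N * 8 * J"
   by (rule singular_integrable(4)[OF _ z, of _ "1 / 2" 8]) (use ln_diff_bounds(2)[OF z] dj J z in auto)
  then show "cmod (reg (dj j) z) \<le> B"
   unfolding reg_def B_def using hb(1,2)[OF z] nn
    norm_triangle_ineq[of "LINT w|lborel. g w * log_kernel (dj j) (z - w)" "hA z + cnj (hB z)"] norm_triangle_ineq[of "hA z" "cnj (hB z)"]
   unfolding complex_mod_cnj by linarith
  have "cmod (LINT w|lborel. g w * log_kernel_p (dj j) (z - w)) \<le> N * (1 / 2) * J'"
   by (rule singular_integrable(4)[OF _ z, of _ 1 "1 / 2"]) (use ln_diff_bounds(4)[OF z] dj J' z in auto)
  then show "cmod (reg_p (dj j) z) \<le> B"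
   unfolding reg_p_def B_def using hb(3)[OF z] nn
    norm_triangle_ineq[of "LINT w|lborel. g w * log_kernel_p (dj j) (z - w)" "hAp z"] by linarith
  have "cmod (LINT w|lborel. g w * cnj (log_kernel_p (dj j) (z - w))) \<le> N * (1 / 2) * J'"
  proof (rule singular_integrable(4)[OF _ z, of _ 1 "1 / 2"])
   show "cmod (cnj (log_kernel_p (dj j) (z - w))) \<le> 1 / 2 * cmod (w - z) powr - 1" if "w \<noteq> z" "cmod w \<le> 1" for w
    unfolding complex_mod_cnj by (rule ln_diff_bounds(4)[OF z that dj(1,2)])
  qed (use J' z in auto)
  then show "cmod (reg_q (dj j) z) \<le> B"
   unfolding reg_q_def B_def using hb(4)[OF z] nn
    norm_triangle_ineq[of "LINT w|lborel. g w * cnj (log_kernel_p (dj j) (z - w))" "cnj (hBp z)"]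
   unfolding complex_mod_cnj by linarith
 next
  fix j z
  show "cmod (4 * reg_l (dj j) z) \<le> kernel_mass * N"
   unfolding reg_l_def integral_mult_right_zero[symmetric]
   using approx_kernel_convolution_bound[OF g_meas dj(1)[of j] gN, of z]
   by (simp only: mult.left_commute[of 4] log_kernel_l_eq approx_kernel_minus[of _ z])
 qed
qed

end

lemma wnorm_tendsto_bounded:
 fixes F :: "nat => complex => complex"
 assumes [measurable]: "\<And>j. F j \<in> borel_fun" "F' \<in> borel_fun" and a: "a > 0"
  and C: "\<And>j z. cmod (F j z) \<le> C" "\<And>j z. cmod z < a \<or> cmod z > 1 ==> F j z = 0"
  and lim: "AE z in lborel. (\<lambda>j. F j z) \<longlonglongrightarrow> F' z"
 shows "(\<lambda>j. wnorm s (\<lambda>z. F j z - F' z)) \<longlonglongrightarrow> 0"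
proof -
 define h where "h z = (if a \<le> cmod z \<and> cmod z \<le> 1 then of_real (2 * C) else 0 :: complex)" for z
 have C0: "C \<ge> 0" using order_trans[OF norm_ge_zero C(1)] .
 have [measurable]: "h \<in> borel_fun" unfolding h_def[abs_def] by measurable
 show ?thesis
 proof (rule wnorm_tendsto_0[where h=h])
  show "wnorm s h < \<infinity>" by (rule wnorm_bounded_finite[OF _ a, of _ "2 * C"]) (use C0 in \<open>auto simp: h_def\<close>)
  show "AE z in lborel. cmod (F j z - F' z) \<le> cmod (h z)" for j
   using lim
  proof eventually_elim
   fix z assume l: "(\<lambda>j. F j z) \<longlonglongrightarrow> F' z"
   show "cmod (F j z - F' z) \<le> cmod (h z)"
   proof (cases "cmod z < a \<or> cmod z > 1")
    case True
    have "F' z = 0" by (rule LIMSEQ_unique[OF l]) (simp add: C(2)[OF True])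
    then show ?thesis using C(2)[OF True] by simp
   next
    case False
    have "cmod (F' z) \<le> C" by (rule tendsto_upperbound[OF tendsto_norm[OF l]]) (auto simp: C)
    then have "cmod (F j z - F' z) \<le> C + C" using C(1)[of j z] norm_triangle_ineq4[of "F j z" "F' z"] by linarith
    then show ?thesis using False C0 by (simp add: h_def)
   qed
  qed
  show "AE z in lborel. (\<lambda>j. F j z - F' z) \<longlonglongrightarrow> 0"
   using lim by eventually_elim (simp add: LIM_zero)
 qed measurable
qed

definition disc_bounded :: "(complex => complex) => bool" where
 "disc_bounded f \<longleftrightarrow> (\<exists>C. \<forall>z. cmod z \<le> 1 --> cmod (f z) \<le> C)"

lemma disc_boundedI: "(\<And>z. cmod z \<le> 1 ==> cmod (f z) \<le> C) ==> disc_bounded f"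
 unfolding disc_bounded_def by blast

lemma disc_bounded_add: "disc_bounded f ==> disc_bounded g ==> disc_bounded (\<lambda>z. f z + g z)"
 unfolding disc_bounded_def by (meson add_mono norm_triangle_ineq order_trans)

lemma disc_bounded_mult: "disc_bounded f ==> disc_bounded g ==> disc_bounded (\<lambda>z. f z * g z)"
 unfolding disc_bounded_def norm_mult by (meson mult_mono norm_ge_zero order_trans)

lemma disc_bounded_cnj: "disc_bounded f ==> disc_bounded (\<lambda>z. cnj (f z))"
 by (simp add: disc_bounded_def)

lemma disc_bounded_const: "disc_bounded (\<lambda>z. c)"
 unfolding disc_bounded_def by blast

lemmas disc_bounded_intros = disc_bounded_add disc_bounded_mult disc_bounded_cnj disc_bounded_const

section \<open>Cut-off potentials of nice charges\<close>

context radial_cutoff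
begin

lemma cutoff_disc_bounded: "disc_bounded ps" "disc_bounded pp" "disc_bounded pl"
 by (rule pp_bound, rule disc_boundedI, use ps1 in blast)+

text \<open>The Leibniz formula for the flat Laplacian of \<open>ps\<close> times
  \<open>potential n g\<close>, with \<open>kernel_mass\<close> times g in place of the Laplacian of
  the potential.\<close>

definition source :: "nat => (complex => complex) => complex => complex" where
 "source n g z = ps z * (of_real kernel_mass * g z) +
  4 * (pp z * potential_q n g z + cnj (pp z) * potential_p n g z + pl z * potential n g z)"

lemma source_borel [measurable]:
 assumes [measurable]: "g \<in> borel_fun"
 shows "source n g \<in> borel_fun"
 unfolding source_def[abs_def] by measurable

end

locale nice_potential = nice_charge + radial_cutoff
begin

text \<open>The charge vanishes for |w| < a, so |z/w| \<le> 1/2 for |z| < a/2 and the kernels vanish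
  at z = 0 to order n + 1 and n.\<close>

lemma near_0:
 obtains C where "\<And>z. cmod z < a / 2 ==> cmod (potential n g z) \<le> C * cmod z ^ (n + 1) \<and>
  cmod (potential_p n g z) \<le> C * cmod z ^ n \<and> cmod (potential_q n g z) \<le> C * cmod z ^ n"
proof -
 have I: "cmod (LINT w|lborel. g w * k w) \<le> c * (LINT w|lborel. cmod (g w))"
  if [measurable]: "k \<in> borel_fun" and k: "\<And>w. a \<le> cmod w ==> cmod (k w) \<le> c" for k c
 proof -
  have i: "integrable lborel (\<lambda>w. g w * k w)" by (rule bounded_integrable[OF _ k]) auto
  have "cmod (LINT w|lborel. g w * k w) \<le> (LINT w|lborel. cmod (g w * k w))" by (rule integral_norm_bound)
  also have "\<dots> \<le> (LINT w|lborel. c * cmod (g w))"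
  proof (rule integral_mono[OF integrable_norm[OF i] integrable_mult_right[OF integrable_norm[OF g_int]]])
   fix w show "cmod (g w * k w) \<le> c * cmod (g w)"
    using k[of w] g0[of w] by (cases "cmod w < a") (auto simp: norm_mult mult.commute[of c] intro: mult_left_mono)
  qed
  also have "\<dots> = c * (LINT w|lborel. cmod (g w))" by (rule integral_mult_right_zero)
  finally show ?thesis .
 qed
 have [measurable]: "(\<lambda>w. complex_of_real (kern n (z / w))) \<in> borel_fun" "kern_p n z \<in> borel_fun" for z
  unfolding kern_p_def[abs_def] by measurable
 let ?M = "LINT w|lborel. cmod (g w)"
 have M0: "?M \<ge> 0" by simp
 show thesis
 proof (rule that[of "2 / a ^ (n + 1) * ?M"], intro conjI)
  fix z assume z: "cmod z < a / 2"
  have k: "cmod (complex_of_real (kern n (z / w))) \<le> 2 / a ^ (n + 1) * cmod z ^ (n + 1)" if "a \<le> cmod w" for w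
  proof -
   have "cmod (z / w) \<le> cmod z / a" unfolding norm_divide using that a by (intro frac_le) auto
   moreover have "cmod z / a \<le> 1 / 2" using z a by (simp add: field_simps)
   ultimately have "cmod (z / w) \<le> 1 / 2" and "cmod (z / w) ^ (n + 1) \<le> (cmod z / a) ^ (n + 1)"
    by (linarith, intro power_mono) auto
   then have "\<bar>kern n (z / w)\<bar> \<le> 2 * (cmod z / a) ^ (n + 1)" using kern_small[of "z / w" n] by linarith
   then show ?thesis by (simp add: power_divide)
  qed
  have kp: "cmod (kern_p n z w) \<le> 2 / a ^ (n + 1) * cmod z ^ n" if "a \<le> cmod w" for w
  proof -
   have "a / 2 \<le> cmod (z - w)" using that z norm_triangle_ineq2[of w z] by (simp add: norm_minus_commute)
   then have "2 * a ^ n * (a / 2) \<le> 2 * cmod w ^ n * cmod (z - w)"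
    using that a by (intro mult_mono power_mono) auto
   then have "cmod z ^ n / (2 * cmod w ^ n * cmod (z - w)) \<le> cmod z ^ n / (2 * a ^ n * (a / 2))"
    using a by (intro frac_le) auto
   also have "\<dots> = 1 / a ^ (n + 1) * cmod z ^ n" by simp
   also have "\<dots> \<le> 2 / a ^ (n + 1) * cmod z ^ n" using a by (intro mult_right_mono divide_right_mono) auto
   finally show ?thesis by (simp only: kern_p_def norm_divide norm_mult norm_power norm_numeral)
  qed
  show "cmod (potential n g z) \<le> 2 / a ^ (n + 1) * ?M * cmod z ^ (n + 1)"
   using I[OF _ k] unfolding potential_def by (simp only: mult_ac) measurable
  show "cmod (potential_p n g z) \<le> 2 / a ^ (n + 1) * ?M * cmod z ^ n"
   using I[OF _ kp] unfolding potential_p_def by (simp only: mult_ac) measurable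
  show "cmod (potential_q n g z) \<le> 2 / a ^ (n + 1) * ?M * cmod z ^ n"
   using I[of "\<lambda>w. cnj (kern_p n z w)" "2 / a ^ (n + 1) * cmod z ^ n"] kp unfolding potential_q_def complex_mod_cnj by (simp only: mult_ac) measurable
 qed
qed

lemma potential_disc_bounded: "disc_bounded (potential n g)" "disc_bounded (potential_p n g)" "disc_bounded (potential_q n g)"
proof -
 obtain B where B: "\<And>j z. cmod z \<le> 1 ==> cmod (reg (dj j) z) \<le> B" "\<And>j z. cmod z \<le> 1 ==> cmod (reg_p (dj j) z) \<le> B"
  "\<And>j z. cmod z \<le> 1 ==> cmod (reg_q (dj j) z) \<le> B" by (rule reg_bounded) blast
 have u: "cmod l \<le> B" if "X \<longlonglongrightarrow> l" "\<And>j. cmod (X j) \<le> B" for X l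
  by (rule tendsto_upperbound[OF tendsto_norm[OF that(1)]]) (auto simp: that)
 show "disc_bounded (potential n g)" "disc_bounded (potential_p n g)" "disc_bounded (potential_q n g)"
  by (rule disc_boundedI[of _ B], rule u, erule reg_tendsto, erule B)+
qed

text \<open>Two limits are taken. For a fixed inner cut-off the regularised potentials give genuine
  test functions, and letting the regularisation tend to 0 puts the potential with both cut-offs
  into the closure. Removing the inner cut-off is \<open>planar_closure_inner_limit\<close>, by the
  vanishing orders of \<open>near_0\<close>.\<close>

lemma potential_in_planar_closure:
 assumes bn: "b \<le> real n" "b > -1" and R: "s < R" "R \<le> 1"
 shows "(\<lambda>z. ps z * potential n g z, source n g) \<in> planar_closure b R"
proof -
 let ?T = "potential n g" and ?p = "potential_p n g" and ?q = "potential_q n g"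
 obtain C where C: "\<And>z. cmod z < a / 2 ==> cmod (?T z) \<le> C * cmod z ^ (n + 1) \<and>
  cmod (?p z) \<le> C * cmod z ^ n \<and> cmod (?q z) \<le> C * cmod z ^ n" by (rule near_0) blast
 define a' where "a' = min (a / 2) r"
 have a': "a' > 0" "a' \<le> 1" "a' \<le> r" "a' \<le> a / 2" using a rs by (auto simp: a'_def)
 have gD: "disc_bounded g" using gN by (rule disc_boundedI)
 obtain Cf where Cf: "\<And>z. cmod z \<le> 1 ==> cmod (ps z * ?T z) \<le> Cf"
  using disc_bounded_mult[OF cutoff_disc_bounded(1) potential_disc_bounded(1)] unfolding disc_bounded_def by blast
 have "disc_bounded (source n g)" unfolding source_def[abs_def]
  by (intro disc_bounded_intros cutoff_disc_bounded potential_disc_bounded gD)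
 then obtain Cw where Cw: "\<And>z. cmod z \<le> 1 ==> cmod (source n g z) \<le> Cw" unfolding disc_bounded_def by blast
 have out: "ps z = 0" "pp z = 0" "pl z = 0" if "cmod z > 1" for z using that rs by (auto intro: zero)
 have src0: "source n g z = 0" if "cmod z < a' \<or> cmod z > 1" for z
  using that
 proof
  assume "cmod z < a'"
  then have "cmod z \<le> r" "g z = 0" using a' a by (auto intro!: g0)
  then show ?thesis using one(2,3)[of z] by (simp add: source_def)
 qed (simp add: source_def out)
 have o: "open (-{0::complex})" by auto
 show ?thesis
 proof (rule planar_closure_inner_limit[where a=a' and C=C and p="\<lambda>z. ps z * ?p z + pp z * ?T z" and q="\<lambda>z. ps z * ?q z + cnj (pp z) * ?T z", OF bn a'(1,2)])
  show "wnorm b (\<lambda>z. ps z * ?T z) < \<infinity>"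
  proof (rule wnorm_bounded_finite'[OF _ bn(2), of _ "\<bar>Cf\<bar>"])
   show "cmod (ps z * ?T z) \<le> \<bar>Cf\<bar>" for z using Cf[of z] out[of z] by (cases "cmod z \<le> 1") auto
  qed (auto simp: out)
  show "wnorm (- b) (source n g) < \<infinity>"
  proof (rule wnorm_bounded_finite[OF _ a'(1), of _ "\<bar>Cw\<bar>"])
   show "cmod (source n g z) \<le> \<bar>Cw\<bar>" for z using Cw[of z] src0[of z] by (cases "cmod z \<le> 1") auto
  qed (auto simp: src0)
  show "cmod (ps z * ?T z) \<le> C * cmod z ^ (n + 1) \<and> cmod (ps z * ?p z + pp z * ?T z) \<le> C * cmod z ^ n \<and>
    cmod (ps z * ?q z + cnj (pp z) * ?T z) \<le> C * cmod z ^ n" if "cmod z < a'" "z \<noteq> 0" for z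
   using C[of z] one[of z] that a' by simp
  fix K :: nat assume K: "K > 0"
  define ic ip il where "ic = inner_cutoff K" and "ip = inner_cutoff_p K" and "il = inner_cutoff_l K"
  have [measurable]: "ic \<in> borel_fun" "ip \<in> borel_fun" "il \<in> borel_fun"
   unfolding ic_def ip_def il_def by (rule log_cutoff_borel)+
  have iz: "ic z = 0" "ip z = 0" "il z = 0" if "cmod z \<le> exp (- real K)" for z
   using inner_cutoff_zero[OF K that] by (simp_all only: ic_def ip_def il_def)
  have icD: "disc_bounded ic" unfolding ic_def by (rule disc_boundedI[OF inner_cutoff_le_1])
  obtain D where D: "\<And>z. cmod (ip z) \<le> D" "\<And>z. cmod (il z) \<le> D"
  proof -
   have "ip z = 0" "il z = 0" if "cmod z < exp (- real K)" for z using iz(2,3)[of z] that by auto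
   then show thesis using that unfolding ip_def il_def by (rule cutoff_p_bounded[OF exp_gt_zero])
  qed
  have iD: "disc_bounded ip" "disc_bounded il" by (rule disc_boundedI[of _ D], rule D)+
  \<comment> \<open>The coefficients of x, of its z-derivative and of its zbar-derivative in the
    flat Laplacian of x times both cut-offs. They are bounded and vanish near 0, so the linear
    expression \<Phi> passes to the limit.\<close>
  define c0 cp cq where "c0 z = 4 * (ic z * pl z + ip z * cnj (pp z) + cnj (ip z) * pp z + il z * ps z)"
   and "cp z = 4 * (ic z * cnj (pp z) + cnj (ip z) * ps z)" and "cq z = 4 * (ic z * pp z + ip z * ps z)" for z
  have [measurable]: "c0 \<in> borel_fun" "cp \<in> borel_fun" "cq \<in> borel_fun"
   unfolding c0_def[abs_def] cp_def[abs_def] cq_def[abs_def] by measurable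
  have "disc_bounded c0" "disc_bounded cp" "disc_bounded cq" "disc_bounded (\<lambda>z. ic z * ps z)"
   unfolding c0_def[abs_def] cp_def[abs_def] cq_def[abs_def] by (intro disc_bounded_intros cutoff_disc_bounded icD iD)+
  then obtain C0 C1 C2 C3 where cb: "\<And>z. cmod z \<le> 1 ==> cmod (c0 z) \<le> C0" "\<And>z. cmod z \<le> 1 ==> cmod (cp z) \<le> C1"
   "\<And>z. cmod z \<le> 1 ==> cmod (cq z) \<le> C2" "\<And>z. cmod z \<le> 1 ==> cmod (ic z * ps z) \<le> C3"
   unfolding disc_bounded_def by metis
  have c_0: "ic z * ps z = 0" "c0 z = 0" "cp z = 0" "cq z = 0" if "cmod z < exp (- real K) \<or> cmod z > 1" for z
   using that iz[of z] out[of z] by (auto simp: c0_def cp_def cq_def)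
  define V where "V x z = ic z * ps z * x z" for x :: "complex => complex" and z
  define \<Phi> where "\<Phi> x p q l z = c0 z * x z + cp z * p z + cq z * q z + ic z * ps z * l z" for x p q l :: "complex => complex" and z
  obtain B where B: "\<And>j z. cmod z \<le> 1 ==> cmod (reg (dj j) z) \<le> B" "\<And>j z. cmod z \<le> 1 ==> cmod (reg_p (dj j) z) \<le> B"
   "\<And>j z. cmod z \<le> 1 ==> cmod (reg_q (dj j) z) \<le> B" "\<And>j z. cmod (4 * reg_l (dj j) z) \<le> kernel_mass * N" by (rule reg_bounded) blast
  note lim = reg_tendsto
  have W: "smooth_on UNIV (reg (dj j))" "wirtinger2 UNIV (reg (dj j)) (reg_p (dj j)) (reg_q (dj j)) (reg_l (dj j))" for j
   by (rule reg_smooth_wirtinger2[OF dj(1)])+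
  have [measurable]: "log_kernel (dj j) \<in> borel_fun" "log_kernel_p (dj j) \<in> borel_fun" for j
   using log_kernel_borel dj by blast+
  have rm [measurable]: "reg (dj j) \<in> borel_fun" "reg_p (dj j) \<in> borel_fun"
   "reg_q (dj j) \<in> borel_fun" "reg_l (dj j) \<in> borel_fun" for j
  proof -
   have "reg_p (dj j) = d_z (reg (dj j))" "reg_q (dj j) = d_zbar (reg (dj j))" "reg_l (dj j) = d_z (d_zbar (reg (dj j)))"
    using wirtinger2D[OF open_UNIV W(2)[of j]] by (auto simp: fun_eq_iff)
   then show "reg (dj j) \<in> borel_fun" "reg_p (dj j) \<in> borel_fun"
    "reg_q (dj j) \<in> borel_fun" "reg_l (dj j) \<in> borel_fun"
    using W(1)[of j] by (auto intro!: borel_measurable_continuous_onI smooth_on_imp_continuous smooth_on_d_z)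
  qed
  have "(V ?T, \<Phi> ?T ?p ?q (\<lambda>z. of_real kernel_mass * g z)) \<in> planar_closure b R"
  proof -
   have Vm [measurable]: "V x \<in> borel_fun" if [measurable]: "x \<in> borel_fun" for x
    unfolding V_def[abs_def] by measurable
   have \<Phi>m [measurable]: "\<Phi> x p q l \<in> borel_fun"
    if [measurable]: "x \<in> borel_fun" "p \<in> borel_fun" "q \<in> borel_fun" "l \<in> borel_fun" for x p q l
    unfolding \<Phi>_def[abs_def] by measurable
   have V0: "V x z = 0" if "cmod z < exp (- real K) \<or> cmod z > 1" for x z using c_0(1)[OF that] by (simp only: V_def mult_zero_left)
   have \<Phi>0: "\<Phi> x p q l z = 0" if "cmod z < exp (- real K) \<or> cmod z > 1" for x p q l z
    using c_0[OF that] by (simp only: \<Phi>_def mult_zero_left add_0)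
   have V_b: "cmod (V x z) \<le> C3 * B" if "cmod z \<le> 1" "cmod (x z) \<le> B" for x B z
    unfolding V_def norm_mult[of _ "x z"] using that order_trans[OF norm_ge_zero cb(4)[OF that(1)]] by (intro mult_mono cb) auto
   have \<Phi>_b: "cmod (\<Phi> x p q l z) \<le> C0 * B + C1 * B + C2 * B + C3 * B'" if z: "cmod z \<le> 1"
     and l: "cmod (x z) \<le> B" "cmod (p z) \<le> B" "cmod (q z) \<le> B" "cmod (l z) \<le> B'" for x p q l z B B'
   proof -
    have m: "cmod (c * y) \<le> D * E" if "cmod c \<le> D" "cmod y \<le> E" for c y D E
     unfolding norm_mult using that order_trans[OF norm_ge_zero that(1)] by (intro mult_mono) auto
    show ?thesis unfolding \<Phi>_def by (intro norm_triangle_le add_mono m cb z l)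
   qed
   have lims: "AE z in lborel. (\<lambda>j. V (reg (dj j)) z) \<longlonglongrightarrow> V ?T z"
    "AE z in lborel. (\<lambda>j. \<Phi> (reg (dj j)) (reg_p (dj j)) (reg_q (dj j)) (\<lambda>z. 4 * reg_l (dj j) z) z) \<longlonglongrightarrow> \<Phi> ?T ?p ?q (\<lambda>z. of_real kernel_mass * g z) z"
   proof -
    have "(\<lambda>j. V (reg (dj j)) z) \<longlonglongrightarrow> V ?T z" for z
     by (cases "cmod z \<le> 1") (unfold V_def, auto intro!: tendsto_intros lim simp: out)
    then show "AE z in lborel. (\<lambda>j. V (reg (dj j)) z) \<longlonglongrightarrow> V ?T z" by simp
    show "AE z in lborel. (\<lambda>j. \<Phi> (reg (dj j)) (reg_p (dj j)) (reg_q (dj j)) (\<lambda>z. 4 * reg_l (dj j) z) z) \<longlonglongrightarrow> \<Phi> ?T ?p ?q (\<lambda>z. of_real kernel_mass * g z) z"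
     using cont
    proof eventually_elim
     fix z assume c: "isCont g z"
     show "(\<lambda>j. \<Phi> (reg (dj j)) (reg_p (dj j)) (reg_q (dj j)) (\<lambda>z. 4 * reg_l (dj j) z) z) \<longlonglongrightarrow> \<Phi> ?T ?p ?q (\<lambda>z. of_real kernel_mass * g z) z"
     proof (cases "cmod z \<le> 1")
      case True
      show ?thesis unfolding \<Phi>_def by (intro tendsto_add tendsto_mult[OF tendsto_const] lim True c)
     qed (simp add: \<Phi>0)
    qed
   qed
   have Vb: "cmod (V (reg (dj j)) z) \<le> \<bar>C3 * B\<bar>" for j z
   proof (cases "cmod z \<le> 1")
    case True
    show ?thesis by (rule order_trans[OF V_b[where x="reg (dj j)", OF True B(1)[OF True]] abs_ge_self])
   qed (simp add: V0)
   have \<Phi>b: "cmod (\<Phi> (reg (dj j)) (reg_p (dj j)) (reg_q (dj j)) (\<lambda>z. 4 * reg_l (dj j) z) z) \<le>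
     \<bar>C0 * B + C1 * B + C2 * B + C3 * (kernel_mass * N)\<bar>" for j z
   proof (cases "cmod z \<le> 1")
    case True
    show ?thesis by (rule order_trans[OF \<Phi>_b[where x="reg (dj j)" and p="reg_p (dj j)" and q="reg_q (dj j)" and l="\<lambda>z. 4 * reg_l (dj j) z", OF True B(1)[OF True] B(2)[OF True] B(3)[OF True] B(4)] abs_ge_self])
   qed (simp add: \<Phi>0)
   have lv: "(\<lambda>j. wnorm b (\<lambda>z. V (reg (dj j)) z - V ?T z)) \<longlonglongrightarrow> 0"
    by (rule wnorm_tendsto_bounded[OF _ _ exp_gt_zero Vb V0 lims(1)]) auto
   have lw: "(\<lambda>j. wnorm (- b) (\<lambda>z. \<Phi> (reg (dj j)) (reg_p (dj j)) (reg_q (dj j)) (\<lambda>z. 4 * reg_l (dj j) z) z - \<Phi> ?T ?p ?q (\<lambda>z. of_real kernel_mass * g z) z)) \<longlonglongrightarrow> 0"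
    by (rule wnorm_tendsto_bounded[OF _ _ exp_gt_zero \<Phi>b \<Phi>0 lims(2)]) auto
   obtain Ct Cs where ts: "\<And>z. cmod z \<le> 1 ==> cmod (V ?T z) \<le> Ct" "\<And>z. cmod z \<le> 1 ==> cmod (\<Phi> ?T ?p ?q (\<lambda>z. of_real kernel_mass * g z) z) \<le> Cs"
   proof -
    have "disc_bounded (V ?T)" "disc_bounded (\<Phi> ?T ?p ?q (\<lambda>z. of_real kernel_mass * g z))"
     unfolding V_def[abs_def] \<Phi>_def[abs_def] c0_def[abs_def] cp_def[abs_def] cq_def[abs_def]
     by (intro disc_bounded_intros cutoff_disc_bounded icD iD gD potential_disc_bounded)+
    then show thesis using that unfolding disc_bounded_def by blast
   qed
   show ?thesis
   proof (rule planar_closure_limit_seq[OF _ _ _ _ _ lv lw])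
    show "wnorm b (V ?T) < \<infinity>"
    proof (rule wnorm_bounded_finite[OF _ exp_gt_zero _ V0])
     show "cmod (V ?T z) \<le> \<bar>Ct\<bar>" for z using ts(1)[of z] V0[of z] by (cases "cmod z \<le> 1") auto
    qed auto
    show "wnorm (- b) (\<Phi> ?T ?p ?q (\<lambda>z. of_real kernel_mass * g z)) < \<infinity>"
    proof (rule wnorm_bounded_finite[OF _ exp_gt_zero _ \<Phi>0])
     show "cmod (\<Phi> ?T ?p ?q (\<lambda>z. of_real kernel_mass * g z) z) \<le> \<bar>Cs\<bar>" for z using ts(2)[of z] \<Phi>0[of z] by (cases "cmod z \<le> 1") auto
    qed auto
    have "(V (reg (dj j)), \<Phi> (reg (dj j)) (reg_p (dj j)) (reg_q (dj j)) (\<lambda>z. 4 * reg_l (dj j) z)) \<in> planar_closure b R" for j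
    proof (rule planar_test_in_closure'[OF _ R(2)])
     have V': "V (reg (dj j)) = (\<lambda>z. ic z * (ps z * reg (dj j) z))" by (simp add: V_def fun_eq_iff mult.assoc)
     have WW: "wirtinger2 (-{0}) ic ip (\<lambda>z. cnj (ip z)) il" unfolding ic_def ip_def il_def by (rule wirtinger2_log_cutoff')
     note w2 = wirtinger2_mult[OF WW wirtinger2_mult[OF psW wirtinger2_subset[OF W(2)[of j] subset_UNIV]]]
     have "exp (- real K) \<le> cmod z \<and> cmod z \<le> s" if "V (reg (dj j)) z \<noteq> 0" for z
     proof -
      have "\<not> cmod z < exp (- real K)" "\<not> s \<le> cmod z" using that V0[of z] zero(1)[of z] by (auto simp: V_def)
      then show ?thesis by linarith
     qed
     moreover have "smooth_on (-{0}) (V (reg (dj j)))" unfolding V'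
      by (intro smooth_on_mult o smooth_on_subset[OF W(1)]) (auto simp: ic_def ps_def intro!: log_cutoff_smooth)
     ultimately show "V (reg (dj j)) \<in> planar_test R" unfolding planar_test_def using exp_gt_zero R(1) by blast
     fix z :: complex assume "z \<noteq> 0"
     then show "\<Phi> (reg (dj j)) (reg_p (dj j)) (reg_q (dj j)) (\<lambda>z. 4 * reg_l (dj j) z) z = 4 * d_z (d_zbar (V (reg (dj j)))) z"
      unfolding V' using wirtinger2D(3)[OF o w2, of z] by (simp add: \<Phi>_def c0_def cp_def cq_def algebra_simps)
    qed measurable
    then show "\<forall>\<^sub>F j in sequentially. (V (reg (dj j)), \<Phi> (reg (dj j)) (reg_p (dj j)) (reg_q (dj j)) (\<lambda>z. 4 * reg_l (dj j) z)) \<in> planar_closure b R" by simp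
   qed measurable
  qed
  moreover have "V ?T = (\<lambda>z. ic z * (ps z * ?T z))" by (simp add: V_def fun_eq_iff mult.assoc)
  moreover have "\<Phi> ?T ?p ?q (\<lambda>z. of_real kernel_mass * g z) = (\<lambda>z. ic z * source n g z + 4 * (ip z * (ps z * ?q z + cnj (pp z) * ?T z) +
    cnj (ip z) * (ps z * ?p z + pp z * ?T z) + il z * (ps z * ?T z)))"
   by (simp add: \<Phi>_def source_def c0_def cp_def cq_def fun_eq_iff algebra_simps)
  ultimately show "(\<lambda>z. inner_cutoff K z * (ps z * ?T z), \<lambda>z. inner_cutoff K z * source n g z + 4 * (inner_cutoff_p K z * (ps z * ?q z + cnj (pp z) * ?T z) +
    cnj (inner_cutoff_p K z) * (ps z * ?p z + pp z * ?T z) + inner_cutoff_l K z * (ps z * ?T z))) \<in> planar_closure b R"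
   by (simp only: ic_def ip_def il_def)
 qed measurable
qed

end

lemma wnorm_le_indicator:
 assumes [measurable]: "S \<in> sets borel" and F: "\<And>z. ennreal ((cmod (F z))^2) \<le> c * indicator S z"
 shows "wnorm s F \<le> c * wnorm s (indicator S)"
proof -
 have "wnorm s F \<le> (\<integral>\<^sup>+z. c * ennreal ((cmod (indicator S z))^2 * cmod z powr (2 * s)) \<partial>lborel)"
  unfolding wnorm_def
 proof (rule nn_integral_mono)
  fix z
  have "ennreal ((cmod (F z))^2 * cmod z powr (2 * s)) \<le> c * indicator S z * ennreal (cmod z powr (2 * s))"
   unfolding ennreal_mult[OF zero_le_power2 powr_ge_zero] by (intro mult_right_mono F) auto
  then show "ennreal ((cmod (F z))^2 * cmod z powr (2 * s)) \<le> c * ennreal ((cmod (indicator S z))^2 * cmod z powr (2 * s))"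
   by (auto simp: indicator_def split: if_splits)
 qed
 then show ?thesis unfolding wnorm_def by (subst (asm) nn_integral_cmult) auto
qed

lemma isCont_annulus:
 assumes h: "continuous_on UNIV h" and z: "cmod z \<noteq> a" "cmod z \<noteq> r"
 shows "isCont (\<lambda>w. if a \<le> cmod w \<and> cmod w \<le> r then h w else 0 :: complex) z"
proof (cases "a < cmod z \<and> cmod z < r")
 case True
 have "open ({w. a < cmod w} \<inter> {w. cmod w < r})" by (intro open_Int open_Collect_less continuous_intros)
 then have "eventually (\<lambda>w. w \<in> {w. a < cmod w} \<inter> {w. cmod w < r}) (nhds z)" using True by (intro eventually_nhds_in_open) auto
 then have e: "eventually (\<lambda>w. (if a \<le> cmod w \<and> cmod w \<le> r then h w else 0) = h w) (nhds z)"
  by eventually_elim auto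
 show ?thesis unfolding isCont_cong[OF e] using h by (simp add: continuous_on_eq_continuous_at)
next
 case False
 have "open ({w. cmod w < a} \<union> {w. r < cmod w})" by (intro open_Un open_Collect_less continuous_intros)
 then have "eventually (\<lambda>w. w \<in> {w. cmod w < a} \<union> {w. r < cmod w}) (nhds z)" using False z by (intro eventually_nhds_in_open) auto
 then have e: "eventually (\<lambda>w. (if a \<le> cmod w \<and> cmod w \<le> r then h w else 0) = 0) (nhds z)"
  by eventually_elim auto
 show ?thesis unfolding isCont_cong[OF e] by simp
qed

lemma AE_lborel_norm_neq: "AE z in lborel. cmod z \<noteq> r"
proof -
 have "sphere (0::complex) r \<in> null_sets lebesgue" using negligible_sphere negligible_iff_null_sets by blast
 then have "sphere (0::complex) r \<in> null_sets lborel" by (simp add: null_sets_completion_iff)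
 from AE_not_in[OF this] show ?thesis by simp
qed

section \<open>From nice charges to all charges by density\<close>

context radial_cutoff
begin

context
 fixes b :: real and n :: nat and r' :: real
 assumes bn: "real n < b + 1" "b + 1 \<le> real n + 1" and r': "r' < r"
begin

text \<open>The support radius r' is smaller than r, and the derivatives of \<open>ps\<close> vanish
  inside radius r, so |z - w| \<ge> r - r' wherever first derivatives of the potential
  enter.\<close>

abbreviation charge :: "(complex => complex) => bool" where
 "charge h \<equiv> h \<in> borel_fun \<and> wnorm (- b) h < \<infinity> \<and> (\<forall>w. cmod w > r' --> h w = 0)"

text \<open>For r \<le> |z| \<le> 1 the kernel is at most 1 / (2 (r - r') |w|^n), and its square is
  integrable against |w|^(2b) because n < b + 1.\<close>

lemma kern_p_bound:
 obtains c where "c < \<infinity>" "\<And>h z. charge h ==> r \<le> cmod z ==> cmod z \<le> 1 ==>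
  (\<integral>\<^sup>+w. ennreal (cmod (h w * kern_p n z w)) \<partial>lborel)^2 \<le> c * wnorm (- b) h"
proof
 define k :: "complex => real" where "k w = 1 / (2 * (r - r') * cmod w ^ n) * indicator (cball 0 1) w" for w
 have [measurable]: "k \<in> borel_fun" unfolding k_def[abs_def] by measurable
 let ?c = "\<integral>\<^sup>+w. ennreal ((k w)^2 * cmod w powr (2 * b)) \<partial>lborel"
 let ?d = "(1 / (2 * (r - r')))^2"
 have "?c \<le> (\<integral>\<^sup>+w. ennreal ?d * (ennreal (cmod w powr - (2 * real n - 2 * b)) * indicator (cball 0 1) w) \<partial>lborel)"
 proof (rule nn_integral_mono)
  fix w :: complex
  show "ennreal ((k w)^2 * cmod w powr (2 * b)) \<le> ennreal ?d * (ennreal (cmod w powr - (2 * real n - 2 * b)) * indicator (cball 0 1) w)"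
  proof (cases "w = 0 \<or> cmod w > 1")
   case False
   then have "(k w)^2 * cmod w powr (2 * b) = ?d * (cmod w powr (2 * b) / (cmod w ^ n)^2)"
    by (simp add: k_def power_divide power_mult_distrib)
   also have "(cmod w ^ n)^2 = cmod w powr (2 * real n)"
    using False powr_realpow[of "cmod w" "2 * n"] by (simp add: power_even_eq)
   also have "cmod w powr (2 * b) / cmod w powr (2 * real n) = cmod w powr - (2 * real n - 2 * b)"
    by (simp add: powr_diff[symmetric])
   finally show ?thesis using False by (simp add: ennreal_mult)
  qed (auto simp: k_def)
 qed
 also have "\<dots> = ennreal ?d * (\<integral>\<^sup>+w\<in>cball 0 1. ennreal (cmod w powr - (2 * real n - 2 * b)) \<partial>lborel)"
  by (rule nn_integral_cmult) measurable
 also have "\<dots> < \<infinity>" using nn_integral_powr_finite[of "2 * real n - 2 * b"] bn by (simp add: ennreal_mult_less_top)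
 finally show "?c < \<infinity>" .
 fix h z assume h: "charge h" and z: "r \<le> cmod z" "cmod z \<le> 1"
 then have [measurable]: "h \<in> borel_fun" by blast
 have "(\<integral>\<^sup>+w. ennreal (cmod (h w * kern_p n z w)) \<partial>lborel) \<le> (\<integral>\<^sup>+w. ennreal (cmod (h w) * \<bar>k w\<bar>) \<partial>lborel)"
 proof (rule nn_integral_mono, rule ennreal_leI)
  fix w
  show "cmod (h w * kern_p n z w) \<le> cmod (h w) * \<bar>k w\<bar>"
  proof (cases "cmod w > r' \<or> cmod w ^ n = 0")
   case True
   then have "h w = 0 \<or> kern_p n z w = 0" using h by (auto simp: kern_p_def)
   then show ?thesis by auto
  next
   case False
   have d: "r - r' \<le> cmod (z - w)" using norm_triangle_ineq2[of z w] z False by linarith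
   have "cmod w \<le> 1" using False r' rs by linarith
   then have k: "\<bar>k w\<bar> = 1 / (2 * cmod w ^ n * (r - r'))" using r' by (simp add: k_def mult_ac)
   have "cmod (kern_p n z w) = cmod z ^ n / (2 * cmod w ^ n * cmod (z - w))"
    by (simp only: kern_p_def norm_divide norm_mult norm_power norm_numeral)
   also have "\<dots> \<le> \<bar>k w\<bar>"
    unfolding k using False d r' power_le_one[OF norm_ge_zero z(2)] by (intro frac_le mult_left_mono) auto
   finally show ?thesis unfolding norm_mult by (rule mult_left_mono) auto
  qed
 qed
 then have "(\<integral>\<^sup>+w. ennreal (cmod (h w * kern_p n z w)) \<partial>lborel)^2 \<le> (\<integral>\<^sup>+w. ennreal (cmod (h w) * \<bar>k w\<bar>) \<partial>lborel)^2"
  by (rule power_mono) auto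
 also have "\<dots> \<le> wnorm (- b) h * ?c" by (rule wnorm_Cauchy_Schwarz) measurable
 finally show "(\<integral>\<^sup>+w. ennreal (cmod (h w * kern_p n z w)) \<partial>lborel)^2 \<le> ?c * wnorm (- b) h" by (simp add: mult.commute)
qed

lemma charge_zero: "charge h ==> cmod w > 1 ==> h w = 0"
 using r' rs by auto

lemma annulus_cases: "z = 0 \<or> cmod z > 1 ==> ps z = 0" "cmod z < r \<or> cmod z > 1 ==> pp z = 0 \<and> pl z = 0"
 using at0 zero[of z] one(2,3)[of z] rs by auto

lemma kernel_integrable:
 assumes "charge h" "r \<le> cmod z" "cmod z \<le> 1"
 shows "integrable lborel (\<lambda>w. h w * kern_p n z w)" "integrable lborel (\<lambda>w. h w * cnj (kern_p n z w))"
proof -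
 obtain c where c: "c < \<infinity>" "\<And>h z. charge h ==> r \<le> cmod z ==> cmod z \<le> 1 ==>
  (\<integral>\<^sup>+w. ennreal (cmod (h w * kern_p n z w)) \<partial>lborel)^2 \<le> c * wnorm (- b) h" by (rule kern_p_bound) blast
 have [measurable]: "h \<in> borel_fun" "kern_p n z \<in> borel_fun"
  using assms unfolding kern_p_def[abs_def] by auto
 have "c * wnorm (- b) h < \<infinity>" using c(1) assms(1) by (simp add: ennreal_mult_less_top)
 from le_less_trans[OF c(2)[OF assms] this] have "(\<integral>\<^sup>+w. ennreal (cmod (h w * kern_p n z w)) \<partial>lborel) < \<infinity>"
  by (rule ennreal_square_less_top)
 then show "integrable lborel (\<lambda>w. h w * kern_p n z w)" "integrable lborel (\<lambda>w. h w * cnj (kern_p n z w))"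
  by (auto intro!: integrableI_bounded simp: norm_mult)
qed

text \<open>Linearity requires convergent integrals. Convergence is known for 0 < |z| \<le> 1, and
  for the derivative kernels for r \<le> |z| \<le> 1; elsewhere the cut-off factors in front of them
  vanish.\<close>

lemma potential_source_diff:
 assumes "charge g" "charge h"
 shows "ps z * potential n g z - ps z * potential n h z = ps z * potential n (\<lambda>z. g z - h z) z"
  "source n g z - source n h z = source n (\<lambda>z. g z - h z) z"
proof -
 have T: "potential n (\<lambda>z. g z - h z) z = potential n g z - potential n h z" if "z \<noteq> 0" "cmod z \<le> 1"
  unfolding potential_def left_diff_distrib using assms that charge_zero
  by (intro Bochner_Integration.integral_diff potential_kernel_integrable[OF bn]) auto
 then show "ps z * potential n g z - ps z * potential n h z = ps z * potential n (\<lambda>z. g z - h z) z"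
  using annulus_cases(1)[of z] by (cases "z = 0 \<or> cmod z > 1") (auto simp: right_diff_distrib)
 show "source n g z - source n h z = source n (\<lambda>z. g z - h z) z"
 proof (cases "cmod z < r \<or> cmod z > 1")
  case True
  then show ?thesis using annulus_cases(2)[of z] by (simp add: source_def algebra_simps)
 next
  case False
  then have z: "r \<le> cmod z" "cmod z \<le> 1" "z \<noteq> 0" using rs by auto
  have pq: "potential_p n (\<lambda>z. g z - h z) z = potential_p n g z - potential_p n h z"
   "potential_q n (\<lambda>z. g z - h z) z = potential_q n g z - potential_q n h z"
   unfolding potential_p_def potential_q_def left_diff_distrib
   by (intro Bochner_Integration.integral_diff kernel_integrable assms z)+
  show ?thesis unfolding source_def pq T[OF z(3,2)] by (simp add: algebra_simps)
 qed
qed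

text \<open>The pointwise Cauchy-Schwarz bounds are uniform in z on the unit disc and on the annulus
  r \<le> |z| \<le> 1 respectively. The weight |z|^(2b) is integrable on the former and |z|^(-2b) on
  the latter.\<close>

lemma potential_source_bound:
 obtains c where "c < \<infinity>" "\<And>h. charge h ==> wnorm b (\<lambda>z. ps z * potential n h z) \<le> c * wnorm (- b) h"
  "\<And>h. charge h ==> wnorm (- b) (source n h) \<le> c * wnorm (- b) h"
proof -
 obtain x where x: "real n < x" "x < real n + 1" "b + 1 / 2 \<le> x" "x < b + 1" using exists_powr_exponent[OF bn] by blast
 obtain C where C: "C > 0" "\<And>g z. g \<in> borel_fun ==> (\<And>w. cmod w > 1 ==> g w = 0) ==> z \<noteq> 0 ==> cmod z \<le> 1 ==>
   (\<integral>\<^sup>+w. ennreal (cmod (g w * of_real (kern n (z / w)))) \<partial>lborel)^2 \<le> ennreal (C * cmod z powr (2 * x)) * wnorm (- b) g"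
  using potential_bound[OF x] by blast
 obtain c where c: "c < \<infinity>" "\<And>h z. charge h ==> r \<le> cmod z ==> cmod z \<le> 1 ==>
  (\<integral>\<^sup>+w. ennreal (cmod (h w * kern_p n z w)) \<partial>lborel)^2 \<le> c * wnorm (- b) h" by (rule kern_p_bound) blast
 obtain D where D: "\<And>z. cmod (pp z) \<le> D" "\<And>z. cmod (pl z) \<le> D" by (rule pp_bound) blast
 have D0: "D \<ge> 0" using order_trans[OF norm_ge_zero D(1)] .
 let ?S = "{z. r \<le> cmod z \<and> cmod z \<le> 1}"
 let ?I = "wnorm b (indicator (cball 0 1))" and ?J = "wnorm (- b) (indicator ?S)"
 have m: "cball 0 1 \<in> sets (borel :: complex measure)" "?S \<in> sets borel" by auto
 have IJ: "?I < \<infinity>" "?J < \<infinity>"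
 proof -
  note [measurable] = m
  show "?I < \<infinity>" by (rule wnorm_bounded_finite'[of _ _ 1]) (use bn in \<open>auto simp: indicator_def\<close>)
  show "?J < \<infinity>" by (rule wnorm_bounded_finite[OF _ rs(1), of _ 1]) (auto simp: indicator_def)
 qed
 \<comment> \<open>48 is 16 times 3: the square of the factor 4, and the bound of the square of a
   sum of three terms by three times the sum of the squares.\<close>
 let ?k = "ennreal (48 * D^2) * (c + c + ennreal C)"
 define K where "K = ennreal C * ?I + (2 * ennreal (kernel_mass^2) + 2 * (?k * ?J))"
 show thesis
 proof (rule that[of K])
  show "K < \<infinity>" unfolding K_def using IJ c(1) by (simp add: ennreal_mult_less_top)
  fix h assume h: "charge h"
  then have [measurable]: "h \<in> borel_fun" by blast
  let ?N = "wnorm (- b) h"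
  have T: "ennreal ((cmod (potential n h z))^2) \<le> ennreal C * ?N" if z: "z \<noteq> 0" "cmod z \<le> 1" for z
  proof -
   have "ennreal ((cmod (potential n h z))^2) \<le> (\<integral>\<^sup>+w. ennreal (cmod (h w * of_real (kern n (z / w)))) \<partial>lborel)^2"
    unfolding potential_def by (rule ennreal_norm_integral_square_le)
   also have "\<dots> \<le> ennreal (C * cmod z powr (2 * x)) * ?N" using charge_zero[OF h] by (intro C z) auto
   also have "cmod z powr (2 * x) \<le> 1" using z x(1) by (intro powr_le1) auto
   then have "ennreal (C * cmod z powr (2 * x)) \<le> ennreal C" using C(1) by (intro ennreal_leI) (simp add: mult_left_le)
   then have "ennreal (C * cmod z powr (2 * x)) * ?N \<le> ennreal C * ?N" by (rule mult_right_mono) auto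
   finally show ?thesis .
  qed
  have T': "ennreal ((cmod (potential_p n h z))^2) \<le> c * ?N" "ennreal ((cmod (potential_q n h z))^2) \<le> c * ?N"
   if z: "r \<le> cmod z" "cmod z \<le> 1" for z
   using order_trans[OF ennreal_norm_integral_square_le c(2)[OF h z]]
    order_trans[OF ennreal_norm_integral_square_le, of "\<lambda>w. h w * cnj (kern_p n z w)"] c(2)[OF h z]
   unfolding potential_p_def potential_q_def norm_mult complex_mod_cnj by blast+
  have "wnorm b (\<lambda>z. ps z * potential n h z) \<le> (ennreal C * ?N) * ?I"
  proof (rule wnorm_le_indicator[OF m(1)])
   fix z
   show "ennreal ((cmod (ps z * potential n h z))^2) \<le> ennreal C * ?N * indicator (cball 0 1) z"
   proof (cases "z = 0 \<or> cmod z > 1")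
    case False
    have "(cmod (ps z * potential n h z))^2 \<le> (cmod (potential n h z))^2"
     unfolding norm_mult by (intro power_mono mult_left_le_one_le ps1) auto
    from order_trans[OF ennreal_leI[OF this] T[of z]] show ?thesis using False by simp
   qed (simp add: annulus_cases)
  qed
  also have "\<dots> = (ennreal C * ?I) * ?N" by (simp only: mult_ac)
  also have "\<dots> \<le> K * ?N" unfolding K_def by (intro mult_right_mono) auto
  finally show "wnorm b (\<lambda>z. ps z * potential n h z) \<le> K * ?N" .
  let ?E = "\<lambda>z. 4 * (pp z * potential_q n h z + cnj (pp z) * potential_p n h z + pl z * potential n h z)"
  have E: "wnorm (- b) ?E \<le> (?k * ?N) * ?J"
  proof (rule wnorm_le_indicator[OF m(2)])
   fix z
   show "ennreal ((cmod (?E z))^2) \<le> ?k * ?N * indicator ?S z"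
   proof (cases "cmod z < r \<or> cmod z > 1")
    case False
    then have z: "r \<le> cmod z" "cmod z \<le> 1" "z \<noteq> 0" using rs by auto
    let ?q = "cmod (potential_q n h z)" and ?p = "cmod (potential_p n h z)" and ?t = "cmod (potential n h z)"
    have "cmod (?E z) \<le> 4 * (D * ?q + D * ?p + D * ?t)"
     unfolding norm_mult[of 4] norm_numeral
     by (intro mult_left_mono norm_triangle_le add_mono) (auto simp: norm_mult intro!: mult_right_mono D)
    also have "\<dots> = 4 * D * (?q + ?p + ?t)" by (simp add: algebra_simps)
    finally have "(cmod (?E z))^2 \<le> (4 * D * (?q + ?p + ?t))^2" by (rule power_mono) simp
    also have "\<dots> = 16 * D^2 * (?q + ?p + ?t)^2" by (simp add: power_mult_distrib)
    also have "(?q + ?p + ?t)^2 \<le> 3 * (?q^2 + ?p^2 + ?t^2)"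
     using sum_squares_ge_zero[of "?q - ?p" "?p - ?t"] zero_le_power2[of "?q - ?t"] by (simp add: power2_eq_square algebra_simps)
    then have "16 * D^2 * (?q + ?p + ?t)^2 \<le> 16 * D^2 * (3 * (?q^2 + ?p^2 + ?t^2))" by (intro mult_left_mono) auto
    also have "\<dots> = 48 * D^2 * (?q^2 + ?p^2 + ?t^2)" by simp
    finally have "(cmod (?E z))^2 \<le> 48 * D^2 * (?q^2 + ?p^2 + ?t^2)" .
    then have "ennreal ((cmod (?E z))^2) \<le> ennreal (48 * D^2 * (?q^2 + ?p^2 + ?t^2))" by (rule ennreal_leI)
    also have "\<dots> = ennreal (48 * D^2) * (ennreal (?q^2) + ennreal (?p^2) + ennreal (?t^2))"
     by (simp add: ennreal_mult ennreal_plus[symmetric] del: ennreal_plus)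
    also have "\<dots> \<le> ennreal (48 * D^2) * (c * ?N + c * ?N + ennreal C * ?N)"
     by (intro mult_left_mono add_mono T T' z) auto
    finally show ?thesis using False by (simp add: distrib_left distrib_right mult_ac)
   qed (use annulus_cases(2)[of z] in auto)
  qed
  have M: "wnorm (- b) (\<lambda>z. ps z * (of_real kernel_mass * h z)) \<le> ennreal (kernel_mass^2) * ?N"
  proof (rule wnorm_mono_AE, rule AE_I2)
   fix z
   have "cmod (ps z) * (kernel_mass * cmod (h z)) \<le> 1 * (kernel_mass * cmod (h z))"
    using kernel_mass_pos by (intro mult_right_mono ps1) auto
   then show "cmod (ps z * (of_real kernel_mass * h z)) \<le> kernel_mass * cmod (h z)"
    using kernel_mass_pos by (simp add: norm_mult)
  qed (use kernel_mass_pos in auto)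
  have "wnorm (- b) (source n h) \<le> 2 * wnorm (- b) (\<lambda>z. ps z * (of_real kernel_mass * h z)) + 2 * wnorm (- b) ?E"
   unfolding source_def[abs_def] by (rule wnorm_add) measurable
  also have "\<dots> \<le> 2 * (ennreal (kernel_mass^2) * ?N) + 2 * ((?k * ?N) * ?J)" by (intro add_mono mult_left_mono M E) auto
  also have "\<dots> = (2 * ennreal (kernel_mass^2) + 2 * (?k * ?J)) * ?N" by (simp only: distrib_right mult.assoc mult.commute[of ?N ?J])
  also have "\<dots> \<le> K * ?N" unfolding K_def by (intro mult_right_mono) auto
  finally show "wnorm (- b) (source n h) \<le> K * ?N" .
 qed
qed

lemma potential_closure_limit:
 assumes g: "charge g" and gj: "\<And>j. charge (g' j)" and lim: "(\<lambda>j. wnorm (- b) (\<lambda>z. g' j z - g z)) \<longlonglongrightarrow> 0"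
  and cl: "\<And>j. (\<lambda>z. ps z * potential n (g' j) z, source n (g' j)) \<in> planar_closure b R"
 shows "(\<lambda>z. ps z * potential n g z, source n g) \<in> planar_closure b R"
proof -
 obtain c where c: "c < \<infinity>" "\<And>h. charge h ==> wnorm b (\<lambda>z. ps z * potential n h z) \<le> c * wnorm (- b) h"
  "\<And>h. charge h ==> wnorm (- b) (source n h) \<le> c * wnorm (- b) h" by (rule potential_source_bound) blast
 have [measurable]: "g \<in> borel_fun" "\<And>j. g' j \<in> borel_fun" using g gj by auto
 have fin: "c * wnorm (- b) g < \<infinity>" using c(1) g by (simp add: ennreal_mult_less_top)
 have d: "charge (\<lambda>z. g' j z - g z)" for j
 proof -
  have "wnorm (- b) (\<lambda>z. g' j z + - g z) \<le> 2 * wnorm (- b) (g' j) + 2 * wnorm (- b) (\<lambda>z. - g z)" by (rule wnorm_add) measurable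
  also have "wnorm (- b) (\<lambda>z. - g z) = wnorm (- b) g" by (simp add: wnorm_def)
  also have "2 * wnorm (- b) (g' j) + 2 * wnorm (- b) g < \<infinity>" using g gj[of j] by (simp add: ennreal_mult_less_top)
  finally show ?thesis using g gj[of j] by simp
 qed
 have l: "(\<lambda>j. c * wnorm (- b) (\<lambda>z. g' j z - g z)) \<longlonglongrightarrow> 0"
  using ennreal_tendsto_cmult[OF c(1)[unfolded infinity_ennreal_def] lim] by simp
 show ?thesis
 proof (rule planar_closure_limit_seq[where v'="\<lambda>j z. ps z * potential n (g' j) z" and w'="\<lambda>j. source n (g' j)"])
  show "wnorm b (\<lambda>z. ps z * potential n g z) < \<infinity>" "wnorm (- b) (source n g) < \<infinity>"
   using le_less_trans[OF c(2)[OF g] fin] le_less_trans[OF c(3)[OF g] fin] .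
  show "(\<lambda>j. wnorm b (\<lambda>z. ps z * potential n (g' j) z - ps z * potential n g z)) \<longlonglongrightarrow> 0"
   unfolding potential_source_diff(1)[OF gj g] by (rule tendsto_sandwich[OF _ _ tendsto_const l]) (use c(2)[OF d] in auto)
  show "(\<lambda>j. wnorm (- b) (\<lambda>z. source n (g' j) z - source n g z)) \<longlonglongrightarrow> 0"
   unfolding potential_source_diff(2)[OF gj g] by (rule tendsto_sandwich[OF _ _ tendsto_const l]) (use c(3)[OF d] in auto)
 qed (use cl in auto)
qed

text \<open>A bounded charge is an almost everywhere limit of uniformly bounded continuous
  functions. Cut to the annulus a \<le> |z| \<le> r', these are nice charges and converge in the
  weighted norm by dominated convergence.\<close>

lemma bounded_potential_in_planar_closure:
 assumes g: "charge g" and N: "\<And>z. cmod (g z) \<le> N" and a: "a > 0" "\<And>z. cmod z < a ==> g z = 0" and R: "s < R" "R \<le> 1"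
 shows "(\<lambda>z. ps z * potential n g z, source n g) \<in> planar_closure b R"
proof -
 have [measurable]: "g \<in> borel_fun" using g by blast
 obtain h where h: "\<And>j. continuous_on UNIV (h j)" "\<And>j z. cmod (h j z) \<le> N + 1"
  "AE z in lborel. (\<lambda>j. h j z) \<longlonglongrightarrow> g z" using AE_lborel_lim_continuous[of g N] N by auto
 define g' where "g' j z = (if a \<le> cmod z \<and> cmod z \<le> r' then h j z else 0)" for j z
 have [measurable]: "h j \<in> borel_fun" for j by (rule borel_measurable_continuous_onI[OF h(1)])
 have gm [measurable]: "g' j \<in> borel_fun" for j unfolding g'_def[abs_def] by measurable
 have N0: "N + 1 \<ge> 0" using order_trans[OF norm_ge_zero h(2)] .
 have b1: "cmod (g' j z) \<le> N + 1" for j z using h(2) N0 by (auto simp: g'_def)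
 have z0: "cmod z < a \<or> cmod z > 1 ==> g' j z = 0" for j z using r' rs by (auto simp: g'_def)
 have "wnorm (- b) (g' j) < \<infinity>" for j by (rule wnorm_bounded_finite[OF gm a(1) b1 z0])
 then have ch: "charge (g' j)" for j by (simp add: gm) (simp add: g'_def)
 show ?thesis
 proof (rule potential_closure_limit[OF g ch])
  show "(\<lambda>j. wnorm (- b) (\<lambda>z. g' j z - g z)) \<longlonglongrightarrow> 0"
  proof (rule wnorm_tendsto_bounded[OF gm _ a(1) b1 z0])
   show "AE z in lborel. (\<lambda>j. g' j z) \<longlonglongrightarrow> g z"
    using h(3)
   proof eventually_elim
    fix z assume "(\<lambda>j. h j z) \<longlonglongrightarrow> g z"
    moreover have "g z = 0" if "\<not> (a \<le> cmod z \<and> cmod z \<le> r')" using that a(2)[of z] g by auto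
    ultimately show "(\<lambda>j. g' j z) \<longlonglongrightarrow> g z" by (cases "a \<le> cmod z \<and> cmod z \<le> r'") (auto simp: g'_def)
   qed
  qed auto
  fix j
  interpret nice_potential n "g' j" "N + 1" a r s
  proof
   show "AE z in lborel. isCont (g' j) z"
    using AE_lborel_norm_neq[of a] AE_lborel_norm_neq[of r']
    by eventually_elim (unfold g'_def[abs_def], rule isCont_annulus[OF h(1)])
  qed (use b1 z0 a in auto)
  show "(\<lambda>z. ps z * potential n (g' j) z, source n (g' j)) \<in> planar_closure b R"
   by (rule potential_in_planar_closure) (use bn R in auto)
 qed
qed

text \<open>The charge is truncated both in height and near 0; the truncations are dominated by the
  charge itself and converge to it off the origin.\<close>

lemma charge_potential_in_planar_closure:
 assumes g: "charge g" and R: "s < R" "R \<le> 1"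
 shows "(\<lambda>z. ps z * potential n g z, source n g) \<in> planar_closure b R"
proof -
 have [measurable]: "g \<in> borel_fun" using g by blast
 define g' where "g' j z = (if cmod (g z) \<le> real j \<and> 1 / real (Suc j) \<le> cmod z then g z else 0)" for j z
 have gm [measurable]: "g' j \<in> borel_fun" for j unfolding g'_def[abs_def] by measurable
 have "wnorm (- b) (g' j) \<le> wnorm (- b) g" for j by (rule wnorm_mono) (simp add: g'_def)
 then have ch: "charge (g' j)" for j using g by (auto simp: g'_def intro: le_less_trans)
 show ?thesis
 proof (rule potential_closure_limit[OF g ch])
  show "(\<lambda>j. wnorm (- b) (\<lambda>z. g' j z - g z)) \<longlonglongrightarrow> 0"
  proof (rule wnorm_tendsto_0[where h=g])
   show "AE z in lborel. (\<lambda>j. g' j z - g z) \<longlonglongrightarrow> 0"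
    using AE_lborel_singleton[of "0::complex"]
   proof eventually_elim
    fix z :: complex assume "z \<noteq> 0"
    then have "eventually (\<lambda>j. 1 / real (Suc j) < cmod z) sequentially"
     by (intro order_tendstoD(2)[OF lim_1_over_n[THEN LIMSEQ_Suc]]) simp
    moreover have "eventually (\<lambda>j. cmod (g z) \<le> real j) sequentially"
     using filterlim_real_sequentially by (simp add: filterlim_at_top)
    ultimately have "eventually (\<lambda>j. g' j z - g z = 0) sequentially" by eventually_elim (simp add: g'_def)
    then show "(\<lambda>j. g' j z - g z) \<longlonglongrightarrow> 0" by (rule tendsto_eventually)
   qed
  qed (use g in \<open>auto simp: g'_def\<close>)
  show "(\<lambda>z. ps z * potential n (g' j) z, source n (g' j)) \<in> planar_closure b R" for j
   by (rule bounded_potential_in_planar_closure[OF ch, of j "real j" "1 / real (Suc j)"]) (use R in \<open>auto simp: g'_def\<close>)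
 qed
qed

end

end

section \<open>The planar expansion with remainder\<close>

context weak_cone_solution
begin

text \<open>The remainder v is the cut-off potential plus the Taylor tails, of order n + 1, of both
  parts of the harmonic function. The exponent t lies strictly between n and n + 1, so tails and
  potential obey the same bound; for |z| \<le> R/16 the cut-off equals 1.\<close>

lemma planar_expansion:
 obtains x l H H' c h h' v w C t where "0 < x" "x < R" "(v, w) \<in> planar_closure b R" "real n < t"
  "\<And>z. z \<noteq> 0 ==> cmod z \<le> x ==> cmod (v z) \<le> C * cmod z powr t"
  "AE z in lborel. z \<noteq> 0 \<and> cmod z \<le> x --> cnj (U z) = singular_part n l H H' z + regular_part n c h h' z + v z"
proof -
 obtain l H H' f A B where f: "f \<in> borel_fun" "wnorm (- b) f < \<infinity>"
  "\<And>y. cmod y > 3 * R / 4 ==> f y = 0" and AB: "A holomorphic_on ball 0 (R / 4)" "B holomorphic_on ball 0 (R / 4)"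
  and U: "AE z in lborel. z \<noteq> 0 \<and> cmod z < R / 4 --> U z = singular_part n l H H' z + potential n f z + A z + cnj (B z)"
  by (rule representation) (rule that)
 \<comment> \<open>The expansion is wanted for cnj U. Since \<open>kern\<close> is real, conjugating
   the potential amounts to conjugating the charge.\<close>
 define g where "g z = cnj (f z)" for z
 have g: "g \<in> borel_fun" "wnorm (- b) g < \<infinity>" "\<And>y. cmod y > 3 * R / 4 ==> g y = 0"
  using f borel_measurable_cnj[of f] by (auto simp: g_def[abs_def] wnorm_def)
 have pot: "cnj (potential n f z) = potential n g z" for z
  unfolding potential_def g_def Bochner_Integration.integral_cnj[symmetric] by simp
 define q where "q = R / 4"
 have q: "0 < q" "q < R" using R by (auto simp: q_def)
 note AB = AB[folded q_def] and U = U[folded q_def]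
 \<comment> \<open>Both radii lie between 3R/4, which bounds the support of the charge, and R, which
   bounds the support of planar test functions.\<close>
 interpret X: radial_cutoff "5 * R / 6" "11 * R / 12" by unfold_locales (use R in auto)
 have bn': "b \<le> real n" "b > -1" using bn by auto
 obtain t where t: "real n < t" "t < real n + 1" "b + 1 / 2 \<le> t" "t < b + 1" using exists_powr_exponent[OF bn] by blast
 obtain C where C: "C > 0" "\<And>g z. g \<in> borel_fun ==> (\<And>y. cmod y > 1 ==> g y = 0) ==> z \<noteq> 0 ==> cmod z \<le> 1 ==>
   (\<integral>\<^sup>+y. ennreal (cmod (g y * of_real (kern n (z / y)))) \<partial>lborel)^2 \<le> ennreal (C * cmod z powr (2 * t)) * wnorm (- b) g"
  using potential_bound[OF t] by blast
 obtain a A1 where A1: "A1 holomorphic_on ball 0 q" "\<And>z. z \<in> ball 0 q ==> A z = (\<Sum>m\<le>n. a m * z ^ m) + z ^ (n + 1) * A1 z"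
  using holomorphic_taylor_split[OF AB(1)] by blast
 obtain a' B1 where B1: "B1 holomorphic_on ball 0 q" "\<And>z. z \<in> ball 0 q ==> B z = (\<Sum>m\<le>n. a' m * z ^ m) + z ^ (n + 1) * B1 z"
  using holomorphic_taylor_split[OF AB(2)] by blast
 have v0: "(\<lambda>z. X.ps z * potential n g z, X.source n g) \<in> planar_closure b R"
  by (rule X.charge_potential_in_planar_closure[OF bn, of "3 * R / 4"]) (use g R in auto)
 obtain v1 w1 where v1: "(v1, w1) \<in> planar_closure b R" "\<And>z. z \<noteq> 0 ==> cmod z \<le> q / 4 ==> v1 z = z ^ (n + 1) * B1 z"
  using holomorphic_tail_in_planar_closure(1)[OF bn' q R(2) B1(1)] by blast
 obtain v2 w2 where v2: "(v2, w2) \<in> planar_closure b R" "\<And>z. z \<noteq> 0 ==> cmod z \<le> q / 4 ==> v2 z = cnj (z ^ (n + 1) * A1 z)"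
  using holomorphic_tail_in_planar_closure(2)[OF bn' q R(2) A1(1)] by blast
 define v where "v z = X.ps z * potential n g z + (v1 z + v2 z)" for z
 have v: "(v, \<lambda>z. X.source n g z + (w1 z + w2 z)) \<in> planar_closure b R"
  unfolding v_def[abs_def] by (intro planar_closure_add v0 v1 v2)
 have v_eq: "v z = potential n g z + (z ^ (n + 1) * B1 z + cnj (z ^ (n + 1) * A1 z))" if "z \<noteq> 0" "cmod z \<le> q / 4" for z
  unfolding v_def v1(2)[OF that] v2(2)[OF that] using X.one(1)[of z] that q by (simp add: q_def)
 have "\<exists>K. \<forall>z. cmod z \<le> q / 4 --> cmod (F z) \<le> K" if "F holomorphic_on ball 0 q" for F
 proof -
  have "bounded (F ` cball 0 (q / 4))"
   by (intro compact_imp_bounded compact_continuous_image holomorphic_on_imp_continuous_on holomorphic_on_subset[OF that]) (use q in auto)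
  then show ?thesis unfolding bounded_iff by (metis imageI mem_cball_0)
 qed
 from this[OF A1(1)] this[OF B1(1)] obtain K1 K2 where K: "\<And>z. cmod z \<le> q / 4 ==> cmod (A1 z) \<le> K2" "\<And>z. cmod z \<le> q / 4 ==> cmod (B1 z) \<le> K1"
  by blast
 obtain N where N: "wnorm (- b) g = ennreal N" "N \<ge> 0" using g(2) by (cases "wnorm (- b) g") auto
 \<comment> \<open>Conjugation exchanges the holomorphic and antiholomorphic coefficients: H with
   H', and those of A with those of B.\<close>
 show thesis
 proof (rule that[of "q / 4" v _ t "sqrt (C * N) + (K1 + K2)" "cnj l" "\<lambda>m. cnj (H' m)" "\<lambda>m. cnj (H m)" "a' 0 + cnj (a 0)" a' "\<lambda>m. cnj (a m)"])
  show "0 < q / 4" "q / 4 < R" using q by auto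
  show "real n < t" by (rule t)
  show "(v, \<lambda>z. X.source n g z + (w1 z + w2 z)) \<in> planar_closure b R" by (rule v)
  show "cmod (v z) \<le> (sqrt (C * N) + (K1 + K2)) * cmod z powr t" if z: "z \<noteq> 0" "cmod z \<le> q / 4" for z
  proof -
   have z1: "cmod z \<le> 1" using z q R by linarith
   have "ennreal ((cmod (potential n g z))^2) \<le> (\<integral>\<^sup>+y. ennreal (cmod (g y * of_real (kern n (z / y)))) \<partial>lborel)^2"
    unfolding potential_def by (rule ennreal_norm_integral_square_le)
   also have "\<dots> \<le> ennreal (C * cmod z powr (2 * t)) * wnorm (- b) g" by (rule C(2)) (use g R z z1 in auto)
   also have "\<dots> = ennreal (C * N * cmod z powr (2 * t))" unfolding N(1) using C(1) N(2) by (simp add: ennreal_mult[symmetric] mult_ac)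
   finally have "(cmod (potential n g z))^2 \<le> C * N * cmod z powr (2 * t)" using C(1) N(2) by simp
   then have "(cmod (potential n g z))^2 \<le> (sqrt (C * N) * cmod z powr t)^2"
    using C(1) N(2) by (simp add: power_mult_distrib powr_square)
   then have T: "cmod (potential n g z) \<le> sqrt (C * N) * cmod z powr t"
    by (rule power2_le_imp_le) (use C(1) N(2) in auto)
   have p: "cmod z ^ (n + 1) \<le> cmod z powr t"
   proof -
    have "cmod z ^ (n + 1) = cmod z powr real (n + 1)" using z by (subst powr_realpow) auto
    also have "\<dots> \<le> cmod z powr t" using t z z1 by (intro powr_mono') auto
    finally show ?thesis .
   qed
   have "cmod (z ^ (n + 1) * A1 z) \<le> cmod z powr t * K2" "cmod (z ^ (n + 1) * B1 z) \<le> cmod z powr t * K1"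
    unfolding norm_mult norm_power by (intro mult_mono p K z(2); simp)+
   then show ?thesis
    unfolding v_eq[OF z] distrib_right using T by (intro norm_triangle_le add_mono) (simp_all only: complex_mod_cnj mult.commute)
  qed
  have "cnj (U z) = singular_part n (cnj l) (\<lambda>m. cnj (H' m)) (\<lambda>m. cnj (H m)) z + regular_part n (a' 0 + cnj (a 0)) a' (\<lambda>m. cnj (a m)) z + v z"
   if z: "z \<noteq> 0" "cmod z \<le> q / 4" and e: "U z = singular_part n l H H' z + potential n f z + A z + cnj (B z)" for z
  proof -
   have s: "(\<Sum>m\<le>n. f m) = f 0 + (\<Sum>m=1..n. f m)" for f :: "nat => complex"
    by (simp add: atMost_atLeast0 sum.atLeast_Suc_atMost)
   have b: "z \<in> ball 0 q" using q z by auto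
   show ?thesis
    unfolding e v_eq[OF z] pot[symmetric] A1(2)[OF b] B1(2)[OF b] s singular_part_def regular_part_def by (simp add: algebra_simps)
  qed
  then show "AE z in lborel. z \<noteq> 0 \<and> cmod z \<le> q / 4 --> cnj (U z) = singular_part n (cnj l) (\<lambda>m. cnj (H' m)) (\<lambda>m. cnj (H m)) z +
    regular_part n (a' 0 + cnj (a 0)) a' (\<lambda>m. cnj (a m)) z + v z"
   using U q by (auto elim!: eventually_mono)
 qed
qed

end

section \<open>Transfer to the surface\<close>

text \<open>The closed disc of radius R fits into the image of the chart and contains no conical
  point other than p; R \<le> 1 is what the planar results ask for.\<close>

locale cone_chart =
 fixes A :: "'a::t2_space chart set" and Q :: "'a set" and \<rho> :: "'a density" and dS :: "'a measure"
  and p :: 'a and V :: "'a set" and \<zeta> :: "'a => complex" and b R :: real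
 assumes atlas: "holomorphic_atlas A" and metric: "conformal_metric A Q \<rho>" and Q: "finite Q" "p \<in> Q"
  and dist: "distinguished_parameter A Q \<rho> p b (V, \<zeta>)" and area: "area_measure A \<rho> dS"
  and b: "b > -1" and R: "0 < R" "R \<le> 1" "cball 0 R \<subseteq> \<zeta> ` V"
  and Q_off: "\<And>q. q \<in> Q ==> q \<in> V ==> q \<noteq> p ==> R < cmod (\<zeta> q)"
begin

abbreviation "si \<equiv> inv_into V \<zeta>"

lemma A_local: "A \<subseteq> local_parameters A"
 using atlas by (auto simp: holomorphic_atlas_def local_parameters_def)

lemma V_local: "(V, \<zeta>) \<in> local_parameters A" and p: "p \<in> V" "\<zeta> p = 0"
 and \<rho>V: "\<And>x. x \<in> V ==> x \<notin> Q ==> \<rho> (V, \<zeta>) (\<zeta> x) = (b + 1)^2 * cmod (\<zeta> x) powr (2 * b)"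
 using dist by (auto simp: distinguished_parameter_def)

lemma chart: "(W, \<phi>) \<in> local_parameters A ==> open W \<and> open (\<phi> ` W) \<and> homeomorphism W (\<phi> ` W) \<phi> (inv_into W \<phi>)"
 by (auto simp: local_parameters_def complex_chart_def)

lemma chart_inv: "(W, \<phi>) \<in> local_parameters A ==> x \<in> W ==> inv_into W \<phi> (\<phi> x) = x"
 using chart homeomorphism_apply1 by metis

lemma chart_image_open:
 assumes "(W, \<phi>) \<in> local_parameters A" "open S" "S \<subseteq> W"
 shows "open (\<phi> ` S)"
proof -
 have "openin (top_of_set W) S" using assms by (simp add: open_subset)
 then have "openin (top_of_set (\<phi> ` W)) (\<phi> ` S)" using chart[OF assms(1)] homeomorphism_imp_open_map by blast
 then show ?thesis using chart[OF assms(1)] openin_open_trans by blast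
qed

lemma V: "open V" "continuous_on V \<zeta>" "continuous_on (\<zeta> ` V) si" "\<And>x. x \<in> V ==> si (\<zeta> x) = x" "inj_on \<zeta> V"
 using chart[OF V_local] chart_inv[OF V_local] by (auto simp: homeomorphism_def intro: inj_on_inverseI)

definition "D = V \<inter> \<zeta> -` ball 0 R"

definition lift :: "(complex => complex) => 'a => complex" where
 "lift F x = (if x \<in> D then F (\<zeta> x) else 0)"

lemma D: "open D" "D \<subseteq> V" "p \<in> D" "x \<in> D ==> cmod (\<zeta> x) < R" "x \<in> D ==> si (\<zeta> x) = x"
 using continuous_open_preimage[OF V(2,1) open_ball] p R V(4) by (auto simp: D_def)

lemma D_Q: "x \<in> D ==> x \<in> Q ==> x = p"
 using Q_off[of x] by (cases "x = p") (auto simp: D_def)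

lemma zeta_0: "x \<in> V ==> \<zeta> x = 0 \<longleftrightarrow> x = p"
 using V(5) p by (metis inj_onD)

subsection \<open>Integration in the chart\<close>

text \<open>Total measurable versions of the coordinate, of the area density and of the indicator of
  D, since measurability statements concern functions on the whole type.\<close>

definition "\<zeta>D x = (if x \<in> D then \<zeta> x else 0)"
definition "wt z = (if cmod z < R then (b + 1)\<^sup>2 * cmod z powr (2 * b) else 0)" for z :: complex
definition "iD x = (if x \<in> D then 1 else 0 :: real)"

lemma sets_dS [measurable_cong]: "sets dS = sets borel" and space_dS: "space dS = UNIV"
 using area sets_eq_imp_space_eq[of dS borel] by (auto simp: area_measure_def)

lemma D_borel [measurable]: "D \<in> sets borel"
 using D(1) by simp

lemma chart_measurable [measurable]: "\<zeta>D \<in> borel_measurable dS" "iD \<in> borel_measurable dS" "wt \<in> borel_fun"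
proof -
 show "\<zeta>D \<in> borel_measurable dS" unfolding measurable_cong_sets[OF sets_dS refl] \<zeta>D_def[abs_def]
  by (intro borel_measurable_continuous_on_if D_borel continuous_on_subset[OF V(2) D(2)] continuous_on_const)
 show "iD \<in> borel_measurable dS" unfolding iD_def[abs_def] by measurable
 show "wt \<in> borel_fun" unfolding wt_def[abs_def] by measurable
qed

lemma emeasure_dS:
 assumes "(W, \<phi>) \<in> local_parameters A" "B \<in> sets borel" "B \<subseteq> W"
 shows "emeasure dS B = (\<integral>\<^sup>+z\<in>\<phi> ` B. ennreal (\<rho> (W, \<phi>) z) \<partial>lborel)"
 using area assms unfolding area_measure_def by blast

lemma AE_not_Q: "AE x in dS. x \<notin> Q"
proof -
 have "{q} \<in> null_sets dS" for q
 proof (rule null_setsI)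
  have "q \<in> (\<Union>c\<in>A. fst c)" using atlas by (simp add: holomorphic_atlas_def)
  then obtain W \<phi> where W: "(W, \<phi>) \<in> local_parameters A" "q \<in> W" using A_local by force
  have "emeasure dS {q} = (\<integral>\<^sup>+z\<in>{\<phi> q}. ennreal (\<rho> (W, \<phi>) z) \<partial>lborel)" using emeasure_dS[OF W(1), of "{q}"] W(2) by simp
  also have "\<dots> = (\<integral>\<^sup>+z. 0 \<partial>(lborel :: complex measure))"
   by (rule nn_integral_cong_AE) (use AE_lborel_singleton[of "\<phi> q"] in \<open>eventually_elim, simp\<close>)
  finally show "emeasure dS {q} = 0" by simp
 qed (simp add: sets_dS)
 then have "(\<Union>q\<in>Q. {q}) \<in> null_sets dS" using Q(1) by (intro null_sets_UN') (auto intro: countable_finite)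
 from AE_not_in[OF this] show ?thesis by simp
qed

text \<open>The change of variables formula: \<open>area_measure\<close> gives areas of subsets of a
  chart as integrals over their images, and off the origin the density in the distinguished
  parameter is \<open>wt\<close>.\<close>

lemma distr_chart: "distr (density dS (\<lambda>x. ennreal (iD x))) borel \<zeta>D = density lborel (\<lambda>z. ennreal (wt z))"
proof (rule measure_eqI)
 fix B assume "B \<in> sets (distr (density dS (\<lambda>x. ennreal (iD x))) borel \<zeta>D)"
 then have [measurable]: "B \<in> sets borel" by simp
 have zm: "\<zeta>D \<in> measurable dS borel" by measurable
 have "\<zeta>D -` B \<inter> space dS \<in> sets dS" by measurable
 then have m: "\<zeta>D -` B \<in> sets borel" by (simp add: space_dS sets_dS)
 have im: "\<zeta> ` (D \<inter> \<zeta>D -` B) = ball 0 R \<inter> B"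
 proof
  show "\<zeta> ` (D \<inter> \<zeta>D -` B) \<subseteq> ball 0 R \<inter> B" by (auto simp: D_def \<zeta>D_def)
  show "ball 0 R \<inter> B \<subseteq> \<zeta> ` (D \<inter> \<zeta>D -` B)"
  proof
   fix z assume z: "z \<in> ball 0 R \<inter> B"
   then obtain x where "x \<in> V" "z = \<zeta> x" using R(3) by (meson IntD1 ball_subset_cball imageE subset_iff)
   then show "z \<in> \<zeta> ` (D \<inter> \<zeta>D -` B)" using z by (intro image_eqI[of _ _ x]) (auto simp: D_def \<zeta>D_def)
  qed
 qed
 have "emeasure (distr (density dS (\<lambda>x. ennreal (iD x))) borel \<zeta>D) B = emeasure (density dS (\<lambda>x. ennreal (iD x))) (\<zeta>D -` B)"
  by (subst emeasure_distr) (auto simp: space_dS)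
 also have "\<dots> = (\<integral>\<^sup>+x. ennreal (iD x) * indicator (\<zeta>D -` B) x \<partial>dS)"
  by (rule emeasure_density) (auto simp: m sets_dS)
 also have "\<dots> = (\<integral>\<^sup>+x. indicator (D \<inter> \<zeta>D -` B) x \<partial>dS)" by (intro nn_integral_cong) (auto simp: iD_def indicator_def)
 also have "\<dots> = emeasure dS (D \<inter> \<zeta>D -` B)" by (rule nn_integral_indicator) (use m in \<open>simp add: sets_dS D_borel\<close>)
 also have "\<dots> = (\<integral>\<^sup>+z\<in>ball 0 R \<inter> B. ennreal (\<rho> (V, \<zeta>) z) \<partial>lborel)"
  using emeasure_dS[OF V_local, of "D \<inter> \<zeta>D -` B"] m D(2) D_borel unfolding im by auto
 also have "\<dots> = (\<integral>\<^sup>+z. ennreal (wt z) * indicator B z \<partial>lborel)"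
 proof (rule nn_integral_cong_AE)
  show "AE z in lborel. ennreal (\<rho> (V, \<zeta>) z) * indicator (ball 0 R \<inter> B) z = ennreal (wt z) * indicator B z"
   using AE_lborel_singleton[of "0::complex"]
  proof eventually_elim
   fix z :: complex assume z: "z \<noteq> 0"
   have "\<rho> (V, \<zeta>) z = (b + 1)^2 * cmod z powr (2 * b)" if "cmod z < R"
   proof -
    obtain x where x: "x \<in> V" "z = \<zeta> x" using R(3) \<open>cmod z < R\<close> by force
    then have "x \<in> D" "x \<noteq> p" using that z p by (auto simp: D_def)
    then show ?thesis using \<rho>V[OF x(1)] D_Q x by auto
   qed
   then show "ennreal (\<rho> (V, \<zeta>) z) * indicator (ball 0 R \<inter> B) z = ennreal (wt z) * indicator B z"
    by (auto simp: wt_def indicator_def)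
  qed
 qed
 also have "\<dots> = emeasure (density lborel (\<lambda>z. ennreal (wt z))) B" by (rule emeasure_density[symmetric]) auto
 finally show "emeasure (distr (density dS (\<lambda>x. ennreal (iD x))) borel \<zeta>D) B = emeasure (density lborel (\<lambda>z. ennreal (wt z))) B" .
qed simp

lemma nn_integral_chart:
 assumes [measurable]: "h \<in> borel_fun"
 shows "(\<integral>\<^sup>+x. ennreal (iD x) * h (\<zeta>D x) \<partial>dS) = (\<integral>\<^sup>+z. ennreal (wt z) * h z \<partial>lborel)"
proof -
 have "(\<integral>\<^sup>+x. ennreal (iD x) * h (\<zeta>D x) \<partial>dS) = (\<integral>\<^sup>+x. h (\<zeta>D x) \<partial>density dS (\<lambda>x. ennreal (iD x)))"
  by (subst nn_integral_density) auto
 also have "\<dots> = (\<integral>\<^sup>+z. h z \<partial>density lborel (\<lambda>z. ennreal (wt z)))"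
  unfolding distr_chart[symmetric] by (subst nn_integral_distr) auto
 also have "\<dots> = (\<integral>\<^sup>+z. ennreal (wt z) * h z \<partial>lborel)" by (subst nn_integral_density) auto
 finally show ?thesis .
qed

lemma integral_chart:
 fixes h :: "complex => complex"
 assumes [measurable]: "h \<in> borel_fun"
 shows "(LINT x|dS. lift h x) = (LINT z|lborel. of_real (wt z) * h z)"
proof -
 have "(LINT x|dS. lift h x) = (LINT x|dS. iD x *\<^sub>R h (\<zeta>D x))"
  by (intro Bochner_Integration.integral_cong) (auto simp: lift_def iD_def \<zeta>D_def)
 also have "\<dots> = (LINT x|density dS (\<lambda>x. ennreal (iD x)). h (\<zeta>D x))"
  by (subst integral_density) (auto simp: iD_def)
 also have "\<dots> = (LINT z|density lborel (\<lambda>z. ennreal (wt z)). h z)"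
  unfolding distr_chart[symmetric] by (subst integral_distr) auto
 also have "\<dots> = (LINT z|lborel. wt z *\<^sub>R h z)" by (subst integral_density) (auto simp: wt_def)
 finally show ?thesis by (simp add: scaleR_conv_of_real)
qed

lemma AE_chart:
 assumes "AE z in lborel. P z"
 shows "AE x in dS. x \<in> D --> P (\<zeta> x)"
proof -
 have "AE z in density lborel (\<lambda>z. ennreal (wt z)). P z" using assms by (subst AE_density) auto
 then have "AE x in density dS (\<lambda>x. ennreal (iD x)). P (\<zeta>D x)"
  unfolding distr_chart[symmetric] by (rule AE_distrD[rotated]) measurable
 then show ?thesis by (subst (asm) AE_density) (auto simp: iD_def \<zeta>D_def elim!: eventually_mono)
qed

lemma lift_borel:
 assumes [measurable]: "F \<in> borel_fun"
 shows "lift F \<in> borel_measurable dS"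
proof -
 have "lift F = (\<lambda>x. of_real (iD x) * F (\<zeta>D x))" by (auto simp: lift_def iD_def \<zeta>D_def fun_eq_iff)
 then show ?thesis by simp
qed

lemma nn_integral_lift:
 assumes [measurable]: "F \<in> borel_fun"
 shows "(\<integral>\<^sup>+x. ennreal ((cmod (lift F x))^2) \<partial>dS) = (\<integral>\<^sup>+z. ennreal (wt z * (cmod (F z))^2) \<partial>lborel)"
proof -
 have "(\<integral>\<^sup>+x. ennreal ((cmod (lift F x))^2) \<partial>dS) = (\<integral>\<^sup>+x. ennreal (iD x) * ennreal ((cmod (F (\<zeta>D x)))^2) \<partial>dS)"
  by (intro nn_integral_cong) (auto simp: lift_def iD_def \<zeta>D_def)
 also have "\<dots> = (\<integral>\<^sup>+z. ennreal (wt z) * ennreal ((cmod (F z))^2) \<partial>lborel)" by (rule nn_integral_chart) measurable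
 also have "\<dots> = (\<integral>\<^sup>+z. ennreal (wt z * (cmod (F z))^2) \<partial>lborel)"
  by (intro nn_integral_cong) (auto simp: wt_def ennreal_mult)
 finally show ?thesis .
qed

subsection \<open>Test functions and the Laplacian in the chart\<close>

text \<open>The passage from a flat Laplacian w = 4 \<open>d_z\<close> \<open>d_zbar\<close> F to
  the surface Laplacian in the distinguished parameter; it includes the sign convention of the
  latter.\<close>

definition Lap :: "(complex => complex) => complex => complex" where
 "Lap w z = - w z / of_real ((b + 1)^2 * cmod z powr (2 * b))"

lemma Lap_borel [measurable]:
 assumes [measurable]: "w \<in> borel_fun"
 shows "Lap w \<in> borel_fun"
 unfolding Lap_def[abs_def] by measurable

lemma planar_test_support:
 assumes "F \<in> planar_test R"
 obtains K where "compact K" "K \<subseteq> D - {p}" "\<And>x. x \<notin> K ==> lift F x = 0"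
proof -
 obtain a r where ar: "a > 0" "r < R" "\<And>z. F z \<noteq> 0 ==> a \<le> cmod z \<and> cmod z \<le> r"
  using assms unfolding planar_test_def by blast
 let ?K = "cball 0 r - ball (0::complex) a"
 have sub: "?K \<subseteq> \<zeta> ` V" using R(3) ar(2) by auto
 show thesis
 proof (rule that[of "si ` ?K"])
  have "compact ?K" by (intro compact_diff) auto
  then show "compact (si ` ?K)" by (intro compact_continuous_image continuous_on_subset[OF V(3) sub])
  show "si ` ?K \<subseteq> D - {p}"
  proof
   fix x assume "x \<in> si ` ?K"
   then obtain z where z: "z \<in> ?K" "x = si z" by blast
   then obtain y where "y \<in> V" "z = \<zeta> y" using sub by blast
   then show "x \<in> D - {p}" using z V(4) ar(1,2) p by (auto simp: D_def)
  qed
  show "lift F x = 0" if "x \<notin> si ` ?K" for x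
  proof (rule ccontr)
   assume "lift F x \<noteq> 0"
   then have x: "x \<in> D" "F (\<zeta> x) \<noteq> 0" by (auto simp: lift_def split: if_splits)
   then have "\<zeta> x \<in> ?K" using ar(3) by force
   then show False using that D(5)[OF x(1)] by (metis image_eqI)
  qed
 qed
qed

lemma lift_in_chart:
 assumes F: "F \<in> planar_test R" and W: "(W, \<phi>) \<in> A"
 defines "h \<equiv> \<zeta> \<circ> inv_into W \<phi>"
 shows "h holomorphic_on \<phi> ` (W \<inter> V)" "z \<in> \<phi> ` (W \<inter> V) ==> (lift F \<circ> inv_into W \<phi>) z = F (h z)"
  "z \<in> \<phi> ` (W \<inter> V - {p}) ==> h z \<noteq> 0"
proof -
 have Wl: "(W, \<phi>) \<in> local_parameters A" using W A_local by blast
 have "holomorphic_transition (W, \<phi>) (V, \<zeta>)" using V_local W by (auto simp: local_parameters_def)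
 then show "h holomorphic_on \<phi> ` (W \<inter> V)" by (simp add: holomorphic_transition_def h_def)
 show "(lift F \<circ> inv_into W \<phi>) z = F (h z)" if "z \<in> \<phi> ` (W \<inter> V)"
 proof -
  obtain x where x: "x \<in> W" "x \<in> V" "z = \<phi> x" using \<open>z \<in> _\<close> by blast
  have "F (\<zeta> x) = 0" if "x \<notin> D"
   using that x(2) F unfolding planar_test_def by (force simp: D_def)
  then show ?thesis using x chart_inv[OF Wl] by (simp add: h_def lift_def)
 qed
 show "z \<in> \<phi> ` (W \<inter> V - {p}) ==> h z \<noteq> 0" using chart_inv[OF Wl] zeta_0 by (auto simp: h_def)
qed

text \<open>In any chart, near points of the compact support the lift is F composed with a
  holomorphic transition map that avoids 0; near all other points it is 0. The support meets no
  conical point, since D contains only p.\<close>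

lemma lift_test_function:
 assumes F: "F \<in> planar_test R"
 shows "lift F \<in> test_functions A Q"
proof -
 obtain K where K: "compact K" "K \<subseteq> D - {p}" "\<And>x. x \<notin> K ==> lift F x = 0" by (rule planar_test_support[OF F]) blast
 have sub: "closure {x. lift F x \<noteq> 0} \<subseteq> K" using K(1,3) by (intro closure_minimal compact_imp_closed) auto
 have "smooth_on (\<phi> ` W) (lift F \<circ> inv_into W \<phi>)" if W: "(W, \<phi>) \<in> A" for W \<phi>
 proof (rule smooth_on_local)
  fix z assume "z \<in> \<phi> ` W"
  then obtain x where x: "x \<in> W" "z = \<phi> x" by blast
  have Wl: "(W, \<phi>) \<in> local_parameters A" using W A_local by blast
  have oW: "open W" using chart[OF Wl] by blast
  show "\<exists>T. open T \<and> z \<in> T \<and> smooth_on T (lift F \<circ> inv_into W \<phi>)"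
  proof (cases "x \<in> K")
   case True
   let ?T = "\<phi> ` (W \<inter> V - {p})"
   have T: "open ?T" by (rule chart_image_open[OF Wl]) (use oW V(1) in auto)
   note h = lift_in_chart[OF F W]
   have sm: "smooth_on (-{0}) F" using F by (simp add: planar_test_def)
   have h0: "(\<zeta> \<circ> inv_into W \<phi>) ` ?T \<subseteq> -{0}"
    by (rule image_subsetI) (unfold Compl_iff singleton_iff, rule h(3))
   have "smooth_on ?T (\<lambda>z. F ((\<zeta> \<circ> inv_into W \<phi>) z))"
    unfolding smooth_on_def
   proof
    fix k
    show "times_differentiable_on k ?T (\<lambda>z. F ((\<zeta> \<circ> inv_into W \<phi>) z))"
     by (rule times_differentiable_on_compose_holomorphic[OF T _ holomorphic_on_subset[OF h(1)], of "-{0}"])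
      (use h0 sm in \<open>auto simp: smooth_on_def\<close>)
   qed
   then have "smooth_on ?T (lift F \<circ> inv_into W \<phi>)"
    by (rule smooth_on_cong[OF T]) (rule h(2)[symmetric], blast)
   then show ?thesis using T x True K(2) D(2) by blast
  next
   case False
   let ?T = "\<phi> ` (W - K)"
   have T: "open ?T" by (rule chart_image_open[OF Wl]) (use oW K(1) compact_imp_closed in auto)
   have "smooth_on ?T (\<lambda>_. 0::complex)" unfolding smooth_on_def by (intro allI times_differentiable_on_const T)
   then have "smooth_on ?T (lift F \<circ> inv_into W \<phi>)"
    by (rule smooth_on_cong[OF T]) (use K(3) chart_inv[OF Wl] in auto)
   then show ?thesis using T x False by blast
  qed
 qed
 moreover have "compact (closure {x. lift F x \<noteq> 0})" using compact_Int_closed[OF K(1) closed_closure] sub by (metis Int_absorb1)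
 moreover have "closure {x. lift F x \<noteq> 0} \<inter> Q = {}" using sub K(2) D_Q by blast
 ultimately show ?thesis unfolding test_functions_def smooth_function_def by blast
qed

text \<open>Conformal invariance. The transition map h to the distinguished parameter multiplies the
  mixed derivative by |h'|^2, and the density changes by the same factor, so the chart picked by
  \<open>SOME\<close> is immaterial.\<close>

lemma laplacian_lift:
 assumes F: "F \<in> planar_test R" and x: "x \<notin> Q"
 shows "laplacian A \<rho> (lift F) x = lift (Lap (\<lambda>z. 4 * d_z (d_zbar F) z)) x"
proof -
 define c where "c = (SOME c. c \<in> A \<and> x \<in> fst c)"
 have "x \<in> (\<Union>c\<in>A. fst c)" using atlas by (simp add: holomorphic_atlas_def)
 then have "\<exists>c. c \<in> A \<and> x \<in> fst c" by blast
 then have "c \<in> A \<and> x \<in> fst c" unfolding c_def by (rule someI_ex)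
 moreover obtain W \<phi> where c: "c = (W, \<phi>)" by (cases c)
 ultimately have W: "(W, \<phi>) \<in> A" "x \<in> W" by auto
 have Wl: "(W, \<phi>) \<in> local_parameters A" using W A_local by blast
 have oW: "open W" using chart[OF Wl] by blast
 let ?f = "lift F \<circ> inv_into W \<phi>"
 have L: "laplacian A \<rho> (lift F) x = - 4 / of_real (\<rho> (W, \<phi>) (\<phi> x)) * d_z (d_zbar ?f) (\<phi> x)"
  unfolding laplacian_def c_def[symmetric] c by simp
 have zero: "d_z (d_zbar f) z = 0" if "open S" "z \<in> S" "\<And>z. z \<in> S ==> f z = 0" for f z S
 proof -
  have "wirtinger2 S f (\<lambda>_. 0) (\<lambda>_. 0) (\<lambda>_. 0)" by (rule wirtinger2_cong_open[OF that(1) wirtinger2_const[of S 0]]) (use that in auto)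
  from wirtinger2D(3)[OF that(1) this that(2)] show ?thesis .
 qed
 show ?thesis
 proof (cases "x \<in> D")
  case True
  let ?T = "\<phi> ` (W \<inter> V - {p})" and ?h = "\<zeta> \<circ> inv_into W \<phi>"
  have T: "open ?T" by (rule chart_image_open[OF Wl]) (use oW V(1) in auto)
  have xT: "\<phi> x \<in> ?T" using True x Q(2) W(2) D(2) by blast
  have hx: "?h (\<phi> x) = \<zeta> x" using chart_inv[OF Wl W(2)] by simp
  note h = lift_in_chart[OF F W(1)]
  have hT: "?h holomorphic_on ?T" by (rule holomorphic_on_subset[OF h(1)]) blast
  have o: "open (-{0::complex})" by auto
  have FW: "wirtinger2 (-{0}) F (d_z F) (d_zbar F) (d_z (d_zbar F))"
   by (rule wirtinger2_smooth[OF o]) (use F in \<open>simp add: planar_test_def\<close>)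
  have "wirtinger2 ?T (\<lambda>z. F (?h z)) (\<lambda>z. d_z F (?h z) * deriv ?h z) (\<lambda>z. d_zbar F (?h z) * cnj (deriv ?h z))
   (\<lambda>z. d_zbar F (?h z) * 0 + d_z (d_zbar F) (?h z) * deriv ?h z * cnj (deriv ?h z))"
   unfolding wirtinger2_def
  proof (intro ballI conjI)
   fix z assume z: "z \<in> ?T"
   have d: "(?h has_field_derivative deriv ?h z) (at z)" by (rule holomorphic_derivI[OF hT T z])
   have h0: "?h z \<in> -{0}" using h(3)[OF z] by simp
   show "has_wirtinger (\<lambda>z. F (?h z)) (d_z F (?h z) * deriv ?h z) (d_zbar F (?h z) * cnj (deriv ?h z)) z"
    by (rule has_wirtinger_compose_holomorphic[OF d]) (use FW h0 in \<open>unfold wirtinger2_def, blast\<close>)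
   obtain m where m: "has_wirtinger (d_zbar F) (d_z (d_zbar F) (?h z)) m (?h z)" using FW h0 unfolding wirtinger2_def by blast
   have "has_wirtinger (\<lambda>z. cnj (deriv ?h z)) 0 (cnj (deriv (deriv ?h) z)) z"
    using has_wirtinger_cnj[OF has_wirtinger_holomorphic[OF holomorphic_derivI[OF holomorphic_deriv[OF hT T] T z]]] by simp
   from has_wirtinger_mult[OF has_wirtinger_compose_holomorphic[OF d m] this]
   show "\<exists>m. has_wirtinger (\<lambda>z. d_zbar F (?h z) * cnj (deriv ?h z))
     (d_zbar F (?h z) * 0 + d_z (d_zbar F) (?h z) * deriv ?h z * cnj (deriv ?h z)) m z" by blast
  qed
  then have "wirtinger2 ?T ?f (\<lambda>z. d_z F (?h z) * deriv ?h z) (\<lambda>z. d_zbar F (?h z) * cnj (deriv ?h z))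
   (\<lambda>z. d_zbar F (?h z) * 0 + d_z (d_zbar F) (?h z) * deriv ?h z * cnj (deriv ?h z))"
   by (rule wirtinger2_cong_open[OF T]) (rule h(2), blast, rule refl, rule refl, rule refl)
  from wirtinger2D(3)[OF T this xT]
  have l: "d_z (d_zbar ?f) (\<phi> x) = d_z (d_zbar F) (\<zeta> x) * of_real ((cmod (deriv ?h (\<phi> x)))^2)"
   unfolding hx complex_norm_square by (simp only: mult_zero_right add_0 mult.assoc)
  have \<rho>W: "\<rho> (W, \<phi>) (\<phi> x) > 0" using metric Wl W(2) x by (auto simp: conformal_metric_def)
  have "\<rho> (W, \<phi>) (\<phi> x) = \<rho> (V, \<zeta>) (\<zeta> x) * (cmod (deriv ?h (\<phi> x)))^2"
  proof -
   have x': "x \<in> W \<inter> V - Q" using W(2) True D(2) x by blast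
   have m: "\<forall>(U, \<phi>)\<in>local_parameters A. \<forall>(V, \<psi>)\<in>local_parameters A. \<forall>x\<in>U \<inter> V - Q. \<rho> (U, \<phi>) (\<phi> x) =
     \<rho> (V, \<psi>) (\<psi> x) * (cmod (deriv (\<psi> \<circ> inv_into U \<phi>) (\<phi> x)))^2"
    using metric unfolding conformal_metric_def by (rule conjunct2)
   from bspec[OF bspec[OF m Wl, unfolded prod.case] V_local, unfolded prod.case] show ?thesis using x' by (rule bspec)
  qed
  also have "\<rho> (V, \<zeta>) (\<zeta> x) = (b + 1)^2 * cmod (\<zeta> x) powr (2 * b)" using \<rho>V True D(2) x by blast
  finally have e: "\<rho> (W, \<phi>) (\<phi> x) = (b + 1)^2 * cmod (\<zeta> x) powr (2 * b) * (cmod (deriv ?h (\<phi> x)))^2" .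
  \<comment> \<open>The density is positive off the conical points, so |h'|^2 is non-zero and may be
    cancelled.\<close>
  have nz: "(cmod (deriv ?h (\<phi> x)))^2 \<noteq> 0" using \<rho>W unfolding e by auto
  have div: "- 4 / of_real (y * t) * (X * of_real t) = - (4 * X) / of_real y" if "t \<noteq> 0" for y t and X :: complex
   using that by (simp add: field_simps)
  show ?thesis
   unfolding L l e using True nz by (simp only: lift_def if_True Lap_def div[OF nz])
 next
  case False
  obtain K where K: "compact K" "K \<subseteq> D - {p}" "\<And>x. x \<notin> K ==> lift F x = 0" by (rule planar_test_support[OF F]) blast
  have "d_z (d_zbar ?f) (\<phi> x) = 0"
  proof (rule zero)
   show "open (\<phi> ` (W - K))" by (rule chart_image_open[OF Wl]) (use oW K(1) compact_imp_closed in auto)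
   show "\<phi> x \<in> \<phi> ` (W - K)" using W False K(2) by blast
  qed (use K(3) chart_inv[OF Wl] in auto)
  then show ?thesis using False L by (simp add: lift_def)
 qed
qed

subsection \<open>The closure and the adjoint in the chart\<close>

text \<open>Where the two weights come from: the area element contributes |z|^(2b), while
  \<open>Lap\<close> divides by |z|^(2b), which squared and multiplied by the area element leaves
  |z|^(-2b).\<close>

lemma nn_integral_lift_le:
 assumes [measurable]: "F \<in> borel_fun"
 shows "(\<integral>\<^sup>+x. ennreal ((cmod (lift F x))^2) \<partial>dS) \<le> ennreal ((b + 1)^2) * wnorm b F"
  "(\<integral>\<^sup>+x. ennreal ((cmod (lift (Lap F) x))^2) \<partial>dS) \<le> ennreal (1 / (b + 1)^2) * wnorm (- b) F"
proof -
 have "(\<integral>\<^sup>+x. ennreal ((cmod (lift F x))^2) \<partial>dS) \<le> (\<integral>\<^sup>+z. ennreal ((b + 1)^2) * ennreal ((cmod (F z))^2 * cmod z powr (2 * b)) \<partial>lborel)"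
  unfolding nn_integral_lift[OF assms] by (intro nn_integral_mono) (auto simp: wt_def ennreal_mult[symmetric] mult_ac)
 also have "\<dots> = ennreal ((b + 1)^2) * wnorm b F" unfolding wnorm_def by (rule nn_integral_cmult) measurable
 finally show "(\<integral>\<^sup>+x. ennreal ((cmod (lift F x))^2) \<partial>dS) \<le> ennreal ((b + 1)^2) * wnorm b F" .
 have "(\<integral>\<^sup>+x. ennreal ((cmod (lift (Lap F) x))^2) \<partial>dS) \<le> (\<integral>\<^sup>+z. ennreal (1 / (b + 1)^2) * ennreal ((cmod (F z))^2 * cmod z powr (2 * - b)) \<partial>lborel)"
  unfolding nn_integral_lift[OF Lap_borel[OF assms]]
 proof (rule nn_integral_mono)
  fix z
  have "wt z * (cmod (Lap F z))^2 \<le> 1 / (b + 1)^2 * ((cmod (F z))^2 * cmod z powr (2 * - b))"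
  proof (cases "z \<noteq> 0 \<and> cmod z < R")
   case True
   let ?c = "(b + 1)^2" and ?y = "cmod z powr (2 * b)"
   have y: "?c > 0" "?y > 0" using b True by auto
   have "cmod z powr (2 * - b) = 1 / ?y" by (simp add: powr_minus inverse_eq_divide)
   moreover have "cmod (Lap F z) = cmod (F z) / (?c * ?y)" unfolding Lap_def norm_divide norm_minus_cancel norm_of_real using y by simp
   moreover have "C * Y * (t / (C * Y))^2 = 1 / C * (t^2 * (1 / Y))" if "C > 0" "Y > 0" for C Y t :: real
    using that by (simp add: power2_eq_square)
   note this[OF y]
   ultimately show ?thesis using True by (simp only: wt_def if_True)
  qed (use b in \<open>auto simp: wt_def\<close>)
  then show "ennreal (wt z * (cmod (Lap F z))^2) \<le> ennreal (1 / (b + 1)^2) * ennreal ((cmod (F z))^2 * cmod z powr (2 * - b))"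
   by (subst ennreal_mult[symmetric]) (auto intro: ennreal_leI)
 qed
 also have "\<dots> = ennreal (1 / (b + 1)^2) * wnorm (- b) F" unfolding wnorm_def by (rule nn_integral_cmult) measurable
 finally show "(\<integral>\<^sup>+x. ennreal ((cmod (lift (Lap F) x))^2) \<partial>dS) \<le> ennreal (1 / (b + 1)^2) * wnorm (- b) F" .
qed

lemma lift_L2:
 assumes "F \<in> borel_fun" "(\<integral>\<^sup>+x. ennreal ((cmod (lift F x))^2) \<partial>dS) < \<infinity>"
 shows "lift F \<in> L2 dS"
proof -
 have [measurable]: "lift F \<in> borel_measurable dS" by (rule lift_borel[OF assms(1)])
 show ?thesis unfolding L2_def using assms(2) by (auto intro!: integrableI_nonneg)
qed

lemma L2_tendstoI:
 assumes [measurable]: "\<And>j. X j \<in> borel_measurable dS" "Y \<in> borel_measurable dS"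
  and "(\<lambda>j. \<integral>\<^sup>+x. ennreal ((cmod (X j x - Y x))^2) \<partial>dS) \<longlonglongrightarrow> 0"
 shows "L2_tendsto dS X Y"
proof -
 have "(LINT x|dS. (cmod (X j x - Y x))^2) = enn2real (\<integral>\<^sup>+x. ennreal ((cmod (X j x - Y x))^2) \<partial>dS)" for j
  by (rule integral_eq_nn_integral) auto
 moreover have "(\<lambda>j. enn2real (\<integral>\<^sup>+x. ennreal ((cmod (X j x - Y x))^2) \<partial>dS)) \<longlonglongrightarrow> 0"
  using tendsto_enn2real[OF assms(3)[folded ennreal_0]] by simp
 ultimately show ?thesis unfolding L2_tendsto_def by simp
qed

lemma laplacian_lift_AE:
 assumes F: "F \<in> planar_test R"
 shows "laplacian A \<rho> (lift F) \<in> borel_measurable dS"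
  "AE x in dS. laplacian A \<rho> (lift F) x = lift (Lap (\<lambda>z. 4 * d_z (d_zbar F) z)) x"
proof -
 note [measurable] = planar_test_borel[OF F]
 show "AE x in dS. laplacian A \<rho> (lift F) x = lift (Lap (\<lambda>z. 4 * d_z (d_zbar F) z)) x"
  using AE_not_Q by eventually_elim (rule laplacian_lift[OF F])
 show "laplacian A \<rho> (lift F) \<in> borel_measurable dS"
  by (rule measurable_discrete_difference[of "lift (Lap (\<lambda>z. 4 * d_z (d_zbar F) z))" _ _ Q])
   (auto intro!: lift_borel countable_finite Q simp: sets_dS laplacian_lift[OF F])
qed

text \<open>By \<open>nn_integral_lift_le\<close>, approximation in the weighted norms of the disc
  becomes L2 convergence on the surface of the lifted test functions and of their
  Laplacians.\<close>

lemma lift_in_closure: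
 assumes vw: "(v, w) \<in> planar_closure b R"
 shows "lift v \<in> Domain (op_closure dS (symmetric_laplacian A \<rho> Q))"
proof -
 have m [measurable]: "v \<in> borel_fun" "w \<in> borel_fun" and fin: "wnorm b v < \<infinity>" "wnorm (- b) w < \<infinity>"
  and ap: "\<And>e. e > 0 ==> \<exists>f\<in>planar_test R. wnorm b (\<lambda>z. f z - v z) < e \<and> wnorm (- b) (\<lambda>z. 4 * d_z (d_zbar f) z - w z) < e"
  using vw by (auto simp: planar_closure_def)
 define e where "e j = ennreal (1 / real (Suc j))" for j
 have "e j > 0" for j by (simp add: e_def)
 then have "\<forall>j. \<exists>f\<in>planar_test R. wnorm b (\<lambda>z. f z - v z) < e j \<and> wnorm (- b) (\<lambda>z. 4 * d_z (d_zbar f) z - w z) < e j"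
  using ap by blast
 then obtain F where F: "\<And>j. F j \<in> planar_test R" "\<And>j. wnorm b (\<lambda>z. F j z - v z) < e j"
  "\<And>j. wnorm (- b) (\<lambda>z. 4 * d_z (d_zbar (F j)) z - w z) < e j" by metis
 have Fm [measurable]: "F j \<in> borel_fun" "(\<lambda>z. d_z (d_zbar (F j)) z) \<in> borel_fun" for j
  using planar_test_borel[OF F(1)] by auto
 have lim: "X \<longlonglongrightarrow> 0" if "\<And>j. X j \<le> ennreal c * e j" for c X
 proof (rule tendsto_sandwich[OF _ _ tendsto_const])
  have "(\<lambda>j. ennreal c * e j) \<longlonglongrightarrow> ennreal c * ennreal 0"
   unfolding e_def by (intro ennreal_tendsto_cmult tendsto_ennrealI LIMSEQ_Suc[OF lim_1_over_n]) simp
  then show "(\<lambda>j. ennreal c * e j) \<longlonglongrightarrow> 0" by simp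
 qed (auto simp: that)
 have L2: "lift v \<in> L2 dS" "lift (Lap w) \<in> L2 dS"
  by (intro lift_L2 m Lap_borel le_less_trans[OF nn_integral_lift_le(1)] le_less_trans[OF nn_integral_lift_le(2)];
    use fin in \<open>simp add: ennreal_mult_less_top\<close>)+
 have "L2_tendsto dS (\<lambda>j. lift (F j)) (lift v)"
 proof (intro L2_tendstoI lift_borel m Fm lim)
  fix j
  have "(\<integral>\<^sup>+x. ennreal ((cmod (lift (F j) x - lift v x))^2) \<partial>dS) = (\<integral>\<^sup>+x. ennreal ((cmod (lift (\<lambda>z. F j z - v z) x))^2) \<partial>dS)"
   by (intro nn_integral_cong) (simp add: lift_def)
  also have "\<dots> \<le> ennreal ((b + 1)^2) * wnorm b (\<lambda>z. F j z - v z)" by (rule nn_integral_lift_le) measurable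
  also have "\<dots> \<le> ennreal ((b + 1)^2) * e j" by (rule mult_left_mono[OF less_imp_le[OF F(2)]]) simp
  finally show "(\<integral>\<^sup>+x. ennreal ((cmod (lift (F j) x - lift v x))^2) \<partial>dS) \<le> ennreal ((b + 1)^2) * e j" .
 qed
 moreover have "L2_tendsto dS (\<lambda>j. laplacian A \<rho> (lift (F j))) (lift (Lap w))"
 proof (intro L2_tendstoI lift_borel Lap_borel m laplacian_lift_AE F lim)
  fix j
  have "(\<integral>\<^sup>+x. ennreal ((cmod (laplacian A \<rho> (lift (F j)) x - lift (Lap w) x))^2) \<partial>dS) =
    (\<integral>\<^sup>+x. ennreal ((cmod (lift (Lap (\<lambda>z. 4 * d_z (d_zbar (F j)) z - w z)) x))^2) \<partial>dS)"
  proof (rule nn_integral_cong_AE)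
   have "lift (Lap f) x - lift (Lap g) x = lift (Lap (\<lambda>z. f z - g z)) x" for f g x
    by (simp add: lift_def Lap_def diff_divide_distrib)
   then show "AE x in dS. ennreal ((cmod (laplacian A \<rho> (lift (F j)) x - lift (Lap w) x))^2) =
     ennreal ((cmod (lift (Lap (\<lambda>z. 4 * d_z (d_zbar (F j)) z - w z)) x))^2)"
    using laplacian_lift_AE(2)[OF F(1)[of j]] by (auto elim!: eventually_mono)
  qed
  also have "\<dots> \<le> ennreal (1 / (b + 1)^2) * wnorm (- b) (\<lambda>z. 4 * d_z (d_zbar (F j)) z - w z)" by (rule nn_integral_lift_le) measurable
  also have "\<dots> \<le> ennreal (1 / (b + 1)^2) * e j" by (rule mult_left_mono[OF less_imp_le[OF F(3)]]) simp
  finally show "(\<integral>\<^sup>+x. ennreal ((cmod (laplacian A \<rho> (lift (F j)) x - lift (Lap w) x))^2) \<partial>dS) \<le> ennreal (1 / (b + 1)^2) * e j" .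
 qed
 moreover have "(lift (F j), laplacian A \<rho> (lift (F j))) \<in> symmetric_laplacian A \<rho> Q" for j
  using lift_test_function[OF F(1)] by (auto simp: symmetric_laplacian_def)
 ultimately have "(lift v, lift (Lap w)) \<in> op_closure dS (symmetric_laplacian A \<rho> Q)"
  unfolding op_closure_def using L2 by (intro CollectI case_prodI conjI exI[of _ "\<lambda>j. lift (F j)"] exI[of _ "\<lambda>j. laplacian A \<rho> (lift (F j))"]) auto
 then show ?thesis by blast
qed

definition "siD z = (if z \<in> ball 0 R then si z else p)"

lemma pullback_borel:
 assumes [measurable]: "f \<in> borel_measurable dS"
 shows "(\<lambda>z. f (siD z)) \<in> borel_fun"
proof -
 have "continuous_on (ball 0 R) si" by (rule continuous_on_subset[OF V(3)]) (use R(3) ball_subset_cball in blast)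
 then have "siD \<in> borel \<rightarrow>\<^sub>M borel" unfolding siD_def[abs_def] by (intro borel_measurable_continuous_on_if continuous_on_const) auto
 then have [measurable]: "siD \<in> borel \<rightarrow>\<^sub>M dS" by (simp add: measurable_cong_sets[OF refl sets_dS])
 show ?thesis by measurable
qed

lemma lift_pullback: "lift (\<lambda>z. f (siD z)) x = (if x \<in> D then f x else 0)"
 using D(4,5)[of x] by (simp add: lift_def siD_def)

text \<open>The adjoint relation for lifted test functions, written in the coordinate, is the weak
  equation. Conjugates appear because \<open>L2_inner\<close> conjugates its second argument. The
  density cancels against the denominator of \<open>Lap\<close> on the side of u and stays in the
  charge on the side of w.\<close>

lemma weak_cone_solution_pullback:
 assumes bn: "real n < b + 1" "b + 1 \<le> real n + 1" and u: "(u, w) \<in> op_adjoint dS (symmetric_laplacian A \<rho> Q)"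
 shows "weak_cone_solution b R n (\<lambda>z. if cmod z < R then cnj (u (siD z)) else 0)
  (\<lambda>z. - of_real (wt z) * cnj (w (siD z)))"
proof
 let ?U = "\<lambda>z. if cmod z < R then cnj (u (siD z)) else 0" and ?G = "\<lambda>z. - of_real (wt z) * cnj (w (siD z))"
 have uw: "u \<in> L2 dS" "w \<in> L2 dS" and adj: "\<And>f g. (f, g) \<in> symmetric_laplacian A \<rho> Q ==> L2_inner dS g u = L2_inner dS f w"
  using u by (auto simp: op_adjoint_def)
 have [measurable]: "u \<in> borel_measurable dS" "w \<in> borel_measurable dS" using uw by (auto simp: L2_def)
 note [measurable] = pullback_borel[of u] pullback_borel[of w] borel_measurable_cnj
 show "?U \<in> borel_fun" "?G \<in> borel_fun" by measurable
 have fin: "(\<integral>\<^sup>+z. ennreal (wt z * (cmod (f (siD z)))^2) \<partial>lborel) < \<infinity>" if "f \<in> L2 dS" for f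
 proof -
  have [measurable]: "f \<in> borel_measurable dS" and i: "integrable dS (\<lambda>x. (cmod (f x))^2)" using that by (auto simp: L2_def)
  have "(\<integral>\<^sup>+z. ennreal (wt z * (cmod (f (siD z)))^2) \<partial>lborel) = (\<integral>\<^sup>+x. ennreal ((cmod (lift (\<lambda>z. f (siD z)) x))^2) \<partial>dS)"
   by (rule nn_integral_lift[symmetric]) (rule pullback_borel, measurable)
  also have "\<dots> \<le> (\<integral>\<^sup>+x. ennreal ((cmod (f x))^2) \<partial>dS)" by (rule nn_integral_mono) (simp add: lift_pullback)
  also have "\<dots> < \<infinity>" using i by (simp add: integrable_iff_bounded)
  finally show ?thesis .
 qed
 let ?c = "(b + 1)^2"
 have c: "?c > 0" using b by simp
 have "wnorm b ?U = (\<integral>\<^sup>+z. ennreal (1 / ?c) * ennreal (wt z * (cmod (u (siD z)))^2) \<partial>lborel)"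
  unfolding wnorm_def using c by (intro nn_integral_cong) (auto simp: wt_def ennreal_mult[symmetric] mult_ac)
 also have "\<dots> = ennreal (1 / ?c) * (\<integral>\<^sup>+z. ennreal (wt z * (cmod (u (siD z)))^2) \<partial>lborel)" by (rule nn_integral_cmult) measurable
 also have "\<dots> < \<infinity>" using fin[OF uw(1)] by (simp add: ennreal_mult_less_top)
 finally show "wnorm b ?U < \<infinity>" .
 have "wnorm (- b) ?G = (\<integral>\<^sup>+z. ennreal ?c * ennreal (wt z * (cmod (w (siD z)))^2) \<partial>lborel)"
  unfolding wnorm_def
 proof (rule nn_integral_cong)
  fix z
  have "(cmod (?G z))^2 * cmod z powr (2 * - b) = ?c * (wt z * (cmod (w (siD z)))^2)"
  proof (cases "z \<noteq> 0 \<and> cmod z < R")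
   case True
   let ?y = "cmod z powr (2 * b)"
   have y: "?y > 0" using True by auto
   have "cmod z powr (2 * - b) = 1 / ?y" by (simp add: powr_minus inverse_eq_divide)
   moreover have "cmod (?G z) = ?c * ?y * cmod (w (siD z))"
    unfolding norm_mult norm_minus_cancel norm_of_real complex_mod_cnj using True c y by (simp add: wt_def)
   moreover have "(C * Y * t)^2 * (1 / Y) = C * (C * Y * t^2)" if "Y > 0" for C Y t :: real
    using that by (simp add: power2_eq_square)
   note this[OF y]
   ultimately show ?thesis using True by (simp only: wt_def if_True)
  qed (auto simp: wt_def)
  then show "ennreal ((cmod (?G z))^2 * cmod z powr (2 * - b)) = ennreal ?c * ennreal (wt z * (cmod (w (siD z)))^2)"
   by (subst ennreal_mult[symmetric]) (auto simp: wt_def)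
 qed
 also have "\<dots> = ennreal ?c * (\<integral>\<^sup>+z. ennreal (wt z * (cmod (w (siD z)))^2) \<partial>lborel)" by (rule nn_integral_cmult) measurable
 also have "\<dots> < \<infinity>" using fin[OF uw(2)] by (simp add: ennreal_mult_less_top)
 finally show "wnorm (- b) ?G < \<infinity>" .
 fix F assume F: "F \<in> planar_test R"
 note [measurable] = planar_test_borel[OF F] laplacian_lift_AE(1)[OF F] lift_borel[of F] lift_borel[OF Lap_borel]
 let ?L = "\<lambda>z. 4 * d_z (d_zbar F) z"
 have m: "?L \<in> borel_fun" by measurable
 have "(LINT z|lborel. of_real (wt z) * (Lap ?L z * cnj (u (siD z)))) = (LINT x|dS. lift (\<lambda>z. Lap ?L z * cnj (u (siD z))) x)"
  by (rule integral_chart[symmetric]) (use m in measurable)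
 also have "\<dots> = (LINT x|dS. laplacian A \<rho> (lift F) x * cnj (u x))"
 proof (rule integral_cong_AE)
  show "lift (\<lambda>z. Lap ?L z * cnj (u (siD z))) \<in> borel_measurable dS" by (rule lift_borel) measurable
  show "(\<lambda>x. laplacian A \<rho> (lift F) x * cnj (u x)) \<in> borel_measurable dS" by measurable
  show "AE x in dS. lift (\<lambda>z. Lap ?L z * cnj (u (siD z))) x = laplacian A \<rho> (lift F) x * cnj (u x)"
   using laplacian_lift_AE(2)[OF F]
   by eventually_elim (use D(4,5) in \<open>auto simp: lift_def siD_def\<close>)
 qed
 also have "\<dots> = (LINT x|dS. lift F x * cnj (w x))"
  using adj[of "lift F" "laplacian A \<rho> (lift F)"] lift_test_function[OF F] by (auto simp: symmetric_laplacian_def L2_inner_def)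
 also have "\<dots> = (LINT x|dS. lift (\<lambda>z. F z * cnj (w (siD z))) x)"
  by (intro Bochner_Integration.integral_cong) (use D(4,5) in \<open>auto simp: lift_def siD_def\<close>)
 also have "\<dots> = (LINT z|lborel. of_real (wt z) * (F z * cnj (w (siD z))))" by (rule integral_chart) measurable
 finally have e: "(LINT z|lborel. of_real (wt z) * (Lap ?L z * cnj (u (siD z)))) = (LINT z|lborel. of_real (wt z) * (F z * cnj (w (siD z))))" .
 have "(LINT z|lborel. ?U z * ?L z) = (LINT z|lborel. - (of_real (wt z) * (Lap ?L z * cnj (u (siD z)))))"
 proof (rule integral_cong_AE)
  show "(\<lambda>z. ?U z * ?L z) \<in> borel_measurable lborel" by measurable
  show "(\<lambda>z. - (of_real (wt z) * (Lap ?L z * cnj (u (siD z))))) \<in> borel_measurable lborel" by measurable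
  show "AE z in lborel. ?U z * ?L z = - (of_real (wt z) * (Lap ?L z * cnj (u (siD z))))"
   using AE_lborel_singleton[of "0::complex"]
  proof eventually_elim
   fix z :: complex assume z: "z \<noteq> 0"
   have nz: "?c * cmod z powr (2 * b) \<noteq> 0" using z c by simp
   have "of_real t * (- X / of_real t * y) = - (y * X)" if "t \<noteq> 0" for t and X y :: complex
    using that by simp
   note this[OF nz]
   then show "?U z * ?L z = - (of_real (wt z) * (Lap ?L z * cnj (u (siD z))))"
    by (cases "cmod z < R") (simp_all only: Lap_def wt_def if_True if_False, simp_all only: of_real_0 mult_zero_left minus_zero minus_minus)
  qed
 qed
 also have "\<dots> = (LINT z|lborel. - (of_real (wt z) * (F z * cnj (w (siD z)))))"
  unfolding Bochner_Integration.integral_minus e ..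
 also have "\<dots> = (LINT z|lborel. ?G z * F z)" by (intro Bochner_Integration.integral_cong) (auto simp: mult_ac)
 finally show "(LINT z|lborel. ?U z * ?L z) = (LINT z|lborel. ?G z * F z)" .
qed (use bn R in \<open>auto simp: wt_def\<close>)

lemma lift_small_o:
 assumes C: "\<And>z. z \<noteq> 0 ==> cmod z \<le> r ==> cmod (v z) \<le> C * cmod z powr \<alpha>" and r: "0 < r" and \<alpha>: "real n < \<alpha>"
 shows "lift v \<in> o[at p](\<lambda>x. of_real (cmod (\<zeta> x) ^ n))"
proof (rule landau_o.smallI)
 fix c :: real assume c: "c > 0"
 have "isCont \<zeta> p" using V(1,2) p(1) by (simp add: continuous_on_eq_continuous_at)
 then have z: "((\<lambda>x. cmod (\<zeta> x)) \<longlongrightarrow> 0) (at p)" unfolding isCont_def p(2) by (rule tendsto_norm_zero)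
 have "((\<lambda>x. C * cmod (\<zeta> x) powr (\<alpha> - real n)) \<longlongrightarrow> C * 0) (at p)"
  by (intro tendsto_mult tendsto_const tendsto_zero_powrI[OF z]) (use \<alpha> in auto)
 then have "eventually (\<lambda>x. C * cmod (\<zeta> x) powr (\<alpha> - real n) < c) (at p)" by (rule order_tendstoD) (use c in simp)
 moreover have "eventually (\<lambda>x. cmod (\<zeta> x) < r) (at p)" by (rule order_tendstoD(2)[OF z r])
 moreover have "eventually (\<lambda>x. x \<in> D \<and> x \<noteq> p) (at p)"
  unfolding eventually_at_topological using D(1,3) by blast
 ultimately show "eventually (\<lambda>x. norm (lift v x) \<le> c * norm (complex_of_real (cmod (\<zeta> x) ^ n))) (at p)"
 proof eventually_elim
  fix x assume x: "C * cmod (\<zeta> x) powr (\<alpha> - real n) < c" "cmod (\<zeta> x) < r" "x \<in> D \<and> x \<noteq> p"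
  then have "\<zeta> x \<noteq> 0" using zeta_0 D(2) by blast
  then have "cmod (\<zeta> x) powr \<alpha> = cmod (\<zeta> x) powr (\<alpha> - real n) * cmod (\<zeta> x) ^ n"
   by (simp add: powr_realpow[symmetric] powr_add[symmetric])
  then have "cmod (v (\<zeta> x)) \<le> C * cmod (\<zeta> x) powr (\<alpha> - real n) * cmod (\<zeta> x) ^ n" using C[of "\<zeta> x"] \<open>\<zeta> x \<noteq> 0\<close> x(2) by simp
  also have "\<dots> \<le> c * cmod (\<zeta> x) ^ n" using x(1) by (intro mult_right_mono) auto
  finally show "norm (lift v x) \<le> c * norm (complex_of_real (cmod (\<zeta> x) ^ n))" using x(3) by (simp add: lift_def norm_power)
 qed
qed

lemma expansion:
 assumes bn: "real n < b + 1" "b + 1 \<le> real n + 1" and u: "u \<in> Domain (op_adjoint dS (symmetric_laplacian A \<rho> Q))"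
 obtains r l H H' c h h' v where "0 < r" "v \<in> Domain (op_closure dS (symmetric_laplacian A \<rho> Q))"
  "v \<in> o[at p](\<lambda>x. of_real (cmod (\<zeta> x) ^ n))"
  "AE x in dS. x \<in> D \<and> cmod (\<zeta> x) < r --> u x = singular_part n l H H' (\<zeta> x) + regular_part n c h h' (\<zeta> x) + v x"
proof -
 obtain w where w: "(u, w) \<in> op_adjoint dS (symmetric_laplacian A \<rho> Q)" using u by blast
 interpret weak_cone_solution b R n "\<lambda>z. if cmod z < R then cnj (u (siD z)) else 0" "\<lambda>z. - of_real (wt z) * cnj (w (siD z))"
  by (rule weak_cone_solution_pullback[OF bn w])
 obtain r l H H' c h h' v w' C \<alpha> where r: "0 < r" "r < R" and v: "(v, w') \<in> planar_closure b R" and \<alpha>: "real n < \<alpha>"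
  and C: "\<And>z. z \<noteq> 0 ==> cmod z \<le> r ==> cmod (v z) \<le> C * cmod z powr \<alpha>"
  and e: "AE z in lborel. z \<noteq> 0 \<and> cmod z \<le> r --> cnj (if cmod z < R then cnj (u (siD z)) else 0) =
   singular_part n l H H' z + regular_part n c h h' z + v z" by (rule planar_expansion) (rule that)
 show thesis
 proof (rule that[OF r(1) lift_in_closure[OF v] lift_small_o[OF C r(1) \<alpha>]])
  show "AE x in dS. x \<in> D \<and> cmod (\<zeta> x) < r --> u x = singular_part n l H H' (\<zeta> x) + regular_part n c h h' (\<zeta> x) + lift v x"
   using AE_chart[OF e] AE_not_Q
  proof eventually_elim
   case (elim x)
   have "\<zeta> x \<noteq> 0" if "x \<in> D" using elim(2) that Q(2) D(2) zeta_0 by auto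
   then show ?case using elim(1) D(4,5)[of x] by (auto simp: lift_def siD_def)
  qed
 qed
qed

end

lemma rescale_coefficient:
 assumes "m \<noteq> 0"
 shows "(x::complex) = 1 / of_real (sqrt (4 * pi * real m)) * (of_real (sqrt (4 * pi * real m)) * x)"
 using assms by simp

theorem mainTheorem1:
 fixes A :: "'a::t2_space chart set"
  and \<rho> :: "'a density"
  and M :: nat
  and P :: "nat => 'a"
  and b :: "nat => real"
  and n :: "nat => nat"
  and U :: "nat => 'a set"
  and \<zeta> :: "nat => 'a => complex"
  and dS :: "'a measure"
  and u :: "'a => complex"
 assumes surface: "compact_riemann_surface A"
  and metric: "flat_conical_metric A \<rho> M P b"
  and n: "\<And>k. k \<in> {1..M} ==>
   2 * pi * real (n k) < cone_angle (b k) \<and> cone_angle (b k) \<le> 2 * pi * (real (n k) + 1)"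
  and zeta: "\<And>k. k \<in> {1..M} ==>
   distinguished_parameter A (P ` {1..M}) \<rho> (P k) (b k) (U k, \<zeta> k)"
  and area: "area_measure A \<rho> dS"
  and u: "u \<in> Domain (op_adjoint dS (symmetric_laplacian A \<rho> (P ` {1..M})))"
 shows "\<forall>k\<in>{1..M}. \<exists>(L::complex) (c::complex)
   (H::nat => complex) (A'::nat => complex) (h::nat => complex) (a::nat => complex).
  \<forall>\<eta>. cutoff A (P k) (U k) \<eta> -->
   (\<exists>v \<in> Domain (op_closure dS (symmetric_laplacian A \<rho> (P ` {1..M}))).
    (\<exists>W. open W \<and> P k \<in> W \<and> W \<subseteq> U k \<and>
     (AE x in dS. x \<in> W -->
      u x = \<i> / of_real (sqrt (2 * pi)) * L * of_real (ln (cmod (\<zeta> k x)))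
       + (\<Sum>m=1..n k. 1 / of_real (sqrt (4 * pi * real m)) * H m * (1 / \<zeta> k x ^ m))
       + (\<Sum>m=1..n k. 1 / of_real (sqrt (4 * pi * real m)) * A' m * (1 / cnj (\<zeta> k x) ^ m))
       + \<i> / of_real (sqrt (2 * pi)) * c
       + (\<Sum>m=1..n k. 1 / of_real (sqrt (4 * pi * real m)) * h m * \<zeta> k x ^ m)
       + (\<Sum>m=1..n k. 1 / of_real (sqrt (4 * pi * real m)) * a m * cnj (\<zeta> k x) ^ m)
       + of_real (\<eta> x) * v x)) \<and>
    v \<in> o[at (P k)](\<lambda>x. of_real (cmod (\<zeta> k x) ^ n k)))"
proof
 fix k assume k: "k \<in> {1..M}"
 let ?Q = "P ` {1..M}"
 let ?p = "P k" and ?V = "U k" and ?z = "\<zeta> k"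
 have d: "distinguished_parameter A ?Q \<rho> ?p (b k) (?V, ?z)" by (rule zeta[OF k])
 then have V: "complex_chart (?V, ?z)" "?p \<in> ?V" "?z ?p = 0" by (auto simp: distinguished_parameter_def local_parameters_def)
 then have inj: "inj_on ?z ?V" and oV: "open (?z ` ?V)"
  by (auto simp: complex_chart_def homeomorphism_def intro: inj_on_inverseI)
 \<comment> \<open>The images of the other conical points are removed from the coordinate domain, so
   that a small disc around 0 contains none of them.\<close>
 let ?S = "?z ` ?V - ?z ` (?V \<inter> ?Q - {?p})"
 have "open ?S" by (intro open_Diff oV finite_imp_closed finite_imageI) auto
 moreover have "0 \<in> ?S" using V inj by (force simp: inj_on_def)
 ultimately obtain e where e: "e > 0" "ball 0 e \<subseteq> ?S" by (meson open_contains_ball)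
 \<comment> \<open>Half of e makes the closed disc fit into the open one; the bound 1 serves the
   planar estimates.\<close>
 define R where "R = min 1 (e / 2)"
 have "cball 0 R \<subseteq> ball 0 e" using e(1) by (auto simp: R_def)
 with e have R: "0 < R" "R \<le> 1" "cball 0 R \<subseteq> ?S" by (simp_all add: R_def) blast
 interpret cone_chart A ?Q \<rho> dS ?p ?V ?z "b k" R
 proof
  show "holomorphic_atlas A" using surface by (simp add: compact_riemann_surface_def)
  show "conformal_metric A ?Q \<rho>" "b k > -1" using metric k by (auto simp: flat_conical_metric_def)
  show "R < cmod (?z q)" if "q \<in> ?Q" "q \<in> ?V" "q \<noteq> ?p" for q
  proof (rule ccontr)
   assume "\<not> R < cmod (?z q)"
   then have "?z q \<in> cball 0 R" by simp
   from subsetD[OF R(3) this]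
   show False using that by blast
  qed
  show "cball 0 R \<subseteq> ?z ` ?V" using R(3) by blast
 qed (use k d area R in auto)
 have bn: "real (n k) < b k + 1" "b k + 1 \<le> real (n k) + 1"
  using n[OF k] pi_gt_zero by (auto simp: cone_angle_def mult.assoc)
 obtain r l H H' c h h' v where r: "0 < r" and v: "v \<in> Domain (op_closure dS (symmetric_laplacian A \<rho> ?Q))"
  "v \<in> o[at ?p](\<lambda>x. of_real (cmod (?z x) ^ n k))"
  and ex: "AE x in dS. x \<in> D \<and> cmod (?z x) < r --> u x = singular_part (n k) l H H' (?z x) + regular_part (n k) c h h' (?z x) + v x"
  by (rule expansion[OF bn u]) (rule that)
 let ?s = "\<lambda>m. complex_of_real (sqrt (4 * pi * real m))" and ?t = "complex_of_real (sqrt (2 * pi))"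
 \<comment> \<open>The normalising constants of the statement are non-zero and are absorbed into the
   coefficients.\<close>
 have s: "(\<Sum>m=1..n k. 1 / ?s m * (?s m * X m) * Y m) = (\<Sum>m=1..n k. X m * Y m)" for X Y :: "nat => complex"
  by (intro sum.cong refl) (use rescale_coefficient in simp)
 have t: "\<i> / ?t * (- \<i> * ?t * x) = x" for x by (simp add: field_simps)
 show "\<exists>L c H A' h a. \<forall>\<eta>. cutoff A (P k) (U k) \<eta> -->
   (\<exists>v \<in> Domain (op_closure dS (symmetric_laplacian A \<rho> (P ` {1..M}))).
    (\<exists>W. open W \<and> P k \<in> W \<and> W \<subseteq> U k \<and>
     (AE x in dS. x \<in> W -->
      u x = \<i> / of_real (sqrt (2 * pi)) * L * of_real (ln (cmod (\<zeta> k x)))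
       + (\<Sum>m=1..n k. 1 / of_real (sqrt (4 * pi * real m)) * H m * (1 / \<zeta> k x ^ m))
       + (\<Sum>m=1..n k. 1 / of_real (sqrt (4 * pi * real m)) * A' m * (1 / cnj (\<zeta> k x) ^ m))
       + \<i> / of_real (sqrt (2 * pi)) * c
       + (\<Sum>m=1..n k. 1 / of_real (sqrt (4 * pi * real m)) * h m * \<zeta> k x ^ m)
       + (\<Sum>m=1..n k. 1 / of_real (sqrt (4 * pi * real m)) * a m * cnj (\<zeta> k x) ^ m)
       + of_real (\<eta> x) * v x)) \<and>
    v \<in> o[at (P k)](\<lambda>x. of_real (cmod (\<zeta> k x) ^ n k)))"
 \<comment> \<open>The factor -\<i> sqrt (2 pi) inverts \<i> / sqrt (2 pi). All coefficients, and v
   itself, are chosen without reference to \<eta>.\<close>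
 proof (rule exI[of _ "- \<i> * ?t * l"], rule exI[of _ "- \<i> * ?t * c"], rule exI[of _ "\<lambda>m. ?s m * H m"],
   rule exI[of _ "\<lambda>m. ?s m * H' m"], rule exI[of _ "\<lambda>m. ?s m * h m"], rule exI[of _ "\<lambda>m. ?s m * h' m"],
   intro allI impI bexI[OF _ v(1)] conjI v(2))
  fix \<eta> assume "cutoff A (P k) (U k) \<eta>"
  then have "eventually (\<lambda>x. \<eta> x = 1) (nhds ?p)" by (simp add: cutoff_def)
  then obtain W1 where W1: "open W1" "?p \<in> W1" "\<And>x. x \<in> W1 ==> \<eta> x = 1" unfolding eventually_nhds by blast
  have "continuous_on D ?z" by (rule continuous_on_subset[OF V(2) D(2)])
  then have "open (D \<inter> ?z -` ball 0 r)" using D(1) by (intro continuous_open_preimage) auto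
  moreover have "?p \<in> D \<inter> ?z -` ball 0 r" using D(3) p r by simp
  ultimately show "\<exists>W. open W \<and> P k \<in> W \<and> W \<subseteq> U k \<and>
     (AE x in dS. x \<in> W -->
      u x = \<i> / ?t * (- \<i> * ?t * l) * of_real (ln (cmod (\<zeta> k x)))
       + (\<Sum>m=1..n k. 1 / ?s m * (?s m * H m) * (1 / \<zeta> k x ^ m))
       + (\<Sum>m=1..n k. 1 / ?s m * (?s m * H' m) * (1 / cnj (\<zeta> k x) ^ m))
       + \<i> / ?t * (- \<i> * ?t * c)
       + (\<Sum>m=1..n k. 1 / ?s m * (?s m * h m) * \<zeta> k x ^ m)
       + (\<Sum>m=1..n k. 1 / ?s m * (?s m * h' m) * cnj (\<zeta> k x) ^ m)
       + of_real (\<eta> x) * v x)"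
   unfolding s t
  \<comment> \<open>On \<open>W1\<close> the cut-off equals 1, so that \<eta> v = v there.\<close>
  proof (intro exI[of _ "W1 \<inter> (D \<inter> ?z -` ball 0 r)"] conjI)
   show "AE x in dS. x \<in> W1 \<inter> (D \<inter> ?z -` ball 0 r) --> u x = l * of_real (ln (cmod (?z x))) +
    (\<Sum>m=1..n k. H m * (1 / ?z x ^ m)) + (\<Sum>m=1..n k. H' m * (1 / cnj (?z x) ^ m)) + c +
    (\<Sum>m=1..n k. h m * ?z x ^ m) + (\<Sum>m=1..n k. h' m * cnj (?z x) ^ m) + of_real (\<eta> x) * v x"
    using ex by eventually_elim (simp add: W1(3) singular_part_def regular_part_def add.assoc)
  qed (use W1 D(2) in auto)
 qed
qed

end
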